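(* Let $\pi:E\to G$ be a saturated Fell bundle and $A$ a localizable completion with associated quantale map $p:\operatorname{Max}A\to\Omega(G)$. The following are equivalent: (1) $\pi$ is a Fell line bundle; (2) $\pi$ is abelian and $p$ is a quantic bundle.
   Context: Groupoids. A groupoid $G$ is a topological groupoid with unit space $G_0\subset G$, $d(g)=g^{-1}g$, $r(g)=gg^{-1}$, $G_2=\{(g,h): d(g)=r(h)\}$. Every groupoid is assumed étale ($d$ is a local homeomorphism) with $G_0$ locally compact Hausdorff; $G$ need not be Hausdorff. A local bisection is an open $U\subset G$ on which $d$ and $r$ are injective; $\mathcal I(G)$ is the set of local bisections. Quantales. An involutive quantale is a complete lattice with an associative product distributing over arbitrary joins on both sides and a join-preserving involution with $(ab)^*=b^*a^*$. A map $p:Q\to X$ of involutive quantales is a map $p^*:X\to Q$ preserving arbitrary joins, products and involution; $p$ is a surjection if $p^*$ is injective, and semiopen if $p^*$ has a left adjoint $p_!:Q\to X$ ($p_!(a)\le x\iff a\le p^*(x)$). $\Omega(G)$, the topology of $G$, is an involutive quantale under pointwise product and $U\mapsto U^{-1}$. $\operatorname{Max}A$ is the involutive quantale of closed linear subspaces of a C*-algebra $A$ with inclusion order, pointwise involution, and product $VW=\overline{\operatorname{span}}\{ab:a\in V,b\in W\}$. A map $p:Q\to\Omega(G)$ is a quantic bundle if it is semiopen, surjective, and $p_!(a\,p^*(U)\,b)=p_!(a)\,U\,p_!(b)$ for all $U\in\Omega(G)$ and all $a,b\in Q$ with $p_!(a),p_!(b)\in\mathcal I(G)$. Fell bundles.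 A Banach bundle over a locally Hausdorff space $X$ is a continuous open surjection $\pi:E\to X$ with complex Banach space fibres $E_x=\pi^{-1}(\{x\})$ such that: $\pi^{-1}(U)$ is Hausdorff for each Hausdorff open $U\subset X$; addition $E\times_XE\to E$ and scalar multiplication by each $\lambda\in\mathbb C$ are continuous; $e\mapsto\|e\|$ is upper semicontinuous; for each $x$ and open $V\ni 0_x$ there are $\varepsilon>0$ and an open $U\ni x$ with $\{e\in\pi^{-1}(U):\|e\|<\varepsilon\}\subset V$. A Fell bundle on $G$ is a Banach bundle $\pi:E\to G$ with a continuous associative multiplication $(e,f)\mapsto ef$ defined when $(\pi(e),\pi(f))\in G_2$ and a continuous involution $e\mapsto e^*$, such that $\pi(ef)=\pi(e)\pi(f)$, $\pi(e^* )=\pi(e)^{-1}$, multiplication is fibrewise bilinear, the involution is fibrewise conjugate-linear, $e^{**}=e$, $(ef)^*=f^*e^*$, $\|ef\|\le\|e\|\|f\|$, $\|e^*\|=\|e\|$, $\|e^*e\|=\|e\|^2$, and $e^*e\ge0$ in the C*-algebra over $d(\pi(e))$. It is saturated if $E_gE_h=E_{gh}$ for all $(g,h)\in G_2$, where $E_gE_h$ is the closed linear span of the products; abelian if the C*-algebra $E_x$ is commutative for all $x\in G_0$; a Fell line bundle if every fibre $E_g$ has complex dimension $1$. Convolution algebra. For a Hausdorff open $U\subset G$, $C_c(U,E)$ is the space of sections $s:G\to E$ of $\pi$ (not necessarily continuous on $G$) that vanish outside $U$, are continuous on $U$, and satisfy $\{g:s(g)\ne0\}\subset K\subset U$ for some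 compact $K$. $\Gamma_c(G,E)$ is the linear span of $\bigcup_{U\in\mathcal I(G)}C_c(U,E)$, a $*$-algebra with $st(g)=\sum_{g=hk}s(h)t(k)$ and $s^*(g)=s(g^{-1})^*$. Let $\|s\|_\infty=\sup_g\|s(g)\|$. A compatible norm is a C*-norm $\|\cdot\|$ on $\Gamma_c(G,E)$ with $\|s\|_\infty\le\|s\|$ for all $s$ and $\|s\|_\infty=\|s\|$ if $s\in C_c(U,E)$ for some $U\in\mathcal I(G)$; the C*-completion $A$ in it is a compatible completion. For $g\in G$, $s\mapsto s(g)$ extends to a continuous linear map $\operatorname{eval}_g:A\to E_g$. For saturated $\pi$ the associated map $p:\operatorname{Max}A\to\Omega(G)$ of involutive quantales is given by $p^*(V)=\overline{\operatorname{span}}\bigcup\{C_c(U,E):U\in\mathcal I(G),\ U\subset V\}$. Localizability. For $a\in A$ let $\sigma(\langle a\rangle)=\operatorname{int}\{g\in G:\operatorname{eval}_g(a)\ne0\}$, and for $V\in\Omega(G)$ let $\gamma(V)=\overline{\operatorname{span}}\{a\in A:\sigma(\langle a\rangle)\subset V\}$. A localizable completion is a compatible completion $A$ with $p^*=\gamma$; in this case $p$ is semiopen with $p_!(V)=\bigcup_{a\in V}\operatorname{int}\{g:\operatorname{eval}_g(a)\neq0\}$. *)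

theory Defs
  imports "HOL-Analysis.Analysis" "HOL-Algebra.Galois_Connection" "HOL-Algebra.Module"
begin

section \<open>Etale groupoids\<close>

text \<open>The arrows are the points of the underlying topology. Multiplication is a total function of
  which only the values on composable pairs are ever constrained.\<close>

record 'g groupoid =
  gtop :: "'g topology"
  gmul :: "'g \<Rightarrow> 'g \<Rightarrow> 'g" (infixl "\<cdot>\<index>" 70)
  ginv :: "'g \<Rightarrow> 'g"

definition arrows :: "('g, 'm) groupoid_scheme \<Rightarrow> 'g set" where
  "arrows G = topspace (gtop G)"

definition gdom :: "('g, 'm) groupoid_scheme \<Rightarrow> 'g \<Rightarrow> 'g" where
  "gdom G g = ginv G g \<cdot>\<^bsub>G\<^esub> g"

definition grng :: "('g, 'm) groupoid_scheme \<Rightarrow> 'g \<Rightarrow> 'g" where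
  "grng G g = g \<cdot>\<^bsub>G\<^esub> ginv G g"

definition units :: "('g, 'm) groupoid_scheme \<Rightarrow> 'g set" where
  "units G = gdom G ` arrows G"

definition composable :: "('g, 'm) groupoid_scheme \<Rightarrow> ('g \<times> 'g) set" where
  "composable G = {(g, h). g \<in> arrows G \<and> h \<in> arrows G \<and> gdom G g = grng G h}"

locale topological_groupoid =
  fixes G :: "('g, 'm) groupoid_scheme" (structure)
  assumes mul_closed: "(g, h) \<in> composable G \<Longrightarrow> g \<cdot> h \<in> arrows G"
    and inv_closed: "g \<in> arrows G \<Longrightarrow> ginv G g \<in> arrows G"
    and inv_inv: "g \<in> arrows G \<Longrightarrow> ginv G (ginv G g) = g"
    and dom_mul: "(g, h) \<in> composable G \<Longrightarrow> gdom G (g \<cdot> h) = gdom G h"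
    and rng_mul: "(g, h) \<in> composable G \<Longrightarrow> grng G (g \<cdot> h) = grng G g"
    and mul_assoc: "(g, h) \<in> composable G \<Longrightarrow> (h, k) \<in> composable G \<Longrightarrow>
      (g \<cdot> h) \<cdot> k = g \<cdot> (h \<cdot> k)"
    and mul_dom: "g \<in> arrows G \<Longrightarrow> g \<cdot> gdom G g = g"
    and rng_mul_self: "g \<in> arrows G \<Longrightarrow> grng G g \<cdot> g = g"
    and continuous_inv: "continuous_map (gtop G) (gtop G) (ginv G)"
    and continuous_mul:
      "continuous_map (subtopology (prod_topology (gtop G) (gtop G)) (composable G)) (gtop G)
        (\<lambda>(g, h). g \<cdot> h)"

definition local_homeomorphism_map :: "'x topology \<Rightarrow> 'y topology \<Rightarrow> ('x \<Rightarrow> 'y) \<Rightarrow> bool" where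
  "local_homeomorphism_map X Y f \<longleftrightarrow>
    (\<forall>x\<in>topspace X. \<exists>U. openin X U \<and> x \<in> U \<and> openin Y (f ` U) \<and>
      homeomorphic_map (subtopology X U) (subtopology Y (f ` U)) f)"

text \<open>The space of arrows is not required to be Hausdorff.\<close>

locale etale_groupoid = topological_groupoid +
  assumes locally_compact_units: "locally_compact_space (subtopology (gtop G) (units G))"
    and Hausdorff_units: "Hausdorff_space (subtopology (gtop G) (units G))"
    and local_homeomorphism_dom:
      "local_homeomorphism_map (gtop G) (subtopology (gtop G) (units G)) (gdom G)"

definition bisections :: "('g, 'm) groupoid_scheme \<Rightarrow> 'g set set" where
  "bisections G = {U. openin (gtop G) U \<and> inj_on (gdom G) U \<and> inj_on (grng G) U}"


section \<open>Involutive quantales\<close>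

record 'q quantale_struct = "'q gorder" +
  qmul :: "'q \<Rightarrow> 'q \<Rightarrow> 'q" (infixl "\<odot>\<odot>\<index>" 70)
  qinv :: "'q \<Rightarrow> 'q"

locale involutive_quantale = complete_lattice Q
  for Q :: "('q, 'm) quantale_struct_scheme" (structure) +
  assumes qmul_closed: "a \<in> carrier Q \<Longrightarrow> b \<in> carrier Q \<Longrightarrow> a \<odot>\<odot> b \<in> carrier Q"
    and qinv_closed: "a \<in> carrier Q \<Longrightarrow> qinv Q a \<in> carrier Q"
    and qmul_assoc: "a \<in> carrier Q \<Longrightarrow> b \<in> carrier Q \<Longrightarrow> c \<in> carrier Q \<Longrightarrow>
      (a \<odot>\<odot> b) \<odot>\<odot> c = a \<odot>\<odot> (b \<odot>\<odot> c)"
    and qmul_Sup_left: "a \<in> carrier Q \<Longrightarrow> S \<subseteq> carrier Q \<Longrightarrow>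
      a \<odot>\<odot> (\<Squnion>S) = \<Squnion>((\<lambda>s. a \<odot>\<odot> s) ` S)"
    and qmul_Sup_right: "a \<in> carrier Q \<Longrightarrow> S \<subseteq> carrier Q \<Longrightarrow>
      (\<Squnion>S) \<odot>\<odot> a = \<Squnion>((\<lambda>s. s \<odot>\<odot> a) ` S)"
    and qinv_qinv: "a \<in> carrier Q \<Longrightarrow> qinv Q (qinv Q a) = a"
    and qinv_Sup: "S \<subseteq> carrier Q \<Longrightarrow> qinv Q (\<Squnion>S) = \<Squnion>(qinv Q ` S)"
    and qinv_qmul: "a \<in> carrier Q \<Longrightarrow> b \<in> carrier Q \<Longrightarrow>
      qinv Q (a \<odot>\<odot> b) = qinv Q b \<odot>\<odot> qinv Q a"

text \<open>A map \<open>p : Q \<rightarrow> X\<close> is represented by its inverse image \<open>p\<^sup>*\<close>, a function from \<open>X\<close> to \<open>Q\<close>.\<close>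

locale quantale_map = Q?: involutive_quantale Q + X?: involutive_quantale X
  for Q :: "('q, 'm) quantale_struct_scheme" and X :: "('x, 'n) quantale_struct_scheme" +
  fixes pstar :: "'x \<Rightarrow> 'q"
  assumes pstar_closed: "x \<in> carrier X \<Longrightarrow> pstar x \<in> carrier Q"
    and pstar_Sup: "S \<subseteq> carrier X \<Longrightarrow> pstar (\<Squnion>\<^bsub>X\<^esub>S) = \<Squnion>\<^bsub>Q\<^esub>(pstar ` S)"
    and pstar_qmul: "x \<in> carrier X \<Longrightarrow> y \<in> carrier X \<Longrightarrow>
      pstar (x \<odot>\<odot>\<^bsub>X\<^esub> y) = pstar x \<odot>\<odot>\<^bsub>Q\<^esub> pstar y"
    and pstar_qinv: "x \<in> carrier X \<Longrightarrow> pstar (qinv X x) = qinv Q (pstar x)"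

definition surjection ::
  "('q, 'm) quantale_struct_scheme \<Rightarrow> ('x, 'n) quantale_struct_scheme \<Rightarrow> ('x \<Rightarrow> 'q) \<Rightarrow> bool" where
  "surjection Q X pstar \<longleftrightarrow> inj_on pstar (carrier X)"

definition direct_image ::
  "('q, 'm) quantale_struct_scheme \<Rightarrow> ('x, 'n) quantale_struct_scheme \<Rightarrow> ('x \<Rightarrow> 'q) \<Rightarrow>
    ('q \<Rightarrow> 'x) \<Rightarrow> bool" where
  "direct_image Q X pstar pbang \<longleftrightarrow>
    galois_connection \<lparr>orderA = Q, orderB = X, lower = pbang, upper = pstar\<rparr>"

text \<open>The topology of a groupoid.\<close>

definition Omega :: "('g, 'm) groupoid_scheme \<Rightarrow> 'g set quantale_struct" where
  "Omega G = \<lparr>carrier = {U. openin (gtop G) U}, eq = (=), le = (\<subseteq>),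
     qmul = (\<lambda>U V. {g \<cdot>\<^bsub>G\<^esub> h | g h. g \<in> U \<and> h \<in> V \<and> (g, h) \<in> composable G}),
     qinv = (\<lambda>U. ginv G ` U)\<rparr>"

text \<open>The left adjoint is unique on the carrier, so the existential quantifier expresses that the
  map is semiopen and that its direct image satisfies the displayed identity.\<close>

definition quantic_bundle ::
  "('g, 'm) groupoid_scheme \<Rightarrow> ('q, 'n) quantale_struct_scheme \<Rightarrow> ('g set \<Rightarrow> 'q) \<Rightarrow> bool" where
  "quantic_bundle G Q pstar \<longleftrightarrow>
    quantale_map Q (Omega G) pstar \<and> surjection Q (Omega G) pstar \<and>
    (\<exists>pbang. direct_image Q (Omega G) pstar pbang \<and>
      (\<forall>U\<in>carrier (Omega G). \<forall>a\<in>carrier Q. \<forall>b\<in>carrier Q.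
        pbang a \<in> bisections G \<longrightarrow> pbang b \<in> bisections G \<longrightarrow>
        pbang (a \<odot>\<odot>\<^bsub>Q\<^esub> pstar U \<odot>\<odot>\<^bsub>Q\<^esub> b) =
          pbang a \<odot>\<odot>\<^bsub>Omega G\<^esub> U \<odot>\<odot>\<^bsub>Omega G\<^esub> pbang b))"


section \<open>C*-algebras and their quantales of closed subspaces\<close>

class cstar_algebra = banach + real_normed_algebra +
  fixes scaleC :: "complex \<Rightarrow> 'a \<Rightarrow> 'a" (infixr "*\<^sub>C" 75)
    and adj :: "'a \<Rightarrow> 'a"
  assumes scaleR_scaleC: "r *\<^sub>R x = complex_of_real r *\<^sub>C x"
    and scaleC_add_right: "c *\<^sub>C (x + y) = c *\<^sub>C x + c *\<^sub>C y"
    and scaleC_add_left: "(c + d) *\<^sub>C x = c *\<^sub>C x + d *\<^sub>C x"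
    and scaleC_scaleC: "c *\<^sub>C d *\<^sub>C x = (c * d) *\<^sub>C x"
    and scaleC_one: "1 *\<^sub>C x = x"
    and norm_scaleC: "norm (c *\<^sub>C x) = cmod c * norm x"
    and mult_scaleC_left: "(c *\<^sub>C x) * y = c *\<^sub>C (x * y)"
    and mult_scaleC_right: "x * (c *\<^sub>C y) = c *\<^sub>C (x * y)"
    and adj_add: "adj (x + y) = adj x + adj y"
    and adj_scaleC: "adj (c *\<^sub>C x) = cnj c *\<^sub>C adj x"
    and adj_adj: "adj (adj x) = x"
    and adj_mult: "adj (x * y) = adj y * adj x"
    and cstar_identity: "norm (adj x * x) = (norm x)\<^sup>2"

interpretation cvec: vector_space "scaleC :: complex \<Rightarrow> 'a \<Rightarrow> 'a::cstar_algebra"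
  by unfold_locales
    (simp_all add: scaleC_add_right scaleC_add_left scaleC_scaleC scaleC_one)

definition closed_cspan :: "'a::cstar_algebra set \<Rightarrow> 'a set" where
  "closed_cspan S = closure (cvec.span S)"

definition Max_quantale :: "'a::cstar_algebra set quantale_struct" where
  "Max_quantale = \<lparr>carrier = {V. closed V \<and> cvec.subspace V}, eq = (=), le = (\<subseteq>),
     qmul = (\<lambda>V W. closed_cspan {a * b | a b. a \<in> V \<and> b \<in> W}),
     qinv = (\<lambda>V. adj ` V)\<rparr>"


section \<open>Banach bundles\<close>

definition complex_ring :: "complex ring" where
  "complex_ring = \<lparr>carrier = UNIV, mult = (*), one = 1, zero = 0, add = (+)\<rparr>"

text \<open>Set to 0 off the carrier because \<^locale>\<open>Metric_space\<close> demands a nonnegative symmetric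
  function on the whole type.\<close>

definition norm_dist :: "(complex, 'e) module \<Rightarrow> ('e \<Rightarrow> real) \<Rightarrow> 'e \<Rightarrow> 'e \<Rightarrow> real" where
  "norm_dist M nrm e f =
    (if e \<in> carrier M \<and> f \<in> carrier M then nrm (e \<ominus>\<^bsub>M\<^esub> f) else 0)"

definition norm_topology :: "(complex, 'e) module \<Rightarrow> ('e \<Rightarrow> real) \<Rightarrow> 'e topology" where
  "norm_topology M nrm = Metric_space.mtopology (carrier M) (norm_dist M nrm)"

locale complex_normed_space = Module.module complex_ring M
  for M :: "(complex, 'e) module" and nrm :: "'e \<Rightarrow> real" +
  assumes nrm_nonneg: "e \<in> carrier M \<Longrightarrow> 0 \<le> nrm e"
    and nrm_eq_0: "e \<in> carrier M \<Longrightarrow> nrm e = 0 \<longleftrightarrow> e = \<zero>\<^bsub>M\<^esub>"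
    and nrm_smult: "e \<in> carrier M \<Longrightarrow> nrm (c \<odot>\<^bsub>M\<^esub> e) = cmod c * nrm e"
    and nrm_triangle: "e \<in> carrier M \<Longrightarrow> f \<in> carrier M \<Longrightarrow> nrm (e \<oplus>\<^bsub>M\<^esub> f) \<le> nrm e + nrm f"

lemma cring_complex_ring: "cring complex_ring"
  by (unfold_locales)
    (auto simp: complex_ring_def Units_def algebra_simps intro: exI[of _ "- x" for x])

lemma (in complex_normed_space) smult_uminus_one:
  assumes "e \<in> carrier M"
  shows "(-1) \<odot>\<^bsub>M\<^esub> e = \<ominus>\<^bsub>M\<^esub> e"
proof (rule M.minus_equality[symmetric])
  have z: "0 \<odot>\<^bsub>M\<^esub> e = \<zero>\<^bsub>M\<^esub>"
    using smult_l_null[OF assms] by (simp add: complex_ring_def)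
  have o: "1 \<odot>\<^bsub>M\<^esub> e = e"
    using smult_one[OF assms] by (simp add: complex_ring_def)
  have "(-1) \<odot>\<^bsub>M\<^esub> e \<oplus>\<^bsub>M\<^esub> 1 \<odot>\<^bsub>M\<^esub> e = (-1 + 1) \<odot>\<^bsub>M\<^esub> e"
    using smult_l_distr[of "-1" 1 e] assms by (simp add: complex_ring_def)
  then show "(-1) \<odot>\<^bsub>M\<^esub> e \<oplus>\<^bsub>M\<^esub> e = \<zero>\<^bsub>M\<^esub>"
    by (simp add: o z)
  show "(-1) \<odot>\<^bsub>M\<^esub> e \<in> carrier M" "e \<in> carrier M"
    using smult_closed[of "-1" e] assms by (simp_all add: complex_ring_def)
qed

lemma (in complex_normed_space) Metric_space_norm_dist: "Metric_space (carrier M) (norm_dist M nrm)"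
proof
  fix e f
  show "0 \<le> norm_dist M nrm e f"
    by (simp add: norm_dist_def nrm_nonneg)
  show "norm_dist M nrm e f = norm_dist M nrm f e"
  proof (cases "e \<in> carrier M \<and> f \<in> carrier M")
    case True
    then have "f \<ominus>\<^bsub>M\<^esub> e = \<ominus>\<^bsub>M\<^esub> (e \<ominus>\<^bsub>M\<^esub> f)"
      by (simp add: M.minus_eq M.minus_add M.a_comm)
    also have "\<dots> = (-1) \<odot>\<^bsub>M\<^esub> (e \<ominus>\<^bsub>M\<^esub> f)"
      using True by (simp add: smult_uminus_one)
    finally show ?thesis
      using True nrm_smult[of "e \<ominus>\<^bsub>M\<^esub> f" "-1"] by (simp add: norm_dist_def)
  qed (auto simp: norm_dist_def)
next
  fix e f
  assume "e \<in> carrier M" "f \<in> carrier M"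
  then show "norm_dist M nrm e f = 0 \<longleftrightarrow> e = f"
    using M.minus_equality[of e "\<ominus>\<^bsub>M\<^esub> f"] M.minus_minus[of f]
    by (auto simp: norm_dist_def nrm_eq_0 M.minus_eq M.r_neg)
next
  fix e f k
  assume ef: "e \<in> carrier M" "f \<in> carrier M" "k \<in> carrier M"
  then have "e \<ominus>\<^bsub>M\<^esub> k = (e \<ominus>\<^bsub>M\<^esub> f) \<oplus>\<^bsub>M\<^esub> (f \<ominus>\<^bsub>M\<^esub> k)"
    by (simp add: M.minus_eq M.a_assoc M.r_neg1)
  then show "norm_dist M nrm e k \<le> norm_dist M nrm e f + norm_dist M nrm f k"
    using ef nrm_triangle[of "e \<ominus>\<^bsub>M\<^esub> f" "f \<ominus>\<^bsub>M\<^esub> k"] by (simp add: norm_dist_def)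
qed

locale complex_banach_space = complex_normed_space +
  assumes nrm_complete: "Metric_space.mcomplete (carrier M) (norm_dist M nrm)"

text \<open>The linear operations and the norm are functions on the total space, constrained only within
  fibres (\<open>bzero B x\<close> is the zero vector of the fibre over \<open>x\<close>).\<close>

record ('x, 'e) banach_struct =
  btop :: "'e topology"
  proj :: "'e \<Rightarrow> 'x"
  bzero :: "'x \<Rightarrow> 'e"
  badd :: "'e \<Rightarrow> 'e \<Rightarrow> 'e"
  bscale :: "complex \<Rightarrow> 'e \<Rightarrow> 'e"
  bnorm :: "'e \<Rightarrow> real"

text \<open>The ring multiplication and unit demanded by the record type \<open>module\<close> play no role.\<close>

definition fibre :: "('x, 'e, 'm) banach_struct_scheme \<Rightarrow> 'x \<Rightarrow> (complex, 'e) module" where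
  "fibre B x = \<lparr>carrier = {e \<in> topspace (btop B). proj B e = x}, mult = undefined, one = undefined,
     zero = bzero B x, add = badd B, smult = bscale B\<rparr>"

locale banach_bundle =
  fixes X :: "'x topology" and B :: "('x, 'e, 'm) banach_struct_scheme"
  assumes locally_Hausdorff:
      "x \<in> topspace X \<Longrightarrow> \<exists>U. openin X U \<and> x \<in> U \<and> Hausdorff_space (subtopology X U)"
    and proj_continuous: "continuous_map (btop B) X (proj B)"
    and proj_open: "open_map (btop B) X (proj B)"
    and proj_surjective: "proj B ` topspace (btop B) = topspace X"
    and fibre_banach: "x \<in> topspace X \<Longrightarrow> complex_banach_space (fibre B x) (bnorm B)"
    and Hausdorff_over: "openin X U \<Longrightarrow> Hausdorff_space (subtopology X U) \<Longrightarrow>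
      Hausdorff_space (subtopology (btop B) {e \<in> topspace (btop B). proj B e \<in> U})"
    and badd_continuous:
      "continuous_map
        (subtopology (prod_topology (btop B) (btop B)) {(e, f). proj B e = proj B f}) (btop B)
        (\<lambda>(e, f). badd B e f)"
    and bscale_continuous: "continuous_map (btop B) (btop B) (bscale B c)"
    and bnorm_upper_semicontinuous: "openin (btop B) {e \<in> topspace (btop B). bnorm B e < r}"
    and zero_neighbourhoods:
      "x \<in> topspace X \<Longrightarrow> openin (btop B) V \<Longrightarrow> bzero B x \<in> V \<Longrightarrow>
        \<exists>\<epsilon>>0. \<exists>U. openin X U \<and> x \<in> U \<and>
          {e \<in> topspace (btop B). proj B e \<in> U \<and> bnorm B e < \<epsilon>} \<subseteq> V"

definition fibre_closed_span ::
  "('x, 'e, 'm) banach_struct_scheme \<Rightarrow> 'x \<Rightarrow> 'e set \<Rightarrow> 'e set" where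
  "fibre_closed_span B x S = \<Inter>{H. submodule H complex_ring (fibre B x) \<and>
     closedin (norm_topology (fibre B x) (bnorm B)) H \<and> S \<subseteq> H}"


section \<open>Fell bundles\<close>

record ('g, 'e) fell_struct = "('g, 'e) banach_struct" +
  bmul :: "'e \<Rightarrow> 'e \<Rightarrow> 'e"
  bstar :: "'e \<Rightarrow> 'e"

definition mult_pairs ::
  "('g, 'm) groupoid_scheme \<Rightarrow> ('g, 'e, 'n) banach_struct_scheme \<Rightarrow> ('e \<times> 'e) set" where
  "mult_pairs G E = {(e, f). e \<in> topspace (btop E) \<and> f \<in> topspace (btop E) \<and>
     (proj E e, proj E f) \<in> composable G}"

text \<open>Positivity of an element of the C*-algebra over a unit \<open>x\<close>: it has the form \<open>b\<^sup>* b\<close> with \<open>b\<close> in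
  that same fibre.\<close>

definition fibre_positive :: "('g, 'e, 'n) fell_struct_scheme \<Rightarrow> 'g \<Rightarrow> 'e \<Rightarrow> bool" where
  "fibre_positive E x a \<longleftrightarrow> (\<exists>b\<in>carrier (fibre E x). a = bmul E (bstar E b) b)"

locale fell_bundle = etale_groupoid G + banach_bundle "gtop G" E
  for G :: "('g, 'm) groupoid_scheme" and E :: "('g, 'e, 'n) fell_struct_scheme" +
  assumes bmul_continuous:
      "continuous_map (subtopology (prod_topology (btop E) (btop E)) (mult_pairs G E)) (btop E)
        (\<lambda>(e, f). bmul E e f)"
    and bstar_continuous: "continuous_map (btop E) (btop E) (bstar E)"
    and proj_bmul: "(e, f) \<in> mult_pairs G E \<Longrightarrow> proj E (bmul E e f) = proj E e \<cdot>\<^bsub>G\<^esub> proj E f"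
    and proj_bstar: "e \<in> topspace (btop E) \<Longrightarrow> proj E (bstar E e) = ginv G (proj E e)"
    and bmul_assoc: "(e, f) \<in> mult_pairs G E \<Longrightarrow> (f, k) \<in> mult_pairs G E \<Longrightarrow>
      bmul E (bmul E e f) k = bmul E e (bmul E f k)"
    and bmul_add_left:
      "(e, f) \<in> mult_pairs G E \<Longrightarrow> (e', f) \<in> mult_pairs G E \<Longrightarrow> proj E e = proj E e' \<Longrightarrow>
        bmul E (badd E e e') f = badd E (bmul E e f) (bmul E e' f)"
    and bmul_add_right:
      "(e, f) \<in> mult_pairs G E \<Longrightarrow> (e, f') \<in> mult_pairs G E \<Longrightarrow> proj E f = proj E f' \<Longrightarrow>
        bmul E e (badd E f f') = badd E (bmul E e f) (bmul E e f')"
    and bmul_scale_left: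
      "(e, f) \<in> mult_pairs G E \<Longrightarrow> bmul E (bscale E c e) f = bscale E c (bmul E e f)"
    and bmul_scale_right:
      "(e, f) \<in> mult_pairs G E \<Longrightarrow> bmul E e (bscale E c f) = bscale E c (bmul E e f)"
    and bstar_add:
      "e \<in> topspace (btop E) \<Longrightarrow> f \<in> topspace (btop E) \<Longrightarrow> proj E e = proj E f \<Longrightarrow>
        bstar E (badd E e f) = badd E (bstar E e) (bstar E f)"
    and bstar_scale:
      "e \<in> topspace (btop E) \<Longrightarrow> bstar E (bscale E c e) = bscale E (cnj c) (bstar E e)"
    and bstar_bstar: "e \<in> topspace (btop E) \<Longrightarrow> bstar E (bstar E e) = e"
    and bstar_bmul:
      "(e, f) \<in> mult_pairs G E \<Longrightarrow> bstar E (bmul E e f) = bmul E (bstar E f) (bstar E e)"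
    and bnorm_bmul: "(e, f) \<in> mult_pairs G E \<Longrightarrow> bnorm E (bmul E e f) \<le> bnorm E e * bnorm E f"
    and bnorm_bstar: "e \<in> topspace (btop E) \<Longrightarrow> bnorm E (bstar E e) = bnorm E e"
    and bnorm_cstar:
      "e \<in> topspace (btop E) \<Longrightarrow> bnorm E (bmul E (bstar E e) e) = (bnorm E e)\<^sup>2"
    and bstar_bmul_positive:
      "e \<in> topspace (btop E) \<Longrightarrow> fibre_positive E (gdom G (proj E e)) (bmul E (bstar E e) e)"

definition saturated ::
  "('g, 'm) groupoid_scheme \<Rightarrow> ('g, 'e, 'n) fell_struct_scheme \<Rightarrow> bool" where
  "saturated G E \<longleftrightarrow> (\<forall>(g, h)\<in>composable G.
    fibre_closed_span E (g \<cdot>\<^bsub>G\<^esub> h)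
      {bmul E e f | e f. e \<in> carrier (fibre E g) \<and> f \<in> carrier (fibre E h)}
    = carrier (fibre E (g \<cdot>\<^bsub>G\<^esub> h)))"

definition abelian_bundle ::
  "('g, 'm) groupoid_scheme \<Rightarrow> ('g, 'e, 'n) fell_struct_scheme \<Rightarrow> bool" where
  "abelian_bundle G E \<longleftrightarrow> (\<forall>x\<in>units G. \<forall>e\<in>carrier (fibre E x). \<forall>f\<in>carrier (fibre E x).
    bmul E e f = bmul E f e)"

text \<open>A space has dimension 1 iff it has a basis consisting of a single (nonzero) vector.\<close>

definition line_bundle ::
  "('g, 'm) groupoid_scheme \<Rightarrow> ('g, 'e, 'n) fell_struct_scheme \<Rightarrow> bool" where
  "line_bundle G E \<longleftrightarrow> (\<forall>g\<in>arrows G. \<exists>e\<in>carrier (fibre E g).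
    e \<noteq> bzero E g \<and> carrier (fibre E g) = range (\<lambda>c. bscale E c e))"


section \<open>The convolution algebra\<close>

text \<open>Sections are extensional functions, so that equality of sections is equality of functions.\<close>

definition sections ::
  "('g, 'm) groupoid_scheme \<Rightarrow> ('g, 'e, 'n) banach_struct_scheme \<Rightarrow> ('g \<Rightarrow> 'e) set" where
  "sections G E = (\<Pi>\<^sub>E g\<in>arrows G. carrier (fibre E g))"

definition sec_zero ::
  "('g, 'm) groupoid_scheme \<Rightarrow> ('g, 'e, 'n) banach_struct_scheme \<Rightarrow> 'g \<Rightarrow> 'e" where
  "sec_zero G E = (\<lambda>g\<in>arrows G. bzero E g)"

definition sec_add ::
  "('g, 'm) groupoid_scheme \<Rightarrow> ('g, 'e, 'n) banach_struct_scheme \<Rightarrow>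
    ('g \<Rightarrow> 'e) \<Rightarrow> ('g \<Rightarrow> 'e) \<Rightarrow> 'g \<Rightarrow> 'e" where
  "sec_add G E s t = (\<lambda>g\<in>arrows G. badd E (s g) (t g))"

definition sec_scale ::
  "('g, 'm) groupoid_scheme \<Rightarrow> ('g, 'e, 'n) banach_struct_scheme \<Rightarrow>
    complex \<Rightarrow> ('g \<Rightarrow> 'e) \<Rightarrow> 'g \<Rightarrow> 'e" where
  "sec_scale G E c s = (\<lambda>g\<in>arrows G. bscale E c (s g))"

definition Cc ::
  "('g, 'm) groupoid_scheme \<Rightarrow> ('g, 'e, 'n) banach_struct_scheme \<Rightarrow> 'g set \<Rightarrow> ('g \<Rightarrow> 'e) set" where
  "Cc G E U = {s \<in> sections G E.
     (\<forall>g\<in>arrows G - U. s g = bzero E g) \<and>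
     continuous_map (subtopology (gtop G) U) (btop E) s \<and>
     (\<exists>K. compactin (gtop G) K \<and> {g \<in> arrows G. s g \<noteq> bzero E g} \<subseteq> K \<and> K \<subseteq> U)}"

text \<open>The linear span of the union of all \<open>Cc G E U\<close>, \<open>U\<close> a local bisection. (Local bisections of an
  etale groupoid are automatically Hausdorff.)\<close>

inductive_set Gamma_c :: "('g, 'm) groupoid_scheme \<Rightarrow> ('g, 'e, 'n) banach_struct_scheme \<Rightarrow> ('g \<Rightarrow> 'e) set"
  for G :: "('g, 'm) groupoid_scheme" and E :: "('g, 'e, 'n) banach_struct_scheme" where
  base: "U \<in> bisections G \<Longrightarrow> s \<in> Cc G E U \<Longrightarrow> s \<in> Gamma_c G E"
| zero: "sec_zero G E \<in> Gamma_c G E"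
| add: "s \<in> Gamma_c G E \<Longrightarrow> t \<in> Gamma_c G E \<Longrightarrow> sec_add G E s t \<in> Gamma_c G E"
| scale: "s \<in> Gamma_c G E \<Longrightarrow> sec_scale G E c s \<in> Gamma_c G E"

text \<open>The library's finite sum takes a junk value on infinite index sets, so the vanishing terms of
  the convolution sum are discarded; for \<open>s\<close>, \<open>t\<close> in \<open>Gamma_c G E\<close> only finitely many remain.\<close>

definition conv ::
  "('g, 'm) groupoid_scheme \<Rightarrow> ('g, 'e, 'n) fell_struct_scheme \<Rightarrow>
    ('g \<Rightarrow> 'e) \<Rightarrow> ('g \<Rightarrow> 'e) \<Rightarrow> 'g \<Rightarrow> 'e" where
  "conv G E s t = (\<lambda>g\<in>arrows G.
     finsum (fibre E g) (\<lambda>(h, k). bmul E (s h) (t k))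
       {(h, k) \<in> composable G. h \<cdot>\<^bsub>G\<^esub> k = g \<and> bmul E (s h) (t k) \<noteq> bzero E g})"

definition sec_star ::
  "('g, 'm) groupoid_scheme \<Rightarrow> ('g, 'e, 'n) fell_struct_scheme \<Rightarrow> ('g \<Rightarrow> 'e) \<Rightarrow> 'g \<Rightarrow> 'e" where
  "sec_star G E s = (\<lambda>g\<in>arrows G. bstar E (s (ginv G g)))"

definition sup_norm ::
  "('g, 'm) groupoid_scheme \<Rightarrow> ('g, 'e, 'n) banach_struct_scheme \<Rightarrow> ('g \<Rightarrow> 'e) \<Rightarrow> ennreal" where
  "sup_norm G E s = (SUP g\<in>arrows G. ennreal (bnorm E (s g)))"

locale compatible_norm = fell_bundle G E
  for G :: "('g, 'm) groupoid_scheme" and E :: "('g, 'e, 'n) fell_struct_scheme" +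
  fixes N :: "('g \<Rightarrow> 'e) \<Rightarrow> real"
  assumes N_nonneg: "s \<in> Gamma_c G E \<Longrightarrow> 0 \<le> N s"
    and N_eq_0: "s \<in> Gamma_c G E \<Longrightarrow> N s = 0 \<longleftrightarrow> s = sec_zero G E"
    and N_scale: "s \<in> Gamma_c G E \<Longrightarrow> N (sec_scale G E c s) = cmod c * N s"
    and N_triangle: "s \<in> Gamma_c G E \<Longrightarrow> t \<in> Gamma_c G E \<Longrightarrow> N (sec_add G E s t) \<le> N s + N t"
    and N_conv: "s \<in> Gamma_c G E \<Longrightarrow> t \<in> Gamma_c G E \<Longrightarrow> N (conv G E s t) \<le> N s * N t"
    and N_cstar: "s \<in> Gamma_c G E \<Longrightarrow> N (conv G E (sec_star G E s) s) = (N s)\<^sup>2"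
    and sup_norm_le_N: "s \<in> Gamma_c G E \<Longrightarrow> sup_norm G E s \<le> ennreal (N s)"
    and sup_norm_eq_N:
      "U \<in> bisections G \<Longrightarrow> s \<in> Cc G E U \<Longrightarrow> sup_norm G E s = ennreal (N s)"

text \<open>The completion is given by a C*-algebra \<open>'a\<close> together with the canonical isometric
  *-homomorphism \<open>\<iota>\<close> of the convolution algebra onto a dense *-subalgebra.\<close>

locale compatible_completion = compatible_norm G E N
  for G :: "('g, 'm) groupoid_scheme" and E :: "('g, 'e, 'n) fell_struct_scheme"
    and N :: "('g \<Rightarrow> 'e) \<Rightarrow> real" +
  fixes \<iota> :: "('g \<Rightarrow> 'e) \<Rightarrow> 'a::cstar_algebra"
  assumes iota_add:
      "s \<in> Gamma_c G E \<Longrightarrow> t \<in> Gamma_c G E \<Longrightarrow> \<iota> (sec_add G E s t) = \<iota> s + \<iota> t"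
    and iota_scale: "s \<in> Gamma_c G E \<Longrightarrow> \<iota> (sec_scale G E c s) = c *\<^sub>C \<iota> s"
    and iota_conv: "s \<in> Gamma_c G E \<Longrightarrow> t \<in> Gamma_c G E \<Longrightarrow> \<iota> (conv G E s t) = \<iota> s * \<iota> t"
    and iota_star: "s \<in> Gamma_c G E \<Longrightarrow> \<iota> (sec_star G E s) = adj (\<iota> s)"
    and iota_norm: "s \<in> Gamma_c G E \<Longrightarrow> norm (\<iota> s) = N s"
    and iota_dense: "closure (\<iota> ` Gamma_c G E) = UNIV"

text \<open>\<open>p\<^sup>*\<close>\<close>

definition assoc_map ::
  "('g, 'm) groupoid_scheme \<Rightarrow> ('g, 'e, 'n) banach_struct_scheme \<Rightarrow>
    (('g \<Rightarrow> 'e) \<Rightarrow> 'a::cstar_algebra) \<Rightarrow> 'g set \<Rightarrow> 'a set" where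
  "assoc_map G E \<iota> V = closed_cspan (\<Union>{\<iota> ` Cc G E U | U. U \<in> bisections G \<and> U \<subseteq> V})"


section \<open>Localizability\<close>

text \<open>The evaluation at \<open>g\<close> is the unique continuous linear map from the completion to the fibre
  over \<open>g\<close> that extends evaluation of sections.\<close>

definition eval_at ::
  "('g, 'm) groupoid_scheme \<Rightarrow> ('g, 'e, 'n) banach_struct_scheme \<Rightarrow>
    (('g \<Rightarrow> 'e) \<Rightarrow> 'a::cstar_algebra) \<Rightarrow> 'g \<Rightarrow> 'a \<Rightarrow> 'e" where
  "eval_at G E \<iota> g = (THE T.
     (\<forall>a. T a \<in> carrier (fibre E g)) \<and>
     (\<forall>a b. T (a + b) = badd E (T a) (T b)) \<and>
     (\<forall>c a. T (c *\<^sub>C a) = bscale E c (T a)) \<and>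
     continuous_map euclidean (norm_topology (fibre E g) (bnorm E)) T \<and>
     (\<forall>s\<in>Gamma_c G E. T (\<iota> s) = s g))"

definition open_support ::
  "('g, 'm) groupoid_scheme \<Rightarrow> ('g, 'e, 'n) banach_struct_scheme \<Rightarrow>
    (('g \<Rightarrow> 'e) \<Rightarrow> 'a::cstar_algebra) \<Rightarrow> 'a \<Rightarrow> 'g set" where
  "open_support G E \<iota> a =
    gtop G interior_of {g \<in> arrows G. eval_at G E \<iota> g a \<noteq> bzero E g}"

definition gamma_map ::
  "('g, 'm) groupoid_scheme \<Rightarrow> ('g, 'e, 'n) banach_struct_scheme \<Rightarrow>
    (('g \<Rightarrow> 'e) \<Rightarrow> 'a::cstar_algebra) \<Rightarrow> 'g set \<Rightarrow> 'a set" where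
  "gamma_map G E \<iota> V = closed_cspan {a. open_support G E \<iota> a \<subseteq> V}"

locale localizable_completion = compatible_completion +
  assumes localizable: "openin (gtop G) V \<Longrightarrow> assoc_map G E \<iota> V = gamma_map G E \<iota> V"

end

theory Submission
  imports Defs
begin

text \<open>
  Write \<open>p\<^sup>*\<close> for the map that sends an open set \<open>V\<close> to the closed span of the sections over
  bisections inside \<open>V\<close>. Localizability says that an element of the completion belongs to \<open>p\<^sup>*(V)\<close>
  as soon as its open support lies in \<open>V\<close>, so \<open>p\<^sup>*\<close> has a left adjoint \<open>p\<^sub>!\<close>: the union of the
  open supports of the members of a subspace (\<open>pbang_le_iff\<close>). Both implications thereby turn into
  statements about the places where the evaluations of products are nonzero. Such evaluations can
  be computed over bisections: for \<open>a\<close> in \<open>p\<^sup>*(U)\<close> and \<open>b\<close> in \<open>p\<^sup>*(V)\<close>, with \<open>U\<close> and \<open>V\<close>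
  bisections, the section \<open>g \<mapsto> ev g a\<close> is continuous on \<open>U\<close>, and the value of \<open>a b\<close> at \<open>g h\<close> is
  the product of the values at \<open>g\<close> and \<open>h\<close> (\<open>ev_mult\<close>).

  Line bundles are quantic. In a line bundle the product of two nonzero vectors is nonzero
  (\<open>line_mul_nonzero\<close>), because \<open>e f = 0\<close> would make the two nonzero vectors \<open>e\<^sup>* e\<close> and \<open>f f\<^sup>*\<close>
  of one line annihilate each other. Together with the existence of nonvanishing sections through
  every arrow this gives the injectivity of \<open>p\<^sup>*\<close> and the identity for \<open>p\<^sub>!\<close>
  (\<open>line_pbang_product\<close>). That \<open>p\<^sup>*\<close> preserves joins and products is a localisation argument: a
  section over a bisection belongs to a closed subspace if it does so locally and up to every
  error, in a way that is stable under multiplication by functions (\<open>local_membership\<close>). The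
  existence of enough continuous sections (\<open>enough_sections\<close>, a theorem of Douady and dal
  Soglio-Herault) is obtained by patching sections that are continuous up to an error and letting
  the error tend to zero.

  Abelian quantic bundles are line bundles. If the fibre over \<open>g\<close> were zero, then \<open>p\<^sup>*\<close> would not
  see the difference between \<open>G\<close> and \<open>G - {g}\<close>, so injectivity makes all fibres nonzero. Over a
  unit \<open>x\<close>, the identity for \<open>p\<^sub>!\<close>, applied to the lines spanned by two elements \<open>a\<close> and \<open>b\<close> of
  \<open>p\<^sup>*(G\<^sub>0)\<close> that do not vanish at \<open>x\<close>, yields an element of the closed span of \<open>a p\<^sup>*(G\<^sub>0) b\<close>
  that does not vanish at \<open>x\<close>; as the fibre over \<open>x\<close> is commutative, the product of the two values
  is nonzero (\<open>no_zero_product\<close>). A commutative C*-algebra without zero divisors is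
  one-dimensional. Here this is derived from the connectedness of the real line. Let \<open>y\<close> be
  self-adjoint and let \<open>r\<close> be a lift of a vector \<open>e\<close> over \<open>x\<close>, both over the units. The elements
  \<open>r (|y - \<mu>| - (y - \<mu>))\<close> and \<open>r (|y - \<mu>| + (y - \<mu>))\<close> are orthogonal, so for each \<open>\<mu>\<close> one of the
  two vanishes at \<open>x\<close>; the first one does for very negative \<open>\<mu>\<close>, the second one for very large
  \<open>\<mu>\<close>, so for some \<open>\<mu>\<close> both vanish, and \<open>e\<close> is an eigenvector of right multiplication by the value
  of \<open>y\<close> (\<open>selfadjoint_eigenvalue\<close>). The completion may have no unit, so that the absolute value
  is formed in the algebra of bounded operators, for right multiplication by \<open>y - \<mu>\<close>. The fibres
  over other arrows are reduced to those over units by the maps \<open>e \<mapsto> u\<^sup>* e\<close>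
  (\<open>quantic_line_bundle\<close>).
\<close>


section \<open>Vectors of a Banach bundle\<close>

lemma fibre_simps [simp]:
  "e \<in> carrier (fibre B x) \<longleftrightarrow> e \<in> topspace (btop B) \<and> proj B e = x"
  "zero (fibre B x) = bzero B x" "add (fibre B x) = badd B" "smult (fibre B x) = bscale B"
  by (auto simp: fibre_def)

definition bdist :: "('x, 'e, 'm) banach_struct_scheme \<Rightarrow> 'e \<Rightarrow> 'e \<Rightarrow> real" where
  "bdist B e f = bnorm B (badd B e (bscale B (-1) f))"

context banach_bundle
begin

abbreviation fib :: "'x \<Rightarrow> 'e set" where
  "fib x \<equiv> {e \<in> topspace (btop B). proj B e = x}"

lemma proj_in [simp]: "e \<in> topspace (btop B) \<Longrightarrow> proj B e \<in> topspace X"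
  using proj_surjective by blast

lemma fibre_normed: "x \<in> topspace X \<Longrightarrow> complex_normed_space (fibre B x) (bnorm B)"
  using fibre_banach complex_banach_space.axioms(1) by blast

lemma fibre_module: "x \<in> topspace X \<Longrightarrow> Module.module complex_ring (fibre B x)"
  using fibre_normed complex_normed_space.axioms(1) by blast

lemma fibre_group: "x \<in> topspace X \<Longrightarrow> abelian_group (fibre B x)"
  using fibre_module module.axioms(2) by blast

lemma bzero_fib: "x \<in> topspace X \<Longrightarrow> bzero B x \<in> fib x"
  using abelian_monoid.zero_closed[OF abelian_group.axioms(1)[OF fibre_group]] by fastforce

lemma bzero_in [simp]: "x \<in> topspace X \<Longrightarrow> bzero B x \<in> topspace (btop B)"
  and proj_bzero [simp]: "x \<in> topspace X \<Longrightarrow> proj B (bzero B x) = x"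
  using bzero_fib by auto

lemma badd_fib:
  assumes "e \<in> fib x" "f \<in> fib x" shows "badd B e f \<in> fib x"
proof -
  have "x \<in> topspace X" using assms by auto
  from abelian_monoid.a_closed[OF abelian_group.axioms(1)[OF fibre_group[OF this]], of e f] assms
  show ?thesis by simp
qed

lemma bscale_fib:
  assumes "e \<in> fib x" shows "bscale B c e \<in> fib x"
proof -
  have "x \<in> topspace X" using assms by auto
  from module.smult_closed[OF fibre_module[OF this], of c e] assms
  show ?thesis by (simp add: complex_ring_def)
qed

lemma badd_in [simp]: "\<lbrakk>e \<in> topspace (btop B); f \<in> topspace (btop B); proj B e = proj B f\<rbrakk> \<Longrightarrow> badd B e f \<in> topspace (btop B)"
  and proj_badd [simp]: "\<lbrakk>e \<in> topspace (btop B); f \<in> topspace (btop B); proj B e = proj B f\<rbrakk> \<Longrightarrow> proj B (badd B e f) = proj B f"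
  using badd_fib[of e "proj B e" f] by auto

lemma bscale_in [simp]: "e \<in> topspace (btop B) \<Longrightarrow> bscale B c e \<in> topspace (btop B)"
  and proj_bscale [simp]: "e \<in> topspace (btop B) \<Longrightarrow> proj B (bscale B c e) = proj B e"
  using bscale_fib[of e "proj B e"] by auto

lemma
  assumes "e \<in> fib x"
  shows badd_bzero_left: "badd B (bzero B x) e = e"
    and badd_bzero_right: "badd B e (bzero B x) = e"
    and bscale_zero: "bscale B 0 e = bzero B x"
    and bscale_one: "bscale B 1 e = e"
    and bscale_bscale: "bscale B c (bscale B d e) = bscale B (c * d) e"
    and bscale_add_left: "bscale B (c + d) e = badd B (bscale B c e) (bscale B d e)"
    and bnorm_nonneg: "0 \<le> bnorm B e"
    and bnorm_eq_0: "bnorm B e = 0 \<longleftrightarrow> e = bzero B x"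
    and bnorm_scale: "bnorm B (bscale B c e) = cmod c * bnorm B e"
proof -
  have x: "x \<in> topspace X" using assms by auto
  interpret complex_normed_space "fibre B x" "bnorm B" by (rule fibre_normed[OF x])
  show "badd B (bzero B x) e = e" "badd B e (bzero B x) = e"
    using M.l_zero[of e] M.r_zero[of e] assms by auto
  show "bscale B 0 e = bzero B x" "bscale B 1 e = e"
    using smult_l_null[of e] smult_one[of e] assms by (auto simp: complex_ring_def)
  show "bscale B c (bscale B d e) = bscale B (c * d) e"
    "bscale B (c + d) e = badd B (bscale B c e) (bscale B d e)"
    using smult_assoc1[of c d e] smult_l_distr[of c d e] assms by (auto simp: complex_ring_def)
  show "0 \<le> bnorm B e" "bnorm B e = 0 \<longleftrightarrow> e = bzero B x" "bnorm B (bscale B c e) = cmod c * bnorm B e"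
    using nrm_nonneg[of e] nrm_eq_0[of e] nrm_smult[of e c] assms by auto
qed

lemma
  assumes "e \<in> fib x" "f \<in> fib x"
  shows badd_commute: "badd B e f = badd B f e"
    and bscale_add_right: "bscale B c (badd B e f) = badd B (bscale B c e) (bscale B c f)"
    and bnorm_triangle: "bnorm B (badd B e f) \<le> bnorm B e + bnorm B f"
    and norm_dist_bdist: "norm_dist (fibre B x) (bnorm B) e f = bdist B e f"
proof -
  have x: "x \<in> topspace X" using assms by auto
  interpret complex_normed_space "fibre B x" "bnorm B" by (rule fibre_normed[OF x])
  show "badd B e f = badd B f e" using M.a_comm[of e f] assms by auto
  show "bscale B c (badd B e f) = badd B (bscale B c e) (bscale B c f)"
    using smult_r_distr[of c e f] assms by (auto simp: complex_ring_def)
  show "bnorm B (badd B e f) \<le> bnorm B e + bnorm B f"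
    using nrm_triangle[of e f] assms by auto
  show "norm_dist (fibre B x) (bnorm B) e f = bdist B e f"
    using assms smult_uminus_one[of f] by (auto simp: norm_dist_def bdist_def a_minus_def)
qed

lemma badd_assoc:
  assumes "e \<in> fib x" "f \<in> fib x" "k \<in> fib x"
  shows "badd B (badd B e f) k = badd B e (badd B f k)"
proof -
  have x: "x \<in> topspace X" using assms by auto
  interpret complex_normed_space "fibre B x" "bnorm B" by (rule fibre_normed[OF x])
  show ?thesis using M.a_assoc[of e f k] assms by auto
qed

lemma badd_left_commute:
  assumes "e \<in> fib x" "f \<in> fib x" "k \<in> fib x"
  shows "badd B e (badd B f k) = badd B f (badd B e k)"
  using badd_assoc[of e x f k] badd_assoc[of f x e k] badd_commute[of e x f] assms by simp

lemma badd_swap: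
  assumes "a \<in> fib x" "b \<in> fib x" "c \<in> fib x" "d \<in> fib x"
  shows "badd B (badd B a b) (badd B c d) = badd B (badd B a c) (badd B b d)"
  using assms badd_assoc[of a x b "badd B c d"] badd_left_commute[of b x c d] badd_assoc[of a x c "badd B b d"] by simp

lemma bscale_bzero [simp]: "x \<in> topspace X \<Longrightarrow> bscale B c (bzero B x) = bzero B x"
  using bscale_bscale[of "bzero B x" x c 0] bscale_zero[of "bzero B x" x] by simp

lemma bnorm_bzero [simp]: "x \<in> topspace X \<Longrightarrow> bnorm B (bzero B x) = 0"
  using bnorm_eq_0 bzero_fib by blast

lemma badd_cancel: "e \<in> fib x \<Longrightarrow> badd B e (bscale B (-1) e) = bzero B x"
  using bscale_add_left[of e x 1 "-1"] by (simp add: bscale_one bscale_zero)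

lemma bdist_nonneg:
  assumes "e \<in> fib x" "f \<in> fib x" shows "0 \<le> bdist B e f"
  unfolding bdist_def using assms by (intro bnorm_nonneg[of _ x]) auto

lemma bdist_eq_0:
  assumes "e \<in> fib x" "f \<in> fib x" shows "bdist B e f = 0 \<longleftrightarrow> e = f"
proof
  assume "bdist B e f = 0"
  then have z: "badd B e (bscale B (-1) f) = bzero B x"
    unfolding bdist_def using assms by (subst (asm) bnorm_eq_0[of _ x]) auto
  have "e = badd B e (badd B (bscale B (-1) f) f)"
    using badd_cancel[of f x] badd_commute[of f x "bscale B (-1) f"] badd_bzero_right[of e x] assms by simp
  also have "\<dots> = f" using badd_assoc[of e x "bscale B (-1) f" f] z assms badd_bzero_left[of f x] by auto
  finally show "e = f" .
next
  assume "e = f" then show "bdist B e f = 0" unfolding bdist_def using assms badd_cancel bnorm_bzero by auto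
qed

lemma bdist_self: "e \<in> fib x \<Longrightarrow> bdist B e e = 0"
  using bdist_eq_0 by blast

lemma bdist_bzero: "e \<in> fib x \<Longrightarrow> bdist B e (bzero B x) = bnorm B e"
  unfolding bdist_def using bscale_bzero badd_bzero_right by force

lemma bdist_scale:
  assumes "e \<in> fib x" "f \<in> fib x"
  shows "bdist B (bscale B c e) (bscale B c f) = cmod c * bdist B e f"
proof -
  have "badd B (bscale B c e) (bscale B (-1) (bscale B c f)) = bscale B c (badd B e (bscale B (-1) f))"
    using assms bscale_bscale[of f x] bscale_add_right[of e x "bscale B (-1) f"] bscale_fib by auto
  then show ?thesis unfolding bdist_def using assms bnorm_scale[of "badd B e (bscale B (-1) f)" x] by auto
qed

lemma bdist_scale_left:
  assumes "e \<in> fib x"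
  shows "bdist B (bscale B c e) (bscale B d e) = cmod (c - d) * bnorm B e"
proof -
  have "badd B (bscale B c e) (bscale B (-1) (bscale B d e)) = bscale B (c - d) e"
    using assms bscale_bscale[of e x "-1" d] bscale_add_left[of e x c "-d"] by auto
  then show ?thesis unfolding bdist_def using assms bnorm_scale[of e x] by auto
qed

lemma bdist_sym:
  assumes "e \<in> fib x" "f \<in> fib x" shows "bdist B e f = bdist B f e"
proof -
  have "bscale B (-1) (badd B f (bscale B (-1) e)) = badd B e (bscale B (-1) f)"
    using assms bscale_add_right[of f x "bscale B (-1) e" "-1"] bscale_bscale[of e x "-1" "-1"] bscale_one[of e x]
     badd_commute[of e x "bscale B (-1) f"] by auto
  then show ?thesis unfolding bdist_def
    using bnorm_scale[of "badd B f (bscale B (-1) e)" x "-1"] assms by auto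
qed

lemma bdist_triangle:
  assumes "e \<in> fib x" "f \<in> fib x" "k \<in> fib x"
  shows "bdist B e k \<le> bdist B e f + bdist B f k"
proof -
  have "badd B (bscale B (-1) f) (badd B f (bscale B (-1) k)) = bscale B (-1) k"
    using assms badd_assoc[of "bscale B (-1) f" x f "bscale B (-1) k"] badd_cancel[of f x]
       badd_commute[of f x "bscale B (-1) f"] badd_bzero_left[of "bscale B (-1) k" x] by auto
  then have "badd B e (bscale B (-1) k) = badd B (badd B e (bscale B (-1) f)) (badd B f (bscale B (-1) k))"
    using assms badd_assoc[of e x "bscale B (-1) f" "badd B f (bscale B (-1) k)"] by auto
  then show ?thesis unfolding bdist_def
    using bnorm_triangle[of "badd B e (bscale B (-1) f)" x "badd B f (bscale B (-1) k)"] assms by auto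
qed

lemma bdist_add:
  assumes "a \<in> fib x" "b \<in> fib x" "c \<in> fib x" "d \<in> fib x"
  shows "bdist B (badd B a b) (badd B c d) \<le> bdist B a c + bdist B b d"
proof -
  have "badd B (badd B a b) (bscale B (-1) (badd B c d)) =
     badd B (badd B a (bscale B (-1) c)) (badd B b (bscale B (-1) d))"
    using assms bscale_add_right[of c x d "-1"] badd_swap[of a x b "bscale B (-1) c" "bscale B (-1) d"] by auto
  then show ?thesis unfolding bdist_def
    using bnorm_triangle[of "badd B a (bscale B (-1) c)" x "badd B b (bscale B (-1) d)"] assms by auto
qed

end


section \<open>Sections that are continuous up to an error\<close>

context banach_bundle
begin

lemma badd_diff: "e \<in> fib x \<Longrightarrow> f \<in> fib x \<Longrightarrow> badd B e (badd B f (bscale B (-1) e)) = f"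
  using badd_left_commute[of e x f "bscale B (-1) e"] badd_cancel[of e x] badd_bzero_right[of f x] by auto

text \<open>The operations of a bundle are continuous on pairs of vectors over the same point only; this
  is the form in which that continuity gets used.\<close>

lemma fibre_product_nbhd:
  assumes "openin (subtopology (prod_topology (btop B) (btop B)) {(e, f). proj B e = proj B f}) T"
    and "(e0, f0) \<in> T"
  obtains N1 N2 where "openin (btop B) N1" "openin (btop B) N2" "e0 \<in> N1" "f0 \<in> N2"
    "\<And>e f. e \<in> N1 \<Longrightarrow> f \<in> N2 \<Longrightarrow> proj B e = proj B f \<Longrightarrow> (e, f) \<in> T"
proof -
  obtain U where U: "openin (prod_topology (btop B) (btop B)) U" "T = U \<inter> {(e, f). proj B e = proj B f}"
    using assms(1) unfolding openin_subtopology by blast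
  have "(e0, f0) \<in> U" using assms(2) U by blast
  then obtain N1 N2 where "openin (btop B) N1" "openin (btop B) N2" "e0 \<in> N1" "f0 \<in> N2" "N1 \<times> N2 \<subseteq> U"
    using U(1)[unfolded openin_prod_topology_alt, rule_format, of e0 f0] by auto
  then show thesis using that U(2) by blast
qed

text \<open>Continuity of addition at \<open>(e0, 0)\<close>, where the neighbourhoods of zero are given by the norm:
  near \<open>e0\<close>, small fibrewise displacements do not leave \<open>N\<close>.\<close>

lemma sum_neighbourhood:
  assumes e0: "e0 \<in> fib x" and N: "openin (btop B) N" "e0 \<in> N"
  obtains N' \<epsilon> U where "openin (btop B) N'" "e0 \<in> N'" "0 < \<epsilon>" "openin X U" "x \<in> U"
    "\<And>e f. e \<in> N' \<Longrightarrow> f \<in> fib (proj B e) \<Longrightarrow> proj B e \<in> U \<Longrightarrow> bdist B f e < \<epsilon> \<Longrightarrow> f \<in> N"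
proof -
  have x: "x \<in> topspace X" using e0 by auto
  let ?S = "{(e, f). proj B e = proj B f}"
  let ?Y = "subtopology (prod_topology (btop B) (btop B)) ?S"
  define T where "T = {p \<in> topspace ?Y. (\<lambda>(e, f). badd B e f) p \<in> N}"
  have oT: "openin ?Y T" unfolding T_def
    by (rule openin_continuous_map_preimage[OF badd_continuous N(1)])
  have inT: "(e0, bzero B x) \<in> T" unfolding T_def using e0 x N badd_bzero_right[OF e0] by auto
  obtain N1 V where NV: "openin (btop B) N1" "openin (btop B) V" "e0 \<in> N1" "bzero B x \<in> V"
    "\<And>e f. e \<in> N1 \<Longrightarrow> f \<in> V \<Longrightarrow> proj B e = proj B f \<Longrightarrow> (e, f) \<in> T"
    using fibre_product_nbhd[OF oT inT] by blast
  obtain \<epsilon> U where eU: "\<epsilon> > 0" "openin X U" "x \<in> U"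
    "{e \<in> topspace (btop B). proj B e \<in> U \<and> bnorm B e < \<epsilon>} \<subseteq> V"
    using zero_neighbourhoods[OF x NV(2,4)] by blast
  show thesis
  proof (rule that[OF NV(1,3) eU(1,2,3)])
    fix e f assume A: "e \<in> N1" "f \<in> fib (proj B e)" "proj B e \<in> U" "bdist B f e < \<epsilon>"
    have e: "e \<in> fib (proj B e)" using A(1) NV(1) openin_subset by blast
    let ?d = "badd B f (bscale B (-1) e)"
    have "?d \<in> V" using eU(4) A e by (auto simp: bdist_def)
    then have "(e, ?d) \<in> T" using NV(5) A e by auto
    then show "f \<in> N" unfolding T_def using badd_diff[OF e A(2)] by auto
  qed
qed

text \<open>Only this half of the continuity of the distance is available, because the norm of a Banach
  bundle is merely upper semicontinuous.\<close>

lemma bdist_open: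
  "openin (subtopology (prod_topology (btop B) (btop B)) {(e, f). proj B e = proj B f})
     {(e, f). e \<in> topspace (btop B) \<and> f \<in> topspace (btop B) \<and> proj B e = proj B f \<and> bdist B e f < \<delta>}"
proof -
  let ?S = "{(e, f). proj B e = proj B f}"
  let ?Y = "subtopology (prod_topology (btop B) (btop B)) ?S"
  have 1: "continuous_map ?Y (btop B) fst" "continuous_map ?Y (btop B) snd"
    by (rule continuous_map_from_subtopology, rule continuous_map_fst continuous_map_snd)+
  have "continuous_map ?Y (prod_topology (btop B) (btop B)) (\<lambda>p. (fst p, bscale B (-1) (snd p)))"
    using continuous_map_compose[OF 1(2) bscale_continuous[of "-1"]] 1(1)
    by (simp add: continuous_map_pairwise o_def)
  then have 2: "continuous_map ?Y ?Y (\<lambda>p. (fst p, bscale B (-1) (snd p)))"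
    by (auto simp: continuous_map_in_subtopology)
  have 3: "continuous_map ?Y (btop B) (\<lambda>p. badd B (fst p) (bscale B (-1) (snd p)))"
    using continuous_map_compose[OF 2 badd_continuous] by (simp add: o_def)
  have "openin ?Y {p \<in> topspace ?Y. badd B (fst p) (bscale B (-1) (snd p)) \<in> {e \<in> topspace (btop B). bnorm B e < \<delta>}}"
    by (rule openin_continuous_map_preimage[OF 3 bnorm_upper_semicontinuous])
  moreover have "{p \<in> topspace ?Y. badd B (fst p) (bscale B (-1) (snd p)) \<in> {e \<in> topspace (btop B). bnorm B e < \<delta>}}
    = {(e, f). e \<in> topspace (btop B) \<and> f \<in> topspace (btop B) \<and> proj B e = proj B f \<and> bdist B e f < \<delta>}"
    by (auto simp: bdist_def)
  ultimately show ?thesis by simp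
qed

text \<open>Such a neighbourhood stands in for a local section: all choices of vectors from it agree up
  to \<open>\<delta>\<close> in every fibre.\<close>

lemma thin_neighbourhood:
  assumes "e0 \<in> topspace (btop B)" "0 < \<delta>"
  obtains N where "openin (btop B) N" "e0 \<in> N"
    "\<And>e f. e \<in> N \<Longrightarrow> f \<in> N \<Longrightarrow> proj B e = proj B f \<Longrightarrow> bdist B e f < \<delta>"
proof -
  have "(e0, e0) \<in> {(e, f). e \<in> topspace (btop B) \<and> f \<in> topspace (btop B) \<and> proj B e = proj B f \<and> bdist B e f < \<delta>}"
    using assms bdist_self[of e0 "proj B e0"] by auto
  from fibre_product_nbhd[OF bdist_open this] obtain N1 N2 where N: "openin (btop B) N1" "openin (btop B) N2"
     "e0 \<in> N1" "e0 \<in> N2" "\<And>e f. e \<in> N1 \<Longrightarrow> f \<in> N2 \<Longrightarrow> proj B e = proj B f \<Longrightarrow>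
   (e, f) \<in> {(e, f). e \<in> topspace (btop B) \<and> f \<in> topspace (btop B) \<and> proj B e = proj B f \<and> bdist B e f < \<delta>}"
    by blast
  show thesis
    by (rule that[of "N1 \<inter> N2"]) (use N in auto)
qed

text \<open>Openness of the projection enters here: a vector \<open>e\<close> of \<open>N\<close> has companions in \<open>N\<close>, close to
  \<open>e\<close>, over all points near its base point.\<close>

lemma fattened_open:
  assumes N: "openin (btop B) N"
  shows "openin (btop B) {f \<in> topspace (btop B). \<exists>e\<in>N. proj B e = proj B f \<and> bdist B e f < \<delta>}"
proof (subst openin_subopen, clarify)
  fix f0 e0 assume f0: "f0 \<in> topspace (btop B)" "e0 \<in> N" "proj B e0 = proj B f0" "bdist B e0 f0 < \<delta>"
  have e0: "e0 \<in> topspace (btop B)" using f0 N openin_subset by blast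
  have "(e0, f0) \<in> {(e, f). e \<in> topspace (btop B) \<and> f \<in> topspace (btop B) \<and> proj B e = proj B f \<and> bdist B e f < \<delta>}"
    using f0 e0 by auto
  from fibre_product_nbhd[OF bdist_open this] obtain N1 N2 where N12: "openin (btop B) N1" "openin (btop B) N2"
     "e0 \<in> N1" "f0 \<in> N2" "\<And>e f. e \<in> N1 \<Longrightarrow> f \<in> N2 \<Longrightarrow> proj B e = proj B f \<Longrightarrow>
   (e, f) \<in> {(e, f). e \<in> topspace (btop B) \<and> f \<in> topspace (btop B) \<and> proj B e = proj B f \<and> bdist B e f < \<delta>}"
    by blast
  have o: "openin X (proj B ` (N \<inter> N1))"
    using proj_open N N12(1) by (auto simp: open_map_def)
  have "openin (btop B) {f \<in> topspace (btop B). proj B f \<in> proj B ` (N \<inter> N1)}"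
    by (rule openin_continuous_map_preimage[OF proj_continuous o])
  then have "openin (btop B) (N2 \<inter> {f \<in> topspace (btop B). proj B f \<in> proj B ` (N \<inter> N1)})"
    using N12(2) by blast
  moreover have "f0 \<in> N2 \<inter> {f \<in> topspace (btop B). proj B f \<in> proj B ` (N \<inter> N1)}"
    using f0 N12(3,4) by (auto simp: image_iff intro!: bexI[of _ e0])
  moreover have "N2 \<inter> {f \<in> topspace (btop B). proj B f \<in> proj B ` (N \<inter> N1)} \<subseteq>
     {f \<in> topspace (btop B). \<exists>e\<in>N. proj B e = proj B f \<and> bdist B e f < \<delta>}"
    using N12(5) by (fastforce simp: image_iff)
  ultimately show "\<exists>T. openin (btop B) T \<and> f0 \<in> T \<and> T \<subseteq> {f \<in> topspace (btop B). \<exists>e\<in>N. proj B e = proj B f \<and> bdist B e f < \<delta>}"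
    by blast
qed

text \<open>Continuity of a section up to the error \<open>\<eta>\<close>, measured in the fibres: near \<open>x\<close>, the value
  \<open>s y\<close> is within \<open>\<eta>\<close> of some vector close to \<open>s x\<close>. For \<open>\<eta> > 0\<close> there are discontinuous sections
  with this property that can be written down directly. Admitting every \<open>\<eta>' > \<eta>\<close> makes the notion
  closed under limits of the error.\<close>

definition nearly_continuous_at :: "real \<Rightarrow> ('x \<Rightarrow> 'e) \<Rightarrow> 'x \<Rightarrow> bool" where
  "nearly_continuous_at \<eta> s x \<longleftrightarrow> (\<forall>N \<eta>'. openin (btop B) N \<longrightarrow> s x \<in> N \<longrightarrow> \<eta> < \<eta>' \<longrightarrow>
     (\<exists>U. openin X U \<and> x \<in> U \<and> (\<forall>y\<in>U. \<exists>e\<in>N. proj B e = y \<and> bdist B (s y) e \<le> \<eta>')))"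

lemma nearly_continuous_atD:
  assumes "nearly_continuous_at \<eta> s x" "openin (btop B) N" "s x \<in> N" "\<eta> < \<eta>'"
  obtains U where "openin X U" "x \<in> U" "\<And>y. y \<in> U \<Longrightarrow> \<exists>e\<in>N. proj B e = y \<and> bdist B (s y) e \<le> \<eta>'"
proof -
  from assms(1)[unfolded nearly_continuous_at_def, rule_format, OF assms(2-4)]
  obtain U where "openin X U \<and> x \<in> U \<and> (\<forall>y\<in>U. \<exists>e\<in>N. proj B e = y \<and> bdist B (s y) e \<le> \<eta>')" ..
  then show thesis by (intro that[of U]) auto
qed

text \<open>A neighbourhood of \<open>s x\<close> contains everything within a small distance of a smaller
  neighbourhood, by \<open>sum_neighbourhood\<close>, and so absorbs errors that can be made arbitrarily small.\<close>

lemma continuous_if_nearly: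
  assumes W: "openin X W" and s: "\<And>x. x \<in> W \<Longrightarrow> s x \<in> fib x"
    and c: "\<And>x. x \<in> W \<Longrightarrow> nearly_continuous_at 0 s x"
  shows "continuous_map (subtopology X W) (btop B) s"
  unfolding continuous_map_def
proof (intro conjI allI impI)
  show "s \<in> topspace (subtopology X W) \<rightarrow> topspace (btop B)" using s by auto
  fix N assume N: "openin (btop B) N"
  have "openin X {x \<in> W. s x \<in> N}"
  proof (subst openin_subopen, clarify)
    fix x assume x: "x \<in> W" "s x \<in> N"
    obtain N' \<epsilon> U where N': "openin (btop B) N'" "s x \<in> N'" "0 < \<epsilon>" "openin X U" "x \<in> U"
      "\<And>e f. e \<in> N' \<Longrightarrow> f \<in> fib (proj B e) \<Longrightarrow> proj B e \<in> U \<Longrightarrow> bdist B f e < \<epsilon> \<Longrightarrow> f \<in> N"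
      using sum_neighbourhood[OF s[OF x(1)] N x(2)] by blast
    obtain U' where U': "openin X U'" "x \<in> U'" "\<And>y. y \<in> U' \<Longrightarrow> \<exists>e\<in>N'. proj B e = y \<and> bdist B (s y) e \<le> \<epsilon>/2"
      using nearly_continuous_atD[OF c[OF x(1)] N'(1,2), of "\<epsilon>/2"] N'(3) by auto
    have "U \<inter> U' \<inter> W \<subseteq> {x \<in> W. s x \<in> N}"
    proof
      fix y assume y: "y \<in> U \<inter> U' \<inter> W"
      then obtain e where "e \<in> N'" "proj B e = y" "bdist B (s y) e \<le> \<epsilon>/2" using U'(3) by blast
      with y N'(3) s show "y \<in> {x \<in> W. s x \<in> N}" by (auto intro!: N'(6)[of e])
    qed
    then show "\<exists>T. openin X T \<and> x \<in> T \<and> T \<subseteq> {x \<in> W. s x \<in> N}"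
      using x N'(4,5) U'(1,2) W by (intro exI[of _ "U \<inter> U' \<inter> W"]) auto
  qed
  then have "openin (subtopology X W) {x \<in> W. s x \<in> N}"
    using W openin_open_subtopology by (metis (no_types, lifting) mem_Collect_eq subsetI)
  then show "openin (subtopology X W) {x \<in> topspace (subtopology X W). s x \<in> N}"
    using openin_subset[OF W] by (simp add: Int_absorb1)
qed

lemma nearly_if_continuous:
  assumes W: "openin X W" and s: "\<And>x. x \<in> W \<Longrightarrow> s x \<in> fib x"
    and c: "continuous_map (subtopology X W) (btop B) s" and x: "x \<in> W"
  shows "nearly_continuous_at 0 s x"
  unfolding nearly_continuous_at_def
proof (intro allI impI)
  fix N and \<eta>' :: real assume N: "openin (btop B) N" "s x \<in> N" "0 < \<eta>'"
  have "openin (subtopology X W) {x \<in> topspace (subtopology X W). s x \<in> N}"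
    by (rule openin_continuous_map_preimage[OF c N(1)])
  then have "openin X {y \<in> W. s y \<in> N}"
    using W openin_subset[OF W] by (simp add: Int_absorb1 openin_open_subtopology)
  then show "\<exists>U. openin X U \<and> x \<in> U \<and> (\<forall>y\<in>U. \<exists>e\<in>N. proj B e = y \<and> bdist B (s y) e \<le> \<eta>')"
    using x N s bdist_self by (intro exI[of _ "{y \<in> W. s y \<in> N}"]) force
qed

text \<open>The distance \<open>\<delta>\<close> is paid twice: in passing from \<open>s x\<close> to \<open>m x\<close>, and in returning from \<open>m y\<close>
  to \<open>s y\<close>.\<close>

lemma nearly_continuous_at_perturb:
  assumes U: "openin X U" "x \<in> U" and s: "\<And>y. y \<in> U \<Longrightarrow> s y \<in> fib y" and m: "\<And>y. y \<in> U \<Longrightarrow> m y \<in> fib y"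
    and d: "\<And>y. y \<in> U \<Longrightarrow> bdist B (s y) (m y) \<le> \<delta>"
    and c: "nearly_continuous_at \<eta> m x"
  shows "nearly_continuous_at (\<eta> + 2 * \<delta>) s x"
  unfolding nearly_continuous_at_def
proof (intro allI impI)
  fix N and \<eta>' :: real assume N: "openin (btop B) N" "s x \<in> N" "\<eta> + 2 * \<delta> < \<eta>'"
  define \<kappa> where "\<kappa> = (\<eta>' - \<eta> - 2 * \<delta>) / 2"
  have k: "\<kappa> > 0" using N(3) by (simp add: \<kappa>_def)
  let ?D = "{f \<in> topspace (btop B). \<exists>e\<in>N. proj B e = proj B f \<and> bdist B e f < \<delta> + \<kappa>}"
  have D: "openin (btop B) ?D" by (rule fattened_open[OF N(1)])
  have sm: "s x \<in> fib x" "m x \<in> fib x" using s m U by auto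
  have mD: "m x \<in> ?D" using sm N(2) d[OF U(2)] k by auto
  obtain U' where U': "openin X U'" "x \<in> U'" "\<And>y. y \<in> U' \<Longrightarrow> \<exists>e\<in>?D. proj B e = y \<and> bdist B (m y) e \<le> \<eta> + \<kappa>"
    using nearly_continuous_atD[OF c D mD, of "\<eta> + \<kappa>"] k by auto
  have "\<exists>e\<in>N. proj B e = y \<and> bdist B (s y) e \<le> \<eta>'" if y: "y \<in> U \<inter> U'" for y
  proof -
    obtain f e where f: "f \<in> topspace (btop B)" "proj B f = y" "bdist B (m y) f \<le> \<eta> + \<kappa>" "e \<in> N" "proj B e = proj B f"
      "bdist B e f < \<delta> + \<kappa>" using U'(3)[of y] y by blast
    have fe: "f \<in> fib y" "e \<in> fib y" using f N openin_subset by auto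
    have sy: "s y \<in> fib y" "m y \<in> fib y" using s m y by auto
    have "bdist B (s y) e \<le> bdist B (s y) (m y) + (bdist B (m y) f + bdist B f e)"
      using bdist_triangle[OF sy fe(2)] bdist_triangle[OF sy(2) fe] by linarith
    also have "\<dots> \<le> \<eta>'" using d[of y] y f bdist_sym[OF fe] by (auto simp: \<kappa>_def field_simps)
    finally show ?thesis using f by auto
  qed
  then show "\<exists>U. openin X U \<and> x \<in> U \<and> (\<forall>y\<in>U. \<exists>e\<in>N. proj B e = y \<and> bdist B (s y) e \<le> \<eta>')"
    using U U' by (intro exI[of _ "U \<inter> U'"]) auto
qed

text \<open>Patching of sections by a partition of unity with two members.\<close>

definition glue :: "('x \<Rightarrow> real) \<Rightarrow> ('x \<Rightarrow> 'e) \<Rightarrow> ('x \<Rightarrow> 'e) \<Rightarrow> 'x \<Rightarrow> 'e" where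
  "glue \<phi> s t = (\<lambda>y\<in>topspace X.
     badd B (bscale B (complex_of_real (\<phi> y)) (s y)) (bscale B (complex_of_real (1 - \<phi> y)) (t y)))"

lemma fib_base: "e \<in> fib x \<Longrightarrow> x \<in> topspace X"
  by auto

lemma glue_fib: "s y \<in> fib y \<Longrightarrow> t y \<in> fib y \<Longrightarrow> glue \<phi> s t y \<in> fib y"
  using fib_base[of "s y" y] badd_fib[OF bscale_fib bscale_fib, of "s y" y "t y"] by (simp add: glue_def)

lemma combination_neighbourhood:
  assumes e: "e0 \<in> fib x" "f0 \<in> fib x" and N: "openin (btop B) N" "badd B (bscale B c e0) (bscale B d f0) \<in> N"
  obtains N1 N2 where "openin (btop B) N1" "openin (btop B) N2" "e0 \<in> N1" "f0 \<in> N2"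
    "\<And>e f. e \<in> N1 \<Longrightarrow> f \<in> N2 \<Longrightarrow> proj B e = proj B f \<Longrightarrow> badd B (bscale B c e) (bscale B d f) \<in> N"
proof -
  let ?Y = "subtopology (prod_topology (btop B) (btop B)) {(e, f). proj B e = proj B f}"
  have 1: "continuous_map ?Y (btop B) fst" "continuous_map ?Y (btop B) snd"
    by (rule continuous_map_from_subtopology, rule continuous_map_fst continuous_map_snd)+
  have "continuous_map ?Y (prod_topology (btop B) (btop B)) (\<lambda>p. (bscale B c (fst p), bscale B d (snd p)))"
    using continuous_map_compose[OF 1(2) bscale_continuous[of d]] continuous_map_compose[OF 1(1) bscale_continuous[of c]]
    by (simp add: continuous_map_pairwise o_def)
  then have 2: "continuous_map ?Y ?Y (\<lambda>p. (bscale B c (fst p), bscale B d (snd p)))"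
    by (auto simp: continuous_map_in_subtopology)
  have 3: "continuous_map ?Y (btop B) (\<lambda>p. badd B (bscale B c (fst p)) (bscale B d (snd p)))"
    using continuous_map_compose[OF 2 badd_continuous] by (simp add: o_def)
  have o: "openin ?Y {p \<in> topspace ?Y. badd B (bscale B c (fst p)) (bscale B d (snd p)) \<in> N}"
    by (rule openin_continuous_map_preimage[OF 3 N(1)])
  have i: "(e0, f0) \<in> {p \<in> topspace ?Y. badd B (bscale B c (fst p)) (bscale B d (snd p)) \<in> N}"
    using e N(2) by auto
  show thesis
  proof (rule fibre_product_nbhd[OF o i])
    fix N1 N2 assume N12: "openin (btop B) N1" "openin (btop B) N2" "e0 \<in> N1" "f0 \<in> N2"
      "\<And>e f. e \<in> N1 \<Longrightarrow> f \<in> N2 \<Longrightarrow> proj B e = proj B f \<Longrightarrow>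
        (e, f) \<in> {p \<in> topspace ?Y. badd B (bscale B c (fst p)) (bscale B d (snd p)) \<in> N}"
    show thesis
      by (rule that[OF N12(1-4)]) (use N12(5) in force)
  qed
qed

text \<open>Scalar multiplication is continuous in the vector for a fixed scalar. Hence the coefficient
  is frozen at its value \<open>a\<close> at the point \<open>x\<close>, and the change from \<open>\<phi> y\<close> to \<open>a\<close> is controlled by a
  bound \<open>R\<close> for the norms of nearby vectors.\<close>

lemma glue_nearly_continuous_at:
  assumes W: "openin X W" "x \<in> W"
    and \<phi>: "continuous_map (subtopology X W) euclideanreal \<phi>" "\<And>y. y \<in> W \<Longrightarrow> 0 \<le> \<phi> y \<and> \<phi> y \<le> 1"
    and s: "\<And>y. y \<in> W \<Longrightarrow> s y \<in> fib y" and t: "\<And>y. y \<in> W \<Longrightarrow> t y \<in> fib y"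
    and c: "nearly_continuous_at \<eta> s x" "nearly_continuous_at \<eta> t x"
  shows "nearly_continuous_at \<eta> (glue \<phi> s t) x"
  unfolding nearly_continuous_at_def
proof (intro allI impI)
  fix N and \<eta>' :: real assume N: "openin (btop B) N" "glue \<phi> s t x \<in> N" "\<eta> < \<eta>'"
  have x: "x \<in> topspace X" using W openin_subset by auto
  have st: "s x \<in> fib x" "t x \<in> fib x" using s t W by auto
  define a where "a = \<phi> x"
  have gx: "badd B (bscale B (complex_of_real a) (s x)) (bscale B (complex_of_real (1 - a)) (t x)) \<in> N"
    using N(2) x by (simp add: glue_def a_def)
  obtain N1 N2 where N12: "openin (btop B) N1" "openin (btop B) N2" "s x \<in> N1" "t x \<in> N2"
    "\<And>e f. e \<in> N1 \<Longrightarrow> f \<in> N2 \<Longrightarrow> proj B e = proj B f \<Longrightarrow> badd B (bscale B (complex_of_real a) e) (bscale B (complex_of_real (1 - a)) f) \<in> N"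
    using combination_neighbourhood[OF st N(1) gx] by blast
  define R where "R = bnorm B (s x) + bnorm B (t x) + 1"
  have R: "bnorm B (s x) < R" "bnorm B (t x) < R" "R > 0"
    using bnorm_nonneg[OF st(1)] bnorm_nonneg[OF st(2)] by (auto simp: R_def)
  let ?BR = "{e \<in> topspace (btop B). bnorm B e < R}"
  define \<eta>'' where "\<eta>'' = (\<eta> + \<eta>') / 2"
  have e2: "\<eta> < \<eta>''" "\<eta>'' < \<eta>'" using N(3) by (auto simp: \<eta>''_def)
  obtain U1 where U1: "openin X U1" "x \<in> U1" "\<And>y. y \<in> U1 \<Longrightarrow> \<exists>e\<in>N1 \<inter> ?BR. proj B e = y \<and> bdist B (s y) e \<le> \<eta>''"
    using nearly_continuous_atD[OF c(1), of "N1 \<inter> ?BR" \<eta>''] N12(1,3) st R e2 bnorm_upper_semicontinuous by auto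
  obtain U2 where U2: "openin X U2" "x \<in> U2" "\<And>y. y \<in> U2 \<Longrightarrow> \<exists>e\<in>N2 \<inter> ?BR. proj B e = y \<and> bdist B (t y) e \<le> \<eta>''"
    using nearly_continuous_atD[OF c(2), of "N2 \<inter> ?BR" \<eta>''] N12(2,4) st R e2 bnorm_upper_semicontinuous by auto
  define \<kappa> where "\<kappa> = (\<eta>' - \<eta>'') / (2 * R)"
  have k: "\<kappa> > 0" using e2 R by (simp add: \<kappa>_def)
  define U3 where "U3 = {y \<in> W. \<phi> y \<in> {a - \<kappa><..<a + \<kappa>}}"
  have "openin (subtopology X W) {y \<in> topspace (subtopology X W). \<phi> y \<in> {a - \<kappa><..<a + \<kappa>}}"
    by (rule openin_continuous_map_preimage[OF \<phi>(1)]) auto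
  then have U3: "openin X U3" "x \<in> U3"
    using W openin_subset[OF W(1)] k by (simp_all add: Int_absorb1 openin_open_subtopology U3_def a_def)
  have "\<exists>e\<in>N. proj B e = y \<and> bdist B (glue \<phi> s t y) e \<le> \<eta>'" if y: "y \<in> U1 \<inter> U2 \<inter> U3" for y
  proof -
    obtain e where e: "e \<in> N1" "e \<in> fib y" "bnorm B e < R" "bdist B (s y) e \<le> \<eta>''" using U1(3) y by blast
    obtain f where f: "f \<in> N2" "f \<in> fib y" "bnorm B f < R" "bdist B (t y) f \<le> \<eta>''" using U2(3) y by blast
    have yW: "y \<in> W" "y \<in> topspace X" and p: "\<bar>\<phi> y - a\<bar> < \<kappa>" using y openin_subset[OF W(1)] by (auto simp: U3_def)
    define b where "b = \<phi> y"
    have b: "0 \<le> b" "b \<le> 1" using \<phi>(2)[OF yW(1)] by (auto simp: b_def)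
    have sy: "s y \<in> fib y" "t y \<in> fib y" using s t yW by auto
    let ?c = "\<lambda>r e f. badd B (bscale B (complex_of_real r) e) (bscale B (complex_of_real (1 - r)) f)"
    have cf: "?c r e' f' \<in> fib y" if "e' \<in> fib y" "f' \<in> fib y" for r e' f' using that by auto
    have "bdist B (?c b (s y) (t y)) (?c b e f) \<le> b * bdist B (s y) e + (1 - b) * bdist B (t y) f"
      using bdist_add[of "bscale B (complex_of_real b) (s y)" y "bscale B (complex_of_real (1 - b)) (t y)" "bscale B (complex_of_real b) e" "bscale B (complex_of_real (1 - b)) f"]
        bdist_scale[OF sy(1) e(2), of "complex_of_real b"] bdist_scale[OF sy(2) f(2), of "complex_of_real (1-b)"] sy e f b bscale_fib
      by (simp del: of_real_diff add: norm_of_real)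
    also have "\<dots> \<le> b * \<eta>'' + (1 - b) * \<eta>''"
      using e f b by (intro add_mono mult_left_mono) auto
    finally have 1: "bdist B (?c b (s y) (t y)) (?c b e f) \<le> \<eta>''" by (simp add: algebra_simps)
    have "bdist B (?c b e f) (?c a e f) \<le> \<bar>b - a\<bar> * bnorm B e + \<bar>b - a\<bar> * bnorm B f"
      using bdist_add[of "bscale B (complex_of_real b) e" y "bscale B (complex_of_real (1 - b)) f" "bscale B (complex_of_real a) e" "bscale B (complex_of_real (1 - a)) f"]
        bdist_scale_left[OF e(2), of "complex_of_real b" "complex_of_real a"] bdist_scale_left[OF f(2), of "complex_of_real (1-b)" "complex_of_real (1-a)"] e f b abs_minus_commute[of a b]
      by (simp del: of_real_diff add: norm_of_real flip: of_real_diff)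
    also have "\<dots> \<le> \<kappa> * R + \<kappa> * R"
      using e f p k R bnorm_nonneg[OF e(2)] bnorm_nonneg[OF f(2)] by (intro add_mono mult_mono) (auto simp: b_def)
    also have "\<dots> = \<eta>' - \<eta>''" using R by (simp add: \<kappa>_def field_simps)
    finally have 2: "bdist B (?c b e f) (?c a e f) \<le> \<eta>' - \<eta>''" .
    have "bdist B (glue \<phi> s t y) (?c a e f) \<le> \<eta>'"
      using bdist_triangle[OF cf[OF sy, of b] cf[OF e(2) f(2), of b] cf[OF e(2) f(2), of a]] 1 2 yW
      by (simp add: glue_def b_def)
    moreover have "?c a e f \<in> N" using N12(5) e f by auto
    moreover have "proj B (?c a e f) = y" using e f by auto
    ultimately show ?thesis by blast
  qed
  then show "\<exists>U. openin X U \<and> x \<in> U \<and> (\<forall>y\<in>U. \<exists>e\<in>N. proj B e = y \<and> bdist B (glue \<phi> s t y) e \<le> \<eta>')"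
    using U1 U2 U3 by (intro exI[of _ "U1 \<inter> U2 \<inter> U3"]) auto
qed

definition zero_section :: "'x \<Rightarrow> 'e" where
  "zero_section = (\<lambda>x\<in>topspace X. bzero B x)"

lemma zero_section_nearly_continuous_at:
  assumes x: "x \<in> topspace X" and \<eta>: "0 \<le> \<eta>"
  shows "nearly_continuous_at \<eta> zero_section x"
  unfolding nearly_continuous_at_def
proof (intro allI impI)
  fix N and \<eta>' :: real assume N: "openin (btop B) N" "zero_section x \<in> N" "\<eta> < \<eta>'"
  then obtain \<epsilon> U where eU: "\<epsilon> > 0" "openin X U" "x \<in> U"
    "{e \<in> topspace (btop B). proj B e \<in> U \<and> bnorm B e < \<epsilon>} \<subseteq> N"
    using zero_neighbourhoods[OF x N(1)] x by (auto simp: zero_section_def)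
  have "\<exists>e\<in>N. proj B e = y \<and> bdist B (zero_section y) e \<le> \<eta>'" if y: "y \<in> U" for y
  proof -
    have "y \<in> topspace X" using y eU openin_subset by auto
    then show ?thesis using eU y N(3) \<eta> bdist_self[of "bzero B y" y]
      by (intro bexI[of _ "bzero B y"]) (auto simp: zero_section_def)
  qed
  then show "\<exists>U. openin X U \<and> x \<in> U \<and> (\<forall>y\<in>U. \<exists>e\<in>N. proj B e = y \<and> bdist B (zero_section y) e \<le> \<eta>')"
    using eU by blast
qed

end


section \<open>Patching and continuous sections through a vector\<close>

context banach_bundle
begin

lemma nearly_continuous_at_cong:
  assumes "openin X U" "x \<in> U" "\<And>y. y \<in> U \<Longrightarrow> s y = m y" "\<And>y. y \<in> U \<Longrightarrow> m y \<in> fib y"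
    and "nearly_continuous_at \<eta> m x"
  shows "nearly_continuous_at \<eta> s x"
  using nearly_continuous_at_perturb[of U x s m 0 \<eta>] assms bdist_self by simp

lemma nearly_continuous_at_mono:
  "nearly_continuous_at \<eta> s x \<Longrightarrow> \<eta> \<le> \<eta>' \<Longrightarrow> nearly_continuous_at \<eta>' s x"
  unfolding nearly_continuous_at_def by (meson order_le_less_trans)

lemma nearly_continuous_at_limit:
  assumes "\<And>\<epsilon>. 0 < \<epsilon> \<Longrightarrow> nearly_continuous_at \<epsilon> s x"
  shows "nearly_continuous_at 0 s x"
  unfolding nearly_continuous_at_def
proof (intro allI impI)
  fix N and \<eta>' :: real assume N: "openin (btop B) N" "s x \<in> N" "0 < \<eta>'"
  show "\<exists>U. openin X U \<and> x \<in> U \<and> (\<forall>y\<in>U. \<exists>e\<in>N. proj B e = y \<and> bdist B (s y) e \<le> \<eta>')"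
  proof (rule nearly_continuous_atD[OF assms[of "\<eta>'/2"] N(1,2), of \<eta>'])
    fix U assume "openin X U" "x \<in> U" "\<And>y. y \<in> U \<Longrightarrow> \<exists>e\<in>N. proj B e = y \<and> bdist B (s y) e \<le> \<eta>'"
    then show ?thesis by blast
  qed (use N(3) in auto)
qed

end

text \<open>Truncating \<open>3 f - 1\<close> for a Urysohn function \<open>f\<close> makes the function constant on open sets,
  where \<open>f > 2/3\<close> and where \<open>f < 1/3\<close>, and not just on \<open>L\<close> and off \<open>U\<close>.\<close>

lemma cutoff_function:
  assumes W: "openin X W" and cr: "completely_regular_space (subtopology X W)"
    and L: "compactin X L" "L \<subseteq> U" and U: "openin X U" "U \<subseteq> W"
  shows "\<exists>\<phi> U1 U0. continuous_map (subtopology X W) euclideanreal \<phi> \<and> (\<forall>y. 0 \<le> \<phi> y \<and> \<phi> y \<le> (1::real)) \<and>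
    openin X U1 \<and> L \<subseteq> U1 \<and> U1 \<subseteq> U \<and> (\<forall>y\<in>U1. \<phi> y = 1) \<and>
    openin X U0 \<and> W \<subseteq> U \<union> U0 \<and> U0 \<subseteq> W \<and> (\<forall>y\<in>U0. \<phi> y = 0)"
proof -
  let ?Y = "subtopology X W"
  have tW: "topspace ?Y = W" using openin_subset[OF W] by auto
  have L': "compactin ?Y L" using L U by (auto simp: compactin_subtopology)
  have C: "closedin ?Y (W - U)"
    using U tW openin_diff by (metis W closedin_def Diff_Diff_Int Diff_subset inf.absorb2 openin_open_subtopology)
  have dj: "disjnt L (W - U)" using L by (auto simp: disjnt_def)
  obtain f where f: "continuous_map ?Y euclideanreal f" "f ` (W - U) \<subseteq> {0::real}" "f ` L \<subseteq> {1}"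
    by (rule Urysohn_completely_regular_compact_closed_alt[OF cr L' C dj])
  define \<phi> where "\<phi> y = max 0 (min 1 (3 * f y - 1))" for y
  have o: "openin X {y \<in> W. f y \<in> S}" if "open S" for S
  proof -
    have "openin ?Y {y \<in> topspace ?Y. f y \<in> S}"
      by (rule openin_continuous_map_preimage[OF f(1)]) (use that in auto)
    then show ?thesis unfolding tW by (simp add: openin_open_subtopology[OF W])
  qed
  show ?thesis
  proof (intro exI conjI)
    show "continuous_map ?Y euclideanreal \<phi>" unfolding \<phi>_def
      using f(1) by (intro continuous_map_real_max continuous_map_real_min continuous_intros) auto
    show "openin X {y \<in> W. f y \<in> {2/3<..}}" "openin X {y \<in> W. f y \<in> {..<1/3}}" by (rule o; simp)+
    show "W \<subseteq> U \<union> {y \<in> W. f y \<in> {..<1/3}}" using f(2) by (force simp: image_subset_iff)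
    show "L \<subseteq> {y \<in> W. f y \<in> {2/3<..}}" using f(3) L U by (force simp: image_subset_iff)
    show "{y \<in> W. f y \<in> {2/3<..}} \<subseteq> U" using f(2) by (force simp: image_subset_iff)
  qed (auto simp: \<phi>_def)
qed

context banach_bundle
begin

text \<open>Balls of a fibre are convex, and a section that enters with weight 0 need not be close.\<close>

lemma bdist_glue:
  assumes "s y \<in> fib y" "m y \<in> fib y" "n y \<in> fib y" and p: "0 \<le> \<phi> y" "\<phi> y \<le> 1"
    and m: "0 < \<phi> y \<Longrightarrow> bdist B (s y) (m y) \<le> \<delta>" and n: "\<phi> y < 1 \<Longrightarrow> bdist B (s y) (n y) \<le> \<delta>"
  shows "bdist B (s y) (glue \<phi> m n y) \<le> \<delta>"
proof -
  have y: "y \<in> topspace X" using assms(1) fib_base by blast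
  let ?a = "complex_of_real (\<phi> y)" and ?b = "complex_of_real (1 - \<phi> y)"
  have "s y = badd B (bscale B ?a (s y)) (bscale B ?b (s y))"
    using bscale_add_left[OF assms(1), of ?a ?b] bscale_one[OF assms(1)] by simp
  then have "bdist B (s y) (glue \<phi> m n y) \<le> bdist B (bscale B ?a (s y)) (bscale B ?a (m y)) + bdist B (bscale B ?b (s y)) (bscale B ?b (n y))"
    using bdist_add[of "bscale B ?a (s y)" y "bscale B ?b (s y)" "bscale B ?a (m y)" "bscale B ?b (n y)"] bscale_fib assms(1-3) y
    by (simp add: glue_def)
  also have "\<dots> = \<phi> y * bdist B (s y) (m y) + (1 - \<phi> y) * bdist B (s y) (n y)"
    using bdist_scale[OF assms(1,2), of ?a] bdist_scale[OF assms(1,3), of ?b] p by (simp del: of_real_diff add: norm_of_real)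
  also have "\<dots> \<le> \<phi> y * \<delta> + (1 - \<phi> y) * \<delta>"
  proof (rule add_mono)
    show "\<phi> y * bdist B (s y) (m y) \<le> \<phi> y * \<delta>" using m p by (cases "\<phi> y = 0") (auto intro: mult_left_mono)
    show "(1 - \<phi> y) * bdist B (s y) (n y) \<le> (1 - \<phi> y) * \<delta>" using n p by (cases "\<phi> y = 1") (auto intro: mult_left_mono)
  qed
  also have "\<dots> = \<delta>" by (simp add: algebra_simps)
  finally show ?thesis .
qed

text \<open>The sets near which \<open>s\<close> is approximated by a single member of \<open>M\<close> are stable under finite
  unions of compact sets: two approximations are glued by a cutoff function that is 1 near the
  first set. The bound \<open>\<delta>\<close> depends on the point so that exactness can be demanded at one point.\<close>

lemma patch_local_approximations:
  assumes W: "openin X W" and cr: "completely_regular_space (subtopology X W)"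
    and K: "compactin X K" "K \<subseteq> W"
    and s: "\<And>y. y \<in> W \<Longrightarrow> s y \<in> fib y"
    and M: "\<And>m y. m \<in> M \<Longrightarrow> y \<in> W \<Longrightarrow> m y \<in> fib y" "M \<noteq> {}"
    and glue: "\<And>m n \<phi>. m \<in> M \<Longrightarrow> n \<in> M \<Longrightarrow> continuous_map (subtopology X W) euclideanreal \<phi> \<Longrightarrow>
       (\<And>y. 0 \<le> \<phi> y \<and> \<phi> y \<le> 1) \<Longrightarrow> glue \<phi> m n \<in> M"
    and loc: "\<And>x. x \<in> K \<Longrightarrow> \<exists>U m. openin X U \<and> x \<in> U \<and> m \<in> M \<and> (\<forall>y\<in>U \<inter> W. bdist B (s y) (m y) \<le> \<delta> y)"
  obtains m U where "m \<in> M" "openin X U" "K \<subseteq> U" "U \<subseteq> W" "\<And>y. y \<in> U \<Longrightarrow> bdist B (s y) (m y) \<le> \<delta> y"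
proof -
  define good where "good L \<longleftrightarrow> (\<exists>U m. openin X U \<and> L \<subseteq> U \<and> U \<subseteq> W \<and> m \<in> M \<and> (\<forall>y\<in>U. bdist B (s y) (m y) \<le> \<delta> y))" for L
  have good_mono: "good L' \<Longrightarrow> L \<subseteq> L' \<Longrightarrow> good L" for L L' unfolding good_def by blast
  have good_Un: "good (L1 \<union> L2)" if L: "compactin X L1" "good L1" "good L2" for L1 L2
  proof -
    obtain U1 m1 where 1: "openin X U1" "L1 \<subseteq> U1" "U1 \<subseteq> W" "m1 \<in> M" "\<forall>y\<in>U1. bdist B (s y) (m1 y) \<le> \<delta> y"
      using L(2) unfolding good_def by blast
    obtain U2 m2 where 2: "openin X U2" "L2 \<subseteq> U2" "U2 \<subseteq> W" "m2 \<in> M" "\<forall>y\<in>U2. bdist B (s y) (m2 y) \<le> \<delta> y"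
      using L(3) unfolding good_def by blast
    obtain \<phi> V1 V0 where \<phi>': "continuous_map (subtopology X W) euclideanreal \<phi>" "\<forall>y. 0 \<le> \<phi> y \<and> \<phi> y \<le> (1::real)"
      "openin X V1" "L1 \<subseteq> V1" "V1 \<subseteq> U1" "\<forall>y\<in>V1. \<phi> y = 1"
      "openin X V0" "W \<subseteq> U1 \<union> V0" "V0 \<subseteq> W" "\<forall>y\<in>V0. \<phi> y = 0"
      using cutoff_function[OF W cr L(1) 1(2) 1(1,3)] by (elim exE conjE) (rule that)
    note \<phi> = \<phi>'[rule_format]
    have "bdist B (s y) (glue \<phi> m1 m2 y) \<le> \<delta> y" if y: "y \<in> V1 \<union> U2" for y
    proof -
      have yW: "y \<in> W" using y \<phi>(5) 1(3) 2(3) by blast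
      show ?thesis
      proof (rule bdist_glue)
        show "s y \<in> fib y" "m1 y \<in> fib y" "m2 y \<in> fib y"
          using s[OF yW] M(1)[OF 1(4) yW] M(1)[OF 2(4) yW] by auto
        show "bdist B (s y) (m1 y) \<le> \<delta> y" if "0 < \<phi> y"
        proof -
          have "y \<in> U1" using that yW \<phi>(8) \<phi>(10)[of y] by auto
          then show ?thesis using 1(5) by blast
        qed
        show "bdist B (s y) (m2 y) \<le> \<delta> y" if "\<phi> y < 1"
        proof -
          have "y \<in> U2" using that y \<phi>(6)[of y] by auto
          then show ?thesis using 2(5) by blast
        qed
      qed (use \<phi>(2) in auto)
    qed
    then show ?thesis unfolding good_def
      using \<phi> 1 2 glue[OF 1(4) 2(4) \<phi>(1,2)] by (intro exI[of _ "V1 \<union> U2"] exI[of _ "glue \<phi> m1 m2"]) auto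
  qed
  have "\<exists>V L. openin X V \<and> x \<in> V \<and> compactin X L \<and> V \<inter> K \<subseteq> L \<and> good L" if x: "x \<in> K" for x
  proof -
    obtain U m where Um: "openin X U" "x \<in> U" "m \<in> M" "\<forall>y\<in>U \<inter> W. bdist B (s y) (m y) \<le> \<delta> y" using loc[OF x] by blast
    have xt: "compactin X {x}" "{x} \<subseteq> U \<inter> W" using x K Um openin_subset[OF W] by auto
    have UW: "openin X (U \<inter> W)" "U \<inter> W \<subseteq> W" using Um W by auto
    obtain \<phi> V1 V0 where \<phi>': "continuous_map (subtopology X W) euclideanreal \<phi>" "\<forall>y. 0 \<le> \<phi> y \<and> \<phi> y \<le> (1::real)"
      "openin X V1" "{x} \<subseteq> V1" "V1 \<subseteq> U \<inter> W" "\<forall>y\<in>V1. \<phi> y = 1"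
      "openin X V0" "W \<subseteq> U \<inter> W \<union> V0" "V0 \<subseteq> W" "\<forall>y\<in>V0. \<phi> y = 0"
      using cutoff_function[OF W cr xt UW] by (elim exE conjE) (rule that)
    note \<phi> = \<phi>'[rule_format]
    have "closedin X (topspace X - V0)" using \<phi> by auto
    then have "compactin X (K \<inter> (topspace X - V0))" using K compact_Int_closedin by blast
    moreover have "good (K \<inter> (topspace X - V0))" unfolding good_def
      using Um UW \<phi> K by (intro exI[of _ "U \<inter> W"] exI[of _ m]) auto
    moreover have "V1 \<inter> K \<subseteq> K \<inter> (topspace X - V0)"
    proof
      fix y assume y: "y \<in> V1 \<inter> K"
      then have "\<phi> y = 1" "y \<in> topspace X" using \<phi>(6) openin_subset[OF \<phi>(3)] by blast+
      then show "y \<in> K \<inter> (topspace X - V0)" using \<phi>(10)[of y] y by auto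
    qed
    ultimately show ?thesis using \<phi> by blast
  qed
  then obtain V L where VL: "\<And>x. x \<in> K \<Longrightarrow> openin X (V x) \<and> x \<in> V x \<and> compactin X (L x) \<and> V x \<inter> K \<subseteq> L x \<and> good (L x)"
    by metis
  obtain F where F: "finite F" "F \<subseteq> V ` K" "K \<subseteq> \<Union>F"
    using compactinD[OF K(1), of "V ` K"] VL by blast
  obtain I where I: "finite I" "I \<subseteq> K" "F = V ` I" using F by (meson finite_subset_image)
  have e: "good {}" unfolding good_def using M(2) by auto
  have "I' \<subseteq> K \<Longrightarrow> good (\<Union>i\<in>I'. L i)" if "finite I'" for I'
    using that
  proof induction
    case (insert i I')
    then show ?case using good_Un[of "L i" "\<Union>i\<in>I'. L i"] VL[of i] by auto
  qed (use e in auto)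
  then have "good (\<Union>i\<in>I. L i)" using I by blast
  moreover have "K \<subseteq> (\<Union>i\<in>I. L i)" using F I VL by blast
  ultimately have "good K" using good_mono by blast
  then show thesis using that unfolding good_def by blast
qed

text \<open>If \<open>s\<close> is continuous up to \<open>\<epsilon>\<close>, then a thin neighbourhood of \<open>s x\<close> contains vectors within
  \<open>2 * \<epsilon>\<close> of \<open>s y\<close> for all \<open>y\<close> near \<open>x\<close>. Any choice of such vectors is as continuous as the
  neighbourhood is thin. Keeping the value at \<open>g0\<close> allows this improvement to be iterated with a
  prescribed value there.\<close>

lemma refine_section:
  assumes W: "openin X W" and cr: "completely_regular_space (subtopology X W)"
    and K: "compactin X K" "K \<subseteq> W" and g0: "openin X (W - {g0})"
    and s: "\<And>y. y \<in> W \<Longrightarrow> s y \<in> fib y" "\<And>y. y \<in> W \<Longrightarrow> nearly_continuous_at \<epsilon> s y"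
    and pos: "0 < \<epsilon>" "0 < \<eta>"
  obtains m where "\<And>y. y \<in> W \<Longrightarrow> m y \<in> fib y" "\<And>y. y \<in> W \<Longrightarrow> nearly_continuous_at \<eta> m y"
    "\<And>y. y \<in> K \<Longrightarrow> bdist B (s y) (m y) \<le> (if y = g0 then 0 else 2 * \<epsilon>)"
proof -
  let ?\<delta> = "\<lambda>y. if y = g0 then 0 else 2 * \<epsilon>"
  define M where "M = {m. \<forall>y\<in>W. m y \<in> fib y \<and> nearly_continuous_at \<eta> m y}"
  have WX: "W \<subseteq> topspace X" by (rule openin_subset[OF W])
  have z: "zero_section \<in> M" unfolding M_def
    using WX zero_section_nearly_continuous_at pos by (auto simp: zero_section_def)
  have gl: "glue \<phi> m n \<in> M" if "m \<in> M" "n \<in> M" "continuous_map (subtopology X W) euclideanreal \<phi>"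
       "\<And>y. 0 \<le> \<phi> y \<and> \<phi> y \<le> 1" for m n \<phi>
  proof -
    have mn: "m y \<in> fib y" "n y \<in> fib y" "nearly_continuous_at \<eta> m y" "nearly_continuous_at \<eta> n y" if "y \<in> W" for y
      using \<open>m \<in> M\<close> \<open>n \<in> M\<close> that unfolding M_def by blast+
    have "nearly_continuous_at \<eta> (glue \<phi> m n) y" if "y \<in> W" for y
      by (rule glue_nearly_continuous_at[OF W that \<open>continuous_map _ _ \<phi>\<close>]) (use mn that \<open>\<And>y. 0 \<le> \<phi> y \<and> \<phi> y \<le> 1\<close> in blast)+
    moreover have "glue \<phi> m n y \<in> fib y" if "y \<in> W" for y by (rule glue_fib) (use mn that in blast)+
    ultimately show ?thesis unfolding M_def by blast
  qed
  have loc: "\<exists>U m. openin X U \<and> x \<in> U \<and> m \<in> M \<and> (\<forall>y\<in>U \<inter> W. bdist B (s y) (m y) \<le> ?\<delta> y)" if x: "x \<in> K" for x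
  proof -
    have xW: "x \<in> W" using x K by auto
    have sx: "s x \<in> topspace (btop B)" using s(1)[OF xW] by auto
    obtain N where N: "openin (btop B) N" "s x \<in> N"
      "\<And>e f. e \<in> N \<Longrightarrow> f \<in> N \<Longrightarrow> proj B e = proj B f \<Longrightarrow> bdist B e f < \<eta>"
      using thin_neighbourhood[OF sx pos(2)] by blast
    obtain U where U: "openin X U" "x \<in> U" "\<And>y. y \<in> U \<Longrightarrow> \<exists>e\<in>N. proj B e = y \<and> bdist B (s y) e \<le> 2 * \<epsilon>"
      using nearly_continuous_atD[OF s(2)[OF xW] N(1,2), of "2 * \<epsilon>"] pos by auto
    \<comment> \<open>Neighbourhoods of points other than \<open>g0\<close> avoid \<open>g0\<close>, where no error is admitted.\<close>
    define U' where "U' = (if x = g0 then U \<inter> W else U \<inter> (W - {g0}))"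
    have U': "openin X U'" "x \<in> U'" "U' \<subseteq> U" "U' \<subseteq> W" "g0 \<in> U' \<Longrightarrow> x = g0"
      unfolding U'_def using U W g0 xW by (auto split: if_splits)
    \<comment> \<open>An arbitrary choice of vectors from \<open>N\<close>, exact at \<open>x\<close>; it gets multiplied by a cutoff
      function supported in \<open>U'\<close>.\<close>
    define m0 where "m0 y = (if y \<in> U' then (if y = x then s x else SOME e. e \<in> N \<and> proj B e = y \<and> bdist B (s y) e \<le> 2 * \<epsilon>) else bzero B y)" for y
    have m0: "m0 y \<in> N \<and> proj B (m0 y) = y \<and> bdist B (s y) (m0 y) \<le> ?\<delta> y" if y: "y \<in> U'" for y
    proof (cases "y = x")
      case True then show ?thesis using y N s(1)[OF xW] bdist_self pos by (auto simp: m0_def)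
    next
      case False
      then have "y \<noteq> g0" using U' y by auto
      moreover have "\<exists>e. e \<in> N \<and> proj B e = y \<and> bdist B (s y) e \<le> 2 * \<epsilon>" using U(3)[of y] U' y by blast
      from someI_ex[OF this] have "m0 y \<in> N \<and> proj B (m0 y) = y \<and> bdist B (s y) (m0 y) \<le> 2 * \<epsilon>"
        using False y by (simp add: m0_def)
      ultimately show ?thesis by simp
    qed
    have m0f: "m0 y \<in> fib y" if "y \<in> W" for y
    proof (cases "y \<in> U'")
      case True then show ?thesis using m0[OF True] openin_subset[OF N(1)] by auto
    next
      case False then show ?thesis using that WX by (auto simp: m0_def)
    qed
    have m0c: "nearly_continuous_at \<eta> m0 y" if y: "y \<in> U'" for y
      unfolding nearly_continuous_at_def
    proof (intro allI impI)
      fix N' and \<eta>' :: real assume N': "openin (btop B) N'" "m0 y \<in> N'" "\<eta> < \<eta>'"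
      have "openin X (proj B ` (N \<inter> N'))" using proj_open N(1) N'(1) by (auto simp: open_map_def)
      moreover have "y \<in> proj B ` (N \<inter> N')" using m0[OF y] N' by (auto simp: image_iff intro!: bexI[of _ "m0 y"])
      moreover have "\<exists>e\<in>N'. proj B e = z \<and> bdist B (m0 z) e \<le> \<eta>'" if z: "z \<in> proj B ` (N \<inter> N') \<inter> U'" for z
      proof -
        obtain e where e: "e \<in> N" "e \<in> N'" "proj B e = z" using z by auto
        then have "bdist B (m0 z) e < \<eta>" using N(3)[of "m0 z" e] m0[of z] z by auto
        then show ?thesis using e N'(3) by auto
      qed
      ultimately show "\<exists>U. openin X U \<and> y \<in> U \<and> (\<forall>z\<in>U. \<exists>e\<in>N'. proj B e = z \<and> bdist B (m0 z) e \<le> \<eta>')"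
        using U'(1) y by (intro exI[of _ "proj B ` (N \<inter> N') \<inter> U'"]) auto
    qed
    have xt: "compactin X {x}" "{x} \<subseteq> U'" using xW WX U' by auto
    obtain \<phi> V1 V0 where \<phi>': "continuous_map (subtopology X W) euclideanreal \<phi>" "\<forall>y. 0 \<le> \<phi> y \<and> \<phi> y \<le> (1::real)"
      "openin X V1" "{x} \<subseteq> V1" "V1 \<subseteq> U'" "\<forall>y\<in>V1. \<phi> y = 1"
      "openin X V0" "W \<subseteq> U' \<union> V0" "V0 \<subseteq> W" "\<forall>y\<in>V0. \<phi> y = 0"
      using cutoff_function[OF W cr xt U'(1,4)] by (elim exE conjE) (rule that)
    note \<phi> = \<phi>'[rule_format]
    define m where "m = glue \<phi> m0 zero_section"
    have zf: "zero_section y \<in> fib y" if "y \<in> W" for y using z that by (auto simp: M_def)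
    have mf: "m y \<in> fib y" if "y \<in> W" for y unfolding m_def using glue_fib m0f zf that by blast
    have "nearly_continuous_at \<eta> m y" if y: "y \<in> W" for y
    proof (cases "y \<in> U'")
      case True
      show ?thesis unfolding m_def
        by (rule glue_nearly_continuous_at[OF W y \<phi>(1)])
          (use \<phi>(2) m0f zf m0c[OF True] z[unfolded M_def] y in blast)+
    next
      case False
      have "m v = zero_section v" if v: "v \<in> V0" for v
      proof -
        have "v \<in> W" using v \<phi> by blast
        then show ?thesis using \<phi>(10)[OF v] WX bscale_zero[OF m0f, of v] zf[of v] bscale_one[of "zero_section v" v] badd_bzero_left[of "zero_section v" v]
          by (auto simp: m_def glue_def)
      qed
      moreover have "nearly_continuous_at \<eta> zero_section y" using z y by (auto simp: M_def)
      ultimately show ?thesis using nearly_continuous_at_cong[of V0 y m zero_section \<eta>] \<phi>(7,8,9) zf False y by blast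
    qed
    then have mM: "m \<in> M" unfolding M_def using mf by blast
    have "bdist B (s y) (m y) \<le> ?\<delta> y" if y: "y \<in> V1" for y
    proof -
      have yU: "y \<in> U'" "y \<in> W" using y \<phi> U' by auto
      show ?thesis unfolding m_def
        by (rule bdist_glue) (use s(1) m0f zf m0[OF yU(1)] \<phi>(2) \<phi>(6)[OF y] yU in auto)
    qed
    then show ?thesis using \<phi> mM by blast
  qed
  show thesis
  proof (rule patch_local_approximations[OF W cr K s(1), of M ?\<delta>])
    show "M \<noteq> {}" using z by auto
    fix m U assume m: "m \<in> M" "K \<subseteq> U" "\<And>y. y \<in> U \<Longrightarrow> bdist B (s y) (m y) \<le> ?\<delta> y"
    show thesis
    proof (rule that[of m])
      show "bdist B (s y) (m y) \<le> ?\<delta> y" if "y \<in> K" for y using m that by blast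
    qed (use m(1) in \<open>auto simp: M_def\<close>)
  qed (use gl loc in \<open>auto simp: M_def\<close>)
qed

text \<open>Completeness of a fibre, in terms of an explicit rate of convergence.\<close>

lemma fibre_limit:
  assumes \<sigma>: "\<And>n. \<sigma> n \<in> fib x" and d: "\<And>m n. m \<le> n \<Longrightarrow> bdist B (\<sigma> m) (\<sigma> n) \<le> r m" and r: "r \<longlonglongrightarrow> 0"
  obtains l where "l \<in> fib x" "\<And>n. bdist B (\<sigma> n) l \<le> r n"
proof -
  have x: "x \<in> topspace X" using \<sigma> fib_base by blast
  interpret F: complex_banach_space "fibre B x" "bnorm B" by (rule fibre_banach[OF x])
  interpret M: Metric_space "carrier (fibre B x)" "norm_dist (fibre B x) (bnorm B)"
    by (rule F.Metric_space_norm_dist)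
  have nd: "norm_dist (fibre B x) (bnorm B) e f = bdist B e f" if "e \<in> fib x" "f \<in> fib x" for e f
    by (rule norm_dist_bdist[OF that])
  have "M.MCauchy \<sigma>" unfolding M.MCauchy_def
  proof (intro conjI allI impI)
    show "range \<sigma> \<subseteq> carrier (fibre B x)" using \<sigma> by auto
    fix \<epsilon> :: real assume "\<epsilon> > 0"
    then obtain N where N: "\<And>n. N \<le> n \<Longrightarrow> \<bar>r n\<bar> < \<epsilon>" using r unfolding LIMSEQ_iff by auto
    have le: "bdist B (\<sigma> m) (\<sigma> n) < \<epsilon>" if "N \<le> m" "m \<le> n" for m n
      using d[OF that(2)] N[OF that(1)] by linarith
    have "norm_dist (fibre B x) (bnorm B) (\<sigma> n) (\<sigma> n') < \<epsilon>" if "N \<le> n" "N \<le> n'" for n n'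
    proof (cases "n \<le> n'")
      case True then show ?thesis using le[of n n'] that nd \<sigma> by simp
    next
      case False then show ?thesis using le[of n' n] that nd[OF \<sigma> \<sigma>] bdist_sym[OF \<sigma> \<sigma>, of n n'] by simp
    qed
    then show "\<exists>N. \<forall>n n'. N \<le> n \<longrightarrow> N \<le> n' \<longrightarrow> norm_dist (fibre B x) (bnorm B) (\<sigma> n) (\<sigma> n') < \<epsilon>" by blast
  qed
  then obtain l where l: "limitin M.mtopology \<sigma> l sequentially"
    using F.nrm_complete unfolding M.mcomplete_def by blast
  then have lf: "l \<in> fib x" and lim: "(\<lambda>n. norm_dist (fibre B x) (bnorm B) (\<sigma> n) l) \<longlonglongrightarrow> 0"
    unfolding M.limitin_metric_dist_null by auto
  have lim': "(\<lambda>n. bdist B (\<sigma> n) l) \<longlonglongrightarrow> 0" using lim nd[OF \<sigma> lf] by simp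
  show thesis
  proof (rule that[OF lf])
    fix n
    have "\<forall>\<^sub>F k in sequentially. bdist B (\<sigma> n) l \<le> r n + bdist B (\<sigma> k) l"
      unfolding eventually_sequentially
    proof (intro exI allI impI)
      fix k assume "n \<le> k"
      then show "bdist B (\<sigma> n) l \<le> r n + bdist B (\<sigma> k) l"
        using bdist_triangle[OF \<sigma>[of n] \<sigma>[of k] lf] d[of n k] by linarith
    qed
    moreover have "(\<lambda>k. r n + bdist B (\<sigma> k) l) \<longlonglongrightarrow> r n + 0" by (intro tendsto_intros lim')
    ultimately show "bdist B (\<sigma> n) l \<le> r n"
      using tendsto_lowerbound[of "\<lambda>k. r n + bdist B (\<sigma> k) l" "r n" sequentially "bdist B (\<sigma> n) l"] by simp
  qed
qed

text \<open>The section with value \<open>e0\<close> at \<open>g0\<close> and zero elsewhere is continuous up to any error above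
  the norm of \<open>e0\<close>. Improving it again and again, with errors \<open>c / 2 ^ n\<close>, gives sections that
  converge uniformly on \<open>K\<close>.\<close>

lemma local_section_through:
  assumes W: "openin X W" and cr: "completely_regular_space (subtopology X W)"
    and K: "compactin X K" "K \<subseteq> W" and g0: "openin X (W - {g0})" "g0 \<in> U" and U: "openin X U" "U \<subseteq> K"
    and e0: "e0 \<in> fib g0"
  obtains s where "\<And>y. y \<in> W \<Longrightarrow> s y \<in> fib y" "\<And>y. y \<in> U \<Longrightarrow> nearly_continuous_at 0 s y" "s g0 = e0"
proof -
  define c where "c = bnorm B e0 + 1"
  have c: "c > bnorm B e0" "c > 0" using bnorm_nonneg[OF e0] by (auto simp: c_def)
  define q where "q n = c / 2 ^ n" for n :: nat
  have q: "q n > 0" for n using c by (simp add: q_def)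
  have gW: "g0 \<in> W" "g0 \<in> K" using g0 U K by auto
  have WX: "W \<subseteq> topspace X" by (rule openin_subset[OF W])
  define P where "P n s \<longleftrightarrow> (\<forall>y\<in>W. s y \<in> fib y \<and> nearly_continuous_at (q n) s y) \<and> s g0 = e0" for n s
  define R where "R n s t \<longleftrightarrow> (\<forall>y\<in>K. bdist B (s y) (t y) \<le> 2 * q n)" for n :: nat and s t
  have "\<exists>S. \<forall>n. P n (S n) \<and> R n (S n) (S (Suc n))"
  proof (rule dependent_nat_choice)
    define s where "s y = (if y = g0 then e0 else bzero B y)" for y
    have sf: "s y \<in> fib y" if "y \<in> W" for y using that e0 WX by (auto simp: s_def)
    have "nearly_continuous_at c s y" if y: "y \<in> W" for y
    proof (cases "y = g0")
      case True
      show ?thesis unfolding nearly_continuous_at_def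
      proof (intro allI impI)
        fix N and \<eta>' :: real assume N: "openin (btop B) N" "s y \<in> N" "c < \<eta>'"
        let ?N = "N \<inter> {e \<in> topspace (btop B). bnorm B e < c}"
        have "openin X (proj B ` ?N)" using proj_open N(1) bnorm_upper_semicontinuous by (auto simp: open_map_def)
        moreover have "y \<in> proj B ` ?N" using True N(2) e0 c by (auto simp: s_def image_iff intro!: bexI[of _ e0])
        moreover have "\<exists>e\<in>N. proj B e = z \<and> bdist B (s z) e \<le> \<eta>'" if z: "z \<in> proj B ` ?N" for z
        proof (cases "z = g0")
          case True then show ?thesis using \<open>y = g0\<close> N e0 bdist_self[OF e0] c by (intro bexI[of _ e0]) (auto simp: s_def)
        next
          case False
          obtain e where e: "e \<in> N" "e \<in> fib z" "bnorm B e < c" using z by auto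
          have "bzero B z \<in> fib z" using bzero_fib fib_base[OF e(2)] by blast
          then have "bdist B (s z) e \<le> \<eta>'" using False bdist_sym[of "bzero B z" z e] bdist_bzero[OF e(2)] e N(3) by (auto simp: s_def)
          then show ?thesis using e by auto
        qed
        ultimately show "\<exists>U. openin X U \<and> y \<in> U \<and> (\<forall>z\<in>U. \<exists>e\<in>N. proj B e = z \<and> bdist B (s z) e \<le> \<eta>')" by blast
      qed
    next
      case False
      show ?thesis
        by (rule nearly_continuous_at_cong[OF g0(1), of _ _ zero_section])
          (use False y WX c zero_section_nearly_continuous_at[of y c] in \<open>auto simp: s_def zero_section_def\<close>)
    qed
    then show "\<exists>s. P 0 s" using sf by (intro exI[of _ s]) (auto simp: P_def q_def s_def)
  next
    fix s n assume s: "P n s"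
    show "\<exists>t. P (Suc n) t \<and> R n s t"
    proof (rule refine_section[OF W cr K g0(1), of s "q n" "q (Suc n)"])
      fix m assume m: "\<And>y. y \<in> W \<Longrightarrow> m y \<in> fib y" "\<And>y. y \<in> W \<Longrightarrow> nearly_continuous_at (q (Suc n)) m y"
        "\<And>y. y \<in> K \<Longrightarrow> bdist B (s y) (m y) \<le> (if y = g0 then 0 else 2 * q n)"
      have "s g0 \<in> fib g0" using s gW by (auto simp: P_def)
      then have "m g0 = s g0" using m(3)[OF gW(2)] bdist_eq_0[of "s g0" g0 "m g0"] bdist_nonneg[of "s g0" g0 "m g0"] m(1)[OF gW(1)] by auto
      then have "P (Suc n) m" using m s by (auto simp: P_def)
      moreover have "R n s m" unfolding R_def
      proof
        fix y assume "y \<in> K" then show "bdist B (s y) (m y) \<le> 2 * q n"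
          using m(3)[of y] q[of n] by (auto split: if_splits)
      qed
      ultimately show ?thesis by blast
    qed (use s q in \<open>auto simp: P_def\<close>)
  qed
  then obtain S where S: "\<And>n. P n (S n)" "\<And>n. R n (S n) (S (Suc n))" by blast
  have Sf: "S n y \<in> fib y" if "y \<in> W" for n y using S(1)[of n] that by (auto simp: P_def)
  \<comment> \<open>The bound telescopes because \<open>2 * q n = 4 * (q n - q (Suc n))\<close>.\<close>
  have step: "bdist B (S m y) (S n y) \<le> 4 * (q m - q n)" if y: "y \<in> K" and mn: "m \<le> n" for m n y
    using mn
  proof (induction n rule: dec_induct)
    case base then show ?case using bdist_self Sf y K by fastforce
  next
    case (step n)
    have yW: "y \<in> W" using y K by auto
    have "bdist B (S n y) (S (Suc n) y) \<le> 2 * q n" using S(2)[of n] y by (auto simp: R_def)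
    moreover have "2 * q n = 4 * (q n - q (Suc n))" by (simp add: q_def field_simps)
    ultimately show ?case
      using bdist_triangle[OF Sf[OF yW, of m] Sf[OF yW, of n] Sf[OF yW, of "Suc n"]] step.IH by (simp add: algebra_simps)
  qed
  have qlim: "(\<lambda>n. C * q n) \<longlonglongrightarrow> 0" for C
  proof -
    have "(\<lambda>n. (C * c) * (1/2) ^ n) \<longlonglongrightarrow> C * c * 0" by (intro tendsto_intros LIMSEQ_realpow_zero) auto
    then show ?thesis by (simp add: q_def power_divide)
  qed
  have "\<exists>l. l \<in> fib y \<and> (\<forall>n. bdist B (S n y) l \<le> 4 * q n)" if y: "y \<in> K" for y
  proof -
    have yW: "y \<in> W" using y K by auto
    have d: "bdist B (S m y) (S n y) \<le> 4 * q m" if "m \<le> n" for m n using step[OF y that] q[of n] by (simp add: right_diff_distrib)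
    show ?thesis
      by (rule fibre_limit[of "\<lambda>n. S n y" y "\<lambda>n. 4 * q n", OF Sf[OF yW] d qlim]) auto
  qed
  then obtain l where l: "\<And>y. y \<in> K \<Longrightarrow> l y \<in> fib y" "\<And>y n. y \<in> K \<Longrightarrow> bdist B (S n y) (l y) \<le> 4 * q n" by metis
  define s where "s y = (if y \<in> K then l y else bzero B y)" for y
  show thesis
  proof (rule that)
    show "s y \<in> fib y" if "y \<in> W" for y using l(1) that WX by (auto simp: s_def)
    have "bdist B e0 (l g0) \<le> 0"
    proof (rule tendsto_lowerbound[OF qlim[of 4]])
      show "\<forall>\<^sub>F n in sequentially. bdist B e0 (l g0) \<le> 4 * q n"
        using l(2)[OF gW(2)] S(1) by (auto simp: P_def intro!: always_eventually)
    qed simp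
    then show "s g0 = e0" using bdist_eq_0[OF e0 l(1)[OF gW(2)]] bdist_nonneg[OF e0 l(1)[OF gW(2)]] gW by (auto simp: s_def)
    fix x assume x: "x \<in> U"
    show "nearly_continuous_at 0 s x"
    proof (rule nearly_continuous_at_limit)
      fix \<epsilon> :: real assume "\<epsilon> > 0"
      \<comment> \<open>\<open>9 = 1 + 2 * 4\<close>: the error of \<open>S n\<close>, and twice its distance from the limit.\<close>
      then obtain n where n: "9 * q n < \<epsilon>" using qlim[of 9] unfolding LIMSEQ_iff by (metis abs_ge_self diff_zero dual_order.refl order_le_less_trans real_norm_def)
      have "nearly_continuous_at (q n + 2 * (4 * q n)) s x"
      proof (rule nearly_continuous_at_perturb[OF U(1) x, of s "S n"])
        fix y assume y: "y \<in> U"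
        then have yK: "y \<in> K" "y \<in> W" using U K by auto
        show "s y \<in> fib y" "S n y \<in> fib y" using l(1) yK Sf by (auto simp: s_def)
        show "bdist B (s y) (S n y) \<le> 4 * q n"
          using l(2)[OF yK(1)] bdist_sym[OF l(1)[OF yK(1)] Sf[OF yK(2)]] yK by (simp add: s_def)
      next
        show "nearly_continuous_at (q n) (S n) x" using S(1)[of n] x U K by (auto simp: P_def)
      qed
      then show "nearly_continuous_at \<epsilon> s x" using nearly_continuous_at_mono n by fastforce
    qed
  qed
qed

end


section \<open>Bisections of an etale groupoid\<close>

text \<open>Openness of \<open>f\<close> is continuity of its inverse, once \<open>f\<close> is injective.\<close>

lemma open_map_section:
  assumes c: "open_map X Y f" and inj: "inj_on f U" and U: "openin X U"
  shows "continuous_map (subtopology Y (f ` U)) X (inv_into U f)"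
  unfolding continuous_map_def
proof (intro conjI allI impI)
  have fU: "openin Y (f ` U)" using c U by (auto simp: open_map_def)
  have t: "topspace (subtopology Y (f ` U)) = f ` U" using openin_subset[OF fU] by auto
  show "inv_into U f \<in> topspace (subtopology Y (f ` U)) \<rightarrow> topspace X"
    using inj openin_subset[OF U] t by auto
  fix V assume V: "openin X V"
  have "{y \<in> f ` U. inv_into U f y \<in> V} = f ` (U \<inter> V)" using inj by auto
  moreover have "openin Y (f ` (U \<inter> V))" using c U V by (auto simp: open_map_def)
  ultimately show "openin (subtopology Y (f ` U)) {x \<in> topspace (subtopology Y (f ` U)). inv_into U f x \<in> V}"
    unfolding t by (auto simp: openin_open_subtopology[OF fU])
qed

context topological_groupoid
begin

lemma inv_composable: "g \<in> arrows G \<Longrightarrow> (ginv G g, g) \<in> composable G" "g \<in> arrows G \<Longrightarrow> (g, ginv G g) \<in> composable G"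
  using inv_closed inv_inv by (auto simp: composable_def gdom_def grng_def)

lemma composable_iff: "(g, h) \<in> composable G \<longleftrightarrow> g \<in> arrows G \<and> h \<in> arrows G \<and> gdom G g = grng G h"
  by (simp add: composable_def)

lemma gdom_in [simp]: "g \<in> arrows G \<Longrightarrow> gdom G g \<in> arrows G"
  unfolding gdom_def by (rule mul_closed) (rule inv_composable)

lemma grng_in [simp]: "g \<in> arrows G \<Longrightarrow> grng G g \<in> arrows G"
  unfolding grng_def by (rule mul_closed) (rule inv_composable)

lemma gdom_inv [simp]: "g \<in> arrows G \<Longrightarrow> gdom G (ginv G g) = grng G g"
  and grng_inv [simp]: "g \<in> arrows G \<Longrightarrow> grng G (ginv G g) = gdom G g"
  using inv_inv by (auto simp: gdom_def grng_def)

lemma gdom_gdom [simp]: "g \<in> arrows G \<Longrightarrow> gdom G (gdom G g) = gdom G g"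
  using dom_mul[OF inv_composable(1), of g] by (simp flip: gdom_def)

lemma grng_gdom [simp]: "g \<in> arrows G \<Longrightarrow> grng G (gdom G g) = gdom G g"
  using rng_mul[OF inv_composable(1), of g] by (simp flip: gdom_def)

lemma gdom_grng [simp]: "g \<in> arrows G \<Longrightarrow> gdom G (grng G g) = grng G g"
  using gdom_gdom[of "ginv G g"] inv_closed[of g] by simp

lemma grng_grng [simp]: "g \<in> arrows G \<Longrightarrow> grng G (grng G g) = grng G g"
  using grng_gdom[of "ginv G g"] inv_closed[of g] by simp

lemma units_iff: "x \<in> units G \<longleftrightarrow> x \<in> arrows G \<and> gdom G x = x"
  unfolding units_def by (metis (no_types, lifting) gdom_gdom gdom_in image_iff)

lemma unit_facts:
  assumes "x \<in> units G"
  shows "x \<in> arrows G" "gdom G x = x" "grng G x = x" "(x, x) \<in> composable G" "x \<cdot> x = x" "ginv G x = x"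
proof -
  show x: "x \<in> arrows G" "gdom G x = x" using assms units_iff by auto
  show r: "grng G x = x" using grng_gdom[OF x(1)] x by simp
  show "(x, x) \<in> composable G" using x r by (simp add: composable_iff)
  show "x \<cdot> x = x" using mul_dom[OF x(1)] x by simp
  show "ginv G x = x" using mul_dom[OF inv_closed[OF x(1)]] gdom_inv[OF x(1)] x r gdom_def[of G x] by metis
qed

lemma gdom_unit: "g \<in> arrows G \<Longrightarrow> gdom G g \<in> units G"
  and grng_unit: "g \<in> arrows G \<Longrightarrow> grng G g \<in> units G"
  by (auto simp: units_iff)

lemma inv_mul_cancel: "(g, h) \<in> composable G \<Longrightarrow> ginv G g \<cdot> (g \<cdot> h) = h"
  using mul_assoc[OF inv_composable(1), of g h] rng_mul_self[of h] by (auto simp: composable_iff gdom_def)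

lemma mul_inv_cancel: "(g, h) \<in> composable G \<Longrightarrow> (g \<cdot> h) \<cdot> ginv G h = g"
  using mul_assoc[of g h, OF _ inv_composable(2)] mul_dom[of g] by (auto simp: composable_iff grng_def)

lemma inv_mul:
  assumes c: "(g, h) \<in> composable G"
  shows "ginv G (g \<cdot> h) = ginv G h \<cdot> ginv G g" "(ginv G h, ginv G g) \<in> composable G"
proof -
  have gh: "g \<in> arrows G" "h \<in> arrows G" "gdom G g = grng G h" using c by (auto simp: composable_iff)
  show c2: "(ginv G h, ginv G g) \<in> composable G" using gh by (simp add: composable_iff inv_closed)
  have k: "g \<cdot> h \<in> arrows G" by (rule mul_closed[OF c])
  have c3: "(g \<cdot> h, ginv G h) \<in> composable G" using gh k dom_mul[OF c] by (simp add: composable_iff inv_closed)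
  have "(g \<cdot> h) \<cdot> (ginv G h \<cdot> ginv G g) = g \<cdot> ginv G g"
    using mul_assoc[OF c3 c2] mul_inv_cancel[OF c] by simp
  also have "\<dots> = grng G (g \<cdot> h)" using rng_mul[OF c] by (simp add: grng_def)
  finally have 1: "(g \<cdot> h) \<cdot> (ginv G h \<cdot> ginv G g) = grng G (g \<cdot> h)" .
  have c4: "(g \<cdot> h, ginv G h \<cdot> ginv G g) \<in> composable G"
    using k mul_closed[OF c2] dom_mul[OF c] rng_mul[OF c2] gh by (simp add: composable_iff)
  show "ginv G (g \<cdot> h) = ginv G h \<cdot> ginv G g"
    using inv_mul_cancel[OF c4] 1 mul_dom[OF inv_closed[OF k]] k by simp
qed

lemma continuous_gdom: "continuous_map (gtop G) (gtop G) (gdom G)"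
  and continuous_grng: "continuous_map (gtop G) (gtop G) (grng G)"
proof -
  have "continuous_map (gtop G) (subtopology (prod_topology (gtop G) (gtop G)) (composable G)) (\<lambda>g. (ginv G g, g))"
    using continuous_inv inv_composable(1) by (auto simp: continuous_map_in_subtopology continuous_map_pairwise o_def arrows_def)
  from continuous_map_compose[OF this continuous_mul]
  show "continuous_map (gtop G) (gtop G) (gdom G)" by (simp add: o_def gdom_def[abs_def])
  have "continuous_map (gtop G) (subtopology (prod_topology (gtop G) (gtop G)) (composable G)) (\<lambda>g. (g, ginv G g))"
    using continuous_inv inv_composable(2) by (auto simp: continuous_map_in_subtopology continuous_map_pairwise o_def arrows_def)
  from continuous_map_compose[OF this continuous_mul]
  show "continuous_map (gtop G) (gtop G) (grng G)" by (simp add: o_def grng_def[abs_def])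
qed

lemma open_vimage:
  assumes "continuous_map (gtop G) (gtop G) f" "openin (gtop G) V"
  shows "openin (gtop G) {g \<in> arrows G. f g \<in> V}"
  using openin_continuous_map_preimage[OF assms] by (simp add: arrows_def)

lemma open_arrows: "openin (gtop G) U \<Longrightarrow> U \<subseteq> arrows G"
  unfolding arrows_def by (rule openin_subset)

lemma inv_image_eq: "U \<subseteq> arrows G \<Longrightarrow> ginv G ` U = {g \<in> arrows G. ginv G g \<in> U}"
  using inv_closed inv_inv by (force simp: image_iff)

lemma open_inv: "openin (gtop G) U \<Longrightarrow> openin (gtop G) (ginv G ` U)"
  using open_vimage[OF continuous_inv] inv_image_eq[OF open_arrows] by simp

lemma bisection_open: "U \<in> bisections G \<Longrightarrow> openin (gtop G) U"
  by (simp add: bisections_def)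

lemma bisection_inj:
  assumes "U \<in> bisections G" "g \<in> U" "h \<in> U"
  shows "gdom G g = gdom G h \<Longrightarrow> g = h" "grng G g = grng G h \<Longrightarrow> g = h"
  using assms by (auto simp: bisections_def dest: inj_onD)

lemma bisection_subset: "U \<in> bisections G \<Longrightarrow> openin (gtop G) V \<Longrightarrow> V \<subseteq> U \<Longrightarrow> V \<in> bisections G"
  by (auto simp: bisections_def intro: inj_on_subset)

lemma bisection_inv:
  assumes "U \<in> bisections G" shows "ginv G ` U \<in> bisections G"
proof -
  have U: "U \<subseteq> arrows G" using open_arrows bisection_open assms by blast
  have "inj_on (gdom G) (ginv G ` U)"
    by (auto intro!: inj_onI dest: bisection_inj(2)[OF assms] simp: U[THEN subsetD])
  moreover have "inj_on (grng G) (ginv G ` U)"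
    by (auto intro!: inj_onI dest: bisection_inj(1)[OF assms] simp: U[THEN subsetD])
  ultimately show ?thesis
    using open_inv[OF bisection_open[OF assms]] by (simp add: bisections_def)
qed

definition gprod :: "'g set \<Rightarrow> 'g set \<Rightarrow> 'g set" where
  "gprod U V = {g \<cdot> h | g h. g \<in> U \<and> h \<in> V \<and> (g, h) \<in> composable G}"

lemma gprod_mono: "U \<subseteq> U' \<Longrightarrow> V \<subseteq> V' \<Longrightarrow> gprod U V \<subseteq> gprod U' V'"
  unfolding gprod_def by blast

text \<open>The product \<open>g \<cdot> h\<close> has the range of \<open>g\<close> and the domain of \<open>h\<close>, and these determine \<open>g\<close> in
  \<open>U\<close> and \<open>h\<close> in \<open>V\<close>.\<close>

lemma bisection_prod_unique:
  assumes U: "U \<in> bisections G" and V: "V \<in> bisections G"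
    and "g \<in> U" "h \<in> V" "(g, h) \<in> composable G" "g' \<in> U" "h' \<in> V" "(g', h') \<in> composable G"
    and e: "g \<cdot> h = g' \<cdot> h'"
  shows "g = g'" "h = h'"
proof -
  show "g = g'" using bisection_inj(2)[OF U] rng_mul assms by metis
  show "h = h'" using bisection_inj(1)[OF V] dom_mul assms by metis
qed

end

context etale_groupoid
begin

text \<open>Near a unit, \<open>g\<close> and \<open>d(g)\<close> lie in one set on which \<open>d\<close> is injective, and they have the same
  domain.\<close>

lemma open_units: "openin (gtop G) (units G)"
proof (subst openin_subopen, clarify)
  fix x assume x: "x \<in> units G"
  have xa: "x \<in> topspace (gtop G)" "gdom G x = x" using unit_facts[OF x] by (auto simp: arrows_def)
  obtain U where U: "openin (gtop G) U" "x \<in> U"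
    "homeomorphic_map (subtopology (gtop G) U) (subtopology (subtopology (gtop G) (units G)) (gdom G ` U)) (gdom G)"
    using local_homeomorphism_dom xa(1) unfolding local_homeomorphism_map_def by blast
  have inj: "inj_on (gdom G) U"
    using homeomorphic_imp_injective_map[OF U(3)] openin_subset[OF U(1)] by (simp add: Int_absorb1)
  let ?O = "U \<inter> {g \<in> arrows G. gdom G g \<in> U}"
  have "openin (gtop G) ?O" using U(1) open_vimage[OF continuous_gdom U(1)] by blast
  moreover have "x \<in> ?O" using U xa by (simp add: arrows_def)
  moreover have "?O \<subseteq> units G"
  proof
    fix g assume g: "g \<in> ?O"
    then have "gdom G g = g" using inj_onD[OF inj, of "gdom G g" g] by simp
    then show "g \<in> units G" using g by (auto simp: units_iff)
  qed
  ultimately show "\<exists>T. openin (gtop G) T \<and> x \<in> T \<and> T \<subseteq> units G" by blast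
qed

lemma local_dom:
  assumes g: "g \<in> arrows G"
  obtains U where "openin (gtop G) U" "g \<in> U" "inj_on (gdom G) U"
    "\<And>V. openin (gtop G) V \<Longrightarrow> V \<subseteq> U \<Longrightarrow> openin (gtop G) (gdom G ` V)"
proof -
  have "g \<in> topspace (gtop G)" using g by (simp add: arrows_def)
  then obtain U where U: "openin (gtop G) U" "g \<in> U" "openin (subtopology (gtop G) (units G)) (gdom G ` U)"
    "homeomorphic_map (subtopology (gtop G) U) (subtopology (subtopology (gtop G) (units G)) (gdom G ` U)) (gdom G)"
    using local_homeomorphism_dom unfolding local_homeomorphism_map_def by blast
  have inj: "inj_on (gdom G) U"
    using homeomorphic_imp_injective_map[OF U(4)] openin_subset[OF U(1)] by (simp add: Int_absorb1)
  have o: "openin (gtop G) (gdom G ` V)" if V: "openin (gtop G) V" "V \<subseteq> U" for V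
  proof -
    have "openin (subtopology (gtop G) U) V" using V U by (simp add: openin_open_subtopology)
    then have "openin (subtopology (subtopology (gtop G) (units G)) (gdom G ` U)) (gdom G ` V)"
      using homeomorphic_imp_open_map[OF U(4)] by (auto simp: open_map_def)
    then have "openin (subtopology (gtop G) (units G)) (gdom G ` V)"
      using U(3) openin_trans_full by blast
    then show ?thesis using open_units openin_trans_full by blast
  qed
  show thesis by (rule that[OF U(1,2) inj o])
qed

lemma open_gdom: "open_map (gtop G) (gtop G) (gdom G)"
  unfolding open_map_def
proof (intro allI impI)
  fix V assume V: "openin (gtop G) V"
  show "openin (gtop G) (gdom G ` V)"
  proof (subst openin_subopen, clarify)
    fix g assume g: "g \<in> V"
    then have "g \<in> arrows G" using open_arrows[OF V] by blast
    from local_dom[OF this] obtain U where U: "openin (gtop G) U" "g \<in> U"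
       "\<And>V. openin (gtop G) V \<Longrightarrow> V \<subseteq> U \<Longrightarrow> openin (gtop G) (gdom G ` V)" by metis
    have "openin (gtop G) (gdom G ` (U \<inter> V))" using U V by blast
    then show "\<exists>T. openin (gtop G) T \<and> gdom G g \<in> T \<and> T \<subseteq> gdom G ` V" using g U by blast
  qed
qed

lemma open_grng: "open_map (gtop G) (gtop G) (grng G)"
  unfolding open_map_def
proof (intro allI impI)
  fix V assume V: "openin (gtop G) V"
  have "grng G ` V = gdom G ` (ginv G ` V)" using open_arrows[OF V] by (force simp: image_iff)
  then show "openin (gtop G) (grng G ` V)" using open_gdom open_inv[OF V] by (simp add: open_map_def)
qed

lemma bisection_neighbourhood:
  assumes g: "g \<in> V" and V: "openin (gtop G) V"
  obtains U where "U \<in> bisections G" "g \<in> U" "U \<subseteq> V"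
proof -
  have ga: "g \<in> arrows G" using g open_arrows[OF V] by blast
  from local_dom[OF ga] obtain U1 where U1: "openin (gtop G) U1" "g \<in> U1" "inj_on (gdom G) U1" by metis
  from local_dom[OF inv_closed[OF ga]] obtain U2 where U2: "openin (gtop G) U2" "ginv G g \<in> U2" "inj_on (gdom G) U2" by metis
  let ?U = "U1 \<inter> {g \<in> arrows G. ginv G g \<in> U2} \<inter> V"
  have "inj_on (grng G) ?U"
  proof (rule inj_onI)
    fix a b assume ab: "a \<in> ?U" "b \<in> ?U" "grng G a = grng G b"
    then have "gdom G (ginv G a) = gdom G (ginv G b)" by auto
    then have "ginv G a = ginv G b" using inj_onD[OF U2(3), of "ginv G a" "ginv G b"] ab by blast
    then show "a = b" using inv_inv ab by (metis (no_types, lifting) IntE mem_Collect_eq)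
  qed
  moreover have "inj_on (gdom G) ?U" using U1(3) by (auto intro: inj_on_subset)
  moreover have "openin (gtop G) ?U" using U1 V open_vimage[OF continuous_inv U2(1)] by blast
  ultimately have "?U \<in> bisections G" by (simp add: bisections_def)
  then show thesis using that[of ?U] g U1 U2 ga by auto
qed

lemma units_bisection: "units G \<in> bisections G"
  unfolding bisections_def using open_units unit_facts by (auto simp: inj_on_def)

text \<open>Through \<open>d\<close>, bisections inherit the separation properties and the local compactness of the
  unit space. As \<open>G\<close> need not be Hausdorff, this makes bisections the right place for cutoff
  functions and compactness arguments.\<close>

lemma bisection_homeomorphic:
  assumes U: "U \<in> bisections G"
  shows "homeomorphic_map (subtopology (gtop G) U) (subtopology (gtop G) (gdom G ` U)) (gdom G)"
proof -
  have oU: "openin (gtop G) U" by (rule bisection_open[OF U])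
  have oV: "openin (gtop G) (gdom G ` U)" using open_gdom oU by (simp add: open_map_def)
  have tU: "topspace (subtopology (gtop G) U) = U" "topspace (subtopology (gtop G) (gdom G ` U)) = gdom G ` U"
    using openin_subset[OF oU] openin_subset[OF oV] by auto
  show ?thesis
  proof (rule bijective_open_imp_homeomorphic_map)
    show "continuous_map (subtopology (gtop G) U) (subtopology (gtop G) (gdom G ` U)) (gdom G)"
      using continuous_gdom tU by (auto simp: continuous_map_in_subtopology continuous_map_from_subtopology)
    show "open_map (subtopology (gtop G) U) (subtopology (gtop G) (gdom G ` U)) (gdom G)"
      unfolding open_map_def using open_gdom oU oV by (auto simp: openin_open_subtopology open_map_def)
    show "inj_on (gdom G) (topspace (subtopology (gtop G) U))" using U tU by (simp add: bisections_def)
  qed (use tU in simp)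
qed

lemma gdom_image_units: "U \<subseteq> arrows G \<Longrightarrow> gdom G ` U \<subseteq> units G"
  using gdom_unit by auto

lemma bisection_Hausdorff:
  assumes U: "U \<in> bisections G"
  shows "Hausdorff_space (subtopology (gtop G) U)"
proof -
  have "gdom G ` U \<subseteq> units G" using gdom_image_units[OF open_arrows[OF bisection_open[OF U]]] .
  then have "subtopology (gtop G) (gdom G ` U) = subtopology (subtopology (gtop G) (units G)) (gdom G ` U)"
    by (simp add: subtopology_subtopology inf.absorb2)
  then have "Hausdorff_space (subtopology (gtop G) (gdom G ` U))" using Hausdorff_units Hausdorff_space_subtopology by metis
  then show ?thesis
    using homeomorphic_Hausdorff_space[OF homeomorphic_map_imp_homeomorphic_space[OF bisection_homeomorphic[OF U]]] by blast
qed

lemma bisection_locally_compact: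
  assumes U: "U \<in> bisections G"
  shows "locally_compact_space (subtopology (gtop G) U)"
proof -
  have oU: "openin (gtop G) (gdom G ` U)" using open_gdom bisection_open[OF U] by (simp add: open_map_def)
  have s: "gdom G ` U \<subseteq> units G" using gdom_image_units[OF open_arrows[OF bisection_open[OF U]]] .
  then have e: "subtopology (gtop G) (gdom G ` U) = subtopology (subtopology (gtop G) (units G)) (gdom G ` U)"
    by (simp add: subtopology_subtopology inf.absorb2)
  have "openin (subtopology (gtop G) (units G)) (gdom G ` U)"
    using oU s open_units by (simp add: openin_open_subtopology)
  then have "locally_compact_space (subtopology (gtop G) (gdom G ` U))"
    unfolding e using locally_compact_space_open_subset[OF _ locally_compact_units] Hausdorff_units by blast
  then show ?thesis
    using homeomorphic_locally_compact_space[OF homeomorphic_map_imp_homeomorphic_space[OF bisection_homeomorphic[OF U]]] by blast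
qed

lemma bisection_completely_regular:
  assumes U: "U \<in> bisections G"
  shows "completely_regular_space (subtopology (gtop G) U)"
  using locally_compact_regular_imp_completely_regular_space[OF bisection_locally_compact[OF U]]
    bisection_Hausdorff[OF U] by blast

lemma compact_neighbourhood:
  assumes W: "W \<in> bisections G" and g: "g \<in> W"
  obtains U K where "openin (gtop G) U" "compactin (gtop G) K" "g \<in> U" "U \<subseteq> K" "K \<subseteq> W"
proof -
  have o: "openin (gtop G) W" by (rule bisection_open[OF W])
  have "g \<in> topspace (subtopology (gtop G) W)" using g openin_subset[OF o] by auto
  then obtain U K where "openin (subtopology (gtop G) W) U" "compactin (subtopology (gtop G) W) K" "g \<in> U" "U \<subseteq> K"
    using bisection_locally_compact[OF W] unfolding locally_compact_space_def by blast
  then show thesis using that o by (auto simp: compactin_subtopology openin_open_subtopology)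
qed

lemma bisection_compact_closed:
  assumes W: "W \<in> bisections G" and K: "compactin (gtop G) K" "K \<subseteq> W"
  shows "openin (gtop G) (W - K)"
proof -
  have o: "openin (gtop G) W" by (rule bisection_open[OF W])
  have t: "topspace (subtopology (gtop G) W) = W" using openin_subset[OF o] by auto
  have "closedin (subtopology (gtop G) W) K"
    using compactin_imp_closedin[OF bisection_Hausdorff[OF W]] K by (simp add: compactin_subtopology)
  then have "openin (subtopology (gtop G) W) (W - K)" unfolding closedin_def t by simp
  then show ?thesis using o by (simp add: openin_open_subtopology)
qed

text \<open>Points are closed even if \<open>G\<close> is not Hausdorff: they are closed in every bisection that
  contains them.\<close>

lemma open_delete:
  assumes V: "openin (gtop G) V"
  shows "openin (gtop G) (V - {g})"
proof (subst openin_subopen, intro ballI)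
  fix h assume "h \<in> V - {g}"
  then have h: "h \<in> V" "h \<noteq> g" by auto
  obtain U where U: "U \<in> bisections G" "h \<in> U" "U \<subseteq> V" using bisection_neighbourhood[OF h(1) V] .
  show "\<exists>T. openin (gtop G) T \<and> h \<in> T \<and> T \<subseteq> V - {g}"
  proof (cases "g \<in> U")
    case False then show ?thesis using U bisection_open by blast
  next
    case True
    have "compactin (gtop G) {g}" using True open_arrows[OF bisection_open[OF U(1)]] by (auto simp: arrows_def)
    then have "openin (gtop G) (U - {g})" using bisection_compact_closed[OF U(1)] True by simp
    then show ?thesis using U h by blast
  qed
qed

text \<open>For a bisection \<open>V'\<close>, an arrow \<open>a\<close> with domain in \<open>d(V')\<close> determines the \<open>k\<close> in \<open>V'\<close> with
  the same domain, and \<open>k\<close> depends continuously on \<open>a\<close>. Now \<open>a\<close> is the product of \<open>a k\<^sup>-\<^sup>1\<close> and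
  \<open>k\<close>, and it is an open condition on \<open>a\<close> that the first factor lie in \<open>U\<close>.\<close>

lemma open_gprod:
  assumes U: "openin (gtop G) U" and V: "openin (gtop G) V"
  shows "openin (gtop G) (gprod U V)"
proof (subst openin_subopen, clarify)
  fix p assume "p \<in> gprod U V"
  then obtain g h where gh: "g \<in> U" "h \<in> V" "(g, h) \<in> composable G" "p = g \<cdot> h" unfolding gprod_def by blast
  obtain V' where V': "V' \<in> bisections G" "h \<in> V'" "V' \<subseteq> V" using bisection_neighbourhood[OF gh(2) V] .
  have oV': "openin (gtop G) V'" by (rule bisection_open[OF V'(1)])
  define D where "D = gdom G ` V'"
  have oD: "openin (gtop G) D" using open_gdom oV' by (simp add: open_map_def D_def)
  have injD: "inj_on (gdom G) V'" using V' by (simp add: bisections_def)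
  define P where "P = {a \<in> arrows G. gdom G a \<in> D}"
  have oP: "openin (gtop G) P" unfolding P_def by (rule open_vimage[OF continuous_gdom oD])
  define k where "k a = inv_into V' (gdom G) (gdom G a)" for a
  have k: "k a \<in> V'" "gdom G (k a) = gdom G a" if "a \<in> P" for a
    using that inv_into_into[of "gdom G a" "gdom G" V'] f_inv_into_f[of "gdom G a" "gdom G" V'] by (auto simp: P_def D_def k_def)
  have kv: "k a = v" if "v \<in> V'" "gdom G v = gdom G a" for a v
    using inv_into_f_f[OF injD that(1)] that(2) by (simp add: k_def)
  have PX: "topspace (subtopology (gtop G) P) = P" using openin_subset[OF oP] by auto
  have c1: "continuous_map (subtopology (gtop G) P) (subtopology (gtop G) D) (gdom G)"
    using continuous_gdom PX by (auto simp: continuous_map_in_subtopology continuous_map_from_subtopology P_def)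
  have ck: "continuous_map (subtopology (gtop G) P) (gtop G) k"
    using continuous_map_compose[OF c1 open_map_section[OF open_gdom injD oV', folded D_def]] by (simp add: o_def k_def[abs_def])
  have cki: "continuous_map (subtopology (gtop G) P) (gtop G) (\<lambda>a. ginv G (k a))"
    using continuous_map_compose[OF ck continuous_inv] by (simp add: o_def)
  have kA: "k a \<in> arrows G" if "a \<in> P" for a using k(1)[OF that] open_arrows[OF oV'] by blast
  have comp: "(a, ginv G (k a)) \<in> composable G" if "a \<in> P" for a
    using k[OF that] kA[OF that] that inv_closed by (auto simp: composable_iff P_def)
  have "continuous_map (subtopology (gtop G) P) (subtopology (prod_topology (gtop G) (gtop G)) (composable G)) (\<lambda>a. (a, ginv G (k a)))"
    using cki comp PX by (auto simp: continuous_map_in_subtopology continuous_map_pairwise o_def continuous_map_from_subtopology)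
  from continuous_map_compose[OF this continuous_mul]
  have cm: "continuous_map (subtopology (gtop G) P) (gtop G) (\<lambda>a. a \<cdot> ginv G (k a))" by (simp add: o_def)
  let ?O = "{a \<in> P. a \<cdot> ginv G (k a) \<in> U}"
  have "openin (gtop G) ?O"
    using openin_continuous_map_preimage[OF cm U] oP unfolding PX by (simp add: openin_open_subtopology)
  moreover have "p \<in> ?O"
  proof -
    have "p \<in> P" using gh mul_closed dom_mul V' by (auto simp: P_def D_def)
    moreover have "k p = h" by (rule kv) (use gh V' dom_mul in auto)
    ultimately show ?thesis using mul_inv_cancel gh by simp
  qed
  moreover have "?O \<subseteq> gprod U V"
  proof
    fix a assume a: "a \<in> ?O"
    then have aP: "a \<in> P" by simp
    have c: "(a \<cdot> ginv G (k a), k a) \<in> composable G"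
      using mul_closed[OF comp[OF aP]] dom_mul[OF comp[OF aP]] kA[OF aP] by (simp add: composable_iff)
    have "a = (a \<cdot> ginv G (k a)) \<cdot> k a"
      using mul_inv_cancel[OF comp[OF aP]] inv_inv[OF kA[OF aP]] by simp
    then show "a \<in> gprod U V" unfolding gprod_def using a c k(1)[OF aP] V' by blast
  qed
  ultimately show "\<exists>T. openin (gtop G) T \<and> p \<in> T \<and> T \<subseteq> gprod U V" by blast
qed

lemma bisection_gprod:
  assumes U: "U \<in> bisections G" and V: "V \<in> bisections G"
  shows "gprod U V \<in> bisections G"
proof -
  have "openin (gtop G) (gprod U V)" by (rule open_gprod[OF bisection_open[OF U] bisection_open[OF V]])
  moreover have "inj_on (gdom G) (gprod U V)"
  proof (rule inj_onI)
    fix p q assume "p \<in> gprod U V" "q \<in> gprod U V" and e: "gdom G p = gdom G q"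
    then obtain g h g' h' where p: "p = g \<cdot> h" "g \<in> U" "h \<in> V" "(g, h) \<in> composable G"
      and q: "q = g' \<cdot> h'" "g' \<in> U" "h' \<in> V" "(g', h') \<in> composable G" unfolding gprod_def by blast
    have h: "h = h'" by (rule bisection_inj(1)[OF V p(3) q(3)]) (use e dom_mul p q in simp)
    have "g = g'" by (rule bisection_inj(1)[OF U p(2) q(2)]) (use p(4) q(4) h in \<open>simp add: composable_iff\<close>)
    then show "p = q" using h p q by simp
  qed
  moreover have "inj_on (grng G) (gprod U V)"
  proof (rule inj_onI)
    fix p q assume "p \<in> gprod U V" "q \<in> gprod U V" and e: "grng G p = grng G q"
    then obtain g h g' h' where p: "p = g \<cdot> h" "g \<in> U" "h \<in> V" "(g, h) \<in> composable G"
      and q: "q = g' \<cdot> h'" "g' \<in> U" "h' \<in> V" "(g', h') \<in> composable G" unfolding gprod_def by blast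
    have h: "g = g'" by (rule bisection_inj(2)[OF U p(2) q(2)]) (use e rng_mul p q in simp)
    have "h = h'" by (rule bisection_inj(2)[OF V p(3) q(3)]) (use p(4) q(4) h in \<open>simp add: composable_iff\<close>)
    then show "p = q" using h p q by simp
  qed
  ultimately show ?thesis by (simp add: bisections_def)
qed

lemma product_neighbourhoods:
  assumes W: "openin (gtop G) W" and gh: "(g, h) \<in> composable G" "g \<cdot>\<^bsub>G\<^esub> h \<in> W"
  obtains A B where "openin (gtop G) A" "openin (gtop G) B" "g \<in> A" "h \<in> B" "gprod A B \<subseteq> W"
proof -
  let ?Y = "subtopology (prod_topology (gtop G) (gtop G)) (composable G)"
  let ?T = "{p \<in> topspace ?Y. (\<lambda>(g, h). g \<cdot>\<^bsub>G\<^esub> h) p \<in> W}"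
  have "openin ?Y ?T" by (rule openin_continuous_map_preimage[OF continuous_mul W])
  then obtain R where R: "openin (prod_topology (gtop G) (gtop G)) R" "?T = R \<inter> composable G"
    unfolding openin_subtopology by blast
  have "(g, h) \<in> ?T" using gh by (auto simp: composable_iff arrows_def)
  then have "(g, h) \<in> R" using R by blast
  then obtain A B where AB: "openin (gtop G) A" "openin (gtop G) B" "g \<in> A" "h \<in> B" "A \<times> B \<subseteq> R"
    using R(1)[unfolded openin_prod_topology_alt, rule_format, of g h] by auto
  have "gprod A B \<subseteq> W"
  proof
    fix x assume "x \<in> gprod A B"
    then obtain a b where x: "x = a \<cdot>\<^bsub>G\<^esub> b" "a \<in> A" "b \<in> B" "(a, b) \<in> composable G" unfolding gprod_def by blast
    then have "(a, b) \<in> ?T" using AB(5) R(2) by blast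
    then show "x \<in> W" using x(1) by simp
  qed
  then show thesis using that AB by blast
qed

lemma gprod_units: "gprod (units G) (units G) \<subseteq> units G"
proof
  fix z assume "z \<in> gprod (units G) (units G)"
  then obtain x y where z: "z = x \<cdot>\<^bsub>G\<^esub> y" "x \<in> units G" "y \<in> units G" "(x, y) \<in> composable G" unfolding gprod_def by blast
  then have "x = y" using unit_facts(2)[of x] unit_facts(3)[of y] by (simp add: composable_iff)
  then show "z \<in> units G" using z unit_facts(5)[of x] by simp
qed

end


section \<open>The quantale of open sets\<close>

text \<open>Both quantales in question are families of sets ordered by inclusion, with joins given by an
  explicit operation: the union of open sets, and the closed span of subspaces.\<close>

lemma inclusion_lattice:
  fixes L :: "('s set, 'm) gorder_scheme"
  assumes L: "eq L = (=)" "le L = (\<subseteq>)"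
    and c: "\<And>S. S \<subseteq> carrier L \<Longrightarrow> c S \<in> carrier L"
      "\<And>S V. S \<subseteq> carrier L \<Longrightarrow> V \<in> S \<Longrightarrow> V \<subseteq> c S"
      "\<And>S W. S \<subseteq> carrier L \<Longrightarrow> W \<in> carrier L \<Longrightarrow> (\<And>V. V \<in> S \<Longrightarrow> V \<subseteq> W) \<Longrightarrow> c S \<subseteq> W"
  shows "complete_lattice L" and "S \<subseteq> carrier L \<Longrightarrow> \<Squnion>\<^bsub>L\<^esub>S = c S"
proof -
  have least: "least L (c S) (Upper L S)" if "S \<subseteq> carrier L" for S
  proof -
    have "c S \<subseteq> W" if "W \<in> Upper L S" for W
      using that L \<open>S \<subseteq> carrier L\<close> by (intro c(3)) (auto simp: Upper_def)
    then show ?thesis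
      unfolding least_def using L c(1,2)[OF that] by (auto simp: Upper_def)
  qed
  have po: "partial_order L"
    by unfold_locales (auto simp: L)
  show "complete_lattice L"
  proof (intro complete_lattice.intro[OF po] complete_lattice_axioms.intro)
    fix S assume S: "S \<subseteq> carrier L"
    show "\<exists>s. least L s (Upper L S)" using least[OF S] by blast
    have "greatest L (c (Lower L S)) (Lower L S)"
    proof -
      have lc: "Lower L S \<subseteq> carrier L" by (auto simp: Lower_def)
      have "c (Lower L S) \<subseteq> W" if "W \<in> S" for W
        by (rule c(3)[OF lc]) (use that S L in \<open>auto simp: Lower_def\<close>)
      moreover define k where "k = c (Lower L S)"
      ultimately have "k \<in> Lower L S" using L c(1)[OF lc] by (auto simp: Lower_def)
      then have "c (Lower L S) \<in> Lower L S" by (simp add: k_def)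
      then show ?thesis unfolding greatest_def using lc L c(2)[OF lc] by auto
    qed
    then show "\<exists>i. greatest L i (Lower L S)" by blast
  qed
  show "\<Squnion>\<^bsub>L\<^esub>S = c S" if S: "S \<subseteq> carrier L"
  proof -
    have "least L x (Upper L S) \<Longrightarrow> x = c S" for x
      using least[OF S] L unfolding least_def by auto
    then show ?thesis unfolding sup_def using least[OF S] by (metis someI_ex)
  qed
qed

lemma Omega_sel [simp]:
  "carrier (Omega G) = {U. openin (gtop G) U}" "eq (Omega G) = (=)" "le (Omega G) = (\<subseteq>)"
  "qinv (Omega G) = (\<lambda>U. ginv G ` U)"
  by (auto simp: Omega_def)

lemma (in topological_groupoid) Omega_qmul: "U \<odot>\<odot>\<^bsub>Omega G\<^esub> V = gprod U V"
  by (simp add: Omega_def gprod_def)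

lemma (in topological_groupoid) gprod_assoc: "gprod (gprod U V) W = gprod U (gprod V W)"
proof
  show "gprod (gprod U V) W \<subseteq> gprod U (gprod V W)"
  proof
    fix x assume "x \<in> gprod (gprod U V) W"
    then obtain g h k where x: "x = (g \<cdot> h) \<cdot> k" "g \<in> U" "h \<in> V" "k \<in> W" "(g, h) \<in> composable G" "(g \<cdot> h, k) \<in> composable G"
      unfolding gprod_def by blast
    have hk: "(h, k) \<in> composable G" using x dom_mul[OF x(5)] by (simp add: composable_iff)
    have "(g, h \<cdot> k) \<in> composable G" using x(5) hk mul_closed[OF hk] rng_mul[OF hk] by (simp add: composable_iff)
    moreover have "h \<cdot> k \<in> gprod V W" using x hk unfolding gprod_def by blast
    ultimately have "g \<cdot> (h \<cdot> k) \<in> gprod U (gprod V W)" using x(2) unfolding gprod_def[of U "gprod V W"] by blast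
    then show "x \<in> gprod U (gprod V W)" using x(1) mul_assoc[OF x(5) hk] by simp
  qed
  show "gprod U (gprod V W) \<subseteq> gprod (gprod U V) W"
  proof
    fix x assume "x \<in> gprod U (gprod V W)"
    then obtain g h k where x: "x = g \<cdot> (h \<cdot> k)" "g \<in> U" "h \<in> V" "k \<in> W" "(h, k) \<in> composable G" "(g, h \<cdot> k) \<in> composable G"
      unfolding gprod_def by blast
    have gh: "(g, h) \<in> composable G" using x rng_mul[OF x(5)] by (simp add: composable_iff)
    have "(g \<cdot> h, k) \<in> composable G" using x(5) gh mul_closed[OF gh] dom_mul[OF gh] by (simp add: composable_iff)
    moreover have "g \<cdot> h \<in> gprod U V" using x gh unfolding gprod_def by blast
    ultimately have "(g \<cdot> h) \<cdot> k \<in> gprod (gprod U V) W" using x(4) unfolding gprod_def[of "gprod U V" W] by blast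
    then show "x \<in> gprod (gprod U V) W" using x(1) mul_assoc[OF gh x(5)] by simp
  qed
qed

lemma Omega_lattice: "complete_lattice (Omega G)"
  and Omega_Sup: "S \<subseteq> carrier (Omega G) \<Longrightarrow> \<Squnion>\<^bsub>Omega G\<^esub>S = \<Union>S"
proof -
  show "complete_lattice (Omega G)" by (rule inclusion_lattice(1)[where c = Union]) auto
  show "S \<subseteq> carrier (Omega G) \<Longrightarrow> \<Squnion>\<^bsub>Omega G\<^esub>S = \<Union>S"
    by (rule inclusion_lattice(2)[where c = Union]) auto
qed

lemma (in etale_groupoid) Omega_quantale: "involutive_quantale (Omega G)"
proof (intro involutive_quantale.intro[OF Omega_lattice] involutive_quantale_axioms.intro)
  fix a b c S assume a: "a \<in> carrier (Omega G)"
  have ao: "openin (gtop G) a" and aA: "a \<subseteq> arrows G" using a open_arrows by auto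
  show "qinv (Omega G) a \<in> carrier (Omega G)" using open_inv[OF ao] by simp
  show "qinv (Omega G) (qinv (Omega G) a) = a"
  proof -
    have "ginv G ` ginv G ` a = (\<lambda>x. x) ` a" unfolding image_image using inv_inv aA by (intro image_cong) auto
    then show ?thesis by simp
  qed
  show "a \<odot>\<odot>\<^bsub>Omega G\<^esub> \<Squnion>\<^bsub>Omega G\<^esub>S = \<Squnion>\<^bsub>Omega G\<^esub>((\<odot>\<odot>\<^bsub>Omega G\<^esub>) a ` S)" if S: "S \<subseteq> carrier (Omega G)"
  proof -
    have "(\<odot>\<odot>\<^bsub>Omega G\<^esub>) a ` S \<subseteq> carrier (Omega G)" using S ao open_gprod by (auto simp: Omega_qmul)
    then show ?thesis unfolding Omega_Sup[OF S] by (subst Omega_Sup) (auto simp: Omega_qmul gprod_def)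
  qed
  show "\<Squnion>\<^bsub>Omega G\<^esub>S \<odot>\<odot>\<^bsub>Omega G\<^esub> a = \<Squnion>\<^bsub>Omega G\<^esub>((\<lambda>s. s \<odot>\<odot>\<^bsub>Omega G\<^esub> a) ` S)" if S: "S \<subseteq> carrier (Omega G)"
  proof -
    have "(\<lambda>s. s \<odot>\<odot>\<^bsub>Omega G\<^esub> a) ` S \<subseteq> carrier (Omega G)" using S ao open_gprod by (auto simp: Omega_qmul)
    then show ?thesis unfolding Omega_Sup[OF S] by (subst Omega_Sup) (auto simp: Omega_qmul gprod_def)
  qed
  assume b: "b \<in> carrier (Omega G)"
  have bo: "openin (gtop G) b" and bA: "b \<subseteq> arrows G" using b open_arrows by auto
  show "a \<odot>\<odot>\<^bsub>Omega G\<^esub> b \<in> carrier (Omega G)" using open_gprod[OF ao bo] by (simp add: Omega_qmul)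
  show "qinv (Omega G) (a \<odot>\<odot>\<^bsub>Omega G\<^esub> b) = qinv (Omega G) b \<odot>\<odot>\<^bsub>Omega G\<^esub> qinv (Omega G) a"
  proof
    show "qinv (Omega G) (a \<odot>\<odot>\<^bsub>Omega G\<^esub> b) \<subseteq> qinv (Omega G) b \<odot>\<odot>\<^bsub>Omega G\<^esub> qinv (Omega G) a"
      using inv_mul by (auto simp: Omega_qmul gprod_def) blast
    show "qinv (Omega G) b \<odot>\<odot>\<^bsub>Omega G\<^esub> qinv (Omega G) a \<subseteq> qinv (Omega G) (a \<odot>\<odot>\<^bsub>Omega G\<^esub> b)"
    proof
      fix x assume "x \<in> qinv (Omega G) b \<odot>\<odot>\<^bsub>Omega G\<^esub> qinv (Omega G) a"
      then obtain g h where x: "x = ginv G h \<cdot> ginv G g" "g \<in> a" "h \<in> b" "(ginv G h, ginv G g) \<in> composable G"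
        by (auto simp: Omega_qmul gprod_def)
      have "g \<in> arrows G" "h \<in> arrows G" using x aA bA by auto
      then have gh: "(g, h) \<in> composable G" using x(4) by (simp add: composable_iff)
      then have "g \<cdot> h \<in> a \<odot>\<odot>\<^bsub>Omega G\<^esub> b" using x by (auto simp: Omega_qmul gprod_def)
      then have "ginv G (g \<cdot> h) \<in> qinv (Omega G) (a \<odot>\<odot>\<^bsub>Omega G\<^esub> b)" by simp
      then show "x \<in> qinv (Omega G) (a \<odot>\<odot>\<^bsub>Omega G\<^esub> b)" using x(1) inv_mul(1)[OF gh] by simp
    qed
  qed
  show "a \<odot>\<odot>\<^bsub>Omega G\<^esub> b \<odot>\<odot>\<^bsub>Omega G\<^esub> c = a \<odot>\<odot>\<^bsub>Omega G\<^esub> (b \<odot>\<odot>\<^bsub>Omega G\<^esub> c)"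
    by (simp add: Omega_qmul gprod_assoc)
next
  fix S assume S: "S \<subseteq> carrier (Omega G)"
  have "qinv (Omega G) ` S \<subseteq> carrier (Omega G)" using S open_inv by auto
  then show "qinv (Omega G) (\<Squnion>\<^bsub>Omega G\<^esub>S) = \<Squnion>\<^bsub>Omega G\<^esub>(qinv (Omega G) ` S)"
    unfolding Omega_Sup[OF S] by (subst Omega_Sup) auto
qed

section \<open>The quantale of closed subspaces\<close>

lemma norm_adj [simp]: "norm (adj x) = norm (x::'a::cstar_algebra)"
proof -
  have le: "norm x \<le> norm (adj x)" for x :: 'a
  proof (cases "x = 0")
    case False
    have "norm x * norm x \<le> norm (adj x) * norm x"
      using cstar_identity[of x] norm_mult_ineq[of "adj x" x] by (simp add: power2_eq_square)
    then show ?thesis using False by simp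
  qed simp
  show ?thesis using le[of x] le[of "adj x"] by (simp add: adj_adj)
qed

lemma adj_minus: "adj (- x) = - adj (x::'a::cstar_algebra)"
  using adj_scaleC[of "-1" x] by simp

lemma adj_diff: "adj (x - y) = adj x - adj (y::'a::cstar_algebra)"
  using adj_add[of x "-y"] by (simp add: adj_minus)

lemma adj_zero [simp]: "adj (0::'a::cstar_algebra) = 0"
  using norm_adj[of "0::'a"] by (simp only: norm_zero norm_eq_zero)

lemma continuous_adj: "continuous_on UNIV (adj :: 'a::cstar_algebra \<Rightarrow> 'a)"
  by (rule continuous_onI) (auto simp: dist_norm simp flip: adj_diff intro!: exI)

lemma scaleC_diff: "c *\<^sub>C x - c *\<^sub>C y = c *\<^sub>C (x - (y::'a::cstar_algebra))"
  by (rule cvec.scale_right_diff_distrib[symmetric])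

lemma continuous_scaleC: "continuous_on UNIV (\<lambda>x. c *\<^sub>C (x::'a::cstar_algebra))"
proof (rule continuous_onI)
  fix x :: 'a and e :: real assume e: "e > 0"
  have "cmod c * norm (x' - x) \<le> e" if "norm (x' - x) < e / (cmod c + 1)" for x'
  proof -
    have "cmod c * norm (x' - x) \<le> (cmod c + 1) * (e / (cmod c + 1))"
      using that e by (intro mult_mono) auto
    also have "\<dots> = e" using norm_ge_zero[of c] by (simp add: field_simps del: norm_ge_zero)
    finally show ?thesis .
  qed
  then show "\<exists>d>0. \<forall>x'\<in>UNIV. dist x' x < d \<longrightarrow> dist (c *\<^sub>C x') (c *\<^sub>C x) \<le> e"
    using e by (intro exI[of _ "e / (cmod c + 1)"]) (auto simp: dist_norm scaleC_diff norm_scaleC add_nonneg_pos)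
qed

lemma closed_cspan_closed: "closed (closed_cspan S)"
  by (simp add: closed_cspan_def)

lemma closed_cspan_subspace: "cvec.subspace (closed_cspan (S::'a::cstar_algebra set))"
proof (rule cvec.subspaceI)
  have sp: "cvec.subspace (cvec.span S)" by (rule cvec.subspace_span)
  show "0 \<in> closed_cspan S" unfolding closed_cspan_def using cvec.subspace_0[OF sp] closure_subset by blast
  fix x y c assume x: "x \<in> closed_cspan S"
  have "(\<lambda>x. c *\<^sub>C x) ` closure (cvec.span S) \<subseteq> closure (cvec.span S)"
    by (rule image_closure_subset[OF continuous_on_subset[OF continuous_scaleC]])
      (use cvec.subspace_scale[OF sp] closure_subset in auto)
  then show "c *\<^sub>C x \<in> closed_cspan S" using x unfolding closed_cspan_def by blast
  assume y: "y \<in> closed_cspan S"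
  obtain f g where f: "\<And>n::nat. f n \<in> cvec.span S" "f \<longlonglongrightarrow> x" and g: "\<And>n::nat. g n \<in> cvec.span S" "g \<longlonglongrightarrow> y"
    using x y unfolding closed_cspan_def closure_sequential by blast
  have "f n + g n \<in> cvec.span S" for n using f g cvec.subspace_add[OF sp] by blast
  moreover have "(\<lambda>n. f n + g n) \<longlonglongrightarrow> x + y" by (intro tendsto_add f g)
  ultimately show "x + y \<in> closed_cspan S" unfolding closed_cspan_def closure_sequential
    by (intro exI[of _ "\<lambda>n. f n + g n"]) auto
qed

lemma closed_cspan_superset: "S \<subseteq> closed_cspan S"
  unfolding closed_cspan_def using cvec.span_superset closure_subset by blast

lemma closed_cspan_minimal: "closed V \<Longrightarrow> cvec.subspace V \<Longrightarrow> S \<subseteq> V \<Longrightarrow> closed_cspan S \<subseteq> V"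
  unfolding closed_cspan_def by (simp add: closure_minimal cvec.span_minimal)

lemma closed_cspan_mono: "S \<subseteq> T \<Longrightarrow> closed_cspan S \<subseteq> closed_cspan T"
  by (rule closed_cspan_minimal[OF closed_cspan_closed closed_cspan_subspace])
    (use closed_cspan_superset in blast)

lemma closed_cspan_id: "closed V \<Longrightarrow> cvec.subspace V \<Longrightarrow> closed_cspan V = V"
  using closed_cspan_minimal[of V V] closed_cspan_superset by blast

text \<open>Bilinearity and continuity of the product, used in one variable at a time.\<close>

lemma closed_cspan_products:
  fixes X Y :: "'a::cstar_algebra set"
  assumes Z: "closed Z" "cvec.subspace Z" and XY: "\<And>a b. a \<in> X \<Longrightarrow> b \<in> Y \<Longrightarrow> a * b \<in> Z"
    and a: "a \<in> closed_cspan X" and b: "b \<in> closed_cspan Y"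
  shows "a * b \<in> Z"
proof -
  have 1: "closed_cspan X \<subseteq> {a. a * b \<in> Z}" if b: "b \<in> Y" for b
  proof (rule closed_cspan_minimal)
    show "closed {a. a * b \<in> Z}"
      using closed_vimage[OF Z(1) continuous_on_mult_right[OF continuous_on_id], of b] by (simp add: vimage_def)
    show "cvec.subspace {a. a * b \<in> Z}"
      by (rule cvec.subspaceI) (use Z(2) in \<open>auto simp: cvec.subspace_def distrib_right mult_scaleC_left\<close>)
  qed (use XY b in blast)
  have "closed_cspan Y \<subseteq> {b. a * b \<in> Z}"
  proof (rule closed_cspan_minimal)
    show "closed {b. a * b \<in> Z}"
      using closed_vimage[OF Z(1) continuous_on_mult_left[OF continuous_on_id], of a] by (simp add: vimage_def)
    show "cvec.subspace {b. a * b \<in> Z}"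
      by (rule cvec.subspaceI) (use Z(2) in \<open>auto simp: cvec.subspace_def distrib_left mult_scaleC_right\<close>)
  qed (use 1 a in blast)
  then show ?thesis using b by blast
qed

lemma closed_adj_image:
  assumes "closed (V::'a::cstar_algebra set)" shows "closed (adj ` V)"
proof -
  have "adj ` V = adj -` V" by (auto simp: adj_adj image_iff) (metis adj_adj)
  then show ?thesis using closed_vimage[OF assms continuous_adj] by simp
qed

lemma subspace_adj_image:
  assumes V: "cvec.subspace (V::'a::cstar_algebra set)" shows "cvec.subspace (adj ` V)"
proof -
  have e: "adj ` V = {x. adj x \<in> V}" by (auto simp: adj_adj image_iff) (metis adj_adj)
  show ?thesis unfolding e
    by (rule cvec.subspaceI) (use V in \<open>auto simp: cvec.subspace_def adj_add adj_scaleC\<close>)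
qed

lemma adj_closed_cspan: "adj ` closed_cspan S = closed_cspan (adj ` (S::'a::cstar_algebra set))"
proof -
  have sub: "closed_cspan (adj ` S) \<subseteq> adj ` closed_cspan S" for S :: "'a set"
    by (intro closed_cspan_minimal closed_adj_image subspace_adj_image closed_cspan_closed closed_cspan_subspace image_mono closed_cspan_superset)
  have aa: "adj ` adj ` S = S" for S :: "'a set" by (simp add: image_image adj_adj)
  have "adj ` closed_cspan S \<subseteq> closed_cspan (adj ` S)"
    using image_mono[OF sub[of "adj ` S"], of adj] by (simp add: aa)
  then show ?thesis using sub by blast
qed

lemma Max_sel [simp]:
  "carrier Max_quantale = {V. closed V \<and> cvec.subspace V}" "eq Max_quantale = (=)" "le Max_quantale = (\<subseteq>)"
  "qinv Max_quantale = (\<lambda>V. adj ` V)"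
  "V \<odot>\<odot>\<^bsub>Max_quantale\<^esub> W = closed_cspan {a * b | a b. a \<in> V \<and> b \<in> W}"
  by (auto simp: Max_quantale_def)

lemma Max_lattice: "complete_lattice (Max_quantale :: 'a::cstar_algebra set quantale_struct)"
  and Max_Sup: "S \<subseteq> carrier Max_quantale \<Longrightarrow> \<Squnion>\<^bsub>Max_quantale\<^esub>S = closed_cspan (\<Union>S :: 'a set)"
proof -
  let ?c = "\<lambda>S. closed_cspan (\<Union>S) :: 'a set"
  have car: "?c S \<in> carrier Max_quantale" if "S \<subseteq> carrier Max_quantale" for S
    by (simp add: closed_cspan_closed closed_cspan_subspace)
  have up: "V \<subseteq> ?c S" if "S \<subseteq> carrier Max_quantale" "V \<in> S" for S V
    using closed_cspan_superset[of "\<Union>S"] that by blast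
  have least: "?c S \<subseteq> W" if "S \<subseteq> carrier Max_quantale" "W \<in> carrier Max_quantale" "\<And>V. V \<in> S \<Longrightarrow> V \<subseteq> W" for S W
    by (rule closed_cspan_minimal) (use that in auto)
  note il = inclusion_lattice[of "Max_quantale :: 'a set quantale_struct" ?c, OF Max_sel(2,3) car up least]
  show "complete_lattice (Max_quantale :: 'a set quantale_struct)"
    by (rule il)
  show "S \<subseteq> carrier Max_quantale \<Longrightarrow> \<Squnion>\<^bsub>Max_quantale\<^esub>S = closed_cspan (\<Union>S :: 'a set)"
    by (rule il)
qed

abbreviation sprod :: "'a::cstar_algebra set \<Rightarrow> 'a set \<Rightarrow> 'a set" where
  "sprod V W \<equiv> closed_cspan {a * b | a b. a \<in> V \<and> b \<in> W}"

lemma sprodI: "a \<in> V \<Longrightarrow> b \<in> W \<Longrightarrow> a * b \<in> sprod V W"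
  by (rule closed_cspan_superset[THEN subsetD]) blast

lemma sprod_mono: "V \<subseteq> V' \<Longrightarrow> W \<subseteq> W' \<Longrightarrow> sprod V W \<subseteq> sprod V' W'"
  by (rule closed_cspan_mono) blast

lemma sprod_minimal:
  assumes "closed Z" "cvec.subspace Z" "\<And>a b. a \<in> V \<Longrightarrow> b \<in> W \<Longrightarrow> a * b \<in> Z"
  shows "sprod V W \<subseteq> Z"
  by (rule closed_cspan_minimal) (use assms in auto)

lemma sprod_closed_cspan: "sprod (closed_cspan X) (closed_cspan Y) = sprod X Y"
proof
  show "sprod (closed_cspan X) (closed_cspan Y) \<subseteq> sprod X Y"
    by (intro sprod_minimal closed_cspan_closed closed_cspan_subspace)
      (rule closed_cspan_products[OF closed_cspan_closed closed_cspan_subspace sprodI])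
  show "sprod X Y \<subseteq> sprod (closed_cspan X) (closed_cspan Y)"
    by (intro sprod_mono closed_cspan_superset)
qed

lemma sprod_assoc:
  assumes "closed U" "cvec.subspace U" "closed W" "cvec.subspace W"
  shows "sprod (sprod U V) W = sprod U (sprod V W)"
proof -
  have "sprod (sprod U V) W = sprod {a * b | a b. a \<in> U \<and> b \<in> V} W"
    using sprod_closed_cspan[of "{a * b | a b. a \<in> U \<and> b \<in> V}" W] assms by (simp add: closed_cspan_id)
  also have "{x * c | x c. x \<in> {a * b | a b. a \<in> U \<and> b \<in> V} \<and> c \<in> W} =
      {a * y | a y. a \<in> U \<and> y \<in> {a * b | a b. a \<in> V \<and> b \<in> W}}" (is "?L = ?R")
  proof (intro equalityI subsetI)
    fix z assume "z \<in> ?L"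
    then obtain a b c where "z = a * b * c" "a \<in> U" "b \<in> V" "c \<in> W" by blast
    then show "z \<in> ?R" using mult.assoc[of a b c] by blast
  next
    fix z assume "z \<in> ?R"
    then obtain a b c where "z = a * (b * c)" "a \<in> U" "b \<in> V" "c \<in> W" by blast
    then show "z \<in> ?L" using mult.assoc[of a b c, symmetric] by blast
  qed
  also have "closed_cspan ?R = sprod U (sprod V W)"
    using sprod_closed_cspan[of U "{a * b | a b. a \<in> V \<and> b \<in> W}"] assms by (simp add: closed_cspan_id)
  finally show ?thesis .
qed

lemma closed_cspan_Union:
  "closed_cspan (\<Union>V\<in>S. closed_cspan (F V)) = closed_cspan (\<Union>V\<in>S. F V)"
proof
  show "closed_cspan (\<Union>V\<in>S. closed_cspan (F V)) \<subseteq> closed_cspan (\<Union>V\<in>S. F V)"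
    by (rule closed_cspan_minimal[OF closed_cspan_closed closed_cspan_subspace])
      (use closed_cspan_mono in blast)
  show "closed_cspan (\<Union>V\<in>S. F V) \<subseteq> closed_cspan (\<Union>V\<in>S. closed_cspan (F V))"
    using closed_cspan_superset by (intro closed_cspan_mono) blast
qed

lemma Max_is_quantale: "involutive_quantale (Max_quantale :: 'a::cstar_algebra set quantale_struct)"
proof (intro involutive_quantale.intro[OF Max_lattice] involutive_quantale_axioms.intro)
  let ?Q = "Max_quantale :: 'a set quantale_struct"
  fix a b c S assume a: "a \<in> carrier ?Q"
  show "qinv ?Q a \<in> carrier ?Q" using a closed_adj_image subspace_adj_image by auto
  show "qinv ?Q (qinv ?Q a) = a" by (simp add: image_image adj_adj)
  show "a \<odot>\<odot>\<^bsub>?Q\<^esub> \<Squnion>\<^bsub>?Q\<^esub>S = \<Squnion>\<^bsub>?Q\<^esub>((\<odot>\<odot>\<^bsub>?Q\<^esub>) a ` S)" if S: "S \<subseteq> carrier ?Q"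
  proof -
    have "(\<odot>\<odot>\<^bsub>?Q\<^esub>) a ` S \<subseteq> carrier ?Q" by (auto simp: closed_cspan_closed closed_cspan_subspace)
    then have "\<Squnion>\<^bsub>?Q\<^esub>((\<odot>\<odot>\<^bsub>?Q\<^esub>) a ` S) = closed_cspan (\<Union>V\<in>S. {x * y | x y. x \<in> a \<and> y \<in> V})"
      by (subst Max_Sup) (auto simp: closed_cspan_Union)
    also have "\<dots> = sprod a (\<Union>S)" by (rule arg_cong[where f = closed_cspan]) blast
    also have "\<dots> = sprod a (closed_cspan (\<Union>S))"
      using sprod_closed_cspan[of a "\<Union>S"] a by (simp add: closed_cspan_id)
    finally show ?thesis by (simp add: Max_Sup[OF S])
  qed
  show "\<Squnion>\<^bsub>?Q\<^esub>S \<odot>\<odot>\<^bsub>?Q\<^esub> a = \<Squnion>\<^bsub>?Q\<^esub>((\<lambda>s. s \<odot>\<odot>\<^bsub>?Q\<^esub> a) ` S)" if S: "S \<subseteq> carrier ?Q"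
  proof -
    have "(\<lambda>s. s \<odot>\<odot>\<^bsub>?Q\<^esub> a) ` S \<subseteq> carrier ?Q" by (auto simp: closed_cspan_closed closed_cspan_subspace)
    then have "\<Squnion>\<^bsub>?Q\<^esub>((\<lambda>s. s \<odot>\<odot>\<^bsub>?Q\<^esub> a) ` S) = closed_cspan (\<Union>V\<in>S. {x * y | x y. x \<in> V \<and> y \<in> a})"
      by (subst Max_Sup) (auto simp: closed_cspan_Union)
    also have "\<dots> = sprod (\<Union>S) a" by (rule arg_cong[where f = closed_cspan]) blast
    also have "\<dots> = sprod (closed_cspan (\<Union>S)) a"
      using sprod_closed_cspan[of "\<Union>S" a] a by (simp add: closed_cspan_id)
    finally show ?thesis by (simp add: Max_Sup[OF S])
  qed
  assume b: "b \<in> carrier ?Q"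
  show "a \<odot>\<odot>\<^bsub>?Q\<^esub> b \<in> carrier ?Q" by (simp add: closed_cspan_closed closed_cspan_subspace)
  show "qinv ?Q (a \<odot>\<odot>\<^bsub>?Q\<^esub> b) = qinv ?Q b \<odot>\<odot>\<^bsub>?Q\<^esub> qinv ?Q a"
  proof -
    have "adj ` {x * y | x y. x \<in> a \<and> y \<in> b} = {x * y | x y. x \<in> adj ` b \<and> y \<in> adj ` a}"
      using adj_mult by (force simp: image_iff)
    then show ?thesis by (simp add: adj_closed_cspan)
  qed
  assume c: "c \<in> carrier ?Q"
  show "a \<odot>\<odot>\<^bsub>?Q\<^esub> b \<odot>\<odot>\<^bsub>?Q\<^esub> c = a \<odot>\<odot>\<^bsub>?Q\<^esub> (b \<odot>\<odot>\<^bsub>?Q\<^esub> c)"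
    using sprod_assoc[of a c b] a c by simp
next
  let ?Q = "Max_quantale :: 'a set quantale_struct"
  fix S assume S: "S \<subseteq> carrier ?Q"
  have "qinv ?Q ` S \<subseteq> carrier ?Q" using S closed_adj_image subspace_adj_image by auto
  then show "qinv ?Q (\<Squnion>\<^bsub>?Q\<^esub>S) = \<Squnion>\<^bsub>?Q\<^esub>(qinv ?Q ` S)"
    by (simp add: Max_Sup[OF S] Max_Sup adj_closed_cspan image_Union)
qed


section \<open>Compactly supported sections over bisections\<close>

context fell_bundle
begin

lemma arrows_top: "arrows G = topspace (gtop G)"
  by (simp add: arrows_def)

lemma bisection_arrows: "U \<in> bisections G \<Longrightarrow> U \<subseteq> arrows G"
  using open_arrows bisection_open by blast

lemma sections_iff: "s \<in> sections G E \<longleftrightarrow> (\<forall>g\<in>arrows G. s g \<in> fib g) \<and> s \<in> extensional (arrows G)"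
  unfolding sections_def PiE_def Pi_def by auto

lemma sections_fib: "s \<in> sections G E \<Longrightarrow> g \<in> arrows G \<Longrightarrow> s g \<in> fib g"
  by (simp add: sections_iff)

lemma sec_zero_eq: "sec_zero G E = zero_section"
  by (simp add: sec_zero_def zero_section_def arrows_def)

lemma sec_zero_apply: "g \<in> arrows G \<Longrightarrow> sec_zero G E g = bzero E g"
  by (simp add: sec_zero_def)

lemma bzero_arrows: "g \<in> arrows G \<Longrightarrow> bzero E g \<in> fib g"
  using bzero_fib by (simp add: arrows_def)

lemma sec_zero_section: "sec_zero G E \<in> sections G E"
  unfolding sections_iff using bzero_arrows by (simp add: sec_zero_def)

lemma sec_add_section: "s \<in> sections G E \<Longrightarrow> t \<in> sections G E \<Longrightarrow> sec_add G E s t \<in> sections G E"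
  unfolding sections_iff using badd_fib by (simp add: sec_add_def)

lemma sec_scale_section: "s \<in> sections G E \<Longrightarrow> sec_scale G E c s \<in> sections G E"
  unfolding sections_iff using bscale_fib by (simp add: sec_scale_def)

lemma glue_section: "s \<in> sections G E \<Longrightarrow> t \<in> sections G E \<Longrightarrow> glue \<phi> s t \<in> sections G E"
  unfolding sections_iff using glue_fib by (simp add: glue_def arrows_def)

lemma glue_sec_zero:
  assumes "s \<in> sections G E" "y \<in> arrows G"
  shows "glue \<phi> s (sec_zero G E) y = bscale E (complex_of_real (\<phi> y)) (s y)"
  using assms(2) badd_bzero_right[OF bscale_fib[OF sections_fib[OF assms]]]
  by (simp add: glue_def sec_zero_apply arrows_top[symmetric] bscale_bzero[unfolded arrows_top[symmetric]])

lemma Cc_section: "s \<in> Cc G E U \<Longrightarrow> s \<in> sections G E"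
  by (simp add: Cc_def)

lemma Cc_fib: "s \<in> Cc G E U \<Longrightarrow> g \<in> arrows G \<Longrightarrow> s g \<in> fib g"
  using Cc_section sections_fib by blast

lemma Cc_zero_off: "s \<in> Cc G E U \<Longrightarrow> g \<in> arrows G \<Longrightarrow> g \<notin> U \<Longrightarrow> s g = bzero E g"
  by (simp add: Cc_def)

lemma Cc_support:
  assumes "s \<in> Cc G E U"
  obtains K where "compactin (gtop G) K" "K \<subseteq> U" "\<And>g. g \<in> arrows G \<Longrightarrow> g \<notin> K \<Longrightarrow> s g = bzero E g"
  using assms unfolding Cc_def by blast

lemma Cc_nearly_continuous:
  assumes "s \<in> Cc G E U" "openin (gtop G) U" "g \<in> U"
  shows "nearly_continuous_at 0 s g"
  by (rule nearly_if_continuous[OF assms(2) _ _ assms(3)])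
    (use assms Cc_fib open_arrows[OF assms(2)] in \<open>auto simp: Cc_def\<close>)

lemma CcI:
  assumes U: "openin (gtop G) U" and s: "s \<in> sections G E" and K: "compactin (gtop G) K" "K \<subseteq> U"
    and z: "\<And>g. g \<in> arrows G \<Longrightarrow> g \<notin> K \<Longrightarrow> s g = bzero E g" and c: "\<And>g. g \<in> U \<Longrightarrow> nearly_continuous_at 0 s g"
  shows "s \<in> Cc G E U"
proof -
  have "continuous_map (subtopology (gtop G) U) (btop E) s"
    by (rule continuous_if_nearly[OF U _ c]) (use sections_fib[OF s] open_arrows[OF U] in auto)
  moreover have "{g \<in> arrows G. s g \<noteq> bzero E g} \<subseteq> K" using z by blast
  ultimately show ?thesis using s K z unfolding Cc_def by blast
qed

lemma zero_nearly_continuous: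
  assumes "openin (gtop G) U" "g \<in> U" "\<And>y. y \<in> U \<Longrightarrow> s y = bzero E y"
  shows "nearly_continuous_at 0 s g"
proof (rule nearly_continuous_at_cong[OF assms(1,2), of _ zero_section])
  have U: "U \<subseteq> topspace (gtop G)" using openin_subset[OF assms(1)] .
  then show "nearly_continuous_at 0 zero_section g" using assms(2) zero_section_nearly_continuous_at by blast
  fix y assume "y \<in> U"
  then show "s y = zero_section y" "zero_section y \<in> fib y" using U assms(3) by (auto simp: zero_section_def)
qed

text \<open>The extension by zero is continuous on \<open>W\<close> because the compact support is closed in \<open>W\<close>.\<close>

lemma Cc_mono:
  assumes W: "W \<in> bisections G" and U: "openin (gtop G) U" "U \<subseteq> W" and s: "s \<in> Cc G E U"
  shows "s \<in> Cc G E W"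
proof -
  obtain K where K: "compactin (gtop G) K" "K \<subseteq> U" "\<And>g. g \<in> arrows G \<Longrightarrow> g \<notin> K \<Longrightarrow> s g = bzero E g"
    by (rule Cc_support[OF s]) auto
  show ?thesis
  proof (rule CcI[OF bisection_open[OF W] Cc_section[OF s] K(1) _ K(3)])
    show "K \<subseteq> W" using K U by blast
    fix g assume g: "g \<in> W"
    show "nearly_continuous_at 0 s g"
    proof (cases "g \<in> U")
      case True then show ?thesis by (rule Cc_nearly_continuous[OF s U(1)])
    next
      case False
      have o: "openin (gtop G) (W - K)" by (rule bisection_compact_closed[OF W K(1)]) (use K U in auto)
      show ?thesis
        by (rule zero_nearly_continuous[OF o]) (use g False K open_arrows[OF o] in auto)
    qed
  qed
qed

lemma Cc_sec_zero: "openin (gtop G) U \<Longrightarrow> sec_zero G E \<in> Cc G E U"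
proof (rule CcI[of _ _ "{}"])
  assume U: "openin (gtop G) U"
  show "nearly_continuous_at 0 (sec_zero G E) g" if "g \<in> U" for g
    unfolding sec_zero_eq using that openin_subset[OF U] by (intro zero_section_nearly_continuous_at) auto
qed (use sec_zero_section in \<open>auto simp: sec_zero_apply\<close>)

lemma Cc_glue:
  assumes U: "openin (gtop G) U" and s: "s \<in> Cc G E U" and t: "t \<in> Cc G E U"
    and \<phi>: "continuous_map (subtopology (gtop G) U) euclideanreal \<phi>" "\<And>y. y \<in> U \<Longrightarrow> 0 \<le> \<phi> y \<and> \<phi> y \<le> 1"
  shows "glue \<phi> s t \<in> Cc G E U"
proof -
  obtain K where K: "compactin (gtop G) K" "K \<subseteq> U" "\<And>g. g \<in> arrows G \<Longrightarrow> g \<notin> K \<Longrightarrow> s g = bzero E g"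
    by (rule Cc_support[OF s]) auto
  obtain L where L: "compactin (gtop G) L" "L \<subseteq> U" "\<And>g. g \<in> arrows G \<Longrightarrow> g \<notin> L \<Longrightarrow> t g = bzero E g"
    by (rule Cc_support[OF t]) auto
  show ?thesis
  proof (rule CcI[OF U glue_section[OF Cc_section[OF s] Cc_section[OF t]], of "K \<union> L"])
    show "compactin (gtop G) (K \<union> L)" using K L compactin_Un by blast
    show "glue \<phi> s t g = bzero E g" if "g \<in> arrows G" "g \<notin> K \<union> L" for g
      using K(3)[of g] L(3)[of g] that badd_bzero_left[OF bzero_arrows[OF that(1)]] by (simp add: glue_def arrows_def)
    show "nearly_continuous_at 0 (glue \<phi> s t) g" if g: "g \<in> U" for g
      by (rule glue_nearly_continuous_at[OF U g \<phi>])
        (use open_arrows[OF U] Cc_fib[OF s] Cc_fib[OF t] Cc_nearly_continuous[OF s U g] Cc_nearly_continuous[OF t U g] in auto)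
  qed (use K L in auto)
qed

lemma Cc_add:
  assumes U: "openin (gtop G) U" and s: "s \<in> Cc G E U" and t: "t \<in> Cc G E U"
  shows "sec_add G E s t \<in> Cc G E U"
proof -
  obtain K where K: "compactin (gtop G) K" "K \<subseteq> U" "\<And>g. g \<in> arrows G \<Longrightarrow> g \<notin> K \<Longrightarrow> s g = bzero E g"
    by (rule Cc_support[OF s]) auto
  obtain L where L: "compactin (gtop G) L" "L \<subseteq> U" "\<And>g. g \<in> arrows G \<Longrightarrow> g \<notin> L \<Longrightarrow> t g = bzero E g"
    by (rule Cc_support[OF t]) auto
  have UA: "U \<subseteq> arrows G" by (rule open_arrows[OF U])
  have c: "continuous_map (subtopology (gtop G) U) (btop E) s" "continuous_map (subtopology (gtop G) U) (btop E) t"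
    using s t by (auto simp: Cc_def)
  have eq: "proj E (s g) = proj E (t g)" if "g \<in> U" for g
    using Cc_fib[OF s, of g] Cc_fib[OF t, of g] that UA by auto
  have "continuous_map (subtopology (gtop G) U)
     (subtopology (prod_topology (btop E) (btop E)) {(e, f). proj E e = proj E f}) (\<lambda>g. (s g, t g))"
    using c eq by (auto simp: continuous_map_in_subtopology continuous_map_pairwise o_def)
  from continuous_map_compose[OF this badd_continuous]
  have "continuous_map (subtopology (gtop G) U) (btop E) (\<lambda>g. badd E (s g) (t g))" by (simp add: o_def)
  then have "continuous_map (subtopology (gtop G) U) (btop E) (sec_add G E s t)"
    by (rule continuous_map_eq) (use UA in \<open>auto simp: sec_add_def\<close>)
  moreover have z: "sec_add G E s t g = bzero E g" if "g \<in> arrows G" "g \<notin> K \<union> L" for g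
    using K(3)[of g] L(3)[of g] that badd_bzero_left[OF bzero_arrows[OF that(1)]] by (simp add: sec_add_def)
  moreover have "compactin (gtop G) (K \<union> L)" using K L compactin_Un by blast
  moreover have "{g \<in> arrows G. sec_add G E s t g \<noteq> bzero E g} \<subseteq> K \<union> L" "K \<union> L \<subseteq> U" using z K L by blast+
  moreover have "\<forall>g\<in>arrows G - U. sec_add G E s t g = bzero E g" using z K L by blast
  ultimately show ?thesis
    using sec_add_section[OF Cc_section[OF s] Cc_section[OF t]] unfolding Cc_def by blast
qed

lemma Cc_scale:
  assumes U: "openin (gtop G) U" and s: "s \<in> Cc G E U"
  shows "sec_scale G E c s \<in> Cc G E U"
proof -
  obtain K where K: "compactin (gtop G) K" "K \<subseteq> U" "\<And>g. g \<in> arrows G \<Longrightarrow> g \<notin> K \<Longrightarrow> s g = bzero E g"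
    by (rule Cc_support[OF s]) auto
  have UA: "U \<subseteq> arrows G" by (rule open_arrows[OF U])
  have "continuous_map (subtopology (gtop G) U) (btop E) s" using s by (auto simp: Cc_def)
  from continuous_map_compose[OF this bscale_continuous[of c]]
  have "continuous_map (subtopology (gtop G) U) (btop E) (\<lambda>g. bscale E c (s g))" by (simp add: o_def)
  then have "continuous_map (subtopology (gtop G) U) (btop E) (sec_scale G E c s)"
    by (rule continuous_map_eq) (use UA in \<open>auto simp: sec_scale_def\<close>)
  moreover have z: "sec_scale G E c s g = bzero E g" if "g \<in> arrows G" "g \<notin> K" for g
    using K(3)[of g] that by (simp add: sec_scale_def arrows_def)
  moreover have "{g \<in> arrows G. sec_scale G E c s g \<noteq> bzero E g} \<subseteq> K" using z by blast
  moreover have "\<forall>g\<in>arrows G - U. sec_scale G E c s g = bzero E g" using z K by blast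
  ultimately show ?thesis
    using sec_scale_section[OF Cc_section[OF s]] K(1,2) unfolding Cc_def by blast
qed

text \<open>Upper semicontinuity of the norm says nothing about the set where a section is nonzero.
  Instead, the bundle is Hausdorff over \<open>W\<close>, so that \<open>s x\<close> and the zero vector have disjoint
  neighbourhoods.\<close>

lemma nonzero_open:
  assumes W: "W \<in> bisections G" and s: "\<And>g. g \<in> W \<Longrightarrow> s g \<in> fib g"
    and c: "\<And>g. g \<in> W \<Longrightarrow> nearly_continuous_at 0 s g"
  shows "openin (gtop G) {g \<in> W. s g \<noteq> bzero E g}"
proof (subst openin_subopen, intro ballI)
  fix x assume "x \<in> {g \<in> W. s g \<noteq> bzero E g}"
  then have x: "x \<in> W" "s x \<noteq> bzero E x" by auto
  have oW: "openin (gtop G) W" by (rule bisection_open[OF W])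
  have xt: "x \<in> topspace (gtop G)" using x openin_subset[OF oW] by auto
  let ?P = "{e \<in> topspace (btop E). proj E e \<in> W}"
  have oP: "openin (btop E) ?P" by (rule openin_continuous_map_preimage[OF proj_continuous oW])
  have H: "Hausdorff_space (subtopology (btop E) ?P)"
    by (rule Hausdorff_over[OF oW bisection_Hausdorff[OF W]])
  have tP: "topspace (subtopology (btop E) ?P) = ?P" by auto
  have sP: "s x \<in> ?P" "bzero E x \<in> ?P" using s[OF x(1)] x xt by auto
  obtain N V where NV: "openin (subtopology (btop E) ?P) N" "openin (subtopology (btop E) ?P) V" "s x \<in> N" "bzero E x \<in> V" "disjnt N V"
    using H[unfolded Hausdorff_space_def tP, rule_format, of "s x" "bzero E x"] x(2) sP by auto
  have N: "openin (btop E) N" "openin (btop E) V" using NV oP by (auto simp: openin_open_subtopology)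
  obtain \<epsilon> U where eU: "\<epsilon> > 0" "openin (gtop G) U" "x \<in> U"
    "{e \<in> topspace (btop E). proj E e \<in> U \<and> bnorm E e < \<epsilon>} \<subseteq> V"
    using zero_neighbourhoods[OF xt N(2) NV(4)] by blast
  have cs: "continuous_map (subtopology (gtop G) W) (btop E) s" by (rule continuous_if_nearly[OF oW s c])
  have "openin (subtopology (gtop G) W) {g \<in> topspace (subtopology (gtop G) W). s g \<in> N}"
    by (rule openin_continuous_map_preimage[OF cs N(1)])
  moreover have "topspace (subtopology (gtop G) W) = W" using openin_subset[OF oW] by auto
  ultimately have "openin (gtop G) {g \<in> W. s g \<in> N}" by (simp only: openin_open_subtopology[OF oW])
  then have "openin (gtop G) ({g \<in> W. s g \<in> N} \<inter> U)" using eU by blast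
  moreover have "x \<in> {g \<in> W. s g \<in> N} \<inter> U" using x NV eU by auto
  moreover have "{g \<in> W. s g \<in> N} \<inter> U \<subseteq> {g \<in> W. s g \<noteq> bzero E g}"
  proof
    fix g assume g: "g \<in> {g \<in> W. s g \<in> N} \<inter> U"
    then have gt: "g \<in> topspace (gtop G)" using openin_subset[OF oW] by auto
    then have "bzero E g \<in> V" using eU g by auto
    then show "g \<in> {g \<in> W. s g \<noteq> bzero E g}" using NV(5) g by (auto simp: disjnt_iff)
  qed
  ultimately show "\<exists>T. openin (gtop G) T \<and> x \<in> T \<and> T \<subseteq> {g \<in> W. s g \<noteq> bzero E g}" by blast
qed

text \<open>A continuous section through \<open>e\<close> exists near \<open>g\<close>, and a cutoff function gives it compact
  support.\<close>

lemma enough_sections: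
  assumes W: "W \<in> bisections G" and g: "g \<in> W" and e: "e \<in> fib g"
  obtains s where "s \<in> Cc G E W" "s g = e"
proof -
  have oW: "openin (gtop G) W" by (rule bisection_open[OF W])
  have WA: "W \<subseteq> arrows G" by (rule bisection_arrows[OF W])
  obtain U K where UK: "openin (gtop G) U" "compactin (gtop G) K" "g \<in> U" "U \<subseteq> K" "K \<subseteq> W"
    using compact_neighbourhood[OF W g] .
  obtain s where s: "\<And>y. y \<in> W \<Longrightarrow> s y \<in> fib y" "\<And>y. y \<in> U \<Longrightarrow> nearly_continuous_at 0 s y" "s g = e"
    by (rule local_section_through[OF oW bisection_completely_regular[OF W] UK(2,5) open_delete[OF oW] UK(3,1,4) e]) auto
  have L: "compactin (gtop G) {g}" "{g} \<subseteq> U" "U \<subseteq> W" using g WA UK by (auto simp: arrows_def)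
  obtain \<phi> V1 V0 where \<phi>': "continuous_map (subtopology (gtop G) W) euclideanreal \<phi>" "\<forall>y. 0 \<le> \<phi> y \<and> \<phi> y \<le> (1::real)"
      "openin (gtop G) V1" "{g} \<subseteq> V1" "V1 \<subseteq> U" "\<forall>y\<in>V1. \<phi> y = 1"
      "openin (gtop G) V0" "W \<subseteq> U \<union> V0" "V0 \<subseteq> W" "\<forall>y\<in>V0. \<phi> y = 0"
    using cutoff_function[OF oW bisection_completely_regular[OF W] L(1,2) UK(1) L(3)] by (elim exE conjE) (rule that)
  define s' where "s' = (\<lambda>y\<in>arrows G. if y \<in> W then s y else bzero E y)"
  have s': "s' \<in> sections G E" unfolding sections_iff s'_def using s(1) bzero_arrows by auto
  define t where "t = glue \<phi> s' (sec_zero G E)"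
  have ts: "t \<in> sections G E" unfolding t_def by (rule glue_section[OF s' sec_zero_section])
  have ta: "t y = bscale E (complex_of_real (\<phi> y)) (s' y)" if "y \<in> arrows G" for y
    using that sections_fib[OF s' that] badd_bzero_right[OF bscale_fib[OF sections_fib[OF s' that]]]
    by (simp add: t_def glue_def sec_zero_apply arrows_def[symmetric] bscale_bzero[unfolded arrows_def[symmetric]])
  have t0: "t y = bzero E y" if y: "y \<in> arrows G" "y \<in> V0 \<or> y \<notin> W" for y
  proof (cases "y \<in> W")
    case True
    then have "\<phi> y = 0" using y \<phi>' by blast
    then show ?thesis using ta[OF y(1)] bscale_zero[OF sections_fib[OF s' y(1)]] by simp
  next
    case False
    then show ?thesis using ta[OF y(1)] y(1) by (simp add: s'_def arrows_def)
  qed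
  show thesis
  proof (rule that)
    show "t g = e" using ta[of g] g WA \<phi>' s(3) e bscale_one[OF e] by (auto simp: s'_def)
    show "t \<in> Cc G E W"
    proof (rule CcI[OF oW ts UK(2,5)])
      show "t y = bzero E y" if "y \<in> arrows G" "y \<notin> K" for y
        using t0[OF that(1)] that UK \<phi>' by blast
      show "nearly_continuous_at 0 t y" if y: "y \<in> W" for y
      proof (cases "y \<in> U")
        case True
        have "nearly_continuous_at 0 s' y"
          by (rule nearly_continuous_at_cong[OF UK(1) True _ _ s(2)[OF True]])
            (use L WA s(1) in \<open>auto simp: s'_def\<close>)
        moreover have "nearly_continuous_at 0 (sec_zero G E) y"
          unfolding sec_zero_eq using y WA zero_section_nearly_continuous_at by (auto simp: arrows_def)
        ultimately show ?thesis unfolding t_def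
          by (intro glue_nearly_continuous_at[OF oW y \<phi>'(1)])
            (use \<phi>'(2) WA sections_fib[OF s'] sections_fib[OF sec_zero_section] in auto)
      next
        case False
        then have "y \<in> V0" using y \<phi>' by blast
        then show ?thesis by (rule zero_nearly_continuous[OF \<phi>'(7)]) (use t0 \<phi>'(9) WA in blast)
      qed
    qed
  qed
qed

end


section \<open>Convolution and involution over bisections\<close>

context fell_bundle
begin

lemma mult_pairsI: "e \<in> fib g \<Longrightarrow> f \<in> fib h \<Longrightarrow> (g, h) \<in> composable G \<Longrightarrow> (e, f) \<in> mult_pairs G E"
  by (simp add: mult_pairs_def)

lemma bmul_fib:
  assumes "e \<in> fib g" "f \<in> fib h" "(g, h) \<in> composable G"
  shows "bmul E e f \<in> fib (g \<cdot>\<^bsub>G\<^esub> h)"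
proof -
  have m: "(e, f) \<in> mult_pairs G E" by (rule mult_pairsI[OF assms])
  then have "(e, f) \<in> topspace (subtopology (prod_topology (btop E) (btop E)) (mult_pairs G E))"
    using assms by auto
  then have "(\<lambda>(e, f). bmul E e f) (e, f) \<in> topspace (btop E)"
    using continuous_map_image_subset_topspace[OF bmul_continuous] by (meson image_subset_iff)
  then have "bmul E e f \<in> topspace (btop E)" by simp
  then show ?thesis using proj_bmul[OF m] assms by auto
qed

lemma bmul_zero_left:
  assumes "f \<in> fib h" "(g, h) \<in> composable G"
  shows "bmul E (bzero E g) f = bzero E (g \<cdot>\<^bsub>G\<^esub> h)"
proof -
  have g: "g \<in> arrows G" using assms by (simp add: composable_iff)
  have z: "bscale E 0 (bzero E g) = bzero E g" using bscale_zero[OF bzero_arrows[OF g]] .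
  show ?thesis
    using bmul_scale_left[OF mult_pairsI[OF bzero_arrows[OF g] assms], of 0]
      bscale_zero[OF bmul_fib[OF bzero_arrows[OF g] assms]] z by simp
qed

lemma bmul_zero_right:
  assumes "e \<in> fib g" "(g, h) \<in> composable G"
  shows "bmul E e (bzero E h) = bzero E (g \<cdot>\<^bsub>G\<^esub> h)"
proof -
  have h: "h \<in> arrows G" using assms by (simp add: composable_iff)
  have z: "bscale E 0 (bzero E h) = bzero E h" using bscale_zero[OF bzero_arrows[OF h]] .
  show ?thesis
    using bmul_scale_right[OF mult_pairsI[OF assms(1) bzero_arrows[OF h] assms(2)], of 0]
      bscale_zero[OF bmul_fib[OF assms(1) bzero_arrows[OF h] assms(2)]] z by simp
qed

lemma bstar_fib: "e \<in> fib g \<Longrightarrow> bstar E e \<in> fib (ginv G g)"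
  using proj_bstar[of e] continuous_map_image_subset_topspace[OF bstar_continuous] by (auto simp: image_subset_iff)

lemma bstar_zero: "g \<in> arrows G \<Longrightarrow> bstar E (bzero E g) = bzero E (ginv G g)"
  using bstar_scale[of "bzero E g" 0] bscale_zero[OF bzero_arrows, of g] bscale_zero[OF bstar_fib[OF bzero_arrows], of g]
    bzero_arrows[of g] by simp

lemma bmul_diff_norm:
  assumes "e \<in> fib g" "e' \<in> fib g" "f \<in> fib h" "f' \<in> fib h" "(g, h) \<in> composable G"
  shows "bdist E (bmul E e f) (bmul E e' f') \<le> bdist E e e' * bnorm E f + bnorm E e' * bdist E f f'"
proof -
  have s: "bscale E (-1) e' \<in> fib g" "bscale E (-1) f' \<in> fib h" using assms bscale_fib by auto
  note mp = mult_pairsI[OF _ _ assms(5)]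
  have "bmul E (badd E e (bscale E (-1) e')) f = badd E (bmul E e f) (bscale E (-1) (bmul E e' f))"
    using bmul_add_left[OF mp[OF assms(1,3)] mp[OF s(1) assms(3)]] bmul_scale_left[OF mp[OF assms(2,3)]] assms s by simp
  then have 1: "bdist E (bmul E e f) (bmul E e' f) \<le> bdist E e e' * bnorm E f"
    using bnorm_bmul[OF mp[OF badd_fib[OF assms(1) s(1)] assms(3)]] by (simp add: bdist_def)
  have "bmul E e' (badd E f (bscale E (-1) f')) = badd E (bmul E e' f) (bscale E (-1) (bmul E e' f'))"
    using bmul_add_right[OF mp[OF assms(2,3)] mp[OF assms(2) s(2)]] bmul_scale_right[OF mp[OF assms(2,4)]] assms s by simp
  then have 2: "bdist E (bmul E e' f) (bmul E e' f') \<le> bnorm E e' * bdist E f f'"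
    using bnorm_bmul[OF mp[OF assms(2) badd_fib[OF assms(3) s(2)]]] by (simp add: bdist_def)
  show ?thesis
    using bdist_triangle[OF bmul_fib[OF assms(1,3,5)] bmul_fib[OF assms(2,3,5)] bmul_fib[OF assms(2,4,5)]] 1 2 by linarith
qed

text \<open>Over bisections an arrow has at most one factorisation, so that the convolution sum has at
  most one term.\<close>

lemma conv_at_product:
  assumes U: "U \<in> bisections G" and V: "V \<in> bisections G" and s: "s \<in> Cc G E U" and t: "t \<in> Cc G E V"
    and gh: "g \<in> U" "h \<in> V" "(g, h) \<in> composable G"
  shows "conv G E s t (g \<cdot>\<^bsub>G\<^esub> h) = bmul E (s g) (t h)"
proof -
  have ga: "g \<in> arrows G" "h \<in> arrows G" "g \<cdot>\<^bsub>G\<^esub> h \<in> arrows G" using gh mul_closed by (auto simp: composable_iff)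
  let ?I = "{(h', k') \<in> composable G. h' \<cdot>\<^bsub>G\<^esub> k' = g \<cdot>\<^bsub>G\<^esub> h \<and> bmul E (s h') (t k') \<noteq> bzero E (g \<cdot>\<^bsub>G\<^esub> h)}"
  have I: "?I \<subseteq> {(g, h)}"
  proof clarify
    fix h' k' assume c: "(h', k') \<in> composable G" "h' \<cdot>\<^bsub>G\<^esub> k' = g \<cdot>\<^bsub>G\<^esub> h" "bmul E (s h') (t k') \<noteq> bzero E (g \<cdot>\<^bsub>G\<^esub> h)"
    have a: "h' \<in> arrows G" "k' \<in> arrows G" using c by (auto simp: composable_iff)
    have "s h' \<noteq> bzero E h'" using bmul_zero_left[OF Cc_fib[OF t a(2)] c(1)] c by auto
    then have "h' \<in> U" using Cc_zero_off[OF s a(1)] by blast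
    moreover have "t k' \<noteq> bzero E k'" using bmul_zero_right[OF Cc_fib[OF s a(1)] c(1)] c by auto
    then have "k' \<in> V" using Cc_zero_off[OF t a(2)] by blast
    ultimately show "h' = g \<and> k' = h" using bisection_prod_unique[OF U V gh] c by metis
  qed
  have m: "bmul E (s g) (t h) \<in> fib (g \<cdot>\<^bsub>G\<^esub> h)" by (rule bmul_fib[OF Cc_fib[OF s ga(1)] Cc_fib[OF t ga(2)] gh(3)])
  interpret M: abelian_group "fibre E (g \<cdot>\<^bsub>G\<^esub> h)" using fibre_group ga by (simp add: arrows_def)
  have c: "conv G E s t (g \<cdot>\<^bsub>G\<^esub> h) = finsum (fibre E (g \<cdot>\<^bsub>G\<^esub> h)) (\<lambda>(h, k). bmul E (s h) (t k)) ?I"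
    using ga by (simp add: conv_def)
  show ?thesis
  proof (cases "bmul E (s g) (t h) = bzero E (g \<cdot>\<^bsub>G\<^esub> h)")
    case True
    then have "?I = {}" using I by auto
    then show ?thesis unfolding c True by (simp only: M.finsum_empty fibre_simps)
  next
    case False
    then have "?I = {(g, h)}" using I gh by auto
    moreover have "finsum (fibre E (g \<cdot>\<^bsub>G\<^esub> h)) (\<lambda>(h, k). bmul E (s h) (t k)) {(g, h)} = bmul E (s g) (t h)"
      using M.finsum_insert[of "{}" "(g, h)" "\<lambda>(h, k). bmul E (s h) (t k)"] m badd_bzero_right[OF m] by simp
    ultimately show ?thesis unfolding c by (simp only:)
  qed
qed

lemma conv_off_product:
  assumes s: "s \<in> Cc G E U" and t: "t \<in> Cc G E V" and p: "p \<in> arrows G" "p \<notin> gprod U V"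
  shows "conv G E s t p = bzero E p"
proof -
  let ?I = "{(h', k') \<in> composable G. h' \<cdot>\<^bsub>G\<^esub> k' = p \<and> bmul E (s h') (t k') \<noteq> bzero E p}"
  have "?I = {}"
  proof (rule equals0I)
    fix x assume "x \<in> ?I"
    then obtain h' k' where c: "(h', k') \<in> composable G" "h' \<cdot>\<^bsub>G\<^esub> k' = p" "bmul E (s h') (t k') \<noteq> bzero E p" by blast
    have a: "h' \<in> arrows G" "k' \<in> arrows G" using c by (auto simp: composable_iff)
    have "s h' \<noteq> bzero E h'" using bmul_zero_left[OF Cc_fib[OF t a(2)] c(1)] c by auto
    then have "h' \<in> U" using Cc_zero_off[OF s a(1)] by blast
    moreover have "t k' \<noteq> bzero E k'" using bmul_zero_right[OF Cc_fib[OF s a(1)] c(1)] c by auto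
    then have "k' \<in> V" using Cc_zero_off[OF t a(2)] by blast
    ultimately have "p \<in> gprod U V" using c unfolding gprod_def by blast
    then show False using p by blast
  qed
  interpret M: abelian_group "fibre E p" using fibre_group p by (simp add: arrows_def)
  have "conv G E s t p = finsum (fibre E p) (\<lambda>(h, k). bmul E (s h) (t k)) ?I"
    using p by (simp add: conv_def)
  then show ?thesis unfolding \<open>?I = {}\<close> by (simp only: M.finsum_empty fibre_simps)
qed

lemma conv_section:
  assumes U: "U \<in> bisections G" and V: "V \<in> bisections G" and s: "s \<in> Cc G E U" and t: "t \<in> Cc G E V"
  shows "conv G E s t \<in> sections G E"
  unfolding sections_iff
proof (intro conjI ballI)
  show "conv G E s t \<in> extensional (arrows G)" by (simp add: conv_def)
  fix p assume p: "p \<in> arrows G"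
  show "conv G E s t p \<in> fib p"
  proof (cases "p \<in> gprod U V")
    case True
    then obtain g h where gh: "g \<in> U" "h \<in> V" "(g, h) \<in> composable G" "p = g \<cdot>\<^bsub>G\<^esub> h" unfolding gprod_def by blast
    show ?thesis using conv_at_product[OF U V s t gh(1-3)] bmul_fib[OF Cc_fib[OF s] Cc_fib[OF t] gh(3)] gh(3,4)
      by (simp add: composable_iff)
  next
    case False
    then show ?thesis using conv_off_product[OF s t p] bzero_arrows[OF p] by simp
  qed
qed

text \<open>The factors \<open>l p\<close> and \<open>r p\<close> of \<open>p\<close> are continuous functions of \<open>p\<close>, because range and domain
  are open maps that are injective on \<open>U\<close> and on \<open>V\<close>.\<close>

lemma Cc_conv:
  assumes U: "U \<in> bisections G" and V: "V \<in> bisections G" and s: "s \<in> Cc G E U" and t: "t \<in> Cc G E V"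
  shows "conv G E s t \<in> Cc G E (gprod U V)"
proof -
  let ?P = "gprod U V"
  have oU: "openin (gtop G) U" and oV: "openin (gtop G) V" using bisection_open U V by auto
  have UA: "U \<subseteq> arrows G" and VA: "V \<subseteq> arrows G" using open_arrows oU oV by auto
  have oP: "openin (gtop G) ?P" by (rule open_gprod[OF oU oV])
  have tP: "topspace (subtopology (gtop G) ?P) = ?P" using openin_subset[OF oP] by auto
  have iU: "inj_on (grng G) U" and iV: "inj_on (gdom G) V" "inj_on (grng G) V" using U V by (auto simp: bisections_def)
  define l where "l p = inv_into U (grng G) (grng G p)" for p
  define r where "r p = inv_into V (gdom G) (gdom G p)" for p
  have lr: "l (g \<cdot>\<^bsub>G\<^esub> h) = g" "r (g \<cdot>\<^bsub>G\<^esub> h) = h" if "g \<in> U" "h \<in> V" "(g, h) \<in> composable G" for g h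
    using that inv_into_f_f[OF iU] inv_into_f_f[OF iV(1)] rng_mul dom_mul by (auto simp: l_def r_def)
  have P: "l p \<in> U" "r p \<in> V" "(l p, r p) \<in> composable G" "l p \<cdot>\<^bsub>G\<^esub> r p = p" if "p \<in> ?P" for p
    using that lr unfolding gprod_def by auto
  have cl: "continuous_map (subtopology (gtop G) ?P) (gtop G) l"
  proof -
    have "continuous_map (subtopology (gtop G) ?P) (subtopology (gtop G) (grng G ` U)) (grng G)"
      using continuous_grng tP rng_mul by (auto simp: continuous_map_in_subtopology continuous_map_from_subtopology gprod_def)
    from continuous_map_compose[OF this open_map_section[OF open_grng iU oU]]
    show ?thesis by (simp add: o_def l_def[abs_def])
  qed
  have cr: "continuous_map (subtopology (gtop G) ?P) (gtop G) r"
  proof -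
    have "continuous_map (subtopology (gtop G) ?P) (subtopology (gtop G) (gdom G ` V)) (gdom G)"
      using continuous_gdom tP dom_mul by (auto simp: continuous_map_in_subtopology continuous_map_from_subtopology gprod_def)
    from continuous_map_compose[OF this open_map_section[OF open_gdom iV(1) oV]]
    show ?thesis by (simp add: o_def r_def[abs_def])
  qed
  have csl: "continuous_map (subtopology (gtop G) ?P) (btop E) (\<lambda>p. s (l p))"
  proof -
    have "continuous_map (subtopology (gtop G) ?P) (subtopology (gtop G) U) l"
      using cl P(1) tP by (auto simp: continuous_map_in_subtopology)
    moreover have "continuous_map (subtopology (gtop G) U) (btop E) s" using s by (simp add: Cc_def)
    ultimately have "continuous_map (subtopology (gtop G) ?P) (btop E) (s \<circ> l)" by (rule continuous_map_compose)
    then show ?thesis by (simp add: o_def)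
  qed
  have ctr: "continuous_map (subtopology (gtop G) ?P) (btop E) (\<lambda>p. t (r p))"
  proof -
    have "continuous_map (subtopology (gtop G) ?P) (subtopology (gtop G) V) r"
      using cr P(2) tP by (auto simp: continuous_map_in_subtopology)
    moreover have "continuous_map (subtopology (gtop G) V) (btop E) t" using t by (simp add: Cc_def)
    ultimately have "continuous_map (subtopology (gtop G) ?P) (btop E) (t \<circ> r)" by (rule continuous_map_compose)
    then show ?thesis by (simp add: o_def)
  qed
  have mp: "(s (l p), t (r p)) \<in> mult_pairs G E" if "p \<in> ?P" for p
    by (rule mult_pairsI[OF Cc_fib[OF s] Cc_fib[OF t] P(3)[OF that]]) (use P[OF that] UA VA in auto)
  have "continuous_map (subtopology (gtop G) ?P) (subtopology (prod_topology (btop E) (btop E)) (mult_pairs G E)) (\<lambda>p. (s (l p), t (r p)))"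
    using csl ctr mp tP by (auto simp: continuous_map_in_subtopology continuous_map_pairwise o_def)
  from continuous_map_compose[OF this bmul_continuous]
  have "continuous_map (subtopology (gtop G) ?P) (btop E) (\<lambda>p. bmul E (s (l p)) (t (r p)))" by (simp add: o_def)
  then have cc: "continuous_map (subtopology (gtop G) ?P) (btop E) (conv G E s t)"
  proof (rule continuous_map_eq)
    fix p assume "p \<in> topspace (subtopology (gtop G) ?P)"
    then have p: "p \<in> ?P" using tP by simp
    show "bmul E (s (l p)) (t (r p)) = conv G E s t p" using conv_at_product[OF U V s t P(1-3)[OF p]] P(4)[OF p] by simp
  qed
  obtain K where K: "compactin (gtop G) K" "K \<subseteq> U" "\<And>g. g \<in> arrows G \<Longrightarrow> g \<notin> K \<Longrightarrow> s g = bzero E g"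
    by (rule Cc_support[OF s]) auto
  obtain L where L: "compactin (gtop G) L" "L \<subseteq> V" "\<And>g. g \<in> arrows G \<Longrightarrow> g \<notin> L \<Longrightarrow> t g = bzero E g"
    by (rule Cc_support[OF t]) auto
  have rL: "compactin (gtop G) (grng G ` L)" by (rule image_compactin[OF L(1) continuous_grng])
  have "grng G ` L \<subseteq> units G" using L VA grng_unit by auto
  then have oD: "openin (gtop G) (units G - grng G ` L)" using bisection_compact_closed[OF units_bisection rL] by blast
  \<comment> \<open>\<open>K1\<close> consists of the arrows of \<open>K\<close> composable with some arrow of \<open>L\<close>. It is compact because
    the range of \<open>L\<close> is closed in the Hausdorff unit space, and \<open>\<kappa> g\<close> is the arrow of \<open>V\<close>
    composable with \<open>g\<close>.\<close>
  define K1 where "K1 = K \<inter> (topspace (gtop G) - {g \<in> arrows G. gdom G g \<in> units G - grng G ` L})"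
  have cK1: "compactin (gtop G) K1" unfolding K1_def
    by (rule compact_Int_closedin[OF K(1)]) (use open_vimage[OF continuous_gdom oD] in auto)
  define \<kappa> where "\<kappa> g = inv_into V (grng G) (gdom G g)" for g
  have K1U: "K1 \<subseteq> U" using K by (auto simp: K1_def)
  have K1L: "gdom G g \<in> grng G ` L" if "g \<in> K1" for g
    using that K1U UA gdom_unit by (auto simp: K1_def)
  have \<kappa>: "\<kappa> g \<in> V" "grng G (\<kappa> g) = gdom G g" if "g \<in> K1" for g
    using K1L[OF that] L inv_into_into[of "gdom G g" "grng G" V] f_inv_into_f[of "gdom G g" "grng G" V] by (auto simp: \<kappa>_def)
  have tK: "topspace (subtopology (gtop G) K1) = K1" using compactin_subset_topspace[OF cK1] by auto
  have ck: "continuous_map (subtopology (gtop G) K1) (gtop G) \<kappa>"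
  proof -
    have "continuous_map (subtopology (gtop G) K1) (subtopology (gtop G) (grng G ` V)) (gdom G)"
    proof -
      have "gdom G \<in> K1 \<rightarrow> grng G ` V" using K1L L by blast
      then show ?thesis using continuous_gdom tK by (simp add: continuous_map_in_subtopology continuous_map_from_subtopology)
    qed
    from continuous_map_compose[OF this open_map_section[OF open_grng iV(2) oV]]
    show ?thesis by (simp add: o_def \<kappa>_def[abs_def])
  qed
  have comp: "(g, \<kappa> g) \<in> composable G" if "g \<in> K1" for g
    using \<kappa>[OF that] that K1U UA VA by (auto simp: composable_iff)
  have "continuous_map (subtopology (gtop G) K1) (subtopology (prod_topology (gtop G) (gtop G)) (composable G)) (\<lambda>g. (g, \<kappa> g))"
    using ck comp tK by (auto simp: continuous_map_in_subtopology continuous_map_pairwise o_def continuous_map_from_subtopology)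
  from continuous_map_compose[OF this continuous_mul]
  have cm: "continuous_map (subtopology (gtop G) K1) (gtop G) (\<lambda>g. g \<cdot>\<^bsub>G\<^esub> \<kappa> g)" by (simp add: o_def)
  define C where "C = (\<lambda>g. g \<cdot>\<^bsub>G\<^esub> \<kappa> g) ` K1"
  have C: "compactin (gtop G) C" unfolding C_def
    by (rule image_compactin[OF _ cm]) (use cK1 in \<open>simp add: compactin_subtopology\<close>)
  have CP: "C \<subseteq> ?P" unfolding C_def gprod_def using K1U \<kappa> comp by blast
  have "{p \<in> arrows G. conv G E s t p \<noteq> bzero E p} \<subseteq> C"
  proof clarify
    fix p assume p: "p \<in> arrows G" "conv G E s t p \<noteq> bzero E p"
    then have pP: "p \<in> ?P" using conv_off_product[OF s t] by blast
    let ?g = "l p" and ?h = "r p"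
    have a: "?g \<in> arrows G" "?h \<in> arrows G" using P[OF pP] UA VA by auto
    have ne: "bmul E (s ?g) (t ?h) \<noteq> bzero E (?g \<cdot>\<^bsub>G\<^esub> ?h)" using p conv_at_product[OF U V s t P(1-3)[OF pP]] P(4)[OF pP] by simp
    have "?g \<in> K"
      by (rule ccontr) (use K(3)[OF a(1)] ne bmul_zero_left[OF Cc_fib[OF t a(2)] P(3)[OF pP]] in simp)
    moreover have hL: "?h \<in> L"
      by (rule ccontr) (use L(3)[OF a(2)] ne bmul_zero_right[OF Cc_fib[OF s a(1)] P(3)[OF pP]] in simp)
    moreover have "gdom G ?g \<in> grng G ` L" using hL P(3)[OF pP] by (simp add: composable_iff)
    ultimately have gK: "?g \<in> K1" using a by (simp add: K1_def arrows_def)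
    have "\<kappa> ?g = ?h"
      using inv_into_f_f[OF iV(2) P(2)[OF pP]] P(3)[OF pP] by (simp add: \<kappa>_def composable_iff)
    then show "p \<in> C" unfolding C_def using P(4)[OF pP] gK by (intro image_eqI[of _ _ ?g]) simp_all
  qed
  then show ?thesis unfolding Cc_def
    using conv_section[OF U V s t] cc C CP
    by (intro CollectI conjI ballI exI[of _ C]) (use conv_off_product[OF s t] in auto)
qed

lemma Cc_star:
  assumes U: "openin (gtop G) U" and s: "s \<in> Cc G E U"
  shows "sec_star G E s \<in> Cc G E (ginv G ` U)"
proof -
  have UA: "U \<subseteq> arrows G" by (rule open_arrows[OF U])
  have oI: "openin (gtop G) (ginv G ` U)" by (rule open_inv[OF U])
  have IA: "ginv G ` U \<subseteq> arrows G" by (rule open_arrows[OF oI])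
  have ii: "ginv G g \<in> U" if "g \<in> ginv G ` U" for g using that inv_inv UA by auto
  have sec: "sec_star G E s \<in> sections G E" unfolding sections_iff
  proof (intro conjI ballI)
    fix g assume g: "g \<in> arrows G"
    show "sec_star G E s g \<in> fib g"
      using bstar_fib[OF Cc_fib[OF s inv_closed[OF g]]] inv_inv[OF g] g by (simp add: sec_star_def)
  qed (simp add: sec_star_def)
  obtain K where K: "compactin (gtop G) K" "K \<subseteq> U" "\<And>g. g \<in> arrows G \<Longrightarrow> g \<notin> K \<Longrightarrow> s g = bzero E g"
    by (rule Cc_support[OF s]) auto
  have z: "sec_star G E s g = bzero E g" if g: "g \<in> arrows G" "g \<notin> ginv G ` K" for g
  proof -
    have "ginv G g \<notin> K" using g inv_inv[OF g(1)] by (metis image_eqI)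
    then have "s (ginv G g) = bzero E (ginv G g)" using K(3)[OF inv_closed[OF g(1)]] by blast
    then show ?thesis using bstar_zero[OF inv_closed[OF g(1)]] inv_inv[OF g(1)] g by (simp add: sec_star_def)
  qed
  have "continuous_map (subtopology (gtop G) (ginv G ` U)) (subtopology (gtop G) U) (ginv G)"
    using continuous_inv ii by (auto simp: continuous_map_in_subtopology continuous_map_from_subtopology)
  moreover have "continuous_map (subtopology (gtop G) U) (btop E) s" using s by (simp add: Cc_def)
  ultimately have "continuous_map (subtopology (gtop G) (ginv G ` U)) (btop E) (s \<circ> ginv G)"
    by (rule continuous_map_compose)
  from continuous_map_compose[OF this bstar_continuous]
  have "continuous_map (subtopology (gtop G) (ginv G ` U)) (btop E) (bstar E \<circ> (s \<circ> ginv G))" .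
  then have "continuous_map (subtopology (gtop G) (ginv G ` U)) (btop E) (sec_star G E s)"
    by (rule continuous_map_eq) (use IA in \<open>auto simp: sec_star_def\<close>)
  moreover have "compactin (gtop G) (ginv G ` K)" by (rule image_compactin[OF K(1) continuous_inv])
  moreover have "{g \<in> arrows G. sec_star G E s g \<noteq> bzero E g} \<subseteq> ginv G ` K" "ginv G ` K \<subseteq> ginv G ` U"
    "\<forall>g\<in>arrows G - ginv G ` U. sec_star G E s g = bzero E g" using z K by blast+
  ultimately show ?thesis using sec unfolding Cc_def
    by (intro CollectI conjI exI[of _ "ginv G ` K"]) auto
qed

lemma bmul_bstar_fib:
  assumes "e \<in> fib g"
  shows "bmul E (bstar E e) e \<in> fib (gdom G g)" "bmul E e (bstar E e) \<in> fib (grng G g)"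
proof -
  have g: "g \<in> arrows G" using fib_base[OF assms] by (simp add: arrows_def)
  show "bmul E (bstar E e) e \<in> fib (gdom G g)" "bmul E e (bstar E e) \<in> fib (grng G g)"
    using bmul_fib[OF bstar_fib[OF assms] assms inv_composable(1)[OF g]] bmul_fib[OF assms bstar_fib[OF assms] inv_composable(2)[OF g]]
    by (auto simp: gdom_def grng_def)
qed

lemma bstar_mul_eq_0:
  assumes "e \<in> fib g" "bmul E (bstar E e) e = bzero E (gdom G g)"
  shows "e = bzero E g"
proof -
  have g: "g \<in> arrows G" using fib_base[OF assms(1)] by (simp add: arrows_def)
  have "(bnorm E e)\<^sup>2 = 0"
    using bnorm_cstar[of e] assms g by (simp add: bnorm_bzero[unfolded arrows_top[symmetric]])
  then show ?thesis using bnorm_eq_0[OF assms(1)] by simp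
qed

end


section \<open>Evaluation of elements of a compatible completion\<close>

context compatible_completion
begin

lemma Gamma_section: "s \<in> Gamma_c G E \<Longrightarrow> s \<in> sections G E"
  by (induction rule: Gamma_c.induct) (auto intro: Cc_section sec_zero_section sec_add_section sec_scale_section)

lemma Gamma_fib: "s \<in> Gamma_c G E \<Longrightarrow> g \<in> arrows G \<Longrightarrow> s g \<in> fib g"
  using Gamma_section sections_fib by blast

lemma bnorm_le_N:
  assumes "s \<in> Gamma_c G E" "g \<in> arrows G"
  shows "bnorm E (s g) \<le> N s"
proof -
  have "ennreal (bnorm E (s g)) \<le> sup_norm G E s"
    unfolding sup_norm_def by (rule SUP_upper[OF assms(2)])
  then have "ennreal (bnorm E (s g)) \<le> ennreal (N s)"
    using sup_norm_le_N[OF assms(1)] by (rule order_trans)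
  then show ?thesis using N_nonneg[OF assms(1)] by simp
qed

lemma iota_zero: "\<iota> (sec_zero G E) = 0"
  using N_eq_0[OF Gamma_c.zero] iota_norm[OF Gamma_c.zero] by simp

lemma iota_diff:
  assumes "s \<in> Gamma_c G E" "t \<in> Gamma_c G E"
  shows "sec_add G E s (sec_scale G E (-1) t) \<in> Gamma_c G E"
    "\<iota> (sec_add G E s (sec_scale G E (-1) t)) = \<iota> s - \<iota> t"
    "g \<in> arrows G \<Longrightarrow> bnorm E (sec_add G E s (sec_scale G E (-1) t) g) = bdist E (s g) (t g)"
proof -
  have t: "sec_scale G E (-1) t \<in> Gamma_c G E" by (rule Gamma_c.scale[OF assms(2)])
  show "sec_add G E s (sec_scale G E (-1) t) \<in> Gamma_c G E" by (rule Gamma_c.add[OF assms(1) t])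
  show "\<iota> (sec_add G E s (sec_scale G E (-1) t)) = \<iota> s - \<iota> t"
    using iota_add[OF assms(1) t] iota_scale[OF assms(2)] by simp
  show "g \<in> arrows G \<Longrightarrow> bnorm E (sec_add G E s (sec_scale G E (-1) t) g) = bdist E (s g) (t g)"
    by (simp add: sec_add_def sec_scale_def bdist_def)
qed

lemma bdist_le_iota:
  assumes "s \<in> Gamma_c G E" "t \<in> Gamma_c G E" "g \<in> arrows G"
  shows "bdist E (s g) (t g) \<le> norm (\<iota> s - \<iota> t)"
  using bnorm_le_N[OF iota_diff(1)[OF assms(1,2)] assms(3)] iota_norm[OF iota_diff(1)[OF assms(1,2)]]
    iota_diff(2,3)[OF assms(1,2)] assms(3) by simp

lemma iota_approx:
  assumes "0 < \<epsilon>"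
  obtains s where "s \<in> Gamma_c G E" "norm (a - \<iota> s) < \<epsilon>"
proof -
  have "a \<in> closure (\<iota> ` Gamma_c G E)" using iota_dense by simp
  then obtain x where "x \<in> \<iota> ` Gamma_c G E" "dist x a < \<epsilon>" using assms unfolding closure_approachable by blast
  then show thesis using that by (auto simp: dist_norm norm_minus_commute)
qed

text \<open>The value of \<open>a\<close> at \<open>g\<close>, characterised without a limit by its distance from the values of
  all sections. It agrees with the continuous linear extension of the evaluation of sections, see
  \<open>eval_at_eq_ev\<close>.\<close>

definition ev :: "'g \<Rightarrow> 'a \<Rightarrow> 'e" where
  "ev g a = (THE e. e \<in> fib g \<and> (\<forall>s\<in>Gamma_c G E. bdist E e (s g) \<le> norm (a - \<iota> s)))"

lemma ev_unique:
  assumes g: "g \<in> arrows G" and e: "e \<in> fib g" "\<And>s. s \<in> Gamma_c G E \<Longrightarrow> bdist E e (s g) \<le> norm (a - \<iota> s)"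
    and f: "f \<in> fib g"
    "\<And>\<epsilon>. 0 < \<epsilon> \<Longrightarrow> \<exists>s\<in>Gamma_c G E. norm (a - \<iota> s) < \<epsilon> \<and> bdist E f (s g) \<le> C * \<epsilon>"
  shows "f = e"
proof -
  have "bdist E f e \<le> \<delta>" if d: "\<delta> > 0" for \<delta>
  proof -
    let ?\<epsilon> = "\<delta> / (\<bar>C\<bar> + 1)"
    have ep: "?\<epsilon> > 0" using d by (simp add: add_nonneg_pos)
    obtain s where s: "s \<in> Gamma_c G E" "norm (a - \<iota> s) < ?\<epsilon>" "bdist E f (s g) \<le> C * ?\<epsilon>" using f(2)[OF ep] by blast
    have sg: "s g \<in> fib g" by (rule Gamma_fib[OF s(1) g])
    have "C * ?\<epsilon> \<le> \<bar>C\<bar> * ?\<epsilon>" using ep by (intro mult_right_mono) auto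
    then have "bdist E f (s g) + bdist E e (s g) \<le> \<bar>C\<bar> * ?\<epsilon> + ?\<epsilon>" using s e(2)[OF s(1)] by linarith
    also have "\<dots> = (\<bar>C\<bar> + 1) * ?\<epsilon>" by (simp only: distrib_right mult_1)
    also have "\<dots> = \<delta>" by (simp add: add_nonneg_pos)
    finally show ?thesis using bdist_triangle[OF f(1) sg e(1)] bdist_sym[OF sg e(1)] by linarith
  qed
  then have "bdist E f e \<le> 0" by (meson dense_ge not_less)
  then show ?thesis using bdist_nonneg[OF f(1) e(1)] bdist_eq_0[OF f(1) e(1)] by linarith
qed

lemma ev_exists:
  assumes g: "g \<in> arrows G"
  shows "\<exists>e. e \<in> fib g \<and> (\<forall>s\<in>Gamma_c G E. bdist E e (s g) \<le> norm (a - \<iota> s))"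
proof -
  have "\<exists>s. s \<in> Gamma_c G E \<and> norm (a - \<iota> s) < inverse (real (Suc n))" for n
    using iota_approx[of "inverse (real (Suc n))" a] by auto
  then obtain \<sigma> where \<sigma>: "\<And>n. \<sigma> n \<in> Gamma_c G E" "\<And>n. norm (a - \<iota> (\<sigma> n)) < inverse (real (Suc n))" by metis
  have \<sigma>f: "\<sigma> n g \<in> fib g" for n by (rule Gamma_fib[OF \<sigma>(1) g])
  have d: "bdist E (\<sigma> m g) (\<sigma> n g) \<le> 2 * inverse (real (Suc m))" if mn: "m \<le> n" for m n
  proof -
    have "inverse (real (Suc n)) \<le> inverse (real (Suc m))" using mn by (intro le_imp_inverse_le) auto
    moreover have "norm (\<iota> (\<sigma> m) - \<iota> (\<sigma> n)) \<le> norm (a - \<iota> (\<sigma> m)) + norm (a - \<iota> (\<sigma> n))"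
      using norm_triangle_ineq4[of "a - \<iota> (\<sigma> n)" "a - \<iota> (\<sigma> m)"] by simp
    ultimately show ?thesis using bdist_le_iota[OF \<sigma>(1)[of m] \<sigma>(1)[of n] g] \<sigma>(2)[of m] \<sigma>(2)[of n] by linarith
  qed
  have lim: "(\<lambda>n. C * inverse (real (Suc n))) \<longlonglongrightarrow> 0" for C
    using tendsto_mult_right_zero[OF LIMSEQ_inverse_real_of_nat] by blast
  have "\<exists>l. l \<in> fib g \<and> (\<forall>n. bdist E (\<sigma> n g) l \<le> 2 * inverse (real (Suc n)))"
    by (rule fibre_limit[of "\<lambda>n. \<sigma> n g" g "\<lambda>n. 2 * inverse (real (Suc n))", OF \<sigma>f d lim]) auto
  then obtain l where l: "l \<in> fib g" "\<And>n. bdist E (\<sigma> n g) l \<le> 2 * inverse (real (Suc n))" by blast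
  have "bdist E l (s g) \<le> norm (a - \<iota> s)" if s: "s \<in> Gamma_c G E" for s
  proof (rule tendsto_lowerbound)
    show "(\<lambda>n. 3 * inverse (real (Suc n)) + norm (a - \<iota> s)) \<longlonglongrightarrow> norm (a - \<iota> s)"
      using tendsto_add[OF lim[of 3] tendsto_const[of "norm (a - \<iota> s)"]] by simp
    have "bdist E l (s g) \<le> 3 * inverse (real (Suc n)) + norm (a - \<iota> s)" for n
    proof -
      have sf: "s g \<in> fib g" by (rule Gamma_fib[OF s g])
      have "norm (\<iota> (\<sigma> n) - \<iota> s) \<le> norm (a - \<iota> s) + norm (a - \<iota> (\<sigma> n))"
        using norm_triangle_ineq4[of "a - \<iota> s" "a - \<iota> (\<sigma> n)"] by simp
      then show ?thesis
        using bdist_triangle[OF l(1) \<sigma>f[of n] sf] bdist_sym[OF l(1) \<sigma>f[of n]] l(2)[of n] bdist_le_iota[OF \<sigma>(1)[of n] s g] \<sigma>(2)[of n]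
        by linarith
    qed
    then show "\<forall>\<^sub>F n in sequentially. bdist E l (s g) \<le> 3 * inverse (real (Suc n)) + norm (a - \<iota> s)" by simp
  qed simp
  then show ?thesis using l(1) by blast
qed

lemma
  assumes g: "g \<in> arrows G"
  shows ev_fib: "ev g a \<in> fib g"
    and ev_bound: "\<And>s. s \<in> Gamma_c G E \<Longrightarrow> bdist E (ev g a) (s g) \<le> norm (a - \<iota> s)"
proof -
  have "\<exists>!e. e \<in> fib g \<and> (\<forall>s\<in>Gamma_c G E. bdist E e (s g) \<le> norm (a - \<iota> s))"
  proof (rule ex_ex1I[OF ev_exists[OF g]])
    fix e f assume e: "e \<in> fib g \<and> (\<forall>s\<in>Gamma_c G E. bdist E e (s g) \<le> norm (a - \<iota> s))"
      and f: "f \<in> fib g \<and> (\<forall>s\<in>Gamma_c G E. bdist E f (s g) \<le> norm (a - \<iota> s))"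
    show "e = f"
    proof (rule ev_unique[OF g, of f a e 1])
      fix \<epsilon> :: real assume "\<epsilon> > 0"
      then obtain s where s: "s \<in> Gamma_c G E" "norm (a - \<iota> s) < \<epsilon>" by (rule iota_approx)
      then have "bdist E e (s g) \<le> 1 * \<epsilon>" using e by fastforce
      then show "\<exists>s\<in>Gamma_c G E. norm (a - \<iota> s) < \<epsilon> \<and> bdist E e (s g) \<le> 1 * \<epsilon>" using s by blast
    qed (use e f in auto)
  qed
  from theI'[OF this] show "ev g a \<in> fib g" "\<And>s. s \<in> Gamma_c G E \<Longrightarrow> bdist E (ev g a) (s g) \<le> norm (a - \<iota> s)"
    unfolding ev_def by auto
qed

text \<open>Values are computed by simultaneous approximation of \<open>a\<close> and of the vector by one section.\<close>

lemma ev_eqI: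
  assumes g: "g \<in> arrows G" and "f \<in> fib g"
    "\<And>\<epsilon>. 0 < \<epsilon> \<Longrightarrow> \<exists>s\<in>Gamma_c G E. norm (a - \<iota> s) < \<epsilon> \<and> bdist E f (s g) \<le> C * \<epsilon>"
  shows "ev g a = f"
  using ev_unique[OF g ev_fib[OF g] ev_bound[OF g] assms(2,3)] by simp

lemma ev_iota: "g \<in> arrows G \<Longrightarrow> s \<in> Gamma_c G E \<Longrightarrow> ev g (\<iota> s) = s g"
  using ev_bound[of g s "\<iota> s"] bdist_nonneg[OF ev_fib Gamma_fib] bdist_eq_0[OF ev_fib Gamma_fib]
  by (metis diff_self norm_zero order_antisym)

lemma ev_add:
  assumes g: "g \<in> arrows G"
  shows "ev g (a + b) = badd E (ev g a) (ev g b)"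
proof (rule ev_eqI[where C = 1, OF g badd_fib[OF ev_fib[OF g] ev_fib[OF g]]])
  fix \<epsilon> :: real assume "\<epsilon> > 0"
  then have e2: "\<epsilon> / 2 > 0" by simp
  obtain s where s: "s \<in> Gamma_c G E" "norm (a - \<iota> s) < \<epsilon> / 2" by (rule iota_approx[OF e2])
  obtain t where t: "t \<in> Gamma_c G E" "norm (b - \<iota> t) < \<epsilon> / 2" by (rule iota_approx[OF e2])
  have "norm (a + b - \<iota> (sec_add G E s t)) < \<epsilon>"
    using norm_triangle_ineq[of "a - \<iota> s" "b - \<iota> t"] s t by (simp add: iota_add algebra_simps)
  moreover have "bdist E (badd E (ev g a) (ev g b)) (sec_add G E s t g) \<le> 1 * \<epsilon>"
    using bdist_add[OF ev_fib[OF g, of a] ev_fib[OF g, of b] Gamma_fib[OF s(1) g] Gamma_fib[OF t(1) g]]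
      ev_bound[OF g s(1), of a] ev_bound[OF g t(1), of b] s t g by (simp add: sec_add_def)
  ultimately show "\<exists>s\<in>Gamma_c G E. norm (a + b - \<iota> s) < \<epsilon> \<and> bdist E (badd E (ev g a) (ev g b)) (s g) \<le> 1 * \<epsilon>"
    using Gamma_c.add[OF s(1) t(1)] by blast
qed

lemma ev_scale:
  assumes g: "g \<in> arrows G"
  shows "ev g (c *\<^sub>C a) = bscale E c (ev g a)"
proof (rule ev_eqI[where C = 1, OF g bscale_fib[OF ev_fib[OF g]]])
  fix \<epsilon> :: real assume e: "\<epsilon> > 0"
  let ?d = "\<epsilon> / (cmod c + 1)"
  have d: "?d > 0" using e by (simp add: add_nonneg_pos)
  obtain s where s: "s \<in> Gamma_c G E" "norm (a - \<iota> s) < ?d" by (rule iota_approx[OF d])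
  have le: "cmod c * x < \<epsilon>" if "x < ?d" "0 \<le> x" for x
  proof -
    have "cmod c * x \<le> (cmod c + 1) * x" using that by (simp add: distrib_right)
    also have "\<dots> < (cmod c + 1) * ?d" using that by (intro mult_strict_left_mono) (auto simp: add_nonneg_pos)
    also have "\<dots> = \<epsilon>" using add_nonneg_pos[of "cmod c" 1] by simp
    finally show ?thesis .
  qed
  have "norm (c *\<^sub>C a - \<iota> (sec_scale G E c s)) < \<epsilon>"
    using le[OF s(2)] s(1) by (simp add: iota_scale scaleC_diff norm_scaleC)
  moreover have "bdist E (bscale E c (ev g a)) (sec_scale G E c s g) \<le> 1 * \<epsilon>"
    using bdist_scale[OF ev_fib[OF g, of a] Gamma_fib[OF s(1) g], of c] ev_bound[OF g s(1), of a] g le[OF s(2)]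
      mult_left_mono[OF ev_bound[OF g s(1), of a], of "cmod c"] by (simp add: sec_scale_def)
  ultimately show "\<exists>s\<in>Gamma_c G E. norm (c *\<^sub>C a - \<iota> s) < \<epsilon> \<and> bdist E (bscale E c (ev g a)) (s g) \<le> 1 * \<epsilon>"
    using Gamma_c.scale[OF s(1)] by blast
qed

lemma ev_zero: "g \<in> arrows G \<Longrightarrow> ev g 0 = bzero E g"
  using ev_iota[OF _ Gamma_c.zero] by (simp add: iota_zero sec_zero_apply)

lemma ev_norm:
  assumes g: "g \<in> arrows G"
  shows "bnorm E (ev g a) \<le> norm a"
  using ev_bound[OF g Gamma_c.zero, of a] bdist_bzero[OF ev_fib[OF g, of a]] g
  by (simp add: iota_zero sec_zero_apply)

lemma ev_diff:
  assumes g: "g \<in> arrows G"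
  shows "bdist E (ev g a) (ev g b) = bnorm E (ev g (a - b))"
  using ev_add[OF g, of a "- b"] ev_scale[OF g, of "-1" b] by (simp add: bdist_def)

lemma ev_lipschitz:
  assumes g: "g \<in> arrows G"
  shows "bdist E (ev g a) (ev g b) \<le> norm (a - b)"
  using ev_norm[OF g, of "a - b"] by (simp add: ev_diff[OF g])

text \<open>A continuous extension from the dense subspace of sections is unique, and \<open>ev g\<close> is one.\<close>

lemma eval_at_eq_ev:
  assumes g: "g \<in> arrows G"
  shows "eval_at G E \<iota> g = ev g"
proof -
  have x: "g \<in> topspace (gtop G)" using g by (simp add: arrows_def)
  interpret F: complex_banach_space "fibre E g" "bnorm E" by (rule fibre_banach[OF x])
  interpret M: Metric_space "carrier (fibre E g)" "norm_dist (fibre E g) (bnorm E)"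
    by (rule F.Metric_space_norm_dist)
  have nd: "norm_dist (fibre E g) (bnorm E) e f = bdist E e f" if "e \<in> fib g" "f \<in> fib g" for e f
    by (rule norm_dist_bdist[OF that])
  have nt: "norm_topology (fibre E g) (bnorm E) = M.mtopology" by (simp add: norm_topology_def)
  let ?P = "\<lambda>T. (\<forall>a. T a \<in> carrier (fibre E g)) \<and> (\<forall>a b. T (a + b) = badd E (T a) (T b)) \<and>
     (\<forall>c a. T (c *\<^sub>C a) = bscale E c (T a)) \<and>
     continuous_map euclidean (norm_topology (fibre E g) (bnorm E)) T \<and>
     (\<forall>s\<in>Gamma_c G E. T (\<iota> s) = s g)"
  have "?P (ev g)"
  proof (intro conjI allI ballI)
    show "continuous_map euclidean (norm_topology (fibre E g) (bnorm E)) (ev g)"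
      unfolding nt continuous_map_def
    proof (intro conjI allI impI)
      show "ev g \<in> topspace euclidean \<rightarrow> topspace M.mtopology" using ev_fib[OF g] by auto
      fix U assume U: "openin M.mtopology U"
      have "open {a. ev g a \<in> U}"
        unfolding open_dist
      proof (intro ballI)
        fix a assume "a \<in> {a. ev g a \<in> U}"
        then obtain r where r: "r > 0" "M.mball (ev g a) r \<subseteq> U" using U unfolding M.openin_mtopology by blast
        have "ev g b \<in> U" if "dist b a < r" for b
          using ev_lipschitz[OF g, of a b] that r ev_fib[OF g, of a] ev_fib[OF g, of b] nd[OF ev_fib[OF g] ev_fib[OF g], of a b]
          by (intro r(2)[THEN subsetD]) (auto simp: M.in_mball dist_norm norm_minus_commute)
        then show "\<exists>e>0. \<forall>y. dist y a < e \<longrightarrow> y \<in> {a. ev g a \<in> U}" using r(1) by blast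
      qed
      then show "openin euclidean {a \<in> topspace euclidean. ev g a \<in> U}" by simp
    qed
  qed (use ev_fib[OF g] ev_add[OF g] ev_scale[OF g] ev_iota[OF g] in auto)
  moreover have "T = ev g" if T: "?P T" for T
  proof
    fix a
    have Tf: "T b \<in> fib g" for b using T by simp
    show "T a = ev g a"
    proof (rule ev_eqI[where C = 1, OF g Tf, symmetric])
      fix \<epsilon> :: real assume e: "\<epsilon> > 0"
      have "openin M.mtopology (M.mball (T a) \<epsilon>)" by simp
      then have "open {b. T b \<in> M.mball (T a) \<epsilon>}"
        using T openin_continuous_map_preimage[of euclidean "M.mtopology" T "M.mball (T a) \<epsilon>"] unfolding nt
        by (simp only: topspace_euclidean UNIV_I simp_thms open_openin)
      moreover have "a \<in> {b. T b \<in> M.mball (T a) \<epsilon>}" using Tf[of a] e by simp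
      ultimately obtain d where d: "d > 0" "\<And>b. dist b a < d \<Longrightarrow> T b \<in> M.mball (T a) \<epsilon>"
        unfolding open_dist by blast
      have "min d \<epsilon> > 0" using d e by simp
      then obtain s where s: "s \<in> Gamma_c G E" "norm (a - \<iota> s) < min d \<epsilon>" by (rule iota_approx)
      then have "T (\<iota> s) \<in> M.mball (T a) \<epsilon>" by (intro d) (simp add: dist_norm norm_minus_commute)
      then have "bdist E (T a) (s g) < \<epsilon>" using T s nd[OF Tf Tf, of a "\<iota> s"] by auto
      then show "\<exists>s\<in>Gamma_c G E. norm (a - \<iota> s) < \<epsilon> \<and> bdist E (T a) (s g) \<le> 1 * \<epsilon>" using s by auto
    qed
  qed
  ultimately show ?thesis unfolding eval_at_def by (intro the_equality) blast+
qed

end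


section \<open>The inverse image map\<close>

context compatible_completion
begin

abbreviation pstar :: "'g set \<Rightarrow> 'a set" where
  "pstar \<equiv> assoc_map G E \<iota>"

lemma Cc_Gamma: "W \<in> bisections G \<Longrightarrow> s \<in> Cc G E W \<Longrightarrow> s \<in> Gamma_c G E"
  by (rule Gamma_c.base)

lemma pstar_closed: "closed (pstar V)" and pstar_subspace: "cvec.subspace (pstar V)"
  unfolding assoc_map_def by (rule closed_cspan_closed closed_cspan_subspace)+

lemma pstar_base:
  assumes "U \<in> bisections G" "U \<subseteq> V" "s \<in> Cc G E U"
  shows "\<iota> s \<in> pstar V"
  unfolding assoc_map_def by (rule closed_cspan_superset[THEN subsetD]) (use assms in blast)

lemma pstar_minimal:
  assumes "closed Z" "cvec.subspace Z" "\<And>U s. U \<in> bisections G \<Longrightarrow> U \<subseteq> V \<Longrightarrow> s \<in> Cc G E U \<Longrightarrow> \<iota> s \<in> Z"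
  shows "pstar V \<subseteq> Z"
  unfolding assoc_map_def by (rule closed_cspan_minimal[OF assms(1,2)]) (use assms(3) in blast)

lemma pstar_mono: "U \<subseteq> V \<Longrightarrow> pstar U \<subseteq> pstar V"
  by (rule pstar_minimal[OF pstar_closed pstar_subspace]) (blast intro: pstar_base)

text \<open>Sections over smaller bisections extend by zero to \<open>W\<close>, so that the sections over \<open>W\<close> by
  themselves are already dense.\<close>

lemma pstar_approx:
  assumes W: "W \<in> bisections G" and a: "a \<in> pstar W" and \<epsilon>: "0 < \<epsilon>"
  obtains s where "s \<in> Cc G E W" "norm (a - \<iota> s) < \<epsilon>"
proof -
  have o: "openin (gtop G) W" by (rule bisection_open[OF W])
  let ?S = "\<Union>{\<iota> ` Cc G E U | U. U \<in> bisections G \<and> U \<subseteq> W}"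
  have sub: "cvec.subspace (\<iota> ` Cc G E W)"
  proof (rule cvec.subspaceI)
    show "0 \<in> \<iota> ` Cc G E W" using iota_zero Cc_sec_zero[OF o] by (metis image_eqI)
    fix x y c assume "x \<in> \<iota> ` Cc G E W"
    then obtain s where s: "s \<in> Cc G E W" "x = \<iota> s" by blast
    show "c *\<^sub>C x \<in> \<iota> ` Cc G E W" using iota_scale[OF Cc_Gamma[OF W s(1)]] Cc_scale[OF o s(1)] s(2) by (metis image_eqI)
    assume "y \<in> \<iota> ` Cc G E W"
    then obtain t where t: "t \<in> Cc G E W" "y = \<iota> t" by blast
    show "x + y \<in> \<iota> ` Cc G E W" using iota_add[OF Cc_Gamma[OF W s(1)] Cc_Gamma[OF W t(1)]] Cc_add[OF o s(1) t(1)] s(2) t(2)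
      by (metis image_eqI)
  qed
  have "?S \<subseteq> \<iota> ` Cc G E W" using Cc_mono[OF W bisection_open] by blast
  then have "cvec.span ?S \<subseteq> \<iota> ` Cc G E W" using sub by (rule cvec.span_minimal)
  moreover have "a \<in> closure (cvec.span ?S)" using a by (simp add: assoc_map_def closed_cspan_def)
  ultimately have "a \<in> closure (\<iota> ` Cc G E W)" using closure_mono by blast
  then obtain x where "x \<in> \<iota> ` Cc G E W" "dist x a < \<epsilon>" using \<epsilon> unfolding closure_approachable by blast
  then show thesis using that by (auto simp: dist_norm norm_minus_commute)
qed

lemma ev_kernel:
  assumes g: "g \<in> arrows G"
  shows "closed {a. ev g a = bzero E g}" "cvec.subspace {a. ev g a = bzero E g}"
proof -
  show "closed {a. ev g a = bzero E g}"
    unfolding closed_sequential_limits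
  proof (intro allI impI; elim conjE)
    fix x l assume x: "\<forall>n. x n \<in> {a. ev g a = bzero E g}" "x \<longlonglongrightarrow> l"
    have "bnorm E (ev g l) \<le> norm (l - x n)" for n
      using ev_lipschitz[OF g, of l "x n"] x(1) bdist_bzero[OF ev_fib[OF g]] by simp
    moreover have "(\<lambda>n. norm (l - x n)) \<longlonglongrightarrow> norm (l - l)" by (intro tendsto_intros x(2))
    ultimately have "bnorm E (ev g l) \<le> 0" using LIMSEQ_le_const[of "\<lambda>n. norm (l - x n)" 0] by simp
    then show "l \<in> {a. ev g a = bzero E g}" using bnorm_nonneg[OF ev_fib[OF g]] bnorm_eq_0[OF ev_fib[OF g]] order_antisym by blast
  qed
  show "cvec.subspace {a. ev g a = bzero E g}"
    by (rule cvec.subspaceI)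
      (use ev_zero[OF g] ev_add[OF g] ev_scale[OF g] badd_bzero_left[OF bzero_arrows[OF g]] g in \<open>auto simp: arrows_def\<close>)
qed

lemma pstar_vanish:
  assumes a: "a \<in> pstar V" and g: "g \<in> arrows G" "g \<notin> V"
  shows "ev g a = bzero E g"
proof -
  have "pstar V \<subseteq> {a. ev g a = bzero E g}"
  proof (rule pstar_minimal[OF ev_kernel[OF g(1)]])
    fix U s assume U: "U \<in> bisections G" "U \<subseteq> V" "s \<in> Cc G E U"
    have "s g = bzero E g" by (rule Cc_zero_off[OF U(3) g(1)]) (use U g in auto)
    then show "\<iota> s \<in> {a. ev g a = bzero E g}" using ev_iota[OF g(1) Cc_Gamma[OF U(1,3)]] by simp
  qed
  then show ?thesis using a by blast
qed

text \<open>A uniform limit of continuous sections is continuous.\<close>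

lemma ev_nearly_continuous:
  assumes W: "W \<in> bisections G" and a: "a \<in> pstar W" and x: "x \<in> W"
  shows "nearly_continuous_at 0 (\<lambda>g. ev g a) x"
proof (rule nearly_continuous_at_limit)
  fix \<epsilon> :: real assume "\<epsilon> > 0"
  then obtain s where s: "s \<in> Cc G E W" "norm (a - \<iota> s) < \<epsilon> / 2" using pstar_approx[OF W a, of "\<epsilon> / 2"] by auto
  have o: "openin (gtop G) W" and WA: "W \<subseteq> arrows G" using bisection_open bisection_arrows W by auto
  have "nearly_continuous_at (0 + 2 * (\<epsilon> / 2)) (\<lambda>g. ev g a) x"
  proof (rule nearly_continuous_at_perturb[OF o x, of _ s])
    fix y assume "y \<in> W"
    then have y: "y \<in> arrows G" using WA by auto
    show "ev y a \<in> fib y" "s y \<in> fib y" using ev_fib[OF y] Cc_fib[OF s(1) y] by auto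
    show "bdist E (ev y a) (s y) \<le> \<epsilon> / 2" using ev_bound[OF y Cc_Gamma[OF W s(1)], of a] s(2) by linarith
  qed (rule Cc_nearly_continuous[OF s(1) o x])
  then show "nearly_continuous_at \<epsilon> (\<lambda>g. ev g a) x" by simp
qed

lemma nonvanishing_open:
  assumes W: "W \<in> bisections G" and a: "a \<in> pstar W"
  shows "openin (gtop G) {g \<in> arrows G. ev g a \<noteq> bzero E g}" "{g \<in> arrows G. ev g a \<noteq> bzero E g} \<subseteq> W"
proof -
  have WA: "W \<subseteq> arrows G" by (rule bisection_arrows[OF W])
  show s: "{g \<in> arrows G. ev g a \<noteq> bzero E g} \<subseteq> W" using pstar_vanish[OF a] by blast
  have "openin (gtop G) {g \<in> W. ev g a \<noteq> bzero E g}"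
    by (rule nonzero_open[OF W _ ev_nearly_continuous[OF W a]]) (use ev_fib WA in blast)
  moreover have "{g \<in> W. ev g a \<noteq> bzero E g} = {g \<in> arrows G. ev g a \<noteq> bzero E g}" using s WA by blast
  ultimately show "openin (gtop G) {g \<in> arrows G. ev g a \<noteq> bzero E g}" by simp
qed

lemma open_support_ev:
  "open_support G E \<iota> a = gtop G interior_of {g \<in> arrows G. ev g a \<noteq> bzero E g}"
  unfolding open_support_def
  by (rule arg_cong[where f = "\<lambda>S. gtop G interior_of S"]) (auto simp: eval_at_eq_ev)

lemma open_support_open: "openin (gtop G) (open_support G E \<iota> a)"
  unfolding open_support_def by (rule openin_interior_of)

lemma open_support_nonzero: "g \<in> open_support G E \<iota> a \<Longrightarrow> g \<in> arrows G \<and> ev g a \<noteq> bzero E g"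
  unfolding open_support_ev using interior_of_subset by fastforce

lemma open_support_bisection:
  assumes "W \<in> bisections G" "a \<in> pstar W"
  shows "open_support G E \<iota> a = {g \<in> arrows G. ev g a \<noteq> bzero E g}"
  unfolding open_support_ev by (rule interior_of_openin[OF nonvanishing_open(1)[OF assms]])

lemma open_support_pstar:
  assumes "a \<in> pstar V"
  shows "open_support G E \<iota> a \<subseteq> V"
  using open_support_nonzero pstar_vanish[OF assms] by blast

text \<open>For sections this is the computation of the convolution over bisections, and both sides
  depend continuously on \<open>a\<close> and \<open>b\<close>.\<close>

lemma ev_mult:
  assumes U: "U \<in> bisections G" and V: "V \<in> bisections G" and a: "a \<in> pstar U" and b: "b \<in> pstar V"
    and gh: "g \<in> U" "h \<in> V" "(g, h) \<in> composable G"
  shows "ev (g \<cdot>\<^bsub>G\<^esub> h) (a * b) = bmul E (ev g a) (ev h b)"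
proof -
  have A: "g \<in> arrows G" "h \<in> arrows G" "g \<cdot>\<^bsub>G\<^esub> h \<in> arrows G" using gh(3) mul_closed by (auto simp: composable_iff)
  have ef: "ev g a \<in> fib g" "ev h b \<in> fib h" using ev_fib A by auto
  show ?thesis
  proof (rule ev_eqI[where C = 1, OF A(3) bmul_fib[OF ef gh(3)]])
    fix \<epsilon> :: real assume e: "\<epsilon> > 0"
    define R where "R = norm a + norm b + 2"
    have R: "R > 0" by (simp add: R_def add_nonneg_pos)
    define \<delta> where "\<delta> = min 1 (\<epsilon> / R)"
    have d: "\<delta> > 0" "\<delta> \<le> 1" using e R by (auto simp: \<delta>_def)
    have dR: "\<delta> * R \<le> \<epsilon>" using R by (simp add: \<delta>_def min_def field_simps)
    obtain s where s: "s \<in> Cc G E U" "norm (a - \<iota> s) < \<delta>" by (rule pstar_approx[OF U a d(1)])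
    obtain t where t: "t \<in> Cc G E V" "norm (b - \<iota> t) < \<delta>" by (rule pstar_approx[OF V b d(1)])
    have sG: "s \<in> Gamma_c G E" and tG: "t \<in> Gamma_c G E" using Cc_Gamma U V s t by auto
    have cG: "conv G E s t \<in> Gamma_c G E" by (rule Cc_Gamma[OF bisection_gprod[OF U V] Cc_conv[OF U V s(1) t(1)]])
    have ns: "norm (\<iota> s) \<le> norm a + 1"
      using norm_triangle_ineq4[of a "a - \<iota> s"] s(2) d(2) by simp
    have lt: "\<delta> * norm b + (norm a + 1) * \<delta> < \<epsilon>"
    proof -
      have "\<delta> * norm b + (norm a + 1) * \<delta> = \<delta> * R - \<delta>" by (simp add: R_def algebra_simps)
      then show ?thesis using dR d(1) by linarith
    qed
    have "norm (a * b - \<iota> (conv G E s t)) = norm ((a - \<iota> s) * b + \<iota> s * (b - \<iota> t))"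
      using iota_conv[OF sG tG] by (simp add: algebra_simps)
    also have "\<dots> \<le> norm (a - \<iota> s) * norm b + norm (\<iota> s) * norm (b - \<iota> t)"
      by (intro order_trans[OF norm_triangle_ineq] add_mono norm_mult_ineq)
    also have "\<dots> \<le> \<delta> * norm b + (norm a + 1) * \<delta>"
      using s(2) t(2) ns d by (intro add_mono mult_mono) auto
    also note lt
    finally have 1: "norm (a * b - \<iota> (conv G E s t)) < \<epsilon>" .
    have sf: "s g \<in> fib g" "t h \<in> fib h" using Cc_fib s t A by auto
    have "bdist E (bmul E (ev g a) (ev h b)) (bmul E (s g) (t h))
        \<le> bdist E (ev g a) (s g) * bnorm E (ev h b) + bnorm E (s g) * bdist E (ev h b) (t h)"
      by (rule bmul_diff_norm[OF ef(1) sf(1) ef(2) sf(2) gh(3)])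
    also have "\<dots> \<le> \<delta> * norm b + (norm a + 1) * \<delta>"
    proof (intro add_mono mult_mono)
      show "bdist E (ev g a) (s g) \<le> \<delta>" using ev_bound[OF A(1) sG, of a] s(2) by linarith
      show "bdist E (ev h b) (t h) \<le> \<delta>" using ev_bound[OF A(2) tG, of b] t(2) by linarith
      show "bnorm E (ev h b) \<le> norm b" by (rule ev_norm[OF A(2)])
      show "bnorm E (s g) \<le> norm a + 1" using bnorm_le_N[OF sG A(1)] iota_norm[OF sG] ns by simp
      show "0 \<le> bdist E (ev h b) (t h)" by (rule bdist_nonneg[OF ef(2) sf(2)])
      show "0 \<le> bnorm E (ev h b)" by (rule bnorm_nonneg[OF ef(2)])
    qed (use d in auto)
    finally have "bdist E (bmul E (ev g a) (ev h b)) (conv G E s t (g \<cdot>\<^bsub>G\<^esub> h)) \<le> 1 * \<epsilon>"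
      using conv_at_product[OF U V s(1) t(1) gh] lt by simp
    then show "\<exists>s\<in>Gamma_c G E. norm (a * b - \<iota> s) < \<epsilon> \<and> bdist E (bmul E (ev g a) (ev h b)) (s (g \<cdot>\<^bsub>G\<^esub> h)) \<le> 1 * \<epsilon>"
      using 1 cG by blast
  qed
qed

lemma pstar_mult:
  assumes a: "a \<in> pstar U" and b: "b \<in> pstar V"
  shows "a * b \<in> pstar (gprod U V)"
proof (rule closed_cspan_products[OF pstar_closed pstar_subspace _ a[unfolded assoc_map_def] b[unfolded assoc_map_def]])
  fix x y assume "x \<in> \<Union>{\<iota> ` Cc G E U' | U'. U' \<in> bisections G \<and> U' \<subseteq> U}" "y \<in> \<Union>{\<iota> ` Cc G E V' | V'. V' \<in> bisections G \<and> V' \<subseteq> V}"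
  then obtain U' V' s t where s: "U' \<in> bisections G" "U' \<subseteq> U" "s \<in> Cc G E U'" "x = \<iota> s"
    and t: "V' \<in> bisections G" "V' \<subseteq> V" "t \<in> Cc G E V'" "y = \<iota> t" by blast
  have "\<iota> (conv G E s t) \<in> pstar (gprod U V)"
    by (rule pstar_base[OF bisection_gprod[OF s(1) t(1)] gprod_mono[OF s(2) t(2)] Cc_conv[OF s(1) t(1) s(3) t(3)]])
  then show "x * y \<in> pstar (gprod U V)" using iota_conv[OF Cc_Gamma[OF s(1,3)] Cc_Gamma[OF t(1,3)]] s t by simp
qed

lemma adj_pstar:
  assumes "openin (gtop G) V" shows "adj ` pstar V = pstar (ginv G ` V)"
proof -
  have sub: "adj ` pstar V \<subseteq> pstar (ginv G ` V)" for V
  proof -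
    have "pstar V \<subseteq> adj -` pstar (ginv G ` V)"
    proof (rule pstar_minimal)
      show "closed (adj -` pstar (ginv G ` V))" by (rule closed_vimage[OF pstar_closed continuous_adj])
      show "cvec.subspace (adj -` pstar (ginv G ` V))"
        by (rule cvec.subspaceI) (use pstar_subspace[of "ginv G ` V"] in \<open>auto simp: cvec.subspace_def adj_add adj_scaleC\<close>)
      fix U s assume U: "U \<in> bisections G" "U \<subseteq> V" "s \<in> Cc G E U"
      have "\<iota> (sec_star G E s) \<in> pstar (ginv G ` V)"
        by (rule pstar_base[OF bisection_inv[OF U(1)] _ Cc_star[OF bisection_open[OF U(1)] U(3)]]) (use U(2) in auto)
      then show "\<iota> s \<in> adj -` pstar (ginv G ` V)" using iota_star[OF Cc_Gamma[OF U(1,3)]] by simp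
    qed
    then show ?thesis by blast
  qed
  have "ginv G ` ginv G ` V = (\<lambda>x. x) ` V" unfolding image_image using inv_inv open_arrows[OF assms] by (intro image_cong) auto
  then have "adj ` pstar (ginv G ` V) \<subseteq> pstar V" using sub[of "ginv G ` V"] by simp
  then have "adj ` adj ` pstar (ginv G ` V) \<subseteq> adj ` pstar V" by blast
  then have "pstar (ginv G ` V) \<subseteq> adj ` pstar V" by (simp add: image_image adj_adj)
  then show ?thesis using sub[of V] by blast
qed

lemma Cc_cutoff:
  assumes W: "W \<in> bisections G" and V: "openin (gtop G) V" "V \<subseteq> W" and U0: "openin (gtop G) U0" "W \<subseteq> V \<union> U0"
    and \<phi>: "continuous_map (subtopology (gtop G) W) euclideanreal \<phi>" "\<And>y. 0 \<le> \<phi> y \<and> \<phi> y \<le> 1" "\<And>y. y \<in> U0 \<Longrightarrow> \<phi> y = 0"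
    and s: "s \<in> Cc G E W"
  shows "glue \<phi> s (sec_zero G E) \<in> Cc G E V"
proof -
  have oW: "openin (gtop G) W" by (rule bisection_open[OF W])
  have g: "glue \<phi> s (sec_zero G E) \<in> Cc G E W"
    by (rule Cc_glue[OF oW s Cc_sec_zero[OF oW] \<phi>(1)]) (use \<phi>(2) in auto)
  obtain K where K: "compactin (gtop G) K" "K \<subseteq> W" "\<And>g. g \<in> arrows G \<Longrightarrow> g \<notin> K \<Longrightarrow> s g = bzero E g"
    by (rule Cc_support[OF s]) auto
  show ?thesis
  proof (rule CcI[OF V(1) Cc_section[OF g]])
    show "compactin (gtop G) (K \<inter> (topspace (gtop G) - U0))"
      by (rule compact_Int_closedin[OF K(1)]) (use U0 in auto)
    show "K \<inter> (topspace (gtop G) - U0) \<subseteq> V" using K U0 by blast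
    show "nearly_continuous_at 0 (glue \<phi> s (sec_zero G E)) y" if "y \<in> V" for y
      by (rule Cc_nearly_continuous[OF g oW]) (use that V in auto)
    fix y assume y: "y \<in> arrows G" "y \<notin> K \<inter> (topspace (gtop G) - U0)"
    show "glue \<phi> s (sec_zero G E) y = bzero E y"
    proof (cases "y \<in> K")
      case False
      then show ?thesis using K(3)[OF y(1)] glue_sec_zero[OF Cc_section[OF s] y(1)] y(1) by (simp add: arrows_def)
    next
      case True
      then have "y \<in> U0" using y by (simp add: arrows_def)
      then show ?thesis using \<phi>(3) glue_sec_zero[OF Cc_section[OF s] y(1)] bscale_zero[OF Cc_fib[OF s y(1)]] by simp
    qed
  qed
qed

text \<open>On sections over one bisection, a compatible norm is the supremum norm.\<close>

lemma norm_iota_diff_le: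
  assumes W: "W \<in> bisections G" and s: "s \<in> Cc G E W" and t: "t \<in> Cc G E W"
    and e: "\<And>y. y \<in> arrows G \<Longrightarrow> bdist E (s y) (t y) \<le> \<epsilon>" and \<epsilon>: "0 \<le> \<epsilon>"
  shows "norm (\<iota> s - \<iota> t) \<le> \<epsilon>"
proof -
  have o: "openin (gtop G) W" by (rule bisection_open[OF W])
  let ?d = "sec_add G E s (sec_scale G E (-1) t)"
  have G: "s \<in> Gamma_c G E" "t \<in> Gamma_c G E" using Cc_Gamma W s t by auto
  have d: "?d \<in> Cc G E W" by (rule Cc_add[OF o s Cc_scale[OF o t]])
  have "sup_norm G E ?d \<le> ennreal \<epsilon>"
    unfolding sup_norm_def by (rule SUP_least) (use e iota_diff(3)[OF G] in \<open>simp add: ennreal_leI\<close>)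
  then have "ennreal (N ?d) \<le> ennreal \<epsilon>" using sup_norm_eq_N[OF W d] by simp
  then have "N ?d \<le> \<epsilon>" using \<epsilon> by simp
  then show ?thesis using iota_norm[OF iota_diff(1)[OF G]] iota_diff(2)[OF G] by simp
qed

text \<open>Membership of a section in \<open>Q\<close> is a local property, provided that the local approximations
  stay in \<open>Q\<close> when multiplied by functions. This proviso is part of the class \<open>M\<close> of sections that
  are patched, and it survives gluing: \<open>\<phi> (\<psi> m + (1 - \<psi>) n)\<close> is the sum of \<open>(\<phi> \<psi>) m\<close> and
  \<open>(\<phi> (1 - \<psi>)) n\<close>.\<close>

lemma local_membership:
  assumes W: "W \<in> bisections G" and s: "s \<in> Cc G E W" and Q: "closed Q" "cvec.subspace Q"
    and loc: "\<And>g \<epsilon>. g \<in> W \<Longrightarrow> 0 < \<epsilon> \<Longrightarrow> \<exists>U m. openin (gtop G) U \<and> g \<in> U \<and> m \<in> Cc G E W \<and>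
      (\<forall>y\<in>U \<inter> W. bdist E (s y) (m y) \<le> \<epsilon>) \<and>
      (\<forall>\<phi>. continuous_map (subtopology (gtop G) W) euclideanreal \<phi> \<longrightarrow> (\<forall>y. 0 \<le> \<phi> y \<and> \<phi> y \<le> 1) \<longrightarrow>
         \<iota> (glue \<phi> m (sec_zero G E)) \<in> Q)"
  shows "\<iota> s \<in> Q"
proof -
  have o: "openin (gtop G) W" and WA: "W \<subseteq> arrows G" using bisection_open bisection_arrows W by auto
  obtain K where K: "compactin (gtop G) K" "K \<subseteq> W" "\<And>g. g \<in> arrows G \<Longrightarrow> g \<notin> K \<Longrightarrow> s g = bzero E g"
    by (rule Cc_support[OF s]) auto
  let ?c = "\<lambda>\<phi>. continuous_map (subtopology (gtop G) W) euclideanreal \<phi> \<and> (\<forall>y. 0 \<le> \<phi> y \<and> \<phi> y \<le> (1::real))"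
  let ?z = "sec_zero G E"
  define M where "M = {m \<in> Cc G E W. \<forall>\<phi>. ?c \<phi> \<longrightarrow> \<iota> (glue \<phi> m ?z) \<in> Q}"
  have MC: "m \<in> Cc G E W" and MQ: "\<And>\<phi>. ?c \<phi> \<Longrightarrow> \<iota> (glue \<phi> m ?z) \<in> Q" if "m \<in> M" for m using that by (auto simp: M_def)
  have gl: "glue \<psi> m n \<in> M" if m: "m \<in> M" and n: "n \<in> M" and \<psi>: "?c \<psi>" for m n \<psi>
    unfolding M_def
  proof (intro CollectI conjI allI impI)
    show mn: "glue \<psi> m n \<in> Cc G E W" by (rule Cc_glue[OF o MC[OF m] MC[OF n]]) (use \<psi> in auto)
    fix \<phi> assume \<phi>: "?c \<phi>"
    have c1: "?c (\<lambda>y. \<phi> y * \<psi> y)" "?c (\<lambda>y. \<phi> y * (1 - \<psi> y))"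
      using \<phi> \<psi> by (auto intro!: continuous_map_real_mult continuous_map_diff mult_le_one)
    let ?m = "glue (\<lambda>y. \<phi> y * \<psi> y) m ?z" and ?n = "glue (\<lambda>y. \<phi> y * (1 - \<psi> y)) n ?z"
    have mnC: "?m \<in> Cc G E W" "?n \<in> Cc G E W" using Cc_glue[OF o _ Cc_sec_zero[OF o]] MC m n c1 by auto
    have "glue \<phi> (glue \<psi> m n) ?z = sec_add G E ?m ?n"
    proof (rule extensionalityI[of _ "arrows G"])
      fix y assume y: "y \<in> arrows G"
      have f: "m y \<in> fib y" "n y \<in> fib y" using Cc_fib MC m n y by auto
      show "glue \<phi> (glue \<psi> m n) ?z y = sec_add G E ?m ?n y"
        using glue_sec_zero[OF Cc_section[OF mn] y] glue_sec_zero[OF Cc_section[OF MC[OF m]] y] glue_sec_zero[OF Cc_section[OF MC[OF n]] y] y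
          bscale_add_right[OF bscale_fib[OF f(1)] bscale_fib[OF f(2)]] bscale_bscale[OF f(1)] bscale_bscale[OF f(2)]
        by (simp add: sec_add_def glue_def[of \<psi>] arrows_top[symmetric])
    qed (auto simp: glue_def sec_add_def arrows_top)
    then show "\<iota> (glue \<phi> (glue \<psi> m n) ?z) \<in> Q"
      using iota_add[OF Cc_Gamma[OF W mnC(1)] Cc_Gamma[OF W mnC(2)]] MQ[OF m c1(1)] MQ[OF n c1(2)] Q(2) by (simp add: cvec.subspace_add)
  qed
  have zM: "?z \<in> M" unfolding M_def
  proof (intro CollectI conjI allI impI)
    fix \<phi>
    have "glue \<phi> ?z ?z = ?z"
    proof (rule extensionalityI[of _ "arrows G"])
      fix y assume y: "y \<in> arrows G"
      then show "glue \<phi> ?z ?z y = ?z y" using glue_sec_zero[OF sec_zero_section y] by (simp add: sec_zero_apply arrows_def)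
    qed (auto simp: glue_def sec_zero_def arrows_top)
    then show "\<iota> (glue \<phi> ?z ?z) \<in> Q" using iota_zero cvec.subspace_0[OF Q(2)] by simp
  qed (rule Cc_sec_zero[OF o])
  have "\<exists>q\<in>Q. dist q (\<iota> s) < \<epsilon>" if e: "\<epsilon> > 0" for \<epsilon>
  proof -
    have e2: "\<epsilon> / 2 > 0" using e by simp
    have "\<exists>m U. m \<in> M \<and> openin (gtop G) U \<and> K \<subseteq> U \<and> U \<subseteq> W \<and> (\<forall>y\<in>U. bdist E (s y) (m y) \<le> \<epsilon> / 2)"
    proof (rule patch_local_approximations[OF o bisection_completely_regular[OF W] K(1,2), of s M "\<lambda>_. \<epsilon> / 2"])
      show "s y \<in> fib y" if "y \<in> W" for y using Cc_fib[OF s] that WA by blast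
      show "m y \<in> fib y" if "m \<in> M" "y \<in> W" for m y using Cc_fib[OF MC[OF that(1)]] that(2) WA by blast
      show "M \<noteq> {}" using zM by blast
      show "glue \<phi> m n \<in> M" if "m \<in> M" "n \<in> M" "continuous_map (subtopology (gtop G) W) euclideanreal \<phi>" "\<And>y. 0 \<le> \<phi> y \<and> \<phi> y \<le> 1" for m n \<phi>
        by (rule gl[OF that(1,2)]) (use that(3,4) in simp)
      fix x assume "x \<in> K"
      then have "x \<in> W" using K by auto
      from loc[OF this e2] obtain U m where U: "openin (gtop G) U" "x \<in> U" "m \<in> Cc G E W" "\<forall>y\<in>U \<inter> W. bdist E (s y) (m y) \<le> \<epsilon> / 2"
        "\<forall>\<phi>. continuous_map (subtopology (gtop G) W) euclideanreal \<phi> \<longrightarrow> (\<forall>y. 0 \<le> \<phi> y \<and> \<phi> y \<le> 1) \<longrightarrow> \<iota> (glue \<phi> m ?z) \<in> Q"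
        by (elim exE conjE) (rule that)
      then have "m \<in> M" by (simp add: M_def)
      then show "\<exists>U m. openin (gtop G) U \<and> x \<in> U \<and> m \<in> M \<and> (\<forall>y\<in>U \<inter> W. bdist E (s y) (m y) \<le> \<epsilon> / 2)" using U by blast
    next
      fix m U assume "m \<in> M" "openin (gtop G) U" "K \<subseteq> U" "U \<subseteq> W" "\<And>y. y \<in> U \<Longrightarrow> bdist E (s y) (m y) \<le> \<epsilon> / 2"
      then show "\<exists>m U. m \<in> M \<and> openin (gtop G) U \<and> K \<subseteq> U \<and> U \<subseteq> W \<and> (\<forall>y\<in>U. bdist E (s y) (m y) \<le> \<epsilon> / 2)"
        by (intro exI[of _ m] exI[of _ U] conjI ballI)
    qed
    then obtain m U where U: "m \<in> M" "openin (gtop G) U" "K \<subseteq> U" "U \<subseteq> W" "\<forall>y\<in>U. bdist E (s y) (m y) \<le> \<epsilon> / 2" by blast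
    obtain \<phi> V1 V0 where \<phi>: "continuous_map (subtopology (gtop G) W) euclideanreal \<phi>" "\<forall>y. 0 \<le> \<phi> y \<and> \<phi> y \<le> (1::real)"
      "openin (gtop G) V1" "K \<subseteq> V1" "V1 \<subseteq> U" "\<forall>y\<in>V1. \<phi> y = 1"
      "openin (gtop G) V0" "W \<subseteq> U \<union> V0" "V0 \<subseteq> W" "\<forall>y\<in>V0. \<phi> y = 0"
      using cutoff_function[OF o bisection_completely_regular[OF W] K(1) U(3,2,4)] by (elim exE conjE) (rule that)
    let ?m = "glue \<phi> m ?z"
    have mC: "?m \<in> Cc G E W" using Cc_glue[OF o MC[OF U(1)] Cc_sec_zero[OF o] \<phi>(1)] \<phi>(2) by blast
    have "bdist E (s y) (?m y) \<le> \<epsilon> / 2" if y: "y \<in> arrows G" for y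
    proof (cases "y \<in> W")
      case False
      then have "s y = bzero E y" "?m y = bzero E y" using Cc_zero_off[OF s y] Cc_zero_off[OF mC y] by auto
      then show ?thesis using bdist_self[OF bzero_arrows[OF y]] e by simp
    next
      case True
      have zy: "?z y \<in> fib y" using bzero_arrows[OF y] y by (simp add: sec_zero_apply)
      show ?thesis
      proof (rule bdist_glue[of s y m ?z \<phi>, OF Cc_fib[OF s y] Cc_fib[OF MC[OF U(1)] y] zy])
        show "bdist E (s y) (m y) \<le> \<epsilon> / 2" if p: "0 < \<phi> y"
        proof -
          have "y \<notin> V0" using p \<phi>(10) by auto
          then show ?thesis using U(5) \<phi>(8) True by blast
        qed
        show "bdist E (s y) (?z y) \<le> \<epsilon> / 2" if p: "\<phi> y < 1"
        proof -
          have "y \<notin> K" using p \<phi>(4,6) by auto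
          then show ?thesis using K(3)[OF y] bdist_self[OF bzero_arrows[OF y]] e y by (simp add: sec_zero_apply)
        qed
      qed (use \<phi>(2) in auto)
    qed
    then have "norm (\<iota> s - \<iota> ?m) \<le> \<epsilon> / 2" using norm_iota_diff_le[OF W s mC, of "\<epsilon> / 2"] e by simp
    moreover have "\<iota> ?m \<in> Q" using MQ[OF U(1)] \<phi>(1,2) by blast
    ultimately show ?thesis using e by (intro bexI[of _ "\<iota> ?m"]) (auto simp: dist_norm norm_minus_commute)
  qed
  then have "\<iota> s \<in> closure Q" by (simp add: closure_approachable)
  then show ?thesis using Q(1) by simp
qed

text \<open>Near an arrow of \<open>V\<close>, a section over \<open>W\<close> equals its product with a cutoff function, which is
  a section over \<open>W \<inter> V\<close>.\<close>

lemma pstar_Union: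
  assumes S: "\<And>V. V \<in> S \<Longrightarrow> openin (gtop G) V"
  shows "pstar (\<Union>S) = closed_cspan (\<Union>(pstar ` S))"
proof
  show "closed_cspan (\<Union>(pstar ` S)) \<subseteq> pstar (\<Union>S)"
    by (rule closed_cspan_minimal[OF pstar_closed pstar_subspace]) (use pstar_mono in blast)
  show "pstar (\<Union>S) \<subseteq> closed_cspan (\<Union>(pstar ` S))"
  proof (rule pstar_minimal[OF closed_cspan_closed closed_cspan_subspace])
    fix W s assume W: "W \<in> bisections G" "W \<subseteq> \<Union>S" and s: "s \<in> Cc G E W"
    have o: "openin (gtop G) W" and WA: "W \<subseteq> arrows G" using bisection_open bisection_arrows W by auto
    show "\<iota> s \<in> closed_cspan (\<Union>(pstar ` S))"
    proof (rule local_membership[OF W(1) s closed_cspan_closed closed_cspan_subspace])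
      fix g and \<epsilon> :: real assume g: "g \<in> W" and e: "\<epsilon> > 0"
      obtain V where V: "V \<in> S" "g \<in> V" using g W by blast
      let ?O = "W \<inter> V"
      have oO: "openin (gtop G) ?O" using o S[OF V(1)] by blast
      have bO: "?O \<in> bisections G" by (rule bisection_subset[OF W(1) oO]) auto
      have gK: "compactin (gtop G) {g}" "{g} \<subseteq> ?O" "?O \<subseteq> W" using g V WA by (auto simp: arrows_def)
      obtain \<phi> V1 V0 where \<phi>: "continuous_map (subtopology (gtop G) W) euclideanreal \<phi>" "\<forall>y. 0 \<le> \<phi> y \<and> \<phi> y \<le> (1::real)"
        "openin (gtop G) V1" "{g} \<subseteq> V1" "V1 \<subseteq> ?O" "\<forall>y\<in>V1. \<phi> y = 1"
        "openin (gtop G) V0" "W \<subseteq> ?O \<union> V0" "V0 \<subseteq> W" "\<forall>y\<in>V0. \<phi> y = 0"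
        using cutoff_function[OF o bisection_completely_regular[OF W(1)] gK(1,2) oO gK(3)] by (elim exE conjE) (rule that)
      let ?m = "glue \<phi> s (sec_zero G E)"
      have mO: "?m \<in> Cc G E ?O" by (rule Cc_cutoff[OF W(1) oO gK(3) \<phi>(7,8,1) _ _ s]) (use \<phi> in auto)
      have mW: "?m \<in> Cc G E W" by (rule Cc_mono[OF W(1) oO gK(3) mO])
      have "bdist E (s y) (?m y) \<le> \<epsilon>" if "y \<in> V1 \<inter> W" for y
      proof -
        have y: "y \<in> arrows G" using that WA by blast
        then have "?m y = s y" using glue_sec_zero[OF Cc_section[OF s] y] that \<phi>(6) bscale_one[OF Cc_fib[OF s y]] by simp
        then show ?thesis using bdist_self[OF Cc_fib[OF s y]] e by simp
      qed
      moreover have "\<iota> (glue \<psi> ?m (sec_zero G E)) \<in> closed_cspan (\<Union>(pstar ` S))"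
        if \<psi>: "continuous_map (subtopology (gtop G) W) euclideanreal \<psi>" "\<forall>y. 0 \<le> \<psi> y \<and> \<psi> y \<le> 1" for \<psi>
      proof -
        have "continuous_map (subtopology (gtop G) ?O) euclideanreal \<psi>"
          using continuous_map_from_subtopology_mono[OF \<psi>(1) gK(3)] .
        then have "glue \<psi> ?m (sec_zero G E) \<in> Cc G E ?O"
          using Cc_glue[OF oO mO Cc_sec_zero[OF oO]] \<psi>(2) by blast
        then have "\<iota> (glue \<psi> ?m (sec_zero G E)) \<in> pstar V" by (rule pstar_base[OF bO, rotated]) auto
        then show ?thesis using closed_cspan_superset[of "\<Union>(pstar ` S)"] V(1) by blast
      qed
      ultimately show "\<exists>U m. openin (gtop G) U \<and> g \<in> U \<and> m \<in> Cc G E W \<and> (\<forall>y\<in>U \<inter> W. bdist E (s y) (m y) \<le> \<epsilon>) \<and>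
         (\<forall>\<phi>. continuous_map (subtopology (gtop G) W) euclideanreal \<phi> \<longrightarrow> (\<forall>y. 0 \<le> \<phi> y \<and> \<phi> y \<le> 1) \<longrightarrow>
           \<iota> (glue \<phi> m (sec_zero G E)) \<in> closed_cspan (\<Union>(pstar ` S)))"
        using \<phi>(3,4) mW by (intro exI[of _ V1] exI[of _ ?m]) auto
    qed
  qed
qed

lemma sections_agree_near:
  assumes W: "W \<in> bisections G" and s: "s \<in> Cc G E W" and t: "t \<in> Cc G E W" and g: "g \<in> W" "s g = t g" and \<epsilon>: "0 < \<epsilon>"
  shows "\<exists>U. openin (gtop G) U \<and> g \<in> U \<and> (\<forall>y\<in>U \<inter> W. bdist E (s y) (t y) \<le> \<epsilon>)"
proof -
  have o: "openin (gtop G) W" and WA: "W \<subseteq> arrows G" using bisection_open bisection_arrows W by auto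
  let ?d = "sec_add G E s (sec_scale G E (-1) t)"
  have "?d \<in> Cc G E W" by (rule Cc_add[OF o s Cc_scale[OF o t]])
  then have c: "continuous_map (subtopology (gtop G) W) (btop E) ?d" by (simp add: Cc_def)
  have tW: "topspace (subtopology (gtop G) W) = W" using openin_subset[OF o] by auto
  have db: "bnorm E (?d y) = bdist E (s y) (t y)" if "y \<in> W" for y
    using iota_diff(3)[OF Cc_Gamma[OF W s] Cc_Gamma[OF W t]] that WA by blast
  let ?U = "{y \<in> W. ?d y \<in> {e \<in> topspace (btop E). bnorm E e < \<epsilon>}}"
  have "openin (subtopology (gtop G) W) ?U"
    using openin_continuous_map_preimage[OF c bnorm_upper_semicontinuous[of \<epsilon>]] unfolding tW .
  then have "openin (gtop G) ?U" using o by (simp add: openin_open_subtopology)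
  moreover have "?d g \<in> topspace (btop E)" using Cc_fib[OF \<open>?d \<in> Cc G E W\<close>] g WA by blast
  moreover have "bnorm E (?d g) = 0" using db[OF g(1)] g(2) bdist_self[OF Cc_fib[OF t]] g(1) WA by auto
  ultimately show ?thesis using g(1) \<epsilon> db by (intro exI[of _ ?U]) auto
qed

text \<open>Upper semicontinuity bounds the norm near \<open>g\<close>, and a cutoff function removes the remaining
  values.\<close>

lemma small_section:
  assumes W: "W \<in> bisections G" and g: "g \<in> W" and e: "e \<in> fib g" and R: "bnorm E e < R"
  obtains s where "s \<in> Cc G E W" "s g = e" "norm (\<iota> s) \<le> R"
proof -
  have o: "openin (gtop G) W" and WA: "W \<subseteq> arrows G" using bisection_open bisection_arrows W by auto
  have tW: "topspace (subtopology (gtop G) W) = W" using openin_subset[OF o] by auto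
  obtain s where s: "s \<in> Cc G E W" "s g = e" by (rule enough_sections[OF W g e])
  have c: "continuous_map (subtopology (gtop G) W) (btop E) s" using s by (simp add: Cc_def)
  let ?O = "{y \<in> W. s y \<in> {e \<in> topspace (btop E). bnorm E e < R}}"
  have "openin (subtopology (gtop G) W) ?O"
    using openin_continuous_map_preimage[OF c bnorm_upper_semicontinuous[of R]] unfolding tW .
  then have oO: "openin (gtop G) ?O" using o by (simp add: openin_open_subtopology)
  have gK: "compactin (gtop G) {g}" "{g} \<subseteq> ?O" "?O \<subseteq> W" using g s(2) e R WA by (auto simp: arrows_def)
  obtain \<phi> V1 V0 where \<phi>: "continuous_map (subtopology (gtop G) W) euclideanreal \<phi>" "\<forall>y. 0 \<le> \<phi> y \<and> \<phi> y \<le> (1::real)"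
    "openin (gtop G) V1" "{g} \<subseteq> V1" "V1 \<subseteq> ?O" "\<forall>y\<in>V1. \<phi> y = 1"
    "openin (gtop G) V0" "W \<subseteq> ?O \<union> V0" "V0 \<subseteq> W" "\<forall>y\<in>V0. \<phi> y = 0"
    using cutoff_function[OF o bisection_completely_regular[OF W] gK(1,2) oO gK(3)] by (elim exE conjE) (rule that)
  let ?m = "glue \<phi> s (sec_zero G E)"
  have m: "?m \<in> Cc G E W" using Cc_glue[OF o s(1) Cc_sec_zero[OF o] \<phi>(1)] \<phi>(2) by blast
  have my: "?m y = bscale E (complex_of_real (\<phi> y)) (s y)" if "y \<in> arrows G" for y
    by (rule glue_sec_zero[OF Cc_section[OF s(1)] that])
  have Rpos: "0 \<le> R" using R bnorm_nonneg[OF e] by linarith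
  have "bdist E (?m y) (sec_zero G E y) \<le> R" if y: "y \<in> arrows G" for y
  proof -
    have sf: "s y \<in> fib y" by (rule Cc_fib[OF s(1) y])
    have "bnorm E (?m y) = \<phi> y * bnorm E (s y)"
      unfolding my[OF y] using bnorm_scale[OF sf] \<phi>(2) by simp
    also have "\<dots> \<le> R"
    proof (cases "y \<in> ?O")
      case True
      then have "\<phi> y * bnorm E (s y) \<le> 1 * R" using \<phi>(2) bnorm_nonneg[OF sf] Rpos by (intro mult_mono) auto
      then show ?thesis by simp
    next
      case False
      then have "\<phi> y * bnorm E (s y) = 0"
      proof (cases "y \<in> W")
        case True
        then have "y \<in> V0" using False \<phi>(8) by blast
        then show ?thesis using \<phi>(10) by simp
      next
        case False
        then have "s y = bzero E y" by (rule Cc_zero_off[OF s(1) y])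
        then show ?thesis using bnorm_eq_0[OF sf] by simp
      qed
      then show ?thesis using Rpos by linarith
    qed
    finally show ?thesis using bdist_bzero[OF Cc_fib[OF m y]] y by (simp add: sec_zero_apply)
  qed
  then have "norm (\<iota> ?m - \<iota> (sec_zero G E)) \<le> R" by (rule norm_iota_diff_le[OF W m Cc_sec_zero[OF o] _ Rpos])
  then have "norm (\<iota> ?m) \<le> R" by (simp add: iota_zero)
  moreover have "?m g = e" using my[of g] g WA \<phi>(4,6) s(2) bscale_one[OF e] by auto
  ultimately show thesis using that m by blast
qed

lemma ev_adj:
  assumes W: "W \<in> bisections G" and a: "a \<in> pstar W" and g: "g \<in> arrows G"
  shows "ev (ginv G g) (adj a) = bstar E (ev g a)"
proof (rule ev_eqI[where C = 1, OF inv_closed[OF g] bstar_fib[OF ev_fib[OF g]]])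
  fix \<epsilon> :: real assume "\<epsilon> > 0"
  then obtain s where s: "s \<in> Cc G E W" "norm (a - \<iota> s) < \<epsilon>" by (rule pstar_approx[OF W a])
  have sG: "s \<in> Gamma_c G E" by (rule Cc_Gamma[OF W s(1)])
  have tG: "sec_star G E s \<in> Gamma_c G E"
    by (rule Cc_Gamma[OF bisection_inv[OF W] Cc_star[OF bisection_open[OF W] s(1)]])
  have n: "norm (adj a - \<iota> (sec_star G E s)) < \<epsilon>"
    using s(2) iota_star[OF sG] norm_adj[of "a - \<iota> s"] by (simp add: adj_diff)
  have f: "ev g a \<in> fib g" "s g \<in> fib g" using ev_fib[OF g] Cc_fib[OF s(1) g] by auto
  have sc: "bscale E (-1) (s g) \<in> fib g" using bscale_fib[OF f(2)] .
  have "badd E (bstar E (ev g a)) (bscale E (-1) (bstar E (s g))) = bstar E (badd E (ev g a) (bscale E (-1) (s g)))"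
    using bstar_add[of "ev g a" "bscale E (-1) (s g)"] bstar_scale[of "s g" "-1"] f sc by simp
  then have "bdist E (bstar E (ev g a)) (bstar E (s g)) = bdist E (ev g a) (s g)"
    unfolding bdist_def using bnorm_bstar[of "badd E (ev g a) (bscale E (-1) (s g))"] badd_fib[OF f(1) sc] by simp
  moreover have "sec_star G E s (ginv G g) = bstar E (s g)" using inv_closed[OF g] inv_inv[OF g] by (simp add: sec_star_def)
  ultimately have "bdist E (bstar E (ev g a)) (sec_star G E s (ginv G g)) \<le> 1 * \<epsilon>"
    using ev_bound[OF g sG, of a] s(2) by simp
  then show "\<exists>s\<in>Gamma_c G E. norm (adj a - \<iota> s) < \<epsilon> \<and> bdist E (bstar E (ev g a)) (s (ginv G g)) \<le> 1 * \<epsilon>"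
    using n tG by blast
qed

lemma pstar_units_mult: "a \<in> pstar (units G) \<Longrightarrow> b \<in> pstar (units G) \<Longrightarrow> a * b \<in> pstar (units G)"
  using pstar_mult pstar_mono[OF gprod_units] by blast

lemma pstar_units_adj: "a \<in> pstar (units G) \<Longrightarrow> adj a \<in> pstar (units G)"
proof -
  have "ginv G ` units G = (\<lambda>x. x) ` units G" by (intro image_cong) (auto simp: unit_facts)
  then show "a \<in> pstar (units G) \<Longrightarrow> adj a \<in> pstar (units G)" using adj_pstar[OF open_units] by auto
qed

lemma ev_unit_mult:
  assumes "x \<in> units G" "a \<in> pstar (units G)" "b \<in> pstar (units G)"
  shows "ev x (a * b) = bmul E (ev x a) (ev x b)"
  using ev_mult[OF units_bisection units_bisection assms(2,3,1,1) unit_facts(4)[OF assms(1)]] unit_facts(5)[OF assms(1)] by simp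

lemma real_subspace_pstar: "subspace (pstar V)"
  using pstar_subspace[of V] unfolding subspace_def cvec.subspace_def by (simp add: scaleR_scaleC)

end


section \<open>The direct image map of a localizable completion\<close>

context localizable_completion
begin

text \<open>The left adjoint \<open>p\<^sub>!\<close> of \<open>p\<^sup>*\<close>.\<close>

definition pbang where
  "pbang A = (\<Union>a\<in>A. open_support G E \<iota> a)"

lemma pbang_open: "openin (gtop G) (pbang A)"
  unfolding pbang_def using open_support_open by blast

text \<open>From left to right this is localizability.\<close>

lemma pbang_le_iff:
  assumes V: "openin (gtop G) V"
  shows "pbang A \<subseteq> V \<longleftrightarrow> A \<subseteq> pstar V"
proof
  assume "pbang A \<subseteq> V"
  then have "A \<subseteq> {a. open_support G E \<iota> a \<subseteq> V}" unfolding pbang_def by blast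
  then show "A \<subseteq> pstar V"
    unfolding localizable[OF V] gamma_map_def using closed_cspan_superset by blast
next
  assume "A \<subseteq> pstar V"
  then show "pbang A \<subseteq> V" unfolding pbang_def using open_support_pstar by blast
qed

lemma pbang_unit: "A \<subseteq> pstar (pbang A)"
  using pbang_le_iff[OF pbang_open] by blast

lemma pbang_direct_image: "direct_image Max_quantale (Omega G) pstar pbang"
  unfolding direct_image_def
proof (rule galois_connection.intro)
  let ?C = "\<lparr>orderA = Max_quantale, orderB = Omega G, lower = pbang, upper = pstar\<rparr>"
  show "connection ?C"
    by (rule connection.intro)
      (use complete_lattice.axioms(1)[OF Max_lattice] complete_lattice.axioms(1)[OF Omega_lattice]
        pbang_open pstar_closed pstar_subspace in auto)
  show "galois_connection_axioms ?C"
    by (rule galois_connection_axioms.intro) (simp add: pbang_le_iff)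
qed

lemma direct_image_unique:
  assumes d: "direct_image Max_quantale (Omega G) pstar pb" and A: "closed A" "cvec.subspace A"
  shows "pb A = pbang A"
proof -
  interpret galois_connection "\<lparr>orderA = Max_quantale, orderB = Omega G, lower = pb, upper = pstar\<rparr>"
    using d unfolding direct_image_def .
  have o: "openin (gtop G) (pb A)" using lower_closed[of A] A by simp
  have "pb A \<subseteq> V \<longleftrightarrow> pbang A \<subseteq> V" if "openin (gtop G) V" for V
    using galois_property[of A V] A that pbang_le_iff[OF that] by simp
  then show ?thesis using o pbang_open[of A] by blast
qed

section \<open>Line bundles give quantic bundles\<close>

context
  assumes line: "line_bundle G E"
begin

lemma line_generator:
  assumes "g \<in> arrows G"
  obtains u where "u \<in> fib g" "u \<noteq> bzero E g" "\<And>e. e \<in> fib g \<Longrightarrow> \<exists>c. e = bscale E c u"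
proof -
  obtain u where u: "u \<in> carrier (fibre E g)" "u \<noteq> bzero E g" "carrier (fibre E g) = range (\<lambda>c. bscale E c u)"
    using line assms unfolding line_bundle_def by blast
  have "\<exists>c. e = bscale E c u" if "e \<in> fib g" for e
  proof -
    have "e \<in> carrier (fibre E g)" using that by simp
    then show ?thesis unfolding u(3) by blast
  qed
  then show thesis using that[of u] u(1,2) by simp
qed

lemma line_multiple:
  assumes p: "p \<in> fib g" "p \<noteq> bzero E g" and q: "q \<in> fib g"
  obtains c where "q = bscale E c p"
proof -
  have g: "g \<in> arrows G" using fib_base[OF p(1)] by (simp add: arrows_def)
  obtain u where u: "u \<in> fib g" "u \<noteq> bzero E g" "\<And>e. e \<in> fib g \<Longrightarrow> \<exists>c. e = bscale E c u"
    by (rule line_generator[OF g]) auto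
  obtain c d where cd: "p = bscale E c u" "q = bscale E d u" using u(3) p(1) q by metis
  have c: "c \<noteq> 0" using cd p(2) bscale_zero[OF u(1)] by auto
  have "q = bscale E (d / c) p" using cd bscale_bscale[OF u(1), of "d / c" c] c by simp
  then show thesis by (rule that)
qed

text \<open>If \<open>e f = 0\<close>, then \<open>e\<^sup>* e\<close> and \<open>f f\<^sup>*\<close>, nonzero vectors over the unit \<open>d(g) = r(h)\<close>, have
  product zero. Being multiples of each other they have square zero, against the C*-identity for
  the self-adjoint element \<open>e\<^sup>* e\<close>.\<close>

lemma line_mul_nonzero:
  assumes e: "e \<in> fib g" "e \<noteq> bzero E g" and f: "f \<in> fib h" "f \<noteq> bzero E h" and gh: "(g, h) \<in> composable G"
  shows "bmul E e f \<noteq> bzero E (g \<cdot>\<^bsub>G\<^esub> h)"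
proof
  assume z: "bmul E e f = bzero E (g \<cdot>\<^bsub>G\<^esub> h)"
  have g: "g \<in> arrows G" and h: "h \<in> arrows G" and x: "gdom G g = grng G h" using gh by (auto simp: composable_iff)
  let ?x = "gdom G g"
  have xu: "?x \<in> units G" by (rule gdom_unit[OF g])
  note ux = unit_facts[OF xu]
  define p where "p = bmul E (bstar E e) e"
  define q where "q = bmul E f (bstar E f)"
  have pf: "p \<in> fib ?x" and qf: "q \<in> fib ?x" using bmul_bstar_fib(1)[OF e(1)] bmul_bstar_fib(2)[OF f(1)] x by (auto simp: p_def q_def)
  have p0: "p \<noteq> bzero E ?x" using bstar_mul_eq_0[OF e(1)] e(2) by (auto simp: p_def)
  have q0: "q \<noteq> bzero E ?x"
    using bstar_mul_eq_0[OF bstar_fib[OF f(1)]] f bstar_bstar[of f] bstar_zero[OF inv_closed[OF h]] inv_inv[OF h] x h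
    by (auto simp: q_def)
  have es: "bstar E e \<in> fib (ginv G g)" and fs: "bstar E f \<in> fib (ginv G h)" using bstar_fib e f by auto
  have c1: "(ginv G g, g) \<in> composable G" "(h, ginv G h) \<in> composable G" using inv_composable g h by auto
  have ghA: "g \<cdot>\<^bsub>G\<^esub> h \<in> arrows G" by (rule mul_closed[OF gh])
  have c2: "(g, h \<cdot>\<^bsub>G\<^esub> ginv G h) \<in> composable G" "(g \<cdot>\<^bsub>G\<^esub> h, ginv G h) \<in> composable G"
    using gh c1(2) mul_closed[OF c1(2)] rng_mul[OF c1(2)] dom_mul[OF gh] ghA inv_closed[OF h] by (auto simp: composable_iff)
  have efs: "bmul E e q = bzero E g"
  proof -
    have "bmul E e q = bmul E (bmul E e f) (bstar E f)"
      unfolding q_def using bmul_assoc[OF mult_pairsI[OF e(1) f(1) gh] mult_pairsI[OF f(1) fs c1(2)]] by simp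
    also have "\<dots> = bzero E (g \<cdot>\<^bsub>G\<^esub> h \<cdot>\<^bsub>G\<^esub> ginv G h)" unfolding z by (rule bmul_zero_left[OF fs c2(2)])
    also have "g \<cdot>\<^bsub>G\<^esub> h \<cdot>\<^bsub>G\<^esub> ginv G h = g" by (rule mul_inv_cancel[OF gh])
    finally show ?thesis .
  qed
  have c3: "(g, ?x) \<in> composable G" using g ux by (simp add: composable_iff)
  have pq: "bmul E p q = bzero E ?x"
  proof -
    have "bmul E p q = bmul E (bstar E e) (bmul E e q)"
      unfolding p_def by (rule bmul_assoc[OF mult_pairsI[OF es e(1) c1(1)] mult_pairsI[OF e(1) qf c3]])
    also have "\<dots> = bzero E (ginv G g \<cdot>\<^bsub>G\<^esub> g)" unfolding efs by (rule bmul_zero_right[OF es c1(1)])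
    finally show ?thesis by (simp add: gdom_def)
  qed
  obtain c where c: "p = bscale E c q" by (rule line_multiple[OF qf q0 pf])
  have "bmul E p p = bscale E c (bmul E p q)"
    using bmul_scale_right[OF mult_pairsI[OF pf qf ux(4)], of c] c by simp
  then have pp: "bmul E p p = bzero E ?x" using pq bscale_bzero[unfolded arrows_top[symmetric], OF ux(1)] by simp
  have "bstar E p = p"
    unfolding p_def using bstar_bmul[OF mult_pairsI[OF es e(1) c1(1)]] bstar_bstar[of e] e by simp
  then have "p = bzero E ?x" using bstar_mul_eq_0[OF pf] pp ux(2) by simp
  then show False using p0 by blast
qed

lemma line_abelian: "abelian_bundle G E"
  unfolding abelian_bundle_def
proof (intro ballI)
  fix x e f assume x: "x \<in> units G" and "e \<in> carrier (fibre E x)" "f \<in> carrier (fibre E x)"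
  then have ef: "e \<in> fib x" "f \<in> fib x" by auto
  note ux = unit_facts[OF x]
  obtain u where u: "u \<in> fib x" "u \<noteq> bzero E x" "\<And>e. e \<in> fib x \<Longrightarrow> \<exists>c. e = bscale E c u"
    by (rule line_generator[OF ux(1)]) auto
  obtain c d where cd: "e = bscale E c u" "f = bscale E d u" using u(3) ef by metis
  note mp = mult_pairsI[OF _ _ ux(4)]
  have "bmul E (bscale E c u) (bscale E d u) = bscale E (c * d) (bmul E u u)" for c d
    using bmul_scale_left[OF mp[OF u(1) bscale_fib[OF u(1)]], of c d] bmul_scale_right[OF mp[OF u(1) u(1)], of d]
      bscale_bscale[OF bmul_fib[OF u(1) u(1) ux(4)], of c d] by simp
  then show "bmul E e f = bmul E f e" by (simp add: cd mult.commute)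
qed

lemma line_section:
  assumes "W \<in> bisections G" "g \<in> W"
  obtains s where "s \<in> Cc G E W" "s g \<noteq> bzero E g"
proof -
  obtain u where u: "u \<in> fib g" "u \<noteq> bzero E g"
    using line_generator[of g] bisection_arrows[OF assms(1)] assms(2) by blast
  obtain s where "s \<in> Cc G E W" "s g = u" by (rule enough_sections[OF assms u(1)])
  then show thesis using that u(2) by blast
qed

text \<open>Let \<open>g\<close> be the product of \<open>h\<close> in \<open>U\<close> and \<open>k\<close> in \<open>V\<close>. Sections \<open>a\<close> and \<open>b\<close> that do not vanish
  at \<open>h\<close> and \<open>k\<close> have a convolution that does not vanish at \<open>g\<close>, so one of its multiples agrees
  with \<open>s\<close> at \<open>g\<close>, the fibre being a line. This multiple approximates \<open>s\<close> near \<open>g\<close>.\<close>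

lemma line_pstar_product:
  assumes U: "openin (gtop G) U" and V: "openin (gtop G) V"
  shows "pstar (gprod U V) \<subseteq> sprod (pstar U) (pstar V)"
proof (rule pstar_minimal[OF closed_cspan_closed closed_cspan_subspace])
  fix W s assume W: "W \<in> bisections G" "W \<subseteq> gprod U V" and s: "s \<in> Cc G E W"
  have o: "openin (gtop G) W" and WA: "W \<subseteq> arrows G" using bisection_open bisection_arrows W by auto
  have iW: "inj_on (grng G) W" using W by (simp add: bisections_def)
  have orW: "openin (gtop G) (grng G ` W)" using open_grng o by (simp add: open_map_def)
  show "\<iota> s \<in> sprod (pstar U) (pstar V)"
  proof (rule local_membership[OF W(1) s closed_cspan_closed closed_cspan_subspace])
    fix g and \<epsilon> :: real assume g: "g \<in> W" and \<epsilon>: "\<epsilon> > 0"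
    obtain h k where hk: "g = h \<cdot>\<^bsub>G\<^esub> k" "h \<in> U" "k \<in> V" "(h, k) \<in> composable G" using g W(2) unfolding gprod_def by blast
    obtain A B where AB: "openin (gtop G) A" "openin (gtop G) B" "h \<in> A" "k \<in> B" "gprod A B \<subseteq> W"
      using product_neighbourhoods[OF o hk(4)] g hk(1) by blast
    have hA: "h \<in> arrows G" "k \<in> arrows G" using hk by (auto simp: composable_iff)
    let ?D = "A \<inter> U \<inter> {u \<in> arrows G. grng G u \<in> grng G ` W}"
    have oD: "openin (gtop G) ?D" using AB(1) U open_vimage[OF continuous_grng orW] by blast
    have "grng G h = grng G g" using rng_mul[OF hk(4)] hk(1) by simp
    then have hD: "h \<in> ?D" using AB(3) hk hA g by simp
    obtain U' where U': "U' \<in> bisections G" "h \<in> U'" "U' \<subseteq> ?D" by (rule bisection_neighbourhood[OF hD oD])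
    have BV: "openin (gtop G) (B \<inter> V)" "k \<in> B \<inter> V" using AB V hk by auto
    obtain V' where V': "V' \<in> bisections G" "k \<in> V'" "V' \<subseteq> B \<inter> V" by (rule bisection_neighbourhood[OF BV(2,1)])
    let ?P = "gprod U' V'"
    have P: "?P \<in> bisections G" by (rule bisection_gprod[OF U'(1) V'(1)])
    have "?P \<subseteq> gprod A B" by (rule gprod_mono) (use U' V' in auto)
    then have PW: "?P \<subseteq> W" using AB by blast
    have oP: "openin (gtop G) ?P" by (rule bisection_open[OF P])
    have oU': "openin (gtop G) U'" by (rule bisection_open[OF U'(1)])
    obtain a where a: "a \<in> Cc G E U'" "a h \<noteq> bzero E h" by (rule line_section[OF U'(1,2)])
    obtain b where b: "b \<in> Cc G E V'" "b k \<noteq> bzero E k" by (rule line_section[OF V'(1,2)])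
    have af: "a h \<in> fib h" "b k \<in> fib k" using Cc_fib a b hA by auto
    have ab: "bmul E (a h) (b k) \<in> fib g" "bmul E (a h) (b k) \<noteq> bzero E g"
      using bmul_fib[OF af hk(4)] line_mul_nonzero[OF af(1) a(2) af(2) b(2) hk(4)] hk(1) by auto
    obtain c where c: "s g = bscale E c (bmul E (a h) (b k))"
      by (rule line_multiple[OF ab Cc_fib[OF s]]) (use g WA in auto)
    have cab: "conv G E a b \<in> Cc G E ?P" by (rule Cc_conv[OF U'(1) V'(1) a(1) b(1)])
    define m where "m = sec_scale G E c (conv G E a b)"
    have mP: "m \<in> Cc G E ?P" unfolding m_def by (rule Cc_scale[OF oP cab])
    have mW: "m \<in> Cc G E W" by (rule Cc_mono[OF W(1) oP PW mP])
    have "m g = s g" using c conv_at_product[OF U'(1) V'(1) a(1) b(1) U'(2) V'(2) hk(4)] hk(1) g WA by (auto simp: m_def sec_scale_def)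
    then obtain U1 where U1: "openin (gtop G) U1" "g \<in> U1" "\<forall>y\<in>U1 \<inter> W. bdist E (s y) (m y) \<le> \<epsilon>"
      using sections_agree_near[OF W(1) s mW g _ \<epsilon>] by auto
    have inQ: "\<iota> (glue \<phi> m (sec_zero G E)) \<in> sprod (pstar U) (pstar V)"
      if \<phi>: "continuous_map (subtopology (gtop G) W) euclideanreal \<phi>" "\<forall>y. 0 \<le> \<phi> y \<and> \<phi> y \<le> 1" for \<phi>
    proof -
      \<comment> \<open>Multiplication of the convolution by \<open>\<phi>\<close> is moved to its first factor: an arrow \<open>u\<close> of
        \<open>U'\<close> that is the left factor of \<open>w\<close> in \<open>W\<close> determines \<open>w\<close> by its range.\<close>
      define \<psi> where "\<psi> u = \<phi> (inv_into W (grng G) (grng G u))" for u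
      have c\<psi>: "continuous_map (subtopology (gtop G) U') euclideanreal \<psi>"
      proof -
        have t: "topspace (subtopology (gtop G) U') = U'" using openin_subset[OF oU'] by auto
        have "continuous_map (subtopology (gtop G) U') (subtopology (gtop G) (grng G ` W)) (grng G)"
          using continuous_grng t U'(3) by (auto simp: continuous_map_in_subtopology continuous_map_from_subtopology)
        moreover have "continuous_map (subtopology (gtop G) (grng G ` W)) (subtopology (gtop G) W) (inv_into W (grng G))"
          using open_map_section[OF open_grng iW o] inv_into_into[of _ "grng G" W] by (auto simp: continuous_map_in_subtopology)
        ultimately have "continuous_map (subtopology (gtop G) U') euclideanreal (\<phi> \<circ> (inv_into W (grng G) \<circ> grng G))"
          by (intro continuous_map_compose[OF continuous_map_compose \<phi>(1)])
        then show ?thesis by (simp add: o_def \<psi>_def[abs_def])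
      qed
      define a' where "a' = glue \<psi> a (sec_zero G E)"
      have a': "a' \<in> Cc G E U'" unfolding a'_def
        by (rule Cc_glue[OF oU' a(1) Cc_sec_zero[OF oU'] c\<psi>]) (use \<phi>(2) in \<open>auto simp: \<psi>_def\<close>)
      have ca'b: "conv G E a' b \<in> Cc G E ?P" by (rule Cc_conv[OF U'(1) V'(1) a' b(1)])
      have "glue \<phi> m (sec_zero G E) = sec_scale G E c (conv G E a' b)"
      proof (rule extensionalityI[of _ "arrows G"])
        fix y assume y: "y \<in> arrows G"
        show "glue \<phi> m (sec_zero G E) y = sec_scale G E c (conv G E a' b) y"
        proof (cases "y \<in> ?P")
          case False
          then have "m y = bzero E y" "conv G E a' b y = bzero E y" using Cc_zero_off[OF mP y] Cc_zero_off[OF ca'b y] by auto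
          then show ?thesis using glue_sec_zero[OF Cc_section[OF mP] y] y
            by (simp add: sec_scale_def bscale_bzero[unfolded arrows_top[symmetric]])
        next
          case True
          then obtain u v where uv: "u \<in> U'" "v \<in> V'" "(u, v) \<in> composable G" "y = u \<cdot>\<^bsub>G\<^esub> v" unfolding gprod_def by blast
          have A: "u \<in> arrows G" "v \<in> arrows G" using uv by (auto simp: composable_iff)
          have "inv_into W (grng G) (grng G u) = y"
            using inv_into_f_f[OF iW, of y] True PW rng_mul[OF uv(3)] uv(4) by auto
          then have \<psi>u: "\<psi> u = \<phi> y" by (simp add: \<psi>_def)
          have f: "a u \<in> fib u" "b v \<in> fib v" using Cc_fib a b A by auto
          have abf: "bmul E (a u) (b v) \<in> fib y" using bmul_fib[OF f uv(3)] uv(4) by simp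
          have "conv G E a' b y = bmul E (bscale E (complex_of_real (\<phi> y)) (a u)) (b v)"
            using conv_at_product[OF U'(1) V'(1) a' b(1) uv(1-3)] uv(4) glue_sec_zero[OF Cc_section[OF a(1)] A(1), of \<psi>] \<psi>u
            by (simp add: a'_def)
          also have "\<dots> = bscale E (complex_of_real (\<phi> y)) (bmul E (a u) (b v))"
            by (rule bmul_scale_left[OF mult_pairsI[OF f uv(3)]])
          finally have "conv G E a' b y = bscale E (complex_of_real (\<phi> y)) (bmul E (a u) (b v))" .
          moreover have "m y = bscale E c (bmul E (a u) (b v))"
            using conv_at_product[OF U'(1) V'(1) a(1) b(1) uv(1-3)] uv(4) y by (simp add: m_def sec_scale_def)
          ultimately show ?thesis
            using glue_sec_zero[OF Cc_section[OF mP] y, of \<phi>] bscale_bscale[OF abf] y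
            by (simp add: sec_scale_def mult.commute)
        qed
      qed (auto simp: glue_def sec_scale_def arrows_top)
      then have "\<iota> (glue \<phi> m (sec_zero G E)) = c *\<^sub>C (\<iota> a' * \<iota> b)"
        using iota_scale[OF Cc_Gamma[OF P ca'b], of c] iota_conv[OF Cc_Gamma[OF U'(1) a'] Cc_Gamma[OF V'(1) b(1)]] by simp
      moreover have "\<iota> a' * \<iota> b \<in> sprod (pstar U) (pstar V)"
        by (intro sprodI pstar_base[OF U'(1) _ a'] pstar_base[OF V'(1) _ b(1)]) (use U'(3) V'(3) in auto)
      ultimately show ?thesis by (simp only: cvec.subspace_scale[OF closed_cspan_subspace])
    qed
    show "\<exists>U' m. openin (gtop G) U' \<and> g \<in> U' \<and> m \<in> Cc G E W \<and> (\<forall>y\<in>U' \<inter> W. bdist E (s y) (m y) \<le> \<epsilon>) \<and>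
         (\<forall>\<phi>. continuous_map (subtopology (gtop G) W) euclideanreal \<phi> \<longrightarrow> (\<forall>y. 0 \<le> \<phi> y \<and> \<phi> y \<le> 1) \<longrightarrow>
           \<iota> (glue \<phi> m (sec_zero G E)) \<in> sprod (pstar U) (pstar V))"
      by (intro exI[of _ U1] exI[of _ m] conjI allI impI inQ U1 mW) simp_all
  qed
qed

lemma line_quantale_map: "quantale_map Max_quantale (Omega G) pstar"
proof (intro quantale_map.intro[OF Max_is_quantale Omega_quantale] quantale_map_axioms.intro)
  fix x y assume x: "x \<in> carrier (Omega G)"
  show "pstar x \<in> carrier Max_quantale" using pstar_closed pstar_subspace by simp
  show "pstar (qinv (Omega G) x) = qinv Max_quantale (pstar x)" using adj_pstar[of x] x by simp
  assume y: "y \<in> carrier (Omega G)"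
  have "sprod (pstar x) (pstar y) \<subseteq> pstar (gprod x y)" by (rule sprod_minimal[OF pstar_closed pstar_subspace pstar_mult])
  moreover have "pstar (gprod x y) \<subseteq> sprod (pstar x) (pstar y)" by (rule line_pstar_product) (use x y in simp_all)
  ultimately show "pstar (x \<odot>\<odot>\<^bsub>Omega G\<^esub> y) = pstar x \<odot>\<odot>\<^bsub>Max_quantale\<^esub> pstar y"
    unfolding Omega_qmul Max_sel by (rule subset_antisym[rotated])
next
  fix S assume S: "S \<subseteq> carrier (Omega G)"
  have "pstar ` S \<subseteq> carrier Max_quantale" using pstar_closed pstar_subspace by auto
  moreover have "pstar (\<Union>S) = closed_cspan (\<Union>(pstar ` S))" by (rule pstar_Union) (use S in auto)
  ultimately show "pstar (\<Squnion>\<^bsub>Omega G\<^esub>S) = \<Squnion>\<^bsub>Max_quantale\<^esub>(pstar ` S)"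
    unfolding Omega_Sup[OF S] by (simp only: Max_Sup)
qed

text \<open>A section over a subset of \<open>V\<close> that does not vanish at \<open>g\<close> belongs to \<open>p\<^sup>*(V')\<close> only if \<open>g\<close>
  belongs to \<open>V'\<close>.\<close>

lemma line_surjection: "surjection Max_quantale (Omega G) pstar"
proof -
  have "V \<subseteq> V'" if V: "openin (gtop G) V" and le: "pstar V \<subseteq> pstar V'" for V V'
  proof
    fix g assume g: "g \<in> V"
    obtain U where U: "U \<in> bisections G" "g \<in> U" "U \<subseteq> V" by (rule bisection_neighbourhood[OF g V])
    obtain s where s: "s \<in> Cc G E U" "s g \<noteq> bzero E g" by (rule line_section[OF U(1,2)])
    have gA: "g \<in> arrows G" using bisection_arrows[OF U(1)] U(2) by auto
    have "\<iota> s \<in> pstar V'" using pstar_base[OF U(1,3) s(1)] le by blast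
    then show "g \<in> V'" using pstar_vanish[of "\<iota> s" V' g] gA ev_iota[OF gA Cc_Gamma[OF U(1) s(1)]] s(2) by auto
  qed
  then show ?thesis unfolding surjection_def inj_on_def by (simp add: set_eq_subset)
qed

text \<open>The inclusion of the left side in the right side follows from adjointness. Conversely,
  factors that do not vanish at \<open>s\<close>, \<open>u\<close> and \<open>t\<close> have a product that does not vanish at \<open>s u t\<close>;
  it lives over a bisection, so that \<open>s u t\<close> belongs to its open support.\<close>

lemma line_pbang_product:
  assumes U: "openin (gtop G) U" and S: "pbang A \<in> bisections G" and T: "pbang B \<in> bisections G"
  shows "pbang (sprod (sprod A (pstar U)) B) = gprod (gprod (pbang A) U) (pbang B)"
proof
  let ?S = "pbang A" and ?T = "pbang B"
  have oS: "openin (gtop G) ?S" and oT: "openin (gtop G) ?T" by (rule pbang_open)+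
  have "sprod A (pstar U) \<subseteq> pstar (gprod ?S U)"
    by (rule sprod_minimal[OF pstar_closed pstar_subspace pstar_mult]) (use pbang_unit in blast)+
  then have "sprod (sprod A (pstar U)) B \<subseteq> pstar (gprod (gprod ?S U) ?T)"
    by (intro sprod_minimal[OF pstar_closed pstar_subspace pstar_mult]) (use pbang_unit in blast)+
  then show "pbang (sprod (sprod A (pstar U)) B) \<subseteq> gprod (gprod ?S U) ?T"
    using pbang_le_iff[OF open_gprod[OF open_gprod[OF oS U] oT]] by blast
  show "gprod (gprod ?S U) ?T \<subseteq> pbang (sprod (sprod A (pstar U)) B)"
  proof
    fix p assume "p \<in> gprod (gprod ?S U) ?T"
    then obtain s u t where p: "p = (s \<cdot>\<^bsub>G\<^esub> u) \<cdot>\<^bsub>G\<^esub> t" "s \<in> ?S" "u \<in> U" "t \<in> ?T" "(s, u) \<in> composable G" "(s \<cdot>\<^bsub>G\<^esub> u, t) \<in> composable G"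
      unfolding gprod_def by blast
    obtain a where a: "a \<in> A" "s \<in> open_support G E \<iota> a" using p(2) unfolding pbang_def by blast
    obtain b where b: "b \<in> B" "t \<in> open_support G E \<iota> b" using p(4) unfolding pbang_def by blast
    have a0: "s \<in> arrows G" "ev s a \<noteq> bzero E s" and b0: "t \<in> arrows G" "ev t b \<noteq> bzero E t"
      using open_support_nonzero a b by auto
    obtain U' where U': "U' \<in> bisections G" "u \<in> U'" "U' \<subseteq> U" by (rule bisection_neighbourhood[OF p(3) U])
    obtain z where z: "z \<in> Cc G E U'" "z u \<noteq> bzero E u" by (rule line_section[OF U'(1,2)])
    have uA: "u \<in> arrows G" using bisection_arrows[OF U'(1)] U'(2) by auto
    have zp: "\<iota> z \<in> pstar U'" by (rule pstar_base[OF U'(1) subset_refl z(1)])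
    have ez: "ev u (\<iota> z) = z u" by (rule ev_iota[OF uA Cc_Gamma[OF U'(1) z(1)]])
    have aS: "a \<in> pstar ?S" and bT: "b \<in> pstar ?T" using pbang_unit a b by blast+
    let ?P = "gprod ?S U'"
    have P: "?P \<in> bisections G" by (rule bisection_gprod[OF S U'(1)])
    have su: "s \<cdot>\<^bsub>G\<^esub> u \<in> ?P" unfolding gprod_def using p U' by blast
    have e1: "ev (s \<cdot>\<^bsub>G\<^esub> u) (a * \<iota> z) = bmul E (ev s a) (z u)"
      using ev_mult[OF S U'(1) aS zp p(2) U'(2) p(5)] ez by simp
    have n1: "ev (s \<cdot>\<^bsub>G\<^esub> u) (a * \<iota> z) \<noteq> bzero E (s \<cdot>\<^bsub>G\<^esub> u)"
      unfolding e1 by (rule line_mul_nonzero[OF ev_fib[OF a0(1)] a0(2) Cc_fib[OF z(1) uA] z(2) p(5)])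
    have azP: "a * \<iota> z \<in> pstar ?P" by (rule pstar_mult[OF aS zp])
    have e2: "ev p (a * \<iota> z * b) = bmul E (ev (s \<cdot>\<^bsub>G\<^esub> u) (a * \<iota> z)) (ev t b)"
      unfolding p(1) by (rule ev_mult[OF P T azP bT su p(4) p(6)])
    have n2: "ev p (a * \<iota> z * b) \<noteq> bzero E p"
      unfolding e2 using line_mul_nonzero[OF ev_fib[OF mul_closed[OF p(5)]] n1 ev_fib[OF b0(1)] b0(2) p(6)] p(1) by simp
    have "p \<in> open_support G E \<iota> (a * \<iota> z * b)"
      using open_support_bisection[OF bisection_gprod[OF P T] pstar_mult[OF azP bT]] n2 mul_closed[OF p(6)] p(1) by simp
    moreover have "a * \<iota> z * b \<in> sprod (sprod A (pstar U)) B"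
      by (intro sprodI) (use a b zp pstar_mono[OF U'(3)] in auto)
    ultimately show "p \<in> pbang (sprod (sprod A (pstar U)) B)" unfolding pbang_def by blast
  qed
qed

lemma line_quantic_bundle: "quantic_bundle G Max_quantale pstar"
  unfolding quantic_bundle_def
proof (intro conjI exI[of _ pbang] ballI impI line_quantale_map line_surjection pbang_direct_image)
  fix U A B
  assume "U \<in> carrier (Omega G)" "pbang A \<in> bisections G" "pbang B \<in> bisections G"
  then show "pbang (A \<odot>\<odot>\<^bsub>Max_quantale\<^esub> pstar U \<odot>\<odot>\<^bsub>Max_quantale\<^esub> B) = pbang A \<odot>\<odot>\<^bsub>Omega G\<^esub> U \<odot>\<odot>\<^bsub>Omega G\<^esub> pbang B"
    using line_pbang_product[of U A B] by (simp add: Omega_qmul)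
qed

end
end


section \<open>Absolute values of self-adjoint operators\<close>

text \<open>The case \<open>t = 1\<close> of the iteration \<open>q \<mapsto> (t + q\<^sup>2) / 2\<close>, whose limit is \<open>1 - sqrt (1 - t)\<close>. It
  bounds the iteration for every contraction, which involves nothing but sums and products.\<close>

primrec sqrt_majorant :: "nat \<Rightarrow> real" where
  "sqrt_majorant 0 = 0"
| "sqrt_majorant (Suc n) = (1 + (sqrt_majorant n)\<^sup>2) / 2"

lemma sqrt_majorant_bounds: "0 \<le> sqrt_majorant n \<and> sqrt_majorant n \<le> 1"
proof (induction n)
  case (Suc n)
  then have "(sqrt_majorant n)\<^sup>2 \<le> 1" by (simp add: power_le_one)
  then show ?case by simp
qed simp

lemma sqrt_majorant_Suc: "sqrt_majorant n \<le> sqrt_majorant (Suc n)"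
  using zero_le_power2[of "sqrt_majorant n - 1"] by (simp add: power2_eq_square algebra_simps)

lemma sqrt_majorant_mono: "m \<le> n \<Longrightarrow> sqrt_majorant m \<le> sqrt_majorant n"
  using lift_Suc_mono_le[of sqrt_majorant] sqrt_majorant_Suc by blast

lemma sqrt_majorant_Cauchy: "Cauchy sqrt_majorant"
proof -
  have "incseq sqrt_majorant" using sqrt_majorant_mono by (simp add: incseq_def)
  then have "convergent sqrt_majorant"
    by (intro Bseq_monoseq_convergent BseqI'[of _ 1] incseq_imp_monoseq) (use sqrt_majorant_bounds in auto)
  then show ?thesis by (rule convergent_Cauchy)
qed

type_synonym 'a operator = "'a \<Rightarrow>\<^sub>L 'a"

abbreviation op_mult :: "'a::real_normed_vector operator \<Rightarrow> 'a operator \<Rightarrow> 'a operator" (infixl "\<star>" 70) where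
  "S \<star> T \<equiv> blinfun_compose S T"

primrec sqrt_iterate :: "'a::banach operator \<Rightarrow> nat \<Rightarrow> 'a operator" where
  "sqrt_iterate T 0 = 0"
| "sqrt_iterate T (Suc n) = (1/2) *\<^sub>R (T + sqrt_iterate T n \<star> sqrt_iterate T n)"

text \<open>The operator \<open>1 - sqrt (1 - T)\<close>. Its iterates are polynomials in \<open>T\<close> without constant term,
  so that commutation relations, invariant subspaces and self-adjointness pass from \<open>T\<close> to the
  limit.\<close>

definition sqrt_defect :: "'a::banach operator \<Rightarrow> 'a operator" where
  "sqrt_defect T = lim (sqrt_iterate T)"

lemma compose_diff_squares:
  fixes S T :: "'a::banach operator"
  shows "S \<star> S - T \<star> T = S \<star> (S - T) + (S - T) \<star> T"
  by (rule blinfun_eqI) (simp add: blinfun.bilinear_simps)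

lemma norm_square_le_1: "norm (S \<star> S) \<le> 1" if "norm S \<le> 1" for S :: "'a::banach operator"
  using norm_blinfun_compose[of S S] mult_le_one[OF that norm_ge_zero that] by linarith

lemma sqrt_iterate_norm:
  assumes T: "norm (T :: 'a::banach operator) \<le> 1"
  shows "norm (sqrt_iterate T n) \<le> sqrt_majorant n"
proof (induction n)
  case (Suc n)
  have "norm (sqrt_iterate T n \<star> sqrt_iterate T n) \<le> (sqrt_majorant n)\<^sup>2"
    using norm_blinfun_compose[of "sqrt_iterate T n" "sqrt_iterate T n"] Suc
      mult_mono[OF Suc Suc] sqrt_majorant_bounds[of n] by (simp add: power2_eq_square)
  then have "norm (T + sqrt_iterate T n \<star> sqrt_iterate T n) \<le> 1 + (sqrt_majorant n)\<^sup>2"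
    using norm_triangle_ineq[of T "sqrt_iterate T n \<star> sqrt_iterate T n"] T by linarith
  then show ?case by simp
qed simp

text \<open>One step of the iteration preserves the domination of differences, because
  \<open>A\<^sup>2 - B\<^sup>2 = A (A - B) + (A - B) B\<close>.\<close>

lemma half_square_diff:
  fixes A B T :: "'a::banach operator"
  assumes "norm A \<le> \<alpha>" "norm B \<le> \<beta>" "norm (A - B) \<le> \<alpha> - \<beta>"
  shows "norm ((1/2) *\<^sub>R (T + A \<star> A) - (1/2) *\<^sub>R (T + B \<star> B)) \<le> (1 + \<alpha>\<^sup>2) / 2 - (1 + \<beta>\<^sup>2) / 2"
proof -
  have pos: "0 \<le> norm A" "0 \<le> norm B" "0 \<le> norm (A - B)" by auto
  have "(1/2) *\<^sub>R (T + A \<star> A) - (1/2) *\<^sub>R (T + B \<star> B) = (1/2) *\<^sub>R (A \<star> A - B \<star> B)"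
    by (simp add: scaleR_add_right scaleR_diff_right)
  also have "norm \<dots> \<le> (1/2) * (norm A * norm (A - B) + norm (A - B) * norm B)"
    unfolding compose_diff_squares
    using norm_triangle_ineq[of "A \<star> (A - B)" "(A - B) \<star> B"] norm_blinfun_compose[of A "A - B"] norm_blinfun_compose[of "A - B" B]
    by simp
  also have "\<dots> \<le> (1/2) * (\<alpha> * (\<alpha> - \<beta>) + (\<alpha> - \<beta>) * \<beta>)"
  proof (intro mult_left_mono add_mono mult_mono)
    show "0 \<le> \<alpha>" "0 \<le> \<alpha> - \<beta>" using assms pos by linarith+
  qed (use assms in auto)
  also have "\<dots> = (1 + \<alpha>\<^sup>2) / 2 - (1 + \<beta>\<^sup>2) / 2" by (simp add: power2_eq_square algebra_simps diff_divide_distrib add_divide_distrib)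
  finally show ?thesis .
qed

lemma sqrt_iterate_step:
  assumes T: "norm (T :: 'a::banach operator) \<le> 1"
  shows "norm (sqrt_iterate T (Suc n) - sqrt_iterate T n) \<le> sqrt_majorant (Suc n) - sqrt_majorant n"
proof (induction n)
  case 0
  then show ?case using T by simp
next
  case (Suc n)
  show ?case
    using half_square_diff[OF sqrt_iterate_norm[OF T] sqrt_iterate_norm[OF T] Suc, of T]
    by (simp only: sqrt_iterate.simps sqrt_majorant.simps)
qed

lemma sqrt_iterate_dist:
  assumes T: "norm (T :: 'a::banach operator) \<le> 1" and mn: "m \<le> n"
  shows "norm (sqrt_iterate T n - sqrt_iterate T m) \<le> sqrt_majorant n - sqrt_majorant m"
  using mn
proof (induction n rule: dec_induct)
  case (step n)
  show ?case
    using norm_triangle_ineq[of "sqrt_iterate T (Suc n) - sqrt_iterate T n" "sqrt_iterate T n - sqrt_iterate T m"]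
      sqrt_iterate_step[OF T, of n] step.IH by (simp del: sqrt_iterate.simps sqrt_majorant.simps)
qed simp

lemma sqrt_iterate_limit:
  assumes T: "norm (T :: 'a::banach operator) \<le> 1"
  shows "sqrt_iterate T \<longlonglongrightarrow> sqrt_defect T"
proof -
  have "Cauchy (sqrt_iterate T)"
  proof (rule CauchyI')
    fix e :: real assume "0 < e"
    then obtain M where M: "\<And>m n. m \<ge> M \<Longrightarrow> n > m \<Longrightarrow> dist (sqrt_majorant m) (sqrt_majorant n) < e"
      using sqrt_majorant_Cauchy unfolding Cauchy_altdef by blast
    have "dist (sqrt_iterate T m) (sqrt_iterate T n) < e" if "m \<ge> M" "n > m" for m n
      using sqrt_iterate_dist[OF T, of m n] M[OF that] that(2) by (simp add: dist_norm norm_minus_commute)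
    then show "\<exists>M. \<forall>m\<ge>M. \<forall>n>m. dist (sqrt_iterate T m) (sqrt_iterate T n) < e" by blast
  qed
  then have "convergent (sqrt_iterate T)" by (rule Cauchy_convergent)
  then show ?thesis unfolding sqrt_defect_def by (simp only: convergent_LIMSEQ_iff)
qed

lemma sqrt_defect_norm:
  assumes T: "norm (T :: 'a::banach operator) \<le> 1"
  shows "norm (sqrt_defect T) \<le> 1"
proof (rule LIMSEQ_le_const2[OF tendsto_norm[OF sqrt_iterate_limit[OF T]]])
  have "norm (sqrt_iterate T n) \<le> 1" for n
    using sqrt_iterate_norm[OF T, of n] sqrt_majorant_bounds[of n] by linarith
  then show "\<exists>N. \<forall>n\<ge>N. norm (sqrt_iterate T n) \<le> 1" by blast
qed

lemma sqrt_defect_square: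
  assumes T: "norm (T :: 'a::banach operator) \<le> 1"
  shows "(id_blinfun - sqrt_defect T) \<star> (id_blinfun - sqrt_defect T) = id_blinfun - T"
proof -
  let ?q = "sqrt_defect T"
  have "(\<lambda>n. (1/2) *\<^sub>R (T + sqrt_iterate T n \<star> sqrt_iterate T n)) \<longlonglongrightarrow> (1/2) *\<^sub>R (T + ?q \<star> ?q)"
    by (intro tendsto_intros bounded_bilinear.tendsto[OF bounded_bilinear_blinfun_compose] sqrt_iterate_limit[OF T])
  moreover have "(\<lambda>n. sqrt_iterate T (Suc n)) \<longlonglongrightarrow> ?q" by (rule LIMSEQ_Suc[OF sqrt_iterate_limit[OF T]])
  ultimately have q: "?q = (1/2) *\<^sub>R (T + ?q \<star> ?q)" using LIMSEQ_unique by simp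
  show ?thesis
  proof (rule blinfun_eqI)
    fix x
    have "?q x = (1/2) *\<^sub>R (T x + ?q (?q x))"
      using arg_cong[OF q, of "\<lambda>S. blinfun_apply S x"] by (simp add: blinfun.bilinear_simps)
    from arg_cong[OF this, of "\<lambda>z. 2 *\<^sub>R z"] have "2 *\<^sub>R ?q x = T x + ?q (?q x)" by simp
    then show "((id_blinfun - ?q) \<star> (id_blinfun - ?q)) x = (id_blinfun - T) x"
      by (simp add: blinfun.bilinear_simps scaleR_2 algebra_simps)
  qed
qed

lemma sqrt_defect_commute:
  assumes T: "norm (T :: 'a::banach operator) \<le> 1" and S: "S \<star> T = T \<star> S"
  shows "S \<star> sqrt_defect T = sqrt_defect T \<star> S"
proof -
  have it: "S \<star> sqrt_iterate T n = sqrt_iterate T n \<star> S" for n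
  proof (induction n)
    case (Suc n)
    have 1: "S (T x) = T (S x)" for x using arg_cong[OF S, of "\<lambda>R. blinfun_apply R x"] by simp
    have 2: "S (sqrt_iterate T n x) = sqrt_iterate T n (S x)" for x using arg_cong[OF Suc, of "\<lambda>R. blinfun_apply R x"] by simp
    show ?case by (rule blinfun_eqI) (simp add: blinfun.bilinear_simps 1 2)
  qed (rule blinfun_eqI, simp)
  have "(\<lambda>n. S \<star> sqrt_iterate T n) \<longlonglongrightarrow> S \<star> sqrt_defect T" "(\<lambda>n. sqrt_iterate T n \<star> S) \<longlonglongrightarrow> sqrt_defect T \<star> S"
    by (intro bounded_bilinear.tendsto[OF bounded_bilinear_blinfun_compose] tendsto_const sqrt_iterate_limit[OF T])+
  then show ?thesis unfolding it using LIMSEQ_unique by blast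
qed

lemma sqrt_defect_invariant:
  assumes T: "norm (T :: 'a::banach operator) \<le> 1" and V: "closed V" "subspace V" and inv: "\<And>x. x \<in> V \<Longrightarrow> T x \<in> V"
    and x: "x \<in> V"
  shows "sqrt_defect T x \<in> V"
proof -
  have it: "sqrt_iterate T n x \<in> V" if "x \<in> V" for n x
    using that by (induction n arbitrary: x)
      (auto simp: blinfun.bilinear_simps subspace_0[OF V(2)] intro!: subspace_scale[OF V(2)] subspace_add[OF V(2)] inv)
  have "(\<lambda>n. sqrt_iterate T n x) \<longlonglongrightarrow> sqrt_defect T x"
    by (intro blinfun.tendsto sqrt_iterate_limit[OF T] tendsto_const)
  then show ?thesis by (rule closed_sequentially[OF V(1) it[OF x]])
qed

text \<open>The majorant does not depend on \<open>T\<close>, so the iteration converges uniformly on the unit ball.\<close>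

lemma continuous_sqrt_defect: "continuous_on {T :: 'a::banach operator. norm T \<le> 1} sqrt_defect"
proof (rule uniform_limit_theorem[where F = sequentially])
  have "continuous_on UNIV (\<lambda>T :: 'a operator. sqrt_iterate T n)" for n
    by (induction n) (auto intro!: continuous_intros bounded_bilinear.continuous_on[OF bounded_bilinear_blinfun_compose])
  then show "\<forall>\<^sub>F n in sequentially. continuous_on {T :: 'a operator. norm T \<le> 1} (\<lambda>T. sqrt_iterate T n)"
    by (intro always_eventually allI) (blast intro: continuous_on_subset)
  show "uniform_limit {T :: 'a operator. norm T \<le> 1} (\<lambda>n T. sqrt_iterate T n) sqrt_defect sequentially"
    unfolding uniform_limit_sequentially_iff
  proof (intro allI impI)
    fix e :: real assume e: "0 < e"
    then obtain M where M: "\<And>m n. m \<ge> M \<Longrightarrow> n > m \<Longrightarrow> dist (sqrt_majorant m) (sqrt_majorant n) < e / 2"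
      using sqrt_majorant_Cauchy unfolding Cauchy_altdef by (metis half_gt_zero)
    have close: "dist (sqrt_iterate T m) (sqrt_defect T) < e" if m: "m \<ge> M" and T: "norm T \<le> 1" for m and T :: "'a operator"
    proof -
      have "norm (sqrt_iterate T n - sqrt_iterate T m) \<le> e / 2" if "n \<ge> Suc m" for n
        using sqrt_iterate_dist[OF T, of m n] M[OF m, of n] that unfolding dist_real_def by linarith
      moreover have "(\<lambda>n. norm (sqrt_iterate T n - sqrt_iterate T m)) \<longlonglongrightarrow> norm (sqrt_defect T - sqrt_iterate T m)"
        by (intro tendsto_intros sqrt_iterate_limit[OF T])
      ultimately have "norm (sqrt_defect T - sqrt_iterate T m) \<le> e / 2" using LIMSEQ_le_const2 by blast
      then show ?thesis using e by (simp add: dist_norm norm_minus_commute)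
    qed
    show "\<exists>N. \<forall>n\<ge>N. \<forall>x\<in>{T :: 'a operator. norm T \<le> 1}. dist (sqrt_iterate x n) (sqrt_defect x) < e"
    proof (intro exI[of _ M] allI impI ballI)
      fix n and x :: "'a operator" assume "M \<le> n" "x \<in> {T. norm T \<le> 1}"
      then show "dist (sqrt_iterate x n) (sqrt_defect x) < e" using close[of n x] by blast
    qed
  qed
qed simp

text \<open>Self-adjointness for the algebra-valued inner product \<open>r s\<^sup>*\<close> of \<open>r\<close> and \<open>s\<close>.\<close>

definition selfadjoint_op :: "'a::cstar_algebra operator \<Rightarrow> bool" where
  "selfadjoint_op T \<longleftrightarrow> (\<forall>r s. T r * adj s = r * adj (T s))"

lemma adj_scaleR: "adj (c *\<^sub>R x) = c *\<^sub>R adj (x::'a::cstar_algebra)"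
  by (simp add: scaleR_scaleC adj_scaleC)

lemma tendsto_adj: "(f \<longlongrightarrow> l) F \<Longrightarrow> ((\<lambda>x. adj (f x)) \<longlongrightarrow> adj (l::'a::cstar_algebra)) F"
  using continuous_adj by (rule continuous_on_tendsto_compose) auto

lemma selfadjoint_id: "selfadjoint_op id_blinfun"
  by (simp add: selfadjoint_op_def)

lemma selfadjoint_add: "selfadjoint_op S \<Longrightarrow> selfadjoint_op T \<Longrightarrow> selfadjoint_op (S + T)"
  by (simp add: selfadjoint_op_def blinfun.bilinear_simps adj_add distrib_left distrib_right)

lemma selfadjoint_diff: "selfadjoint_op S \<Longrightarrow> selfadjoint_op T \<Longrightarrow> selfadjoint_op (S - T)"
  by (simp add: selfadjoint_op_def blinfun.bilinear_simps adj_diff left_diff_distrib right_diff_distrib)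

lemma selfadjoint_square: "selfadjoint_op T \<Longrightarrow> selfadjoint_op (T \<star> T)"
  by (simp add: selfadjoint_op_def)

lemma selfadjoint_sqrt_defect:
  assumes T: "norm T \<le> 1" "selfadjoint_op T"
  shows "selfadjoint_op (sqrt_defect T)"
proof -
  have it: "selfadjoint_op (sqrt_iterate T n)" for n
  proof (induction n)
    case (Suc n)
    have "selfadjoint_op (T + sqrt_iterate T n \<star> sqrt_iterate T n)"
      by (intro selfadjoint_add selfadjoint_square T Suc)
    then show ?case by (simp add: selfadjoint_op_def blinfun.scaleR_left adj_scaleR)
  qed (simp add: selfadjoint_op_def)
  show ?thesis unfolding selfadjoint_op_def
  proof (intro allI)
    fix r s
    have lim: "(\<lambda>n. sqrt_iterate T n x) \<longlonglongrightarrow> sqrt_defect T x" for x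
      by (intro blinfun.tendsto sqrt_iterate_limit[OF T(1)] tendsto_const)
    have "(\<lambda>n. sqrt_iterate T n r * adj s) \<longlonglongrightarrow> sqrt_defect T r * adj s"
      by (intro tendsto_intros lim)
    moreover have "(\<lambda>n. r * adj (sqrt_iterate T n s)) \<longlonglongrightarrow> r * adj (sqrt_defect T s)"
      by (intro tendsto_intros tendsto_adj lim)
    moreover have "(\<lambda>n. sqrt_iterate T n r * adj s) = (\<lambda>n. r * adj (sqrt_iterate T n s))"
      using it unfolding selfadjoint_op_def by blast
    ultimately show "sqrt_defect T r * adj s = r * adj (sqrt_defect T s)" using LIMSEQ_unique by metis
  qed
qed

lemma norm_mult_adj: "norm (x * adj x) = (norm (x::'a::cstar_algebra))\<^sup>2"
  using cstar_identity[of "adj x"] by (simp add: adj_adj)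

text \<open>The operators \<open>Y + \<i> W\<close> and \<open>Y - \<i> W\<close> are isometric, like \<open>cos t \<plusminus> \<i> sin t\<close>, and their
  difference is \<open>2 \<i> W\<close>.\<close>

lemma sin_contraction:
  fixes Y W :: "'a::cstar_algebra operator"
  assumes Y: "selfadjoint_op Y" and W: "selfadjoint_op W" and c: "Y \<star> W = W \<star> Y"
    and sq: "Y \<star> Y + W \<star> W = id_blinfun"
  shows "norm W \<le> 1"
proof (rule norm_blinfun_bound)
  fix r
  \<comment> \<open>For \<open>c = \<i>\<close> and \<open>c = - \<i>\<close>; the mixed terms cancel because \<open>c\<close> is imaginary.\<close>
  have unitary: "norm (Y r + c *\<^sub>C W r) = norm r" if c: "c + cnj c = 0" "c * cnj c = 1" for c
  proof -
    have YW: "Y (W r) = W (Y r)" using arg_cong[OF \<open>Y \<star> W = W \<star> Y\<close>, of "\<lambda>S. blinfun_apply S r"] by simp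
    have s: "Y (Y r) + W (W r) = r" using arg_cong[OF sq, of "\<lambda>S. blinfun_apply S r"] by (simp add: blinfun.bilinear_simps)
    have m: "T a * adj b = a * adj (T b)" if "selfadjoint_op T" for T :: "'a operator" and a b
      using that by (simp add: selfadjoint_op_def)
    have "(Y r + c *\<^sub>C W r) * adj (Y r + c *\<^sub>C W r)
        = Y r * adj (Y r) + (c * cnj c) *\<^sub>C (W r * adj (W r)) + (c *\<^sub>C (W r * adj (Y r)) + cnj c *\<^sub>C (Y r * adj (W r)))"
      by (simp add: adj_add adj_scaleC distrib_left distrib_right mult_scaleC_left mult_scaleC_right scaleC_scaleC algebra_simps)
    also have "c *\<^sub>C (W r * adj (Y r)) + cnj c *\<^sub>C (Y r * adj (W r)) = (c + cnj c) *\<^sub>C (r * adj (W (Y r)))"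
      unfolding m[OF W] m[OF Y] YW by (simp add: scaleC_add_left)
    also have "\<dots> = 0" unfolding c(1) by simp
    also have "Y r * adj (Y r) + (c * cnj c) *\<^sub>C (W r * adj (W r)) + 0 = r * adj (Y (Y r) + W (W r))"
      unfolding m[OF W] m[OF Y] c(2) by (simp add: scaleC_one adj_add distrib_left)
    also have "\<dots> = r * adj r" unfolding s ..
    finally have "norm (Y r + c *\<^sub>C W r) ^ 2 = norm r ^ 2" using norm_mult_adj by metis
    then show ?thesis by simp
  qed
  have "norm ((Y r + \<i> *\<^sub>C W r) - (Y r + (- \<i>) *\<^sub>C W r)) \<le> norm r + norm r"
    using norm_triangle_ineq4[of "Y r + \<i> *\<^sub>C W r" "Y r + (- \<i>) *\<^sub>C W r"] unitary[of \<i>] unitary[of "- \<i>"] by simp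
  also have "(Y r + \<i> *\<^sub>C W r) - (Y r + (- \<i>) *\<^sub>C W r) = (2 * \<i>) *\<^sub>C W r"
    by (simp add: cvec.scale_minus_left flip: scaleC_add_left)
  finally show "norm (W r) \<le> 1 * norm r" by (simp add: norm_scaleC norm_mult)
qed simp

lift_definition right_mult :: "'a::cstar_algebra \<Rightarrow> 'a operator" is "\<lambda>y r. r * y"
  by (rule bounded_linear_mult_left)

lemma right_mult_apply [simp]: "right_mult y r = r * y"
  by (simp add: right_mult.rep_eq)

lemma norm_right_mult: "norm (right_mult y) \<le> norm y"
proof (rule norm_blinfun_bound)
  fix r show "norm (right_mult y r) \<le> norm y * norm r"
    using norm_mult_ineq[of r y] by (simp add: mult.commute)
qed simp

text \<open>The stand-in for \<open>(y - \<mu>) / c\<close>, which need not exist in an algebra without unit. The factor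
  \<open>1 / c\<close> is there to obtain a contraction.\<close>

definition shifted :: "'a::cstar_algebra \<Rightarrow> real \<Rightarrow> real \<Rightarrow> 'a operator" where
  "shifted y c \<mu> = (1 / c) *\<^sub>R (right_mult y - \<mu> *\<^sub>R id_blinfun)"

text \<open>The absolute value \<open>sqrt (Y\<^sup>2)\<close> of a self-adjoint contraction, written as \<open>sqrt (1 - W\<^sup>2)\<close>
  with \<open>W = sqrt (1 - Y\<^sup>2)\<close>. The square root of \<open>1 - T\<close> is at hand for contractions \<open>T\<close>; this
  covers \<open>T = Y\<^sup>2\<close>, and then \<open>T = W\<^sup>2\<close> by \<open>sin_contraction\<close>, whereas a bound for \<open>1 - Y\<^sup>2\<close> itself
  is not immediate.\<close>

definition abs_op :: "'a::banach operator \<Rightarrow> 'a operator" where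
  "abs_op Y = id_blinfun - sqrt_defect ((id_blinfun - sqrt_defect (Y \<star> Y)) \<star> (id_blinfun - sqrt_defect (Y \<star> Y)))"

lemma shifted_norm:
  assumes "norm y + \<bar>\<mu>\<bar> \<le> c" "0 < c"
  shows "norm (shifted y c \<mu>) \<le> 1"
proof -
  have "norm (right_mult y - \<mu> *\<^sub>R id_blinfun) \<le> norm y + \<bar>\<mu>\<bar> * 1"
    using norm_triangle_ineq4[of "right_mult y" "\<mu> *\<^sub>R id_blinfun"] norm_right_mult[of y]
      norm_blinfun_id_le mult_left_mono[OF norm_blinfun_id_le, of "\<bar>\<mu>\<bar>"] by (smt (verit) norm_scaleR abs_ge_zero)
  then show ?thesis using assms unfolding shifted_def norm_scaleR by (simp add: divide_le_eq)
qed

lemma shifted_selfadjoint: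
  assumes "adj y = y" shows "selfadjoint_op (shifted y c \<mu>)"
  unfolding selfadjoint_op_def shifted_def using assms
  by (simp add: blinfun.bilinear_simps adj_scaleR adj_diff adj_mult left_diff_distrib right_diff_distrib mult.assoc)

lemma abs_op_facts:
  fixes Y :: "'a::cstar_algebra operator"
  assumes Y: "norm Y \<le> 1" "selfadjoint_op Y"
  shows "selfadjoint_op (abs_op Y)" "abs_op Y \<star> abs_op Y = Y \<star> Y" "Y \<star> abs_op Y = abs_op Y \<star> Y"
    "norm (id_blinfun - abs_op Y) \<le> 1"
    "norm (id_blinfun - sqrt_defect (Y \<star> Y)) \<le> 1"
proof -
  note n2 = norm_square_le_1
  let ?Y2 = "Y \<star> Y"
  define W where "W = id_blinfun - sqrt_defect ?Y2"
  have WW: "W \<star> W = id_blinfun - ?Y2" unfolding W_def by (rule sqrt_defect_square[OF n2[OF Y(1)]])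
  have Wsa: "selfadjoint_op W" unfolding W_def
    by (intro selfadjoint_diff selfadjoint_id selfadjoint_sqrt_defect selfadjoint_square Y n2)
  have YY2: "Y \<star> ?Y2 = ?Y2 \<star> Y" by (rule blinfun_eqI) simp
  have id_comm: "S \<star> (id_blinfun - T) = (id_blinfun - T) \<star> S" if "S \<star> T = T \<star> S" for S T :: "'a operator"
    using arg_cong[OF that, of blinfun_apply] by (intro blinfun_eqI) (simp add: blinfun.bilinear_simps fun_eq_iff)
  have YW: "Y \<star> W = W \<star> Y" unfolding W_def by (intro id_comm sqrt_defect_commute n2 Y YY2)
  show "norm (id_blinfun - sqrt_defect ?Y2) \<le> 1"
    using sin_contraction[OF Y(2) Wsa YW] unfolding WW by (simp add: W_def)
  then have nW: "norm W \<le> 1" by (simp add: W_def)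
  have V: "abs_op Y = id_blinfun - sqrt_defect (W \<star> W)" by (simp add: abs_op_def W_def)
  show "selfadjoint_op (abs_op Y)" unfolding V
    by (intro selfadjoint_diff selfadjoint_id selfadjoint_sqrt_defect selfadjoint_square Wsa n2 nW)
  have "abs_op Y \<star> abs_op Y = id_blinfun - W \<star> W" unfolding V by (rule sqrt_defect_square[OF n2[OF nW]])
  then show "abs_op Y \<star> abs_op Y = ?Y2" unfolding WW by simp
  have "Y \<star> (W \<star> W) = (W \<star> W) \<star> Y"
    using arg_cong[OF YW, of blinfun_apply] by (intro blinfun_eqI) (simp add: fun_eq_iff)
  then show "Y \<star> abs_op Y = abs_op Y \<star> Y" unfolding V by (intro id_comm sqrt_defect_commute n2 nW)
  show "norm (id_blinfun - abs_op Y) \<le> 1" unfolding V using sqrt_defect_norm[OF n2[OF nW]] by simp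
qed

text \<open>The difference of squares \<open>|Y|\<^sup>2 - Y\<^sup>2\<close> is zero.\<close>

lemma positive_negative_parts_orthogonal:
  fixes Y :: "'a::cstar_algebra operator"
  assumes Y: "norm Y \<le> 1" "selfadjoint_op Y"
  shows "(abs_op Y - Y) r * adj ((abs_op Y + Y) s) = 0"
proof -
  note A = abs_op_facts[OF Y]
  have c: "Y (abs_op Y x) = abs_op Y (Y x)" "abs_op Y (abs_op Y x) = Y (Y x)" for x
    using arg_cong[OF A(3), of "\<lambda>S. blinfun_apply S x"] arg_cong[OF A(2), of "\<lambda>S. blinfun_apply S x"] by auto
  have "(abs_op Y - Y) r * adj ((abs_op Y + Y) s) = r * adj ((abs_op Y - Y) ((abs_op Y + Y) s))"
    using selfadjoint_diff[OF A(1) Y(2)] by (simp add: selfadjoint_op_def)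
  also have "(abs_op Y - Y) ((abs_op Y + Y) s) = 0" by (simp add: blinfun.bilinear_simps c)
  finally show ?thesis by simp
qed

lemma abs_op_invariant:
  fixes Y :: "'a::cstar_algebra operator"
  assumes Y: "norm Y \<le> 1" "selfadjoint_op Y" and V: "closed V" "subspace V" and inv: "\<And>x. x \<in> V \<Longrightarrow> Y x \<in> V" and x: "x \<in> V"
  shows "abs_op Y x \<in> V"
proof -
  note n2 = norm_square_le_1
  define W where "W = id_blinfun - sqrt_defect (Y \<star> Y)"
  have 1: "W z \<in> V" if "z \<in> V" for z
    using sqrt_defect_invariant[OF n2[OF Y(1)] V _ that] inv subspace_diff[OF V(2) that]
    by (simp add: W_def blinfun.diff_left)
  have "norm W \<le> 1" using abs_op_facts(5)[OF Y] by (simp add: W_def)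
  then have "sqrt_defect (W \<star> W) x \<in> V"
    by (rule sqrt_defect_invariant[OF n2 V _ x]) (simp add: 1)
  then show ?thesis using subspace_diff[OF V(2) x] by (simp add: abs_op_def blinfun.diff_left flip: W_def)
qed

lemma continuous_abs_shifted:
  fixes y :: "'a::cstar_algebra"
  assumes y: "adj y = y" and c: "0 < c"
  shows "continuous_on {\<mu>. norm y + \<bar>\<mu>\<bar> \<le> c} (\<lambda>\<mu>. abs_op (shifted y c \<mu>))"
proof -
  let ?L = "{\<mu>. norm y + \<bar>\<mu>\<bar> \<le> c}"
  note n2 = norm_square_le_1
  have sq: "continuous_on ?L (\<lambda>\<mu>. f \<mu> \<star> f \<mu>)" if "continuous_on ?L f" for f :: "real \<Rightarrow> 'a operator"
    by (rule bounded_bilinear.continuous_on[OF bounded_bilinear_blinfun_compose that that])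
  have df: "continuous_on ?L (\<lambda>\<mu>. sqrt_defect (f \<mu>))" if "continuous_on ?L f" "\<And>\<mu>. \<mu> \<in> ?L \<Longrightarrow> norm (f \<mu>) \<le> 1" for f :: "real \<Rightarrow> 'a operator"
    by (rule continuous_on_compose2[OF continuous_sqrt_defect that(1)]) (use that(2) in auto)
  have cY: "continuous_on ?L (shifted y c)" unfolding shifted_def[abs_def] by (intro continuous_intros)
  have nY: "norm (shifted y c \<mu>) \<le> 1" if "\<mu> \<in> ?L" for \<mu> using shifted_norm[of y \<mu> c] that c by simp
  have cW: "continuous_on ?L (\<lambda>\<mu>. id_blinfun - sqrt_defect (shifted y c \<mu> \<star> shifted y c \<mu>))"
    by (intro continuous_on_diff continuous_on_const df sq cY n2 nY)
  show ?thesis unfolding abs_op_def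
    by (intro continuous_on_diff continuous_on_const df sq cW n2 abs_op_facts(5) nY shifted_selfadjoint y)
qed


section \<open>Abelian quantic bundles are line bundles\<close>

text \<open>The preimages of \<open>Z\<close> under \<open>f\<close> and \<open>h\<close> are closed and cover the connected interval, and
  neither of them is empty because the other one misses an end point.\<close>

lemma closed_common_point:
  fixes f h :: "real \<Rightarrow> 'a::topological_space"
  assumes K: "-K \<le> K" and f: "continuous_on {-K..K} f" and h: "continuous_on {-K..K} h" and Z: "closed Z"
    and cover: "\<And>\<mu>. \<mu> \<in> {-K..K} \<Longrightarrow> f \<mu> \<in> Z \<or> h \<mu> \<in> Z" and ends: "f K \<notin> Z" "h (-K) \<notin> Z"
  obtains \<mu> where "\<mu> \<in> {-K..K}" "f \<mu> \<in> Z" "h \<mu> \<in> Z"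
proof -
  let ?A = "{-K..K} \<inter> f -` Z" and ?B = "{-K..K} \<inter> h -` Z"
  have "closed ?A" "closed ?B" using continuous_closed_preimage f h Z closed_atLeastAtMost by blast+
  moreover have "{-K..K} \<subseteq> ?A \<union> ?B"
  proof
    fix \<mu> assume "\<mu> \<in> {-K..K}"
    then show "\<mu> \<in> ?A \<union> ?B" using cover[of \<mu>] by blast
  qed
  moreover have "-K \<in> ?A" using cover[of "-K"] ends(2) K by simp
  then have "?A \<inter> {-K..K} \<noteq> {}" by blast
  moreover have "K \<in> ?B" using cover[of K] ends(1) K by simp
  then have "?B \<inter> {-K..K} \<noteq> {}" by blast
  ultimately have "?A \<inter> ?B \<inter> {-K..K} \<noteq> {}"
    using connected_Icc[of "-K" K] unfolding connected_closed by meson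
  then obtain \<mu> where "\<mu> \<in> ?A \<inter> ?B \<inter> {-K..K}" by blast
  then show thesis by (intro that[of \<mu>]) simp_all
qed

context localizable_completion
begin

text \<open>If the fibre over \<open>g\<close> were zero, then no open support could contain \<open>g\<close>, and \<open>p\<^sup>*\<close> would
  have the same value on the set of all arrows and on its subset without \<open>g\<close>.\<close>

lemma fibre_nonzero:
  assumes inj: "surjection Max_quantale (Omega G) pstar" and g: "g \<in> arrows G"
  obtains e where "e \<in> fib g" "e \<noteq> bzero E g"
proof -
  have "\<exists>e. e \<in> fib g \<and> e \<noteq> bzero E g"
  proof (rule ccontr)
    assume "\<not> ?thesis"
    then have z: "ev g a = bzero E g" for a using ev_fib[OF g] by blast
    have oA: "openin (gtop G) (arrows G)" by (simp add: arrows_def)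
    have oD: "openin (gtop G) (arrows G - {g})" by (rule open_delete[OF oA])
    have "open_support G E \<iota> a \<subseteq> arrows G - {g}" for a using open_support_nonzero z by blast
    then have "UNIV \<subseteq> pstar (arrows G - {g})"
      unfolding localizable[OF oD] gamma_map_def using closed_cspan_superset[of "{a. open_support G E \<iota> a \<subseteq> arrows G - {g}}"] by auto
    moreover have "pstar (arrows G - {g}) \<subseteq> pstar (arrows G)" by (rule pstar_mono) auto
    ultimately have "pstar (arrows G - {g}) = pstar (arrows G)" by blast
    then have "arrows G - {g} = arrows G"
      using inj oA oD unfolding surjection_def inj_on_def by simp
    then show False using g by blast
  qed
  then show thesis using that by blast
qed

context
  assumes ab: "abelian_bundle G E" and qb: "quantic_bundle G Max_quantale pstar"
begin

lemma quantic_identity: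
  assumes U: "openin (gtop G) U" and A: "closed A" "cvec.subspace A" "pbang A \<in> bisections G"
    and B: "closed B" "cvec.subspace B" "pbang B \<in> bisections G"
  shows "pbang (sprod (sprod A (pstar U)) B) = gprod (gprod (pbang A) U) (pbang B)"
proof -
  obtain pb where d: "direct_image Max_quantale (Omega G) pstar pb"
    and id: "\<forall>U\<in>carrier (Omega G). \<forall>a\<in>carrier Max_quantale. \<forall>b\<in>carrier Max_quantale.
        pb a \<in> bisections G \<longrightarrow> pb b \<in> bisections G \<longrightarrow>
        pb (a \<odot>\<odot>\<^bsub>Max_quantale\<^esub> pstar U \<odot>\<odot>\<^bsub>Max_quantale\<^esub> b) =
          pb a \<odot>\<odot>\<^bsub>Omega G\<^esub> U \<odot>\<odot>\<^bsub>Omega G\<^esub> pb b"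
    using qb unfolding quantic_bundle_def by blast
  have e: "pb C = pbang C" if "closed C" "cvec.subspace C" for C by (rule direct_image_unique[OF d that])
  have "pb (sprod (sprod A (pstar U)) B) = gprod (gprod (pb A) U) (pb B)"
    using id[rule_format, of U A B] U A B by (simp add: e Omega_qmul)
  then show ?thesis by (simp add: e A B closed_cspan_closed closed_cspan_subspace)
qed

text \<open>By the identity for \<open>p\<^sub>!\<close>, the subspace generated by the products \<open>a \<zeta> b\<close>, with \<open>\<zeta>\<close> over the
  units, has a member that does not vanish at \<open>x\<close>. In the commutative fibre over \<open>x\<close>, however, the
  value of \<open>a \<zeta> b\<close> is a multiple of the product of the values of \<open>a\<close> and \<open>b\<close>.\<close>

lemma no_zero_product:
  assumes x: "x \<in> units G" and a: "a \<in> pstar (units G)" "ev x a \<noteq> bzero E x" and b: "b \<in> pstar (units G)" "ev x b \<noteq> bzero E x"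
  shows "bmul E (ev x a) (ev x b) \<noteq> bzero E x"
proof
  assume z: "bmul E (ev x a) (ev x b) = bzero E x"
  note ux = unit_facts[OF x]
  have xA: "ev x c \<in> fib x" for c by (rule ev_fib[OF ux(1)])
  define A where "A = closed_cspan {a}"
  define B where "B = closed_cspan {b}"
  have supp: "pbang (closed_cspan {c}) \<in> bisections G \<and> x \<in> pbang (closed_cspan {c})"
    if c: "c \<in> pstar (units G)" "ev x c \<noteq> bzero E x" for c
  proof
    have "closed_cspan {c} \<subseteq> pstar (units G)"
      by (rule closed_cspan_minimal[OF pstar_closed pstar_subspace]) (use c in auto)
    then have "pbang (closed_cspan {c}) \<subseteq> units G" using pbang_le_iff[OF open_units] by blast
    then show "pbang (closed_cspan {c}) \<in> bisections G" by (rule bisection_subset[OF units_bisection pbang_open])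
    have "x \<in> open_support G E \<iota> c" using open_support_bisection[OF units_bisection c(1)] c(2) ux(1) by simp
    then show "x \<in> pbang (closed_cspan {c})" unfolding pbang_def using closed_cspan_superset[of "{c}"] by blast
  qed
  have "pbang (sprod (sprod A (pstar (units G))) B) = gprod (gprod (pbang A) (units G)) (pbang B)"
    using quantic_identity[OF open_units] supp[OF a] supp[OF b] closed_cspan_closed closed_cspan_subspace
    unfolding A_def B_def by blast
  moreover have "x \<in> gprod (gprod (pbang A) (units G)) (pbang B)"
  proof -
    have "x \<in> gprod (pbang A) (units G)" unfolding gprod_def A_def using supp[OF a] x ux(4,5) by (metis (mono_tags, lifting) mem_Collect_eq)
    then show ?thesis unfolding gprod_def[of "gprod (pbang A) (units G)"] B_def using supp[OF b] ux(4,5)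
      by (metis (mono_tags, lifting) mem_Collect_eq)
  qed
  ultimately have "x \<in> pbang (sprod (sprod A (pstar (units G))) B)" by simp
  then obtain c where c: "c \<in> sprod (sprod A (pstar (units G))) B" "x \<in> open_support G E \<iota> c" unfolding pbang_def by blast
  have "sprod A (pstar (units G)) = sprod {a} (pstar (units G))"
    using sprod_closed_cspan[of "{a}" "pstar (units G)"] by (simp add: A_def closed_cspan_id[OF pstar_closed pstar_subspace])
  then have "sprod (sprod A (pstar (units G))) B = sprod {a' * b' | a' b'. a' \<in> {a} \<and> b' \<in> pstar (units G)} {b}"
    unfolding B_def by (simp only: sprod_closed_cspan)
  also have "\<dots> \<subseteq> {c. ev x c = bzero E x}"
  proof (rule sprod_minimal[OF ev_kernel[OF ux(1)]])
    fix p q assume "p \<in> {a' * b' | a' b'. a' \<in> {a} \<and> b' \<in> pstar (units G)}" "q \<in> {b}"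
    then obtain \<zeta> where p: "p = a * \<zeta>" "\<zeta> \<in> pstar (units G)" "q = b" by blast
    note mp = mult_pairsI[OF xA xA ux(4)]
    have "ev x (p * q) = bmul E (bmul E (ev x a) (ev x \<zeta>)) (ev x b)"
      using ev_unit_mult[OF x pstar_units_mult[OF a(1) p(2)] b(1)] ev_unit_mult[OF x a(1) p(2)] p by simp
    also have "bmul E (ev x a) (ev x \<zeta>) = bmul E (ev x \<zeta>) (ev x a)"
      using ab[unfolded abelian_bundle_def, rule_format, OF x, of "ev x a" "ev x \<zeta>"] xA by simp
    also have "bmul E (bmul E (ev x \<zeta>) (ev x a)) (ev x b) = bmul E (ev x \<zeta>) (bzero E x)"
      unfolding z[symmetric] by (rule bmul_assoc[OF mp mp])
    also have "\<dots> = bzero E x" using bmul_zero_right[OF xA ux(4)] ux(5) by simp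
    finally show "p * q \<in> {c. ev x c = bzero E x}" by simp
  qed
  finally have "ev x c = bzero E x" using c(1) by blast
  then show False using open_support_nonzero[OF c(2)] by blast
qed

text \<open>Lift \<open>f\<close> to a self-adjoint \<open>y\<close> and \<open>e\<close> to \<open>r\<close>, both over the units. Apply to \<open>r\<close> the
  operators \<open>|Y| - Y\<close> and \<open>|Y| + Y\<close>, where \<open>Y\<close> is right multiplication by \<open>(y - \<mu>) / c\<close>. The
  results are orthogonal, so \<open>no_zero_product\<close> makes one of them vanish at \<open>x\<close>. For the extreme
  values of \<open>\<mu>\<close> it is known which one does not vanish; hence both vanish at \<open>x\<close> for some \<open>\<mu>\<close>, and
  so does their difference \<open>2 (r y - \<mu> r) / c\<close>.\<close>

lemma selfadjoint_eigenvalue: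
  assumes x: "x \<in> units G" and e: "e \<in> fib x" "e \<noteq> bzero E x" and f: "f \<in> fib x" "bstar E f = f"
  obtains \<mu> where "bmul E e f = bscale E (complex_of_real \<mu>) e"
proof -
  note ux = unit_facts[OF x]
  obtain t where t: "t \<in> Cc G E (units G)" "t x = f" by (rule enough_sections[OF units_bisection x f(1)])
  have tp: "\<iota> t \<in> pstar (units G)" by (rule pstar_base[OF units_bisection subset_refl t(1)])
  have et: "ev x (\<iota> t) = f" using ev_iota[OF ux(1) Cc_Gamma[OF units_bisection t(1)]] t(2) by simp
  define y where "y = (1/2) *\<^sub>C (\<iota> t + adj (\<iota> t))"
  have y: "adj y = y" unfolding y_def by (simp add: adj_scaleC adj_add adj_adj add.commute)
  have yp: "y \<in> pstar (units G)" unfolding y_def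
    by (intro cvec.subspace_scale[OF pstar_subspace] cvec.subspace_add[OF pstar_subspace] tp pstar_units_adj)
  have ey: "ev x y = f"
  proof -
    have "ev x (adj (\<iota> t)) = f" using ev_adj[OF units_bisection tp ux(1)] ux(6) et f(2) by simp
    then have "ev x y = bscale E (1/2) (badd E f f)" unfolding y_def by (simp add: ev_scale[OF ux(1)] ev_add[OF ux(1)] et)
    also have "badd E f f = bscale E 2 f" using bscale_add_left[OF f(1), of 1 1] bscale_one[OF f(1)] by simp
    finally show ?thesis using bscale_bscale[OF f(1)] bscale_one[OF f(1)] by simp
  qed
  have epos: "bnorm E e > 0" using bnorm_nonneg[OF e(1)] bnorm_eq_0[OF e(1)] e(2) by linarith
  \<comment> \<open>The constants \<open>6/5\<close>, \<open>3 * n + 1\<close> and \<open>4 * n + 1\<close> are chosen for the contradiction at the end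
    of the proof of \<open>large\<close>: \<open>c + K = 7 * n + 2\<close> exceeds \<open>6/5 * (c + n) = 6 * n + 6/5\<close>.\<close>
  then have R: "bnorm E e < 6/5 * bnorm E e" by simp
  obtain s where s: "s \<in> Cc G E (units G)" "s x = e" "norm (\<iota> s) \<le> 6/5 * bnorm E e"
    by (rule small_section[OF units_bisection x e(1) R])
  define r where "r = \<iota> s"
  have rp: "r \<in> pstar (units G)" unfolding r_def by (rule pstar_base[OF units_bisection subset_refl s(1)])
  have er: "ev x r = e" unfolding r_def using ev_iota[OF ux(1) Cc_Gamma[OF units_bisection s(1)]] s(2) by simp
  have nr: "norm r \<le> 6/5 * bnorm E e" using s(3) by (simp add: r_def)
  define n where "n = norm y"
  define K where "K = 3 * n + 1"
  define c where "c = 4 * n + 1"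
  have n: "n \<ge> 0" by (simp add: n_def)
  have c: "c > 0" and K: "K > 0" using n by (auto simp: c_def K_def)
  have cK: "norm y + \<bar>\<mu>\<bar> \<le> c" if "\<mu> \<in> {-K..K}" for \<mu> using that by (auto simp: c_def K_def n_def)
  let ?Y = "\<lambda>\<mu>. shifted y c \<mu>" and ?V = "\<lambda>\<mu>. abs_op (shifted y c \<mu>)"
  let ?Z = "{a. ev x a = bzero E x}"
  have nY: "norm (?Y \<mu>) \<le> 1" if "\<mu> \<in> {-K..K}" for \<mu> by (rule shifted_norm[OF cK[OF that] c])
  have sY: "selfadjoint_op (?Y \<mu>)" for \<mu> by (rule shifted_selfadjoint[OF y])
  have Yr: "?Y \<mu> a = (1 / c) *\<^sub>R (a * y - \<mu> *\<^sub>R a)" for \<mu> a by (simp add: shifted_def blinfun.bilinear_simps)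
  have Yp: "?Y \<mu> a \<in> pstar (units G)" if "a \<in> pstar (units G)" for \<mu> a
    unfolding Yr by (intro subspace_scale[OF real_subspace_pstar] subspace_diff[OF real_subspace_pstar] pstar_units_mult that yp)
  have Vp: "?V \<mu> r \<in> pstar (units G)" if "\<mu> \<in> {-K..K}" for \<mu>
    by (rule abs_op_invariant[OF nY[OF that] sY pstar_closed real_subspace_pstar Yp rp])
  have cover: "(?V \<mu> - ?Y \<mu>) r \<in> ?Z \<or> (?V \<mu> + ?Y \<mu>) r \<in> ?Z" if m: "\<mu> \<in> {-K..K}" for \<mu>
  proof (rule ccontr)
    let ?a = "(?V \<mu> - ?Y \<mu>) r" and ?b = "(?V \<mu> + ?Y \<mu>) r"
    assume "\<not> (?a \<in> ?Z \<or> ?b \<in> ?Z)"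
    then have nz: "ev x ?a \<noteq> bzero E x" "ev x ?b \<noteq> bzero E x" by auto
    have p: "?a \<in> pstar (units G)" "?b \<in> pstar (units G)"
      using subspace_diff[OF real_subspace_pstar Vp[OF m] Yp[OF rp]] subspace_add[OF real_subspace_pstar Vp[OF m] Yp[OF rp]]
      by (simp_all add: blinfun.bilinear_simps)
    have eb: "ev x (adj ?b) = bstar E (ev x ?b)" using ev_adj[OF units_bisection p(2) ux(1)] ux(6) by simp
    have "ev x (adj ?b) \<noteq> bzero E x"
    proof
      assume "ev x (adj ?b) = bzero E x"
      then have "bstar E (bstar E (ev x ?b)) = bzero E x" using eb bstar_zero[OF ux(1)] ux(6) by simp
      then show False using nz(2) bstar_bstar[of "ev x ?b"] ev_fib[OF ux(1), of ?b] by simp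
    qed
    from no_zero_product[OF x p(1) nz(1) pstar_units_adj[OF p(2)] this]
    have "ev x (?a * adj ?b) \<noteq> bzero E x" using ev_unit_mult[OF x p(1) pstar_units_adj[OF p(2)]] by simp
    moreover have "?a * adj ?b = 0" by (rule positive_negative_parts_orthogonal[OF nY[OF m] sY])
    ultimately show False using ev_zero[OF ux(1)] by simp
  qed
  \<comment> \<open>At \<open>x\<close> the first term has norm \<open>(1 + K / c) * bnorm E e\<close>, too large to be cancelled by the
    value of \<open>z\<close>.\<close>
  have large: "(1 + K / c) *\<^sub>R r - z \<notin> ?Z" if z: "norm z \<le> norm r + (1 / c) * (norm r * n)" for z
  proof
    assume "(1 + K / c) *\<^sub>R r - z \<in> ?Z"
    then have "bdist E (ev x ((1 + K / c) *\<^sub>R r)) (ev x z) = 0"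
      using ev_diff[OF ux(1), of "(1 + K / c) *\<^sub>R r" z] bnorm_eq_0[OF bzero_arrows[OF ux(1)]] by simp
    then have "ev x ((1 + K / c) *\<^sub>R r) = ev x z" using bdist_eq_0[OF ev_fib[OF ux(1)] ev_fib[OF ux(1)]] by simp
    then have "bscale E (complex_of_real (1 + K / c)) e = ev x z"
      unfolding scaleR_scaleC ev_scale[OF ux(1)] er .
    then have "\<bar>1 + K / c\<bar> * bnorm E e = bnorm E (ev x z)" using bnorm_scale[OF e(1), of "complex_of_real (1 + K / c)"] by (metis norm_of_real)
    moreover have "1 + K / c > 0" using K c by (simp add: add_pos_pos)
    ultimately have "(1 + K / c) * bnorm E e \<le> norm r + (1 / c) * (norm r * n)"
      using ev_norm[OF ux(1), of z] z by simp
    also have "\<dots> = norm r * (1 + n / c)" by (simp add: algebra_simps)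
    also have "\<dots> \<le> 6/5 * bnorm E e * (1 + n / c)" using nr n c by (intro mult_right_mono) auto
    finally have "(1 + K / c) * bnorm E e \<le> (6/5 * (1 + n / c)) * bnorm E e" by (simp add: mult_ac)
    then have "1 + K / c \<le> 6/5 * (1 + n / c)" using epos by (rule mult_right_le_imp_le)
    then have "(1 + K / c) * c \<le> 6/5 * (1 + n / c) * c" using c by (intro mult_right_mono) auto
    then have "c + K \<le> 6/5 * (c + n)" using c by (simp add: distrib_right distrib_left)
    then show False using n by (simp add: c_def K_def)
  qed
  have KK: "K \<in> {-K..K}" "-K \<in> {-K..K}" using K by auto
  have q: "norm ((id_blinfun - ?V \<mu>) r) \<le> norm r" if "\<mu> \<in> {-K..K}" for \<mu>
    using norm_blinfun[of "id_blinfun - ?V \<mu>" r] abs_op_facts(4)[OF nY[OF that] sY] mult_right_mono[of "norm (id_blinfun - ?V \<mu>)" 1 "norm r"]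
    by (smt (verit) mult_1 norm_ge_zero)
  have ry: "norm ((1 / c) *\<^sub>R (r * y)) \<le> (1 / c) * (norm r * n)"
    using norm_mult_ineq[of r y] c by (simp add: n_def divide_right_mono)
  \<comment> \<open>At the end points \<open>- \<mu> / c\<close> and \<open>\<mu> / c\<close> contribute \<open>K / c\<close>, and the absolute value is within
    1 of the identity.\<close>
  have end1: "(?V K - ?Y K) r \<notin> ?Z"
  proof -
    have "(?V K - ?Y K) r = (1 + K / c) *\<^sub>R r - ((id_blinfun - ?V K) r + (1 / c) *\<^sub>R (r * y))"
      by (simp add: blinfun.bilinear_simps Yr scaleR_left_distrib scaleR_diff_right)
    moreover have "norm ((id_blinfun - ?V K) r + (1 / c) *\<^sub>R (r * y)) \<le> norm r + (1 / c) * (norm r * n)"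
      using norm_triangle_ineq[of "(id_blinfun - ?V K) r" "(1 / c) *\<^sub>R (r * y)"] q[OF KK(1)] ry by linarith
    ultimately show ?thesis using large by simp
  qed
  have end2: "(?V (-K) + ?Y (-K)) r \<notin> ?Z"
  proof -
    have "(?V (-K) + ?Y (-K)) r = (1 + K / c) *\<^sub>R r - ((id_blinfun - ?V (-K)) r - (1 / c) *\<^sub>R (r * y))"
      by (simp add: blinfun.bilinear_simps Yr scaleR_left_distrib scaleR_add_right)
    moreover have "norm ((id_blinfun - ?V (-K)) r - (1 / c) *\<^sub>R (r * y)) \<le> norm r + (1 / c) * (norm r * n)"
      using norm_triangle_ineq4[of "(id_blinfun - ?V (-K)) r" "(1 / c) *\<^sub>R (r * y)"] q[OF KK(2)] ry by linarith
    ultimately show ?thesis using large by simp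
  qed
  have cV: "continuous_on {-K..K} ?V"
    by (rule continuous_on_subset[OF continuous_abs_shifted[OF y c]]) (use cK in auto)
  have cY: "continuous_on {-K..K} ?Y" unfolding shifted_def[abs_def] by (intro continuous_intros)
  obtain \<mu> where m: "\<mu> \<in> {-K..K}" "(?V \<mu> - ?Y \<mu>) r \<in> ?Z" "(?V \<mu> + ?Y \<mu>) r \<in> ?Z"
    by (rule closed_common_point[of K "\<lambda>\<mu>. (?V \<mu> - ?Y \<mu>) r" "\<lambda>\<mu>. (?V \<mu> + ?Y \<mu>) r" ?Z])
      (use K cover end1 end2 in \<open>auto intro!: blinfun.continuous_on continuous_intros cV cY ev_kernel(1)[OF ux(1)]\<close>)
  note Zsub = ev_kernel(2)[OF ux(1)]
  have "(?V \<mu> + ?Y \<mu>) r - (?V \<mu> - ?Y \<mu>) r = 2 *\<^sub>R ?Y \<mu> r" by (simp add: blinfun.bilinear_simps scaleR_2)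
  then have "2 *\<^sub>R ?Y \<mu> r \<in> ?Z" using cvec.subspace_diff[OF Zsub m(3,2)] by simp
  from cvec.subspace_scale[OF Zsub this, of "complex_of_real (c / 2)"]
  have "(c / 2) *\<^sub>R (2 *\<^sub>R ?Y \<mu> r) \<in> ?Z" by (simp only: scaleR_scaleC)
  then have "r * y - \<mu> *\<^sub>R r \<in> ?Z" using c by (simp add: Yr)
  then have "bdist E (ev x (r * y)) (ev x (\<mu> *\<^sub>R r)) = 0"
    using ev_diff[OF ux(1), of "r * y" "\<mu> *\<^sub>R r"] bnorm_eq_0[OF bzero_arrows[OF ux(1)]] by simp
  then have "ev x (r * y) = ev x (\<mu> *\<^sub>R r)" using bdist_eq_0[OF ev_fib[OF ux(1)] ev_fib[OF ux(1)]] by simp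
  then have "bmul E e f = bscale E (complex_of_real \<mu>) e"
    using ev_unit_mult[OF x rp yp] by (simp add: scaleR_scaleC ev_scale[OF ux(1)] er ey)
  then show thesis by (rule that)
qed

text \<open>Split \<open>f\<close> into its real and imaginary parts.\<close>

lemma eigenvalue:
  assumes x: "x \<in> units G" and e: "e \<in> fib x" "e \<noteq> bzero E x" and f: "f \<in> fib x"
  obtains c where "bmul E e f = bscale E c e"
proof -
  note ux = unit_facts[OF x]
  have fs: "bstar E f \<in> fib x" using bstar_fib[OF f] ux(6) by simp
  have sum: "badd E f (bstar E f) \<in> fib x" "badd E f (bscale E (-1) (bstar E f)) \<in> fib x"
    using badd_fib f fs bscale_fib by auto
  define a where "a = bscale E (1/2) (badd E f (bstar E f))"
  define b where "b = bscale E (- \<i> / 2) (badd E f (bscale E (-1) (bstar E f)))"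
  have abf: "a \<in> fib x" "b \<in> fib x" unfolding a_def b_def using bscale_fib sum by auto
  have st: "bstar E (bstar E f) = f" using bstar_bstar f by simp
  have as: "bstar E a = a"
    unfolding a_def using bstar_scale[of "badd E f (bstar E f)" "1/2"] bstar_add[of f "bstar E f"] sum f fs st badd_commute[OF f fs] by simp
  have bs: "bstar E b = b"
  proof -
    have "bstar E b = bscale E (\<i> / 2) (badd E (bstar E f) (bscale E (-1) f))"
      unfolding b_def using bstar_scale[of "badd E f (bscale E (-1) (bstar E f))" "- \<i> / 2"]
        bstar_add[of f "bscale E (-1) (bstar E f)"] bstar_scale[of "bstar E f" "-1"] sum f fs st bscale_fib[OF fs] by simp
    also have "badd E (bstar E f) (bscale E (-1) f) = bscale E (-1) (badd E f (bscale E (-1) (bstar E f)))"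
      using bscale_add_right[OF f bscale_fib[OF fs], of "-1" "-1"] bscale_bscale[OF fs, of "-1" "-1"] bscale_one[OF fs]
        badd_commute[OF fs bscale_fib[OF f]] by simp
    finally show ?thesis unfolding b_def using bscale_bscale[OF sum(2)] by simp
  qed
  have fab: "f = badd E a (bscale E \<i> b)"
  proof -
    have "bscale E \<i> b = bscale E (1/2) (badd E f (bscale E (-1) (bstar E f)))"
      unfolding b_def using bscale_bscale[OF sum(2), of \<i> "- \<i> / 2"] by simp
    then have "badd E a (bscale E \<i> b) = bscale E (1/2) (badd E (badd E f (bstar E f)) (badd E f (bscale E (-1) (bstar E f))))"
      unfolding a_def using bscale_add_right[OF sum] by simp
    also have "badd E (badd E f (bstar E f)) (badd E f (bscale E (-1) (bstar E f))) = badd E (badd E f f) (bzero E x)"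
      using badd_swap[OF f fs f bscale_fib[OF fs]] badd_cancel[OF fs] by simp
    also have "\<dots> = badd E f f" by (rule badd_bzero_right[OF badd_fib[OF f f]])
    also have "\<dots> = bscale E 2 f" using bscale_add_left[OF f, of 1 1] bscale_one[OF f] by simp
    finally show ?thesis using bscale_bscale[OF f] bscale_one[OF f] by simp
  qed
  obtain \<alpha> where \<alpha>: "bmul E e a = bscale E (complex_of_real \<alpha>) e" by (rule selfadjoint_eigenvalue[OF x e abf(1) as])
  obtain \<beta> where \<beta>: "bmul E e b = bscale E (complex_of_real \<beta>) e" by (rule selfadjoint_eigenvalue[OF x e abf(2) bs])
  note mp = mult_pairsI[OF e(1) _ ux(4)]
  have "bmul E e f = badd E (bmul E e a) (bscale E \<i> (bmul E e b))"
    using bmul_add_right[OF mp[OF abf(1)] mp[OF bscale_fib[OF abf(2)]], of \<i>] bmul_scale_right[OF mp[OF abf(2)], of \<i>] abf fab by simp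
  also have "\<dots> = bscale E (complex_of_real \<alpha> + \<i> * complex_of_real \<beta>) e"
    unfolding \<alpha> \<beta> using bscale_bscale[OF e(1)] bscale_add_left[OF e(1)] by simp
  finally show thesis by (rule that)
qed

lemma fibre_no_zero_divisors:
  assumes x: "x \<in> units G" and e: "e \<in> fib x" "e \<noteq> bzero E x" and f: "f \<in> fib x" "f \<noteq> bzero E x"
  shows "bmul E e f \<noteq> bzero E x"
proof -
  note ux = unit_facts[OF x]
  obtain s where s: "s \<in> Cc G E (units G)" "s x = e" by (rule enough_sections[OF units_bisection x e(1)])
  obtain t where t: "t \<in> Cc G E (units G)" "t x = f" by (rule enough_sections[OF units_bisection x f(1)])
  have "ev x (\<iota> s) = e" "ev x (\<iota> t) = f"
    using ev_iota[OF ux(1)] Cc_Gamma[OF units_bisection] s t by auto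
  then show ?thesis
    using no_zero_product[OF x pstar_base[OF units_bisection subset_refl s(1)] _ pstar_base[OF units_bisection subset_refl t(1)]] e f by simp
qed

text \<open>By commutativity \<open>u f\<close> is a multiple of both \<open>u\<close> and \<open>f\<close>, the second one being nonzero in
  the absence of zero divisors.\<close>

lemma unit_fibre_multiple:
  assumes x: "x \<in> units G" and u: "u \<in> fib x" "u \<noteq> bzero E x" and f: "f \<in> fib x"
  obtains c where "f = bscale E c u"
proof (cases "f = bzero E x")
  case True
  then show thesis using that[of 0] bscale_zero[OF u(1)] by simp
next
  case False
  obtain c where c: "bmul E u f = bscale E c u" by (rule eigenvalue[OF x u f])
  obtain d where d: "bmul E f u = bscale E d f" by (rule eigenvalue[OF x f False u(1)])
  have comm: "bmul E u f = bmul E f u" using ab x u f unfolding abelian_bundle_def by auto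
  have "d \<noteq> 0" using fibre_no_zero_divisors[OF x f False u] d bscale_zero[OF f] by auto
  then have "f = bscale E (1 / d) (bscale E d f)" using bscale_bscale[OF f] bscale_one[OF f] by simp
  also have "bscale E d f = bscale E c u" using c d comm by simp
  also have "bscale E (1 / d) (bscale E c u) = bscale E (c / d) u" using bscale_bscale[OF u(1)] by simp
  finally show thesis by (rule that)
qed

text \<open>Fix \<open>u \<noteq> 0\<close> over \<open>g\<close>. As the fibre over \<open>d(g)\<close> is a line, every \<open>f\<close> over \<open>g\<close> differs from a
  multiple of \<open>u\<close> by some \<open>h\<close> with \<open>u\<^sup>* h = 0\<close>. As the fibre over \<open>r(g)\<close> is a line, \<open>h h\<^sup>*\<close> is a
  multiple of \<open>u u\<^sup>*\<close>, so that \<open>h\<^sup>* h h\<^sup>*\<close> is a multiple of \<open>h\<^sup>* u u\<^sup>* = 0\<close>, and two applications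
  of the C*-identity give \<open>h = 0\<close>.\<close>

lemma quantic_line_bundle: "line_bundle G E"
  unfolding line_bundle_def
proof
  fix g assume g: "g \<in> arrows G"
  have surj: "surjection Max_quantale (Omega G) pstar" using qb by (simp add: quantic_bundle_def)
  obtain u where u: "u \<in> fib g" "u \<noteq> bzero E g" by (rule fibre_nonzero[OF surj g])
  have us: "bstar E u \<in> fib (ginv G g)" by (rule bstar_fib[OF u(1)])
  note c1 = inv_composable[OF g]
  let ?d = "gdom G g" and ?r = "grng G g"
  have du: "?d \<in> units G" "?r \<in> units G" using gdom_unit grng_unit g by auto
  have uu: "bmul E (bstar E u) u \<in> fib ?d" "bmul E (bstar E u) u \<noteq> bzero E ?d"
    using bmul_bstar_fib(1)[OF u(1)] bstar_mul_eq_0[OF u(1)] u(2) by auto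
  have "\<exists>c. f = bscale E c u" if f: "f \<in> fib g" for f
  proof -
    have "bmul E (bstar E u) f \<in> fib ?d" using bmul_fib[OF us f c1(1)] by (simp add: gdom_def)
    then obtain c where c: "bmul E (bstar E u) f = bscale E c (bmul E (bstar E u) u)"
      by (rule unit_fibre_multiple[OF du(1) uu])
    define h where "h = badd E f (bscale E (- c) u)"
    have hf: "h \<in> fib g" unfolding h_def by (rule badd_fib[OF f bscale_fib[OF u(1)]])
    have uh: "bmul E (bstar E u) h = bzero E ?d"
    proof -
      have "bmul E (bstar E u) h = badd E (bmul E (bstar E u) f) (bscale E (- c) (bmul E (bstar E u) u))"
        unfolding h_def
        using bmul_add_right[OF mult_pairsI[OF us f c1(1)] mult_pairsI[OF us bscale_fib[OF u(1)] c1(1)]]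
          bmul_scale_right[OF mult_pairsI[OF us u(1) c1(1)]] f u(1) by simp
      also have "\<dots> = bscale E (c + - c) (bmul E (bstar E u) u)" unfolding c by (rule bscale_add_left[OF uu(1), symmetric])
      finally show ?thesis using bscale_zero[OF uu(1)] by simp
    qed
    have hs: "bstar E h \<in> fib (ginv G g)" by (rule bstar_fib[OF hf])
    have "h = bzero E g"
    proof -
      have hh: "bmul E h (bstar E h) \<in> fib ?r" by (rule bmul_bstar_fib(2)[OF hf])
      have uur: "bmul E u (bstar E u) \<in> fib ?r" by (rule bmul_bstar_fib(2)[OF u(1)])
      have us0: "bstar E u \<noteq> bzero E (ginv G g)"
        using bstar_bstar[of u] u bstar_zero[OF inv_closed[OF g]] inv_inv[OF g] by auto
      have "bmul E (bstar E (bstar E u)) (bstar E u) \<noteq> bzero E (gdom G (ginv G g))"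
        using bstar_mul_eq_0[OF us] us0 by blast
      then have uur0: "bmul E u (bstar E u) \<noteq> bzero E ?r" using bstar_bstar[of u] u g by simp
      obtain d where d: "bmul E h (bstar E h) = bscale E d (bmul E u (bstar E u))"
        by (rule unit_fibre_multiple[OF du(2) uur uur0 hh])
      have hu: "bmul E (bstar E h) u = bzero E ?d"
      proof -
        have "bmul E (bstar E h) u = bstar E (bmul E (bstar E u) h)"
          using bstar_bmul[OF mult_pairsI[OF us hf c1(1)]] bstar_bstar[of u] u by simp
        also have "\<dots> = bzero E ?d" unfolding uh using bstar_zero[of ?d] unit_facts[OF du(1)] by simp
        finally show ?thesis .
      qed
      have dg: "(?d, ginv G g) \<in> composable G" and gr: "(ginv G g, ?r) \<in> composable G"
        using g inv_closed[OF g] by (auto simp: composable_iff)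
      have "bmul E (bstar E h) (bmul E u (bstar E u)) = bmul E (bmul E (bstar E h) u) (bstar E u)"
        by (rule bmul_assoc[OF mult_pairsI[OF hs u(1) c1(1)] mult_pairsI[OF u(1) us c1(2)], symmetric])
      also have "\<dots> = bzero E (?d \<cdot>\<^bsub>G\<^esub> ginv G g)" unfolding hu by (rule bmul_zero_left[OF us dg])
      finally have 0: "bmul E (bstar E h) (bmul E u (bstar E u)) = bzero E (?d \<cdot>\<^bsub>G\<^esub> ginv G g)" .
      have dgi: "?d \<cdot>\<^bsub>G\<^esub> ginv G g = ginv G g" using rng_mul_self[OF inv_closed[OF g]] g by simp
      have giA: "ginv G g \<in> topspace (gtop G)" using inv_closed[OF g] by (simp add: arrows_def)
      have z: "bmul E (bstar E h) (bmul E h (bstar E h)) = bzero E (ginv G g)"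
        unfolding d using bmul_scale_right[OF mult_pairsI[OF hs uur gr], of d] 0 dgi bscale_bzero[OF giA] by simp
      define p where "p = bmul E (bstar E h) h"
      have pf: "p \<in> fib ?d" unfolding p_def by (rule bmul_bstar_fib(1)[OF hf])
      have ps: "bstar E p = p"
        unfolding p_def using bstar_bmul[OF mult_pairsI[OF hs hf c1(1)]] bstar_bstar[of h] hf by simp
      have gd: "(g, ?d) \<in> composable G" using g by (simp add: composable_iff)
      have "bmul E p p = bmul E (bmul E p (bstar E h)) h"
        unfolding p_def using bmul_assoc[OF mult_pairsI[OF pf hs dg] mult_pairsI[OF hs hf c1(1)]] by (simp add: p_def)
      also have "bmul E p (bstar E h) = bzero E (ginv G g)"
        unfolding p_def using bmul_assoc[OF mult_pairsI[OF hs hf c1(1)] mult_pairsI[OF hf hs c1(2)]] z by simp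
      also have "bmul E (bzero E (ginv G g)) h = bzero E ?d" using bmul_zero_left[OF hf c1(1)] by (simp add: gdom_def)
      finally have "bmul E (bstar E p) p = bzero E (gdom G ?d)" using ps g by simp
      then have "p = bzero E ?d" by (rule bstar_mul_eq_0[OF pf])
      then show ?thesis unfolding p_def by (rule bstar_mul_eq_0[OF hf])
    qed
    then have "badd E (bscale E c u) h = badd E (bscale E c u) (bzero E g)" by simp
    moreover have "badd E (bscale E c u) h = f"
      unfolding h_def using badd_diff[OF bscale_fib[OF u(1)] f, of c] bscale_bscale[OF u(1), of "-1" c] by simp
    ultimately have "f = bscale E c u" using badd_bzero_right[OF bscale_fib[OF u(1)]] by simp
    then show ?thesis by blast
  qed
  then have "fib g \<subseteq> range (\<lambda>c. bscale E c u)" by blast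
  moreover have "range (\<lambda>c. bscale E c u) \<subseteq> fib g" using bscale_fib[OF u(1)] by blast
  moreover have "carrier (fibre E g) = fib g" by (simp add: fibre_def)
  ultimately have "carrier (fibre E g) = range (\<lambda>c. bscale E c u)" by blast
  then show "\<exists>e\<in>carrier (fibre E g). e \<noteq> bzero E g \<and> carrier (fibre E g) = range (\<lambda>c. bscale E c e)"
    using u by (intro bexI[of _ u]) auto
qed

end
end

theorem theorem5p3:
  fixes G :: "'g groupoid"
    and E :: "('g, 'e) fell_struct"
    and N :: "('g \<Rightarrow> 'e) \<Rightarrow> real"
    and \<iota> :: "('g \<Rightarrow> 'e) \<Rightarrow> 'a::cstar_algebra"
  assumes "fell_bundle G E"
    and "saturated G E"
    and "localizable_completion G E N \<iota>"
  shows "line_bundle G E \<longleftrightarrow>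
    abelian_bundle G E \<and> quantic_bundle G Max_quantale (assoc_map G E \<iota>)"
proof -
  interpret localizable_completion G E N \<iota> by (rule assms(3))
  show ?thesis
    using line_abelian line_quantic_bundle quantic_line_bundle by blast
qed


end
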